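(* Let $R$ be a Noetherian local ring with $\operatorname{char}(R)\neq 2$ and let $I$ be a height three perfect Gorenstein ideal of $R$ minimally generated by $n\geq 5$ elements. Then $$(\operatorname{Ann}(H_1))^2\subseteq\overline{I}.$$
   Context: $H_1=H_1(I)$ denotes the first homology module of the Koszul complex built on a minimal generating set of $I$, and $\overline{I}$ is the integral closure of $I$. A perfect ideal $I$ is one for which the projective dimension of $R/I$ equals the grade $g$ of $I$; it is a perfect Gorenstein ideal if moreover $\operatorname{Ext}_R^g(R/I,R)\cong R/I$. *)

theory Defs
  imports "HOL-Algebra.Algebra" "HOL-Library.Extended_Nat"
begin

section \<open>Rings and ideals\<close>

definition local_ring :: "('a, 'm) ring_scheme \<Rightarrow> bool"
  where "local_ring R \<longleftrightarrow> cring R \<and> (\<exists>!M. maximalideal M R)"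

definition ring_char :: "('a, 'm) ring_scheme \<Rightarrow> nat"
  where "ring_char R =
    (if \<exists>n::nat. 0 < n \<and> [n] \<cdot>\<^bsub>R\<^esub> \<one>\<^bsub>R\<^esub> = \<zero>\<^bsub>R\<^esub>
     then LEAST n::nat. 0 < n \<and> [n] \<cdot>\<^bsub>R\<^esub> \<one>\<^bsub>R\<^esub> = \<zero>\<^bsub>R\<^esub>
     else 0)"

primrec ideal_pow :: "('a, 'm) ring_scheme \<Rightarrow> 'a set \<Rightarrow> nat \<Rightarrow> 'a set"
  where
    "ideal_pow R I 0 = carrier R"
  | "ideal_pow R I (Suc n) = ideal_prod R I (ideal_pow R I n)"

definition integral_closure :: "('a, 'm) ring_scheme \<Rightarrow> 'a set \<Rightarrow> 'a set"
  where "integral_closure R I = {x \<in> carrier R.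
    \<exists>(n::nat) a. 0 < n \<and> (\<forall>i\<in>{1..n}. a i \<in> ideal_pow R I i) \<and>
      x [^]\<^bsub>R\<^esub> n \<oplus>\<^bsub>R\<^esub> (\<Oplus>\<^bsub>R\<^esub> i\<in>{1..n}. a i \<otimes>\<^bsub>R\<^esub> x [^]\<^bsub>R\<^esub> (n - i)) = \<zero>\<^bsub>R\<^esub>}"

definition prime_height :: "('a, 'm) ring_scheme \<Rightarrow> 'a set \<Rightarrow> enat"
  where "prime_height R p = Sup {enat n | n. \<exists>c :: nat \<Rightarrow> 'a set.
    (\<forall>i\<le>n. primeideal (c i) R) \<and> (\<forall>i<n. c i \<subset> c (Suc i)) \<and> c n = p}"

definition ideal_height :: "('a, 'm) ring_scheme \<Rightarrow> 'a set \<Rightarrow> enat"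
  where "ideal_height R I = Inf {prime_height R p | p. primeideal p R \<and> I \<subseteq> p}"

definition regular_sequence :: "('a, 'm) ring_scheme \<Rightarrow> 'a list \<Rightarrow> bool"
  where "regular_sequence R xs \<longleftrightarrow>
    set xs \<subseteq> carrier R \<and> genideal R (set xs) \<noteq> carrier R \<and>
    (\<forall>i<length xs. \<forall>y\<in>carrier R.
      xs ! i \<otimes>\<^bsub>R\<^esub> y \<in> genideal R (set (take i xs)) \<longrightarrow> y \<in> genideal R (set (take i xs)))"

definition grade :: "('a, 'm) ring_scheme \<Rightarrow> 'a set \<Rightarrow> enat"
  where "grade R I = Sup {enat (length xs) | xs. set xs \<subseteq> I \<and> regular_sequence R xs}"

definition minimally_generates :: "('a, 'm) ring_scheme \<Rightarrow> 'a list \<Rightarrow> 'a set \<Rightarrow> bool"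
  where "minimally_generates R fs I \<longleftrightarrow>
    set fs \<subseteq> carrier R \<and> distinct fs \<and> genideal R (set fs) = I \<and>
    (\<forall>B. B \<subset> set fs \<longrightarrow> genideal R B \<noteq> I)"


section \<open>Modules\<close>

text \<open>The library's module record extends the ring record; the fields \<open>mult\<close> and \<open>one\<close> play no
  role for a module and are left undefined below.\<close>

definition ring_module :: "('a, 'm) ring_scheme \<Rightarrow> ('a, 'a) module"
  where "ring_module R =
    \<lparr>carrier = carrier R, monoid.mult = undefined, one = undefined,
     ring.zero = ring.zero R, ring.add = ring.add R, smult = monoid.mult R\<rparr>"

definition quotient_module :: "('a, 'b) module \<Rightarrow> 'b set \<Rightarrow> ('a, 'b set) module"
  where "quotient_module M N =
    \<lparr>carrier = a_rcosets\<^bsub>M\<^esub> N, monoid.mult = undefined, one = undefined,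
     ring.zero = N, ring.add = set_add M, smult = (\<lambda>r A. \<Union>x\<in>A. N +>\<^bsub>M\<^esub> (r \<odot>\<^bsub>M\<^esub> x))\<rparr>"

definition annihilator :: "('a, 'm) ring_scheme \<Rightarrow> ('a, 'b) module \<Rightarrow> 'a set"
  where "annihilator R M = {r \<in> carrier R. \<forall>x\<in>carrier M. r \<odot>\<^bsub>M\<^esub> x = \<zero>\<^bsub>M\<^esub>}"

definition module_hom ::
    "('a, 'm) ring_scheme \<Rightarrow> ('a, 'b) module \<Rightarrow> ('a, 'c) module \<Rightarrow> ('b \<Rightarrow> 'c) set"
  where "module_hom R M N = {f \<in> hom (add_monoid M) (add_monoid N).
    \<forall>r\<in>carrier R. \<forall>x\<in>carrier M. f (r \<odot>\<^bsub>M\<^esub> x) = r \<odot>\<^bsub>N\<^esub> f x}"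

definition module_iso ::
    "('a, 'm) ring_scheme \<Rightarrow> ('a, 'b) module \<Rightarrow> ('a, 'c) module \<Rightarrow> bool"
  where "module_iso R M N \<longleftrightarrow> (\<exists>f\<in>module_hom R M N. bij_betw f (carrier M) (carrier N))"

text \<open>Functions are made extensional so that each homomorphism is represented exactly once.\<close>

definition Hom_module ::
    "('a, 'm) ring_scheme \<Rightarrow> ('a, 'b) module \<Rightarrow> ('a, 'c) module \<Rightarrow> ('a, 'b \<Rightarrow> 'c) module"
  where "Hom_module R M N =
    \<lparr>carrier = module_hom R M N \<inter> extensional (carrier M), monoid.mult = undefined, one = undefined,
     ring.zero = (\<lambda>x\<in>carrier M. \<zero>\<^bsub>N\<^esub>),
     ring.add = (\<lambda>f g. \<lambda>x\<in>carrier M. f x \<oplus>\<^bsub>N\<^esub> g x),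
     smult = (\<lambda>r f. \<lambda>x\<in>carrier M. r \<odot>\<^bsub>N\<^esub> f x)\<rparr>"

text \<open>Homology of a chain complex with \<open>d i : C (i + 1) \<rightarrow> C i\<close> and \<open>C i = 0\<close> for negative \<open>i\<close>.\<close>

definition cycles :: "(nat \<Rightarrow> ('a, 'b) module) \<Rightarrow> (nat \<Rightarrow> 'b \<Rightarrow> 'b) \<Rightarrow> nat \<Rightarrow> 'b set"
  where "cycles C d i = (case i of 0 \<Rightarrow> carrier (C 0)
    | Suc j \<Rightarrow> {x \<in> carrier (C (Suc j)). d j x = \<zero>\<^bsub>C j\<^esub>})"

definition homology_module ::
    "(nat \<Rightarrow> ('a, 'b) module) \<Rightarrow> (nat \<Rightarrow> 'b \<Rightarrow> 'b) \<Rightarrow> nat \<Rightarrow> ('a, 'b set) module"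
  where "homology_module C d i =
    quotient_module ((C i)\<lparr>carrier := cycles C d i\<rparr>) (d i ` carrier (C (Suc i)))"

text \<open>Cohomology of a cochain complex with \<open>\<delta> i : C i \<rightarrow> C (i + 1)\<close> and \<open>C i = 0\<close> for
  negative \<open>i\<close>.\<close>

definition coboundaries :: "(nat \<Rightarrow> ('a, 'b) module) \<Rightarrow> (nat \<Rightarrow> 'b \<Rightarrow> 'b) \<Rightarrow> nat \<Rightarrow> 'b set"
  where "coboundaries C \<delta> i = (case i of 0 \<Rightarrow> {\<zero>\<^bsub>C 0\<^esub>} | Suc j \<Rightarrow> \<delta> j ` carrier (C j))"

definition cohomology_module ::
    "(nat \<Rightarrow> ('a, 'b) module) \<Rightarrow> (nat \<Rightarrow> 'b \<Rightarrow> 'b) \<Rightarrow> nat \<Rightarrow> ('a, 'b set) module"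
  where "cohomology_module C \<delta> i =
    quotient_module ((C i)\<lparr>carrier := {x \<in> carrier (C i). \<delta> i x = \<zero>\<^bsub>C (Suc i)\<^esub>}\<rparr>)
      (coboundaries C \<delta> i)"


section \<open>Projective resolutions, projective dimension and Ext\<close>

text \<open>The lifting property. HOL forces a choice of carrier types for the test modules \<open>M\<close> and \<open>N\<close>.
  The choice below loses nothing: it includes \<open>N = P\<close> and the free module on the set
  \<open>carrier P\<close> (finitely supported functions from \<open>carrier P\<close> to \<open>R\<close>) as \<open>M\<close>, so that
  a module with this property is a direct summand of a free module.\<close>

definition projective_module :: "('a, 'm) ring_scheme \<Rightarrow> ('a, 'p) module \<Rightarrow> bool"
  where "projective_module R P \<longleftrightarrow> module R P \<and>
    (\<forall>(M :: ('a, 'p \<Rightarrow> 'a) module) (N :: ('a, 'p) module) f g.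
      module R M \<and> module R N \<and> f \<in> module_hom R M N \<and> f ` carrier M = carrier N \<and>
      g \<in> module_hom R P N \<longrightarrow>
      (\<exists>h\<in>module_hom R P M. \<forall>x\<in>carrier P. f (h x) = g x))"

text \<open>Projective resolutions
  \<open>\<dots> \<rightarrow> P 2 \<rightarrow> P 1 \<rightarrow> P 0 \<rightarrow> M \<rightarrow> 0\<close> with maps \<open>d i : P (i + 1) \<rightarrow> P i\<close> and augmentation \<open>e\<close>.
  The carriers of the \<open>P i\<close> live in the type \<open>nat \<Rightarrow> 'a\<close>. Over a Noetherian ring a finitely
  generated module has a resolution by finitely generated projectives, which can be shortened to
  the length of the projective dimension, and every finitely generated projective is isomorphic to
  a submodule of some \<open>R\<^sup>n\<close>, hence to a module with carrier in this type. So for these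
  modules (the only ones used here) the two notions below are the usual ones.\<close>

definition projective_resolution ::
    "('a, 'm) ring_scheme \<Rightarrow> ('a, 'b) module \<Rightarrow> (nat \<Rightarrow> ('a, nat \<Rightarrow> 'a) module) \<Rightarrow>
     (nat \<Rightarrow> (nat \<Rightarrow> 'a) \<Rightarrow> (nat \<Rightarrow> 'a)) \<Rightarrow> ((nat \<Rightarrow> 'a) \<Rightarrow> 'b) \<Rightarrow> bool"
  where "projective_resolution R M P d e \<longleftrightarrow>
    (\<forall>i. projective_module R (P i)) \<and>
    (\<forall>i. d i \<in> module_hom R (P (Suc i)) (P i)) \<and>
    e \<in> module_hom R (P 0) M \<and>
    e ` carrier (P 0) = carrier M \<and>
    d 0 ` carrier (P (Suc 0)) = {x \<in> carrier (P 0). e x = \<zero>\<^bsub>M\<^esub>} \<and>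
    (\<forall>i. d (Suc i) ` carrier (P (Suc (Suc i))) =
      {x \<in> carrier (P (Suc i)). d i x = \<zero>\<^bsub>P i\<^esub>})"

definition projective_dimension :: "('a, 'm) ring_scheme \<Rightarrow> ('a, 'b) module \<Rightarrow> enat"
  where "projective_dimension R M = Inf {enat n | n. \<exists>P d e.
    projective_resolution R M P d e \<and> (\<forall>i>n. carrier (P i) = {\<zero>\<^bsub>P i\<^esub>})}"

text \<open>Ext is computed from an arbitrarily chosen projective resolution; up to isomorphism the
  result does not depend on the choice.\<close>

definition Ext_module ::
    "('a, 'm) ring_scheme \<Rightarrow> nat \<Rightarrow> ('a, 'b) module \<Rightarrow> ('a, 'c) module \<Rightarrow>
     ('a, ((nat \<Rightarrow> 'a) \<Rightarrow> 'c) set) module"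
  where "Ext_module R i M N =
    (let (P, d, e) = (SOME (P, d, e). projective_resolution R M P d e)
     in cohomology_module (\<lambda>j. Hom_module R (P j) N)
          (\<lambda>j f. compose (carrier (P (Suc j))) f (d j)) i)"


section \<open>Perfect and Gorenstein ideals\<close>

definition perfect_ideal :: "('a, 'm) ring_scheme \<Rightarrow> 'a set \<Rightarrow> bool"
  where "perfect_ideal R I \<longleftrightarrow> ideal I R \<and>
    projective_dimension R (quotient_module (ring_module R) I) = grade R I"

definition perfect_gorenstein_ideal :: "('a, 'm) ring_scheme \<Rightarrow> 'a set \<Rightarrow> bool"
  where "perfect_gorenstein_ideal R I \<longleftrightarrow> perfect_ideal R I \<and>
    (\<exists>g. grade R I = enat g \<and>
      module_iso R (Ext_module R g (quotient_module (ring_module R) I) (ring_module R))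
        (quotient_module (ring_module R) I))"


section \<open>The Koszul complex\<close>

text \<open>The exterior power \<open>\<Lambda>\<^sup>i R\<^sup>n\<close> is the free module on the elements
  \<open>e\<^sub>S = e\<^bsub>s1\<^esub> \<and> \<dots> \<and> e\<^bsub>si\<^esub>\<close>, where \<open>S = {s1 < \<dots> < si}\<close> runs through the \<open>i\<close>-element
  subsets of \<open>{0, \<dots>, n - 1}\<close>. The function \<open>x\<close> stands for \<open>\<Sum>\<^sub>S x(S) e\<^sub>S\<close>.\<close>

definition koszul_basis :: "nat \<Rightarrow> nat \<Rightarrow> nat set set"
  where "koszul_basis n i = {S. S \<subseteq> {..<n} \<and> card S = i}"

definition koszul_module ::
    "('a, 'm) ring_scheme \<Rightarrow> nat \<Rightarrow> nat \<Rightarrow> ('a, nat set \<Rightarrow> 'a) module"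
  where "koszul_module R n i =
    \<lparr>carrier = koszul_basis n i \<rightarrow>\<^sub>E carrier R, monoid.mult = undefined, one = undefined,
     ring.zero = (\<lambda>S\<in>koszul_basis n i. \<zero>\<^bsub>R\<^esub>),
     ring.add = (\<lambda>x y. \<lambda>S\<in>koszul_basis n i. x S \<oplus>\<^bsub>R\<^esub> y S),
     smult = (\<lambda>r x. \<lambda>S\<in>koszul_basis n i. r \<otimes>\<^bsub>R\<^esub> x S)\<rparr>"

text \<open>With \<open>d(e\<^sub>S) = \<Sum>\<^bsub>k \<in> S\<^esub> (-1)^#{j \<in> S. j < k} f\<^sub>k e\<^bsub>S - {k}\<^esub>\<close>, the coefficient of \<open>e\<^sub>T\<close> in
  \<open>d(x)\<close> collects the contributions of the sets \<open>S = T \<union> {k}\<close> with \<open>k \<notin> T\<close>.\<close>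

definition koszul_diff ::
    "('a, 'm) ring_scheme \<Rightarrow> 'a list \<Rightarrow> nat \<Rightarrow> (nat set \<Rightarrow> 'a) \<Rightarrow> (nat set \<Rightarrow> 'a)"
  where "koszul_diff R fs i x = (\<lambda>T\<in>koszul_basis (length fs) i.
    (\<Oplus>\<^bsub>R\<^esub> k\<in>{..<length fs} - T.
      (\<ominus>\<^bsub>R\<^esub> \<one>\<^bsub>R\<^esub>) [^]\<^bsub>R\<^esub> card {j \<in> T. j < k} \<otimes>\<^bsub>R\<^esub> (fs ! k \<otimes>\<^bsub>R\<^esub> x (insert k T))))"

definition koszul_homology ::
    "('a, 'm) ring_scheme \<Rightarrow> 'a list \<Rightarrow> nat \<Rightarrow> ('a, (nat set \<Rightarrow> 'a) set) module"
  where "koszul_homology R fs i =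
    homology_module (koszul_module R (length fs)) (koszul_diff R fs) i"

end

theory Submission
  imports Defs "HOL-Combinatorics.Permutations"
begin

text \<open>The first observation is that an element \<open>x\<close> that annihilates \<open>H\<^sub>1\<close> multiplies every coordinate
  of every syzygy of the generators \<open>f\<close> into \<open>I\<close>: a syzygy is a Koszul cycle, and the
  coordinates of a Koszul boundary lie in \<open>I\<close> (\<open>koszul_annihilator_syzygy\<close>). In particular \<open>x\<close>
  multiplies the entries of the matrix \<open>\<rho>\<close> of a minimal set of syzygies into \<open>I\<close>, so products of
  \<open>n - 1\<close> such elements multiply the minors of size \<open>n - 1\<close> of \<open>\<rho>\<close> into \<open>I\<^bsup>n - 1\<^esup>\<close>. The point is
  that \<open>\<rho>\<close> is a square matrix whose minors of size \<open>n - 1\<close> generate \<open>I\<^sup>2\<close>. Hence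
  \<open>L\<^sup>N I\<^sup>2 \<subseteq> I\<^sup>N\<close> with \<open>N = n - 1\<close>, where \<open>L\<close> is the ideal of all such multipliers
  (\<open>multiplier_power_inclusion\<close>). As \<open>N \<ge> 4\<close>, using this inclusion twice gives
  \<open>L\<^bsup>2N\<^esup> I\<^sup>2 \<subseteq> L\<^sup>N I\<^sup>N \<subseteq> I\<^bsup>2N - 2\<^esup> \<subseteq> I\<^sup>N I\<^sup>2\<close>. So for \<open>z \<in> L\<^sup>2\<close> the power \<open>z\<^sup>N\<close> maps the
  faithful ideal \<open>I\<^sup>2\<close> into \<open>I\<^sup>N I\<^sup>2\<close>, and the determinantal trick yields an equation of integral
  dependence of \<open>z\<close> on \<open>I\<close> (\<open>square_in_integral_closure\<close>).

  The minors are found from the minimal free resolution of \<open>R/I\<close>. Its length is at most the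
  projective dimension \<open>g\<close>: mapping it to a projective resolution of length \<open>g\<close> and back is homotopic
  to the identity, which together with minimality forces the kernel in degree \<open>g\<close> to vanish
  (\<open>minimal_resolution_injective\<close>). By perfection \<open>g\<close> is the grade, which is at most the
  height 3 (\<open>grade_le_height\<close>). Since \<open>Ext\<^sup>g(R/I, R)\<close> is cyclic, the last module has rank at most one (\<open>last_rank_le_1\<close>). This excludes
  \<open>g = 2\<close>, where all Koszul relations would be multiples of a single vector, and \<open>g \<le> 1\<close> is
  impossible because there is a Koszul relation at all. Hence \<open>g = 3\<close>, there is a regular sequence
  of length three in \<open>I\<close>, the dual complex is exact except at its end (\<open>dual_exact\<close>), and the
  resolution is \<open>0 \<rightarrow> R \<rightarrow> R\<^sup>m \<rightarrow> R\<^sup>n \<rightarrow> R\<close> with maps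
  given by a column \<open>\<psi>\<close>, a matrix \<open>\<rho>\<close> and the row \<open>f\<close>.

  That \<open>I\<close> annihilates \<open>Ext\<^sup>3(R/I, R)\<close>, the cokernel of the transpose of \<open>\<psi>\<close>, says that the
  \<open>f\<^sub>b\<close> are combinations of the \<open>\<psi>\<^sub>j\<close>. Conversely \<open>\<psi>\<^sub>k\<close> is a combination of the \<open>f\<^sub>b\<close>, because
  multiplication by \<open>\<psi>\<^sub>k\<close> is null-homotopic on the dual complex (\<open>psi_in_f\<close>). By minimality
  \<open>m = n\<close>. Now the kernel of \<open>\<rho>\<close> is spanned by \<open>\<psi>\<close> and its left kernel by \<open>f\<close>, so the cofactors of
  \<open>\<rho>\<close> are \<open>u f\<^sub>b \<psi>\<^sub>k\<close> for a fixed \<open>u\<close>. This \<open>u\<close> is a unit: otherwise all cofactors would vanish at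
  an associated prime of \<open>R/(u)\<close> or of \<open>R\<close>, contrary to the exactness of the complex there
  (\<open>cofactor_eq\<close>). Since the \<open>f\<^sub>b\<close> generate \<open>I\<close> and so do the \<open>\<psi>\<^sub>k\<close>, the cofactors
  generate \<open>I\<^sup>2\<close>.\<close>


section \<open>Leibniz determinants over a commutative ring\<close>

context cring begin

definition leibniz_term :: "nat \<Rightarrow> (nat \<Rightarrow> nat \<Rightarrow> 'a) \<Rightarrow> (nat \<Rightarrow> nat) \<Rightarrow> 'a"
  where "leibniz_term n L p =
    (if evenperm p then (\<Otimes>i\<in>{..<n}. L i (p i)) else \<ominus> (\<Otimes>i\<in>{..<n}. L i (p i)))"

text \<open>A matrix is a function on pairs of natural numbers of which only the entries below \<open>n\<close> count.
  The size is an argument, since the ranks in a resolution are not known beforehand.\<close>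
definition Det :: "nat \<Rightarrow> (nat \<Rightarrow> nat \<Rightarrow> 'a) \<Rightarrow> 'a"
  where "Det n L = (\<Oplus>p\<in>{p. p permutes {..<n}}. leibniz_term n L p)"

lemma leibniz_term_closed [simp]:
  "(\<And>i j. L i j \<in> carrier R) \<Longrightarrow> leibniz_term n L p \<in> carrier R"
  by (simp add: leibniz_term_def Pi_def)

lemma Det_closed [simp]: "(\<And>i j. L i j \<in> carrier R) \<Longrightarrow> Det n L \<in> carrier R"
  by (simp add: Det_def Pi_def)

lemma finprod_remove:
  assumes "finite A" "i \<in> A" "\<And>j. f j \<in> carrier R"
  shows "(\<Otimes>j\<in>A. f j) = f i \<otimes> (\<Otimes>j\<in>A - {i}. f j)"
  using finprod_insert[of "A - {i}" i f] assms by (simp add: insert_absorb Pi_def)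

lemma finsum_remove:
  assumes "finite A" "i \<in> A" "\<And>j. f j \<in> carrier R"
  shows "(\<Oplus>j\<in>A. f j) = f i \<oplus> (\<Oplus>j\<in>A - {i}. f j)"
  using finsum_insert[of "A - {i}" i f] assms by (simp add: insert_absorb Pi_def)

lemma ideal_finsum_closed:
  assumes J: "ideal J R" and g: "\<And>i. i \<in> A \<Longrightarrow> g i \<in> J"
  shows "(\<Oplus>i\<in>A. g i) \<in> J"
  using g
proof (induction A rule: infinite_finite_induct)
  interpret J: ideal J R by fact
  case (insert a A)
  have "(\<Oplus>i\<in>insert a A. g i) = g a \<oplus> (\<Oplus>i\<in>A. g i)"
    by (rule finsum_insert) (use insert J.Icarr in auto)
  then show ?case using insert by simp
qed (use additive_subgroup.zero_closed[OF ideal.axioms(1)[OF J]] in \<open>simp_all add: finsum_infinite\<close>)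

lemma Det_row_linear:
  assumes L: "\<And>i j. L i j \<in> carrier R" and x: "\<And>j. x j \<in> carrier R" and y: "\<And>j. y j \<in> carrier R"
    and a: "a \<in> carrier R" and i: "i < n"
  shows "Det n (L(i := \<lambda>k. a \<otimes> x k \<oplus> y k)) = a \<otimes> Det n (L(i := x)) \<oplus> Det n (L(i := y))"
proof -
  have prod: "(\<Otimes>l\<in>{..<n}. (L(i := r)) l (p l)) = r (p i) \<otimes> (\<Otimes>l\<in>{..<n} - {i}. L l (p l))"
    if r: "\<And>j. r j \<in> carrier R" for r and p :: "nat \<Rightarrow> nat"
  proof -
    have "(\<Otimes>l\<in>{..<n}. (L(i := r)) l (p l))
        = (L(i := r)) i (p i) \<otimes> (\<Otimes>l\<in>{..<n} - {i}. (L(i := r)) l (p l))"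
      by (rule finprod_remove) (use i L r in auto)
    also have "(\<Otimes>l\<in>{..<n} - {i}. (L(i := r)) l (p l)) = (\<Otimes>l\<in>{..<n} - {i}. L l (p l))"
      by (rule finprod_cong') (use L in auto)
    finally show ?thesis by simp
  qed
  have t: "leibniz_term n (L(i := \<lambda>k. a \<otimes> x k \<oplus> y k)) p
      = a \<otimes> leibniz_term n (L(i := x)) p \<oplus> leibniz_term n (L(i := y)) p" for p
  proof -
    have P: "(\<Otimes>l\<in>{..<n} - {i}. L l (p l)) \<in> carrier R" using L by simp
    show ?thesis
      unfolding leibniz_term_def
      by (simp only: prod a x y a_closed m_closed)
        (use P x[of "p i"] y[of "p i"] a in \<open>simp add: l_distr m_assoc minus_add r_minus\<close>)
  qed
  have c1: "leibniz_term n (L(i := x)) p \<in> carrier R" for p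
    by (rule leibniz_term_closed) (use L x in simp)
  have c2: "leibniz_term n (L(i := y)) p \<in> carrier R" for p
    by (rule leibniz_term_closed) (use L y in simp)
  have fin: "finite {p. p permutes {..<n}}" by (simp add: finite_permutations)
  have "Det n (L(i := \<lambda>k. a \<otimes> x k \<oplus> y k)) = (\<Oplus>p\<in>{p. p permutes {..<n}}.
      a \<otimes> leibniz_term n (L(i := x)) p \<oplus> leibniz_term n (L(i := y)) p)"
    unfolding Det_def by (rule finsum_cong') (use c1 c2 a t in auto)
  also have "\<dots> = (\<Oplus>p\<in>{p. p permutes {..<n}}. a \<otimes> leibniz_term n (L(i := x)) p)
      \<oplus> (\<Oplus>p\<in>{p. p permutes {..<n}}. leibniz_term n (L(i := y)) p)"
    by (rule finsum_addf) (use c1 c2 a in auto)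
  also have "(\<Oplus>p\<in>{p. p permutes {..<n}}. a \<otimes> leibniz_term n (L(i := x)) p)
      = a \<otimes> (\<Oplus>p\<in>{p. p permutes {..<n}}. leibniz_term n (L(i := x)) p)"
    by (rule finsum_rdistr[symmetric]) (use c1 a fin in auto)
  finally show ?thesis by (simp only: Det_def)
qed

lemma Det_cong:
  assumes "\<And>i j. i < n \<Longrightarrow> j < n \<Longrightarrow> L i j = K i j" and "\<And>i j. K i j \<in> carrier R"
  shows "Det n L = Det n K"
proof -
  have "leibniz_term n L p = leibniz_term n K p" if "p permutes {..<n}" for p
  proof -
    have "(\<Otimes>i\<in>{..<n}. L i (p i)) = (\<Otimes>i\<in>{..<n}. K i (p i))"
      by (rule finprod_cong') (use assms that permutes_in_image in force)+
    then show ?thesis by (simp add: leibniz_term_def)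
  qed
  then show ?thesis unfolding Det_def
    by (intro finsum_cong') (use assms in auto)
qed

text \<open>The terms of \<open>p\<close> and of \<open>p\<close> composed with the transposition of the two equal rows
  cancel, so that the vanishing holds in every characteristic.\<close>
lemma Det_alternating:
  assumes L: "\<And>i j. L i j \<in> carrier R" and ij: "i < n" "j < n" "i \<noteq> j"
    and eq: "\<And>k. k < n \<Longrightarrow> L i k = L j k"
  shows "Det n L = \<zero>"
proof -
  let ?t = "transpose i j"
  let ?P = "{p. p permutes {..<n}}"
  define E where "E = {p. p permutes {..<n} \<and> evenperm p}"
  define h where "h = (\<lambda>p :: nat \<Rightarrow> nat. p \<circ> ?t)"
  have t: "?t permutes {..<n}" using ij by (auto intro: permutes_swap_id)
  have hh: "h (h p) = p" for p by (simp add: h_def fun_eq_iff)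
  have perm: "permutation p" if "p permutes {..<n}" for p
    using that by (auto simp: permutation_permutes)
  have ev: "evenperm (h p) \<longleftrightarrow> \<not> evenperm p" if "p permutes {..<n}" for p
    using evenperm_comp[OF perm[OF that] perm[OF t]] ij by (auto simp: h_def evenperm_swap)
  have hp: "h p permutes {..<n}" if "p permutes {..<n}" for p
    unfolding h_def by (rule permutes_compose[OF t that])
  have finP: "finite ?P" by (simp add: finite_permutations)
  have finE: "finite E" by (rule finite_subset[OF _ finP]) (auto simp: E_def)
  have split: "?P = E \<union> h ` E"
  proof (intro equalityI subsetI)
    fix p assume "p \<in> ?P"
    then show "p \<in> E \<union> h ` E"
      using hp[of p] ev[of p] hh[of p] imageI[of "h p" E h] by (cases "evenperm p") (auto simp: E_def)
  qed (auto simp: E_def hp)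
  have disj: "E \<inter> h ` E = {}" using ev by (auto simp: E_def)
  have inj: "inj_on h E" by (metis hh inj_onI)
  have opp: "leibniz_term n L (h p) = \<ominus> leibniz_term n L p" if p: "p \<in> E" for p
  proof -
    have pp: "p permutes {..<n}" and pe: "evenperm p" using p by (auto simp: E_def)
    have lt: "p k < n" if "k < n" for k using pp that permutes_in_image by fastforce
    have "(\<Otimes>k\<in>{..<n}. L k (h p k)) = (\<Otimes>k\<in>?t ` {..<n}. L k (h p k))"
      by (simp add: permutes_image[OF t])
    also have "\<dots> = (\<Otimes>k\<in>{..<n}. L (?t k) (h p (?t k)))"
      by (rule finprod_reindex) (use L in auto)
    also have "\<dots> = (\<Otimes>k\<in>{..<n}. L k (p k))"
    proof (rule finprod_cong')
      fix k assume "k \<in> {..<n}"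
      then show "L (?t k) (h p (?t k)) = L k (p k)"
        using eq[OF lt[of k]] by (auto simp: h_def transpose_def)
    qed (use L in auto)
    finally show ?thesis
      using pe ev[OF pp] by (simp add: leibniz_term_def)
  qed
  have c: "leibniz_term n L p \<in> carrier R" for p using L by simp
  have "Det n L = (\<Oplus>p\<in>E. leibniz_term n L p) \<oplus> (\<Oplus>p\<in>h ` E. leibniz_term n L p)"
    unfolding Det_def split
    by (rule finsum_Un_disjoint) (use finE disj c in auto)
  also have "(\<Oplus>p\<in>h ` E. leibniz_term n L p) = (\<Oplus>p\<in>E. leibniz_term n L (h p))"
    by (rule finsum_reindex) (use c inj in auto)
  also have "(\<Oplus>p\<in>E. leibniz_term n L p) \<oplus> \<dots>
      = (\<Oplus>p\<in>E. leibniz_term n L p \<oplus> leibniz_term n L (h p))"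
    by (rule finsum_addf[symmetric]) (use c in auto)
  also have "\<dots> = (\<Oplus>p\<in>E. \<zero>)"
    by (rule finsum_cong') (use c opp r_neg in auto)
  finally show ?thesis by simp
qed

lemma Det_zero_row:
  assumes L: "\<And>i j. L i j \<in> carrier R" and i: "i < n" and z: "\<And>k. k < n \<Longrightarrow> L i k = \<zero>"
  shows "Det n L = \<zero>"
proof -
  have "Det n L = Det n (L(i := \<lambda>k. \<zero>))" by (rule Det_cong) (use L z in auto)
  moreover have "Det n (L(i := \<lambda>k. \<one> \<otimes> \<zero> \<oplus> \<zero>)) = \<one> \<otimes> Det n (L(i := \<lambda>k. \<zero>)) \<oplus> Det n (L(i := \<lambda>k. \<zero>))"
    by (rule Det_row_linear) (use L i in auto)
  ultimately have "Det n L = Det n L \<oplus> Det n L" using L by simp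
  then show ?thesis using L add.l_cancel_one[of "Det n L" "Det n L"] by simp
qed

lemma Det_row_sum:
  assumes L: "\<And>i j. L i j \<in> carrier R" and r: "\<And>j k. r j k \<in> carrier R"
    and c: "\<And>j. c j \<in> carrier R" and i: "i < n" and J: "finite J"
  shows "Det n (L(i := \<lambda>k. \<Oplus>j\<in>J. c j \<otimes> r j k)) = (\<Oplus>j\<in>J. c j \<otimes> Det n (L(i := r j)))"
  using J
proof (induction J rule: finite_induct)
  case empty
  show ?case using L i by (auto intro!: Det_zero_row)
next
  case (insert a J)
  have D: "Det n (L(i := r j)) \<in> carrier R" for j by (rule Det_closed) (use L r in auto)
  have "(\<lambda>k. \<Oplus>j\<in>insert a J. c j \<otimes> r j k) = (\<lambda>k. c a \<otimes> r a k \<oplus> (\<Oplus>j\<in>J. c j \<otimes> r j k))"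
    using insert.hyps r c by (simp add: Pi_def)
  then have "Det n (L(i := \<lambda>k. \<Oplus>j\<in>insert a J. c j \<otimes> r j k))
      = c a \<otimes> Det n (L(i := r a)) \<oplus> Det n (L(i := \<lambda>k. \<Oplus>j\<in>J. c j \<otimes> r j k))"
    using Det_row_linear[of L "r a" "\<lambda>k. \<Oplus>j\<in>J. c j \<otimes> r j k" "c a" i n] L r c i by (simp add: Pi_def)
  also have "\<dots> = c a \<otimes> Det n (L(i := r a)) \<oplus> (\<Oplus>j\<in>J. c j \<otimes> Det n (L(i := r j)))"
    by (simp only: insert.IH)
  also have "\<dots> = (\<Oplus>j\<in>insert a J. c j \<otimes> Det n (L(i := r j)))"
    by (rule finsum_insert[symmetric]) (use insert.hyps D c in auto)
  finally show ?case .
qed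

lemma Det_scale_row:
  assumes L: "\<And>i j. L i j \<in> carrier R" and x: "\<And>j. x j \<in> carrier R"
    and a: "a \<in> carrier R" and i: "i < n"
  shows "Det n (L(i := \<lambda>k. a \<otimes> x k)) = a \<otimes> Det n (L(i := x))"
  using Det_row_sum[of L "\<lambda>_. x" "\<lambda>_. a" i n "{0::nat}"] assms by (simp add: Pi_def)

lemma Det_swap_rows:
  assumes L: "\<And>i j. L i j \<in> carrier R" and x: "\<And>j. x j \<in> carrier R" and y: "\<And>j. y j \<in> carrier R"
    and ij: "i < n" "j < n" "i \<noteq> j"
  shows "Det n (L(i := x, j := y)) = \<ominus> Det n (L(i := y, j := x))"
proof -
  let ?s = "\<lambda>k. \<one> \<otimes> x k \<oplus> y k"
  let ?D = "\<lambda>u v. Det n (L(i := u, j := v))"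
  have [simp]: "?D u v \<in> carrier R" if "\<And>k. u k \<in> carrier R" "\<And>k. v k \<in> carrier R" for u v
    by (rule Det_closed) (use that L in auto)
  have 1: "?D u ?s = ?D u x \<oplus> ?D u y" if u: "\<And>k. u k \<in> carrier R" for u
    using Det_row_linear[of "L(i := u)" x y \<one> j n] that L x y ij by simp
  have 2: "?D ?s v = ?D x v \<oplus> ?D y v" if v: "\<And>k. v k \<in> carrier R" for v
    using Det_row_linear[of "L(j := v)" x y \<one> i n] that L x y ij by (simp add: fun_upd_twist)
  have alt: "?D u u = \<zero>" if "\<And>k. u k \<in> carrier R" for u
    by (rule Det_alternating[OF _ ij]) (use L that ij in auto)
  have "\<zero> = ?D ?s ?s" using alt[of ?s] x y by simp
  also have "\<dots> = (?D x x \<oplus> ?D x y) \<oplus> (?D y x \<oplus> ?D y y)"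
    using 1[of x] 1[of y] 2[of ?s] x y by simp
  also have "\<dots> = ?D x y \<oplus> ?D y x" using alt[of x] alt[of y] x y by simp
  finally have "?D x y \<oplus> ?D y x = \<zero>" by simp
  then show ?thesis using x y by (simp add: minus_equality)
qed

definition unit_vec :: "'i \<Rightarrow> 'i \<Rightarrow> 'a"
  where "unit_vec i = (\<lambda>k. if k = i then \<one> else \<zero>)"

lemma unit_vec_apply: "unit_vec i k = (if k = i then \<one> else \<zero>)"
  by (simp add: unit_vec_def)

lemma unit_vec_closed [simp]: "unit_vec i k \<in> carrier R"
  by (simp add: unit_vec_def)

lemma finsum_delta:
  fixes f :: "'i \<Rightarrow> 'a"
  assumes "finite A" "i \<in> A" "\<And>j. f j \<in> carrier R"
  shows "(\<Oplus>j\<in>A. f j \<otimes> unit_vec i j) = f i" "(\<Oplus>j\<in>A. unit_vec i j \<otimes> f j) = f i"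
    "(\<Oplus>j\<in>A. f j \<otimes> unit_vec j i) = f i" "(\<Oplus>j\<in>A. unit_vec j i \<otimes> f j) = f i"
proof -
  have *: "(\<Oplus>j\<in>A. if i = j then f j else \<zero>) = f i"
    using assms by (intro finsum_singleton) auto
  show "(\<Oplus>j\<in>A. f j \<otimes> unit_vec i j) = f i"
    by (subst *[symmetric], rule finsum_cong') (use assms in \<open>auto simp: unit_vec_def\<close>)
  show "(\<Oplus>j\<in>A. unit_vec i j \<otimes> f j) = f i"
    by (subst *[symmetric], rule finsum_cong') (use assms in \<open>auto simp: unit_vec_def\<close>)
  show "(\<Oplus>j\<in>A. f j \<otimes> unit_vec j i) = f i"
    by (subst *[symmetric], rule finsum_cong') (use assms in \<open>auto simp: unit_vec_def\<close>)
  show "(\<Oplus>j\<in>A. unit_vec j i \<otimes> f j) = f i"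
    by (subst *[symmetric], rule finsum_cong') (use assms in \<open>auto simp: unit_vec_def\<close>)
qed

text \<open>Replace row \<open>i\<close> by the combination of all rows that vanishes: of its expansion only the
  summand with index \<open>i\<close> survives.\<close>
lemma Det_row_relation:
  assumes L: "\<And>i j. L i j \<in> carrier R" and h: "\<And>j. h j \<in> carrier R"
    and rel: "\<And>k. k < n \<Longrightarrow> (\<Oplus>j\<in>{..<n}. h j \<otimes> L j k) = \<zero>" and i: "i < n"
  shows "h i \<otimes> Det n L = \<zero>"
proof -
  have D: "Det n (L(i := L j)) \<in> carrier R" for j by (rule Det_closed) (use L in auto)
  have "\<zero> = Det n (L(i := \<lambda>k. \<Oplus>j\<in>{..<n}. h j \<otimes> L j k))"
    by (rule Det_zero_row[symmetric, where i = i]) (use L h rel i in auto)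
  also have "\<dots> = (\<Oplus>j\<in>{..<n}. h j \<otimes> Det n (L(i := L j)))"
    by (rule Det_row_sum) (use L h i in auto)
  also have "\<dots> = (\<Oplus>j\<in>{..<n}. (h j \<otimes> Det n L) \<otimes> unit_vec i j)"
  proof (rule finsum_cong')
    fix j assume j: "j \<in> {..<n}"
    show "h j \<otimes> Det n (L(i := L j)) = (h j \<otimes> Det n L) \<otimes> unit_vec i j"
    proof (cases "j = i")
      case True then show ?thesis using L h by (simp add: unit_vec_def)
    next
      case False
      then have "Det n (L(i := L j)) = \<zero>"
        by (intro Det_alternating[of _ i n j]) (use L i j in auto)
      then show ?thesis using False L h by (simp add: unit_vec_def)
    qed
  qed (use L h D in auto)
  also have "\<dots> = h i \<otimes> Det n L" by (rule finsum_delta) (use i h L in auto)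
  finally show ?thesis by simp
qed

text \<open>After expansion of every row into the \<open>m\<close> vectors \<open>a\<^sub>j\<close>, each term has two equal rows by the
  pigeonhole principle.\<close>
lemma Det_low_rank:
  assumes a: "\<And>j k. a j k \<in> carrier R" and b: "\<And>i j. b i j \<in> carrier R" and m: "m < n"
  shows "Det n (\<lambda>i k. \<Oplus>j\<in>{..<m}. b i j \<otimes> a j k) = \<zero>"
proof -
  have "Det n (\<lambda>i. if i < q then (\<lambda>k. \<Oplus>j\<in>{..<m}. b i j \<otimes> a j k) else a (g i)) = \<zero>"
    if "q \<le> n" "\<And>i. g i < m" for q and g :: "nat \<Rightarrow> nat"
    using that
  proof (induction q arbitrary: g)
    case 0
    have "\<not> inj_on g {..<n}"
      using card_inj_on_le[of g "{..<n}" "{..<m}"] 0 m by auto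
    then obtain i j where "i < n" "j < n" "i \<noteq> j" "g i = g j" by (auto simp: inj_on_def)
    then show ?case by (intro Det_alternating[of _ i n j]) (use a in auto)
  next
    case (Suc q)
    let ?L = "\<lambda>g. \<lambda>i. if i < q then (\<lambda>k. \<Oplus>j\<in>{..<m}. b i j \<otimes> a j k) else a (g i)"
    have L: "?L g i k \<in> carrier R" for g i k using a b by (auto intro!: finsum_closed)
    have "(\<lambda>i. if i < Suc q then (\<lambda>k. \<Oplus>j\<in>{..<m}. b i j \<otimes> a j k) else a (g i))
        = (?L g)(q := \<lambda>k. \<Oplus>j\<in>{..<m}. b q j \<otimes> a j k)"
      by (auto simp: fun_eq_iff)
    then have "Det n (\<lambda>i. if i < Suc q then (\<lambda>k. \<Oplus>j\<in>{..<m}. b i j \<otimes> a j k) else a (g i))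
        = (\<Oplus>j\<in>{..<m}. b q j \<otimes> Det n ((?L g)(q := a j)))"
      using Det_row_sum[of "?L g" a "b q" q n "{..<m}"] L a b Suc.prems by simp
    also have "\<dots> = (\<Oplus>j\<in>{..<m}. \<zero>)"
    proof (rule finsum_cong')
      fix j assume j: "j \<in> {..<m}"
      have "(?L g)(q := a j) = ?L (g(q := j))" by (auto simp: fun_eq_iff)
      then show "b q j \<otimes> Det n ((?L g)(q := a j)) = \<zero>"
        using Suc.IH[of "g(q := j)"] Suc.prems j b by simp
    qed auto
    finally show ?case by simp
  qed
  from this[of n "\<lambda>_. 0"] have d: "Det n (\<lambda>i. if i < n then (\<lambda>k. \<Oplus>j\<in>{..<m}. b i j \<otimes> a j k) else a 0) = \<zero>"
    if "m \<noteq> 0" using that by simp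
  show ?thesis
  proof (cases "m = 0")
    case True
    then show ?thesis using m by (intro Det_zero_row[of _ 0]) auto
  next
    case False
    show ?thesis
      by (subst d[OF False, symmetric], rule Det_cong) (use a b in \<open>auto intro!: finsum_closed\<close>)
  qed
qed

text \<open>Only the identity permutation avoids the entries off the diagonal. The set \<open>S d\<close> stands for
  the lower terms and \<open>T d\<close> for a leading term plus lower terms, in degree \<open>d\<close>; this covers both
  homogeneous characteristic polynomials and matrices that are the identity modulo an ideal.\<close>
lemma Det_graded:
  fixes S T :: "nat \<Rightarrow> 'a set"
  assumes cl: "\<And>d. S d \<subseteq> carrier R" "\<And>d. T d \<subseteq> carrier R"
    and S0: "\<And>d. \<zero> \<in> S d" and Sadd: "\<And>d x y. x \<in> S d \<Longrightarrow> y \<in> S d \<Longrightarrow> x \<oplus> y \<in> S d"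
    and Sneg: "\<And>d x. x \<in> S d \<Longrightarrow> \<ominus> x \<in> S d"
    and Smult: "\<And>a b x y. x \<in> S a \<Longrightarrow> y \<in> S b \<union> T b \<Longrightarrow> x \<otimes> y \<in> S (a + b)"
    and Tmult: "\<And>a b x y. x \<in> T a \<Longrightarrow> y \<in> T b \<Longrightarrow> x \<otimes> y \<in> T (a + b)"
    and TS: "\<And>d x y. x \<in> T d \<Longrightarrow> y \<in> S d \<Longrightarrow> x \<oplus> y \<in> T d"
    and T1: "\<one> \<in> T 0"
    and L: "\<And>i j. L i j \<in> carrier R"
    and diag: "\<And>i. i < n \<Longrightarrow> L i i \<in> T e"
    and off: "\<And>i j. i < n \<Longrightarrow> j < n \<Longrightarrow> i \<noteq> j \<Longrightarrow> L i j \<in> S e"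
  shows "Det n L \<in> T (e * n)"
proof -
  have clS: "x \<in> carrier R" if "x \<in> S d" for x d using cl that by blast
  have clT: "x \<in> carrier R" if "x \<in> T d" for x d using cl that by blast
  have allT: "(\<Otimes>i\<in>A. x i) \<in> T (e * card A)" if "finite A" "\<And>i. i \<in> A \<Longrightarrow> x i \<in> T e" for A :: "nat set" and x
    using that
  proof (induction A rule: finite_induct)
    case (insert a A)
    then have "x a \<otimes> (\<Otimes>i\<in>A. x i) \<in> T (e + e * card A)" by (intro Tmult) auto
    moreover have "(\<Otimes>i\<in>insert a A. x i) = x a \<otimes> (\<Otimes>i\<in>A. x i)"
      by (rule finprod_insert) (use insert clS clT in \<open>auto, blast+\<close>)
    ultimately show ?case using insert.hyps by simp
  qed (use T1 in simp)
  have ST: "(\<Otimes>i\<in>A. x i) \<in> S (e * card A) \<union> T (e * card A)"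
    if "finite A" "\<And>i. i \<in> A \<Longrightarrow> x i \<in> S e \<union> T e" for A :: "nat set" and x
    using that
  proof (induction A rule: finite_induct)
    case (insert a A)
    then have IH: "(\<Otimes>i\<in>A. x i) \<in> S (e * card A) \<union> T (e * card A)" and xa: "x a \<in> S e \<union> T e"
      by auto
    have "x a \<otimes> (\<Otimes>i\<in>A. x i) \<in> S (e + e * card A) \<union> T (e + e * card A)"
    proof (cases "x a \<in> S e")
      case True
      then show ?thesis using Smult IH by blast
    next
      case False
      then have xT: "x a \<in> T e" using xa by blast
      show ?thesis
      proof (cases "(\<Otimes>i\<in>A. x i) \<in> S (e * card A)")
        case True
        then have "(\<Otimes>i\<in>A. x i) \<otimes> x a \<in> S (e * card A + e)" using Smult xT by blast
        moreover have "(\<Otimes>i\<in>A. x i) \<otimes> x a = x a \<otimes> (\<Otimes>i\<in>A. x i)"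
          using True xT clS clT by (intro m_comm) blast+
        ultimately show ?thesis by (simp add: add.commute)
      next
        case False
        then show ?thesis using Tmult xT IH by blast
      qed
    qed
    moreover have "(\<Otimes>i\<in>insert a A. x i) = x a \<otimes> (\<Otimes>i\<in>A. x i)"
      by (rule finprod_insert) (use insert clS clT in \<open>auto, blast+\<close>)
    ultimately show ?case using insert.hyps by simp
  qed (use T1 in simp)
  have diag': "leibniz_term n L id \<in> T (e * n)"
    using allT[of "{..<n}" "\<lambda>i. L i i"] diag by (simp add: leibniz_term_def)
  have off': "leibniz_term n L p \<in> S (e * n)" if p: "p permutes {..<n}" "p \<noteq> id" for p
  proof -
    obtain i where i: "i < n" "p i \<noteq> i"
      using p by (metis eq_id_iff lessThan_iff permutes_not_in)
    have lt: "p k < n" if "k < n" for k using p that permutes_in_image by fastforce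
    have "(\<Otimes>k\<in>{..<n}. L k (p k)) = L i (p i) \<otimes> (\<Otimes>k\<in>{..<n} - {i}. L k (p k))"
      by (rule finprod_remove) (use i L in auto)
    moreover have "(\<Otimes>k\<in>{..<n} - {i}. L k (p k)) \<in> S (e * card ({..<n} - {i})) \<union> T (e * card ({..<n} - {i}))"
    proof (rule ST)
      fix k assume "k \<in> {..<n} - {i}"
      then show "L k (p k) \<in> S e \<union> T e"
        using diag[of k] off[of k "p k"] lt[of k] by (cases "p k = k") auto
    qed simp
    ultimately have "(\<Otimes>k\<in>{..<n}. L k (p k)) \<in> S (e + e * card ({..<n} - {i}))"
      using Smult[of "L i (p i)" e] off[of i "p i"] i lt[of i] by auto
    moreover have "e + e * card ({..<n} - {i}) = e * n"
      using i by (cases n) auto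
    ultimately show ?thesis using Sneg by (simp add: leibniz_term_def)
  qed
  have sumS: "(\<Oplus>p\<in>A. x p) \<in> S d" if "finite A" "\<And>p. p \<in> A \<Longrightarrow> x p \<in> S d" for A :: "(nat \<Rightarrow> nat) set" and x d
    using that
  proof (induction A rule: finite_induct)
    case (insert a A)
    then have "(\<Oplus>p\<in>insert a A. x p) = x a \<oplus> (\<Oplus>p\<in>A. x p)"
      by (intro finsum_insert) (use clS in auto)
    then show ?case using insert Sadd by simp
  qed (use S0 in simp)
  have fin: "finite {p. p permutes {..<n}}" by (simp add: finite_permutations)
  have "Det n L = leibniz_term n L id \<oplus> (\<Oplus>p\<in>{p. p permutes {..<n}} - {id}. leibniz_term n L p)"
    unfolding Det_def by (rule finsum_remove) (use fin L permutes_id in auto)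
  moreover have "(\<Oplus>p\<in>{p. p permutes {..<n}} - {id}. leibniz_term n L p) \<in> S (e * n)"
    by (rule sumS) (use fin off' in auto)
  ultimately show ?thesis using TS diag' by simp
qed

lemma Det_unit_vecs: "Det n unit_vec = \<one>"
proof -
  have "Det n unit_vec \<in> (\<lambda>d. {\<one>}) (1 * n)"
    by (rule Det_graded[where S = "\<lambda>d. {\<zero>}"]) (auto simp: unit_vec_def)
  then show ?thesis by simp
qed

lemma Det_permute_rows:
  assumes L: "\<And>i j. L i j \<in> carrier R" and q: "q permutes {..<n}"
  shows "Det n (\<lambda>i. L (q i)) \<in> {Det n L, \<ominus> Det n L}"
proof -
  have D: "Det n L \<in> carrier R" using L by simp
  have "finite {..<n}" by simp
  then show ?thesis using q
  proof (induction q rule: permutes_rev_induct)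
    case id
    then show ?case by simp
  next
    case (swap a b p)
    show ?case
    proof (cases "a = b")
      case True
      then show ?thesis using swap by simp
    next
      case False
      have 1: "(\<lambda>i. L ((p \<circ> transpose a b) i)) = (\<lambda>i. L (p i))(a := L (p b), b := L (p a))"
        using False by (auto simp: fun_eq_iff transpose_def)
      have 2: "Det n ((\<lambda>i. L (p i))(a := L (p b), b := L (p a))) = \<ominus> Det n ((\<lambda>i. L (p i))(a := L (p a), b := L (p b)))"
        by (rule Det_swap_rows) (use L swap False in auto)
      have 3: "(\<lambda>i. L (p i))(a := L (p a), b := L (p b)) = (\<lambda>i. L (p i))"
        by (simp add: fun_eq_iff)
      have "Det n (\<lambda>i. L ((p \<circ> transpose a b) i)) = \<ominus> Det n (\<lambda>i. L (p i))"
        by (simp only: 1 2 3)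
      then show ?thesis using swap.IH D by auto
    qed
  qed
qed

lemma finsum_swap:
  assumes "finite A" "finite B" "\<And>a b. g a b \<in> carrier R"
  shows "(\<Oplus>a\<in>A. \<Oplus>b\<in>B. g a b) = (\<Oplus>b\<in>B. \<Oplus>a\<in>A. g a b)"
  using assms(1)
proof (induction A rule: finite_induct)
  case empty
  show ?case using assms(2) by simp
next
  case (insert x A)
  have "(\<Oplus>a\<in>insert x A. \<Oplus>b\<in>B. g a b) = (\<Oplus>b\<in>B. g x b) \<oplus> (\<Oplus>b\<in>B. \<Oplus>a\<in>A. g a b)"
    using insert assms(3) by (simp add: Pi_def finsum_insert)
  also have "\<dots> = (\<Oplus>b\<in>B. g x b \<oplus> (\<Oplus>a\<in>A. g a b))"
    by (rule finsum_addf[symmetric]) (use assms(3) in auto)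
  also have "\<dots> = (\<Oplus>b\<in>B. \<Oplus>a\<in>insert x A. g a b)"
    using insert assms(3) by (intro finsum_cong') auto
  finally show ?case .
qed

lemma bilinear_assoc:
  assumes "finite A" "finite B" and c: "\<And>b. f b \<in> carrier R" "\<And>b j. m b j \<in> carrier R" "\<And>j. w j \<in> carrier R"
  shows "(\<Oplus>b\<in>A. f b \<otimes> (\<Oplus>j\<in>B. m b j \<otimes> w j)) = (\<Oplus>j\<in>B. (\<Oplus>b\<in>A. f b \<otimes> m b j) \<otimes> w j)"
proof -
  have "(\<Oplus>b\<in>A. f b \<otimes> (\<Oplus>j\<in>B. m b j \<otimes> w j)) = (\<Oplus>b\<in>A. \<Oplus>j\<in>B. f b \<otimes> m b j \<otimes> w j)"
    using assms by (intro finsum_cong') (auto simp: finsum_rdistr m_assoc)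
  also have "\<dots> = (\<Oplus>j\<in>B. \<Oplus>b\<in>A. f b \<otimes> m b j \<otimes> w j)"
    by (rule finsum_swap) (use assms in auto)
  also have "\<dots> = (\<Oplus>j\<in>B. (\<Oplus>b\<in>A. f b \<otimes> m b j) \<otimes> w j)"
    using assms by (intro finsum_cong') (auto simp: finsum_ldistr)
  finally show ?thesis .
qed

lemma Det_expand_row:
  assumes L: "\<And>i j. L i j \<in> carrier R" and m: "m < n" and r: "\<And>k. r k \<in> carrier R"
  shows "(\<Oplus>k\<in>{..<n}. r k \<otimes> Det n (L(m := unit_vec k))) = Det n (L(m := r))"
proof -
  have "Det n (L(m := \<lambda>k'. \<Oplus>k\<in>{..<n}. r k \<otimes> unit_vec k k')) =
      (\<Oplus>k\<in>{..<n}. r k \<otimes> Det n (L(m := unit_vec k)))"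
    by (rule Det_row_sum) (use L r m in auto)
  moreover have "Det n (L(m := \<lambda>k'. \<Oplus>k\<in>{..<n}. r k \<otimes> unit_vec k k')) = Det n (L(m := r))"
    by (rule Det_cong) (use L r finsum_delta(3)[of "{..<n}" _ r] in auto)
  ultimately show ?thesis by simp
qed

end


section \<open>Noetherian rings and associated primes\<close>

locale noetherian_cring = noetherian_ring R + cring R for R (structure)

lemma (in noetherian_ring) maximal_in_family:
  assumes "A \<noteq> {}" "\<And>K. K \<in> A \<Longrightarrow> ideal K R"
  shows "\<exists>M\<in>A. \<forall>K\<in>A. M \<subseteq> K \<longrightarrow> K = M"
proof (rule subset_Zorn_nonempty[OF assms(1)])
  fix C assume C: "C \<noteq> {}" "subset.chain A C"
  then have "subset.chain {I. ideal I R} C" using assms(2) by (auto simp: subset.chain_def)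
  from ideal_chain_is_trivial[OF C(1) this] have "\<Union>C \<in> C" .
  then show "\<Union>C \<in> A" using C(2) by (auto simp: subset.chain_def)
qed

lemma (in cring) colon_ideal:
  assumes J: "ideal J R" and s: "s \<in> carrier R"
  shows "ideal {a \<in> carrier R. a \<otimes> s \<in> J} R"
proof -
  interpret J: ideal J R by fact
  show ?thesis
  proof (rule idealI)
    show "subgroup {a \<in> carrier R. a \<otimes> s \<in> J} (add_monoid R)"
    proof (rule add.subgroupI)
      show "{a \<in> carrier R. a \<otimes> s \<in> J} \<noteq> {}" using s by (auto intro!: exI[of _ \<zero>])
    qed (use s in \<open>auto simp: l_minus l_distr a_inv_def[symmetric]\<close>)
  next
    fix a x assume a: "a \<in> {a \<in> carrier R. a \<otimes> s \<in> J}" and x: "x \<in> carrier R"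
    then have "x \<otimes> (a \<otimes> s) \<in> J" using J.I_l_closed[of "a \<otimes> s" x] by simp
    then show "x \<otimes> a \<in> {a \<in> carrier R. a \<otimes> s \<in> J}" using a x s by (simp add: m_assoc)
    then show "a \<otimes> x \<in> {a \<in> carrier R. a \<otimes> s \<in> J}" using a x by (simp add: m_comm)
  qed (rule ring_axioms)
qed

text \<open>A colon ideal \<open>(J : r s0)\<close> that is maximal among the proper ones is prime. The element \<open>r s0\<close>
  is what later arguments compute with: \<open>a \<otimes> (r \<otimes> s0) \<notin> J\<close> says that \<open>a\<close> is nonzero at this
  associated prime of \<open>R/J\<close>.\<close>
lemma (in noetherian_cring) associated_prime:
  assumes J: "ideal J R" and s0: "s0 \<in> carrier R" "s0 \<notin> J"
  obtains r where "r \<in> carrier R" "r \<otimes> s0 \<notin> J"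
    "\<And>a b. a \<in> carrier R \<Longrightarrow> b \<in> carrier R \<Longrightarrow> a \<otimes> b \<otimes> (r \<otimes> s0) \<in> J \<Longrightarrow>
      a \<otimes> (r \<otimes> s0) \<in> J \<or> b \<otimes> (r \<otimes> s0) \<in> J"
proof -
  interpret J: ideal J R by fact
  let ?col = "\<lambda>s. {a \<in> carrier R. a \<otimes> s \<in> J}"
  let ?A = "{?col (r \<otimes> s0) | r. r \<in> carrier R \<and> r \<otimes> s0 \<notin> J}"
  have "?col (\<one> \<otimes> s0) \<in> ?A" using s0 by (intro CollectI exI[of _ \<one>]) auto
  moreover have "ideal K R" if "K \<in> ?A" for K using that colon_ideal[OF J] s0 by auto
  ultimately have "\<exists>M\<in>?A. \<forall>K\<in>?A. M \<subseteq> K \<longrightarrow> K = M"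
    by (intro maximal_in_family) (blast, simp)
  then obtain M where MA: "M \<in> ?A" and M: "\<forall>K\<in>?A. M \<subseteq> K \<longrightarrow> K = M" ..
  from MA have "\<exists>r. M = ?col (r \<otimes> s0) \<and> r \<in> carrier R \<and> r \<otimes> s0 \<notin> J" by simp
  then obtain r where r: "r \<in> carrier R" "r \<otimes> s0 \<notin> J" "M = ?col (r \<otimes> s0)" by (elim exE conjE)
  show thesis
  proof (rule that[OF r(1,2)])
    fix a b assume ab: "a \<in> carrier R" "b \<in> carrier R" "a \<otimes> b \<otimes> (r \<otimes> s0) \<in> J"
    show "a \<otimes> (r \<otimes> s0) \<in> J \<or> b \<otimes> (r \<otimes> s0) \<in> J"
    proof (rule disjCI)
      assume nb: "b \<otimes> (r \<otimes> s0) \<notin> J"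
      have eq: "b \<otimes> r \<otimes> s0 = b \<otimes> (r \<otimes> s0)" using ab r s0 by (simp add: m_assoc)
      have "?col (b \<otimes> r \<otimes> s0) \<in> ?A"
        by (rule CollectI, rule exI[of _ "b \<otimes> r"]) (use nb ab r eq in simp)
      moreover have "M \<subseteq> ?col (b \<otimes> r \<otimes> s0)"
      proof
        fix c assume "c \<in> M"
        then have c: "c \<in> carrier R" "c \<otimes> (r \<otimes> s0) \<in> J" using r by auto
        then have "b \<otimes> (c \<otimes> (r \<otimes> s0)) \<in> J" using ab J.I_l_closed by simp
        moreover have "b \<otimes> (c \<otimes> (r \<otimes> s0)) = c \<otimes> (b \<otimes> r \<otimes> s0)"
          using ab c r s0 by (simp add: m_ac)
        ultimately show "c \<in> ?col (b \<otimes> r \<otimes> s0)" using c by simp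
      qed
      ultimately have "?col (b \<otimes> r \<otimes> s0) = ?col (r \<otimes> s0)" using M r(3) by simp
      moreover have "a \<in> ?col (b \<otimes> r \<otimes> s0)"
        using ab r s0 by (simp add: m_assoc)
      ultimately show "a \<otimes> (r \<otimes> s0) \<in> J" by blast
    qed
  qed
qed


section \<open>Cofactors of a self-dual complex\<close>

text \<open>A complex \<open>R \<rightarrow> R\<^sup>n \<rightarrow> R\<^sup>n \<rightarrow> R\<close> with maps \<open>\<psi>\<close>, \<open>\<rho>\<close>, \<open>f\<close> that is exact except at its right end,
  and whose transpose is exact at the first two places.\<close>
locale self_dual_complex = noetherian_cring R for R (structure) +
  fixes n :: nat and \<rho> :: "nat \<Rightarrow> nat \<Rightarrow> 'a" and f \<psi> :: "nat \<Rightarrow> 'a"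
  assumes rho_closed [simp]: "\<rho> b j \<in> carrier R"
    and f_closed [simp]: "f b \<in> carrier R"
    and psi_closed [simp]: "\<psi> j \<in> carrier R"
    and f_rho: "j < n \<Longrightarrow> (\<Oplus>b\<in>{..<n}. f b \<otimes> \<rho> b j) = \<zero>"
    and rho_psi: "b < n \<Longrightarrow> (\<Oplus>j\<in>{..<n}. \<rho> b j \<otimes> \<psi> j) = \<zero>"
    and ker_rho: "\<lbrakk>\<And>j. w j \<in> carrier R; \<And>b. b < n \<Longrightarrow> (\<Oplus>j\<in>{..<n}. \<rho> b j \<otimes> w j) = \<zero>\<rbrakk>
      \<Longrightarrow> \<exists>t\<in>carrier R. \<forall>j<n. w j = t \<otimes> \<psi> j"
    and ker_f: "\<lbrakk>\<And>b. z b \<in> carrier R; (\<Oplus>b\<in>{..<n}. f b \<otimes> z b) = \<zero>\<rbrakk>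
      \<Longrightarrow> \<exists>y. (\<forall>j. y j \<in> carrier R) \<and> (\<forall>b<n. z b = (\<Oplus>j\<in>{..<n}. \<rho> b j \<otimes> y j))"
    and ker_rho_dual: "\<lbrakk>\<And>b. c b \<in> carrier R; \<And>j. j < n \<Longrightarrow> (\<Oplus>b\<in>{..<n}. c b \<otimes> \<rho> b j) = \<zero>\<rbrakk>
      \<Longrightarrow> \<exists>u\<in>carrier R. \<forall>b<n. c b = u \<otimes> f b"
    and psi_faithful: "\<lbrakk>t \<in> carrier R; \<And>j. j < n \<Longrightarrow> t \<otimes> \<psi> j = \<zero>\<rbrakk> \<Longrightarrow> t = \<zero>"
    and f_faithful: "\<lbrakk>r \<in> carrier R; \<And>b. b < n \<Longrightarrow> r \<otimes> f b = \<zero>\<rbrakk> \<Longrightarrow> r = \<zero>"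
begin

definition cofactor :: "nat \<Rightarrow> nat \<Rightarrow> 'a"
  where "cofactor m k = Det n (\<rho>(m := unit_vec k))"

lemma cofactor_closed [simp]: "cofactor m k \<in> carrier R"
  unfolding cofactor_def by (rule Det_closed) simp

text \<open>Rows are repeated or permuted; in the latter case the relation \<open>f\<close> between the rows makes
  every \<open>f\<^sub>b\<close> kill the determinant.\<close>
lemma Det_rows_eq_zero:
  assumes g: "\<And>i. i < n \<Longrightarrow> g i < n"
  shows "Det n (\<lambda>i. \<rho> (g i)) = \<zero>"
proof (cases "inj_on g {..<n}")
  case False
  then obtain i j where "i < n" "j < n" "i \<noteq> j" "g i = g j" by (auto simp: inj_on_def)
  then show ?thesis by (intro Det_alternating[of _ i n j]) auto
next
  case True
  have im: "g ` {..<n} = {..<n}"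
    by (rule endo_inj_surj) (use True g in auto)
  show ?thesis
  proof (rule f_faithful)
    fix b assume "b < n"
    then obtain i where i: "i < n" "b = g i" using im by (metis imageE lessThan_iff)
    have "f (g i) \<otimes> Det n (\<lambda>i. \<rho> (g i)) = \<zero>"
    proof (rule Det_row_relation[where h = "\<lambda>i. f (g i)"])
      fix k assume "k < n"
      have "(\<Oplus>j\<in>{..<n}. f (g j) \<otimes> \<rho> (g j) k) = (\<Oplus>b\<in>g ` {..<n}. f b \<otimes> \<rho> b k)"
        by (rule finsum_reindex[symmetric]) (use True in auto)
      then show "(\<Oplus>j\<in>{..<n}. f (g j) \<otimes> \<rho> (g j) k) = \<zero>"
        using im f_rho \<open>k < n\<close> by simp
    qed (use i in auto)
    then show "Det n (\<lambda>i. \<rho> (g i)) \<otimes> f b = \<zero>" using i by (simp add: m_comm)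
  qed simp
qed

text \<open>Put the vanishing combination \<open>\<Sum>\<^sub>j f\<^sub>j \<rho>\<^sub>j\<close> into row \<open>i\<close> of the determinant with \<open>e\<^sub>k\<close> in
  row \<open>m\<close>: only the terms \<open>j = i\<close> and \<open>j = m\<close> survive.\<close>
lemma cofactor_exchange:
  assumes ij: "i < n" "m < n"
  shows "f i \<otimes> cofactor m k = f m \<otimes> cofactor i k"
proof (cases "i = m")
  case False
  let ?L = "\<rho>(m := unit_vec k)"
  have L: "?L a b \<in> carrier R" for a b by simp
  let ?t = "\<lambda>j. f j \<otimes> Det n (?L(i := \<rho> j))"
  have tc: "?t j \<in> carrier R" for j by (intro m_closed Det_closed) auto
  have "\<zero> = Det n (?L(i := \<lambda>k. \<Oplus>j\<in>{..<n}. f j \<otimes> \<rho> j k))"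
    by (rule Det_zero_row[symmetric, where i = i]) (use f_rho ij in auto)
  also have "\<dots> = (\<Oplus>j\<in>{..<n}. ?t j)"
    by (rule Det_row_sum) (use ij in auto)
  also have "\<dots> = ?t i \<oplus> (\<Oplus>j\<in>{..<n} - {i}. ?t j)"
    by (rule finsum_remove) (use ij tc in auto)
  also have "(\<Oplus>j\<in>{..<n} - {i}. ?t j) = ?t m \<oplus> (\<Oplus>j\<in>{..<n} - {i} - {m}. ?t j)"
    by (rule finsum_remove) (use ij tc False in auto)
  also have "(\<Oplus>j\<in>{..<n} - {i} - {m}. ?t j) = (\<Oplus>j\<in>{..<n} - {i} - {m}. \<zero>)"
  proof (rule finsum_cong')
    fix j assume j: "j \<in> {..<n} - {i} - {m}"
    have "Det n (?L(i := \<rho> j)) = \<zero>"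
      by (rule Det_alternating[of _ i n j]) (use j ij in auto)
    then show "?t j = \<zero>" by simp
  qed auto
  also have "?L(i := \<rho> i) = ?L" using False by auto
  finally have s: "\<zero> = f i \<otimes> Det n ?L \<oplus> f m \<otimes> Det n (?L(i := \<rho> m))"
    by (simp only: finsum_zero r_zero tc[of m])
  have "Det n (\<rho>(m := unit_vec k, i := \<rho> m)) = \<ominus> Det n (\<rho>(m := \<rho> m, i := unit_vec k))"
    by (rule Det_swap_rows) (use ij False in auto)
  also have "\<rho>(m := \<rho> m, i := unit_vec k) = \<rho>(i := unit_vec k)" by simp
  finally have "f i \<otimes> cofactor m k \<oplus> f m \<otimes> (\<ominus> cofactor i k) = \<zero>"
    using s by (simp only: cofactor_def)
  then have "f i \<otimes> cofactor m k \<ominus> f m \<otimes> cofactor i k = \<zero>"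
    by (simp add: r_minus minus_eq)
  then show ?thesis by simp
qed simp

text \<open>Each row of cofactors lies in the kernel of \<open>\<rho>\<close> and so is a multiple \<open>c\<^sub>m \<psi>\<close>. The exchange
  formula makes \<open>c\<close> proportional to \<open>f\<close>, hence an element of the left kernel of \<open>\<rho>\<close>, which is
  spanned by \<open>f\<close>.\<close>
lemma cofactor_factorization:
  "\<exists>u\<in>carrier R. \<forall>m<n. \<forall>k<n. cofactor m k = u \<otimes> f m \<otimes> \<psi> k"
proof -
  have "\<exists>t\<in>carrier R. \<forall>k<n. cofactor m k = t \<otimes> \<psi> k" if m: "m < n" for m
  proof (rule ker_rho)
    fix b assume b: "b < n"
    have "(\<Oplus>k\<in>{..<n}. \<rho> b k \<otimes> cofactor m k) = Det n (\<rho>(m := \<rho> b))"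
      unfolding cofactor_def by (rule Det_expand_row) (use m in auto)
    also have "\<rho>(m := \<rho> b) = (\<lambda>i. \<rho> ((id(m := b)) i))" by auto
    also have "Det n \<dots> = \<zero>" by (rule Det_rows_eq_zero) (use b in auto)
    finally show "(\<Oplus>k\<in>{..<n}. \<rho> b k \<otimes> cofactor m k) = \<zero>" .
  qed simp
  then obtain c where "m < n \<Longrightarrow> c m \<in> carrier R \<and> (\<forall>k<n. cofactor m k = c m \<otimes> \<psi> k)" for m
    by metis
  then have c: "m < n \<Longrightarrow> c m \<in> carrier R" "m < n \<Longrightarrow> k < n \<Longrightarrow> cofactor m k = c m \<otimes> \<psi> k" for m k
    by auto
  have exch: "f i \<otimes> c m = f m \<otimes> c i" if "i < n" "m < n" for i m
  proof -
    have "f i \<otimes> c m \<ominus> f m \<otimes> c i = \<zero>"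
    proof (rule psi_faithful)
      fix k assume k: "k < n"
      have "f i \<otimes> (c m \<otimes> \<psi> k) = f m \<otimes> (c i \<otimes> \<psi> k)"
        using cofactor_exchange[OF that, of k] c k that by simp
      then show "(f i \<otimes> c m \<ominus> f m \<otimes> c i) \<otimes> \<psi> k = \<zero>"
        using c that by (simp add: minus_eq l_distr l_minus m_assoc r_neg)
    qed (use c that in simp)
    then show ?thesis using c that by simp
  qed
  define c' where "c' = (\<lambda>m. if m < n then c m else \<zero>)"
  have c': "c' m \<in> carrier R" for m using c by (simp add: c'_def)
  have "\<exists>u\<in>carrier R. \<forall>b<n. c' b = u \<otimes> f b"
  proof (rule ker_rho_dual[OF c'])
    fix j assume j: "j < n"
    let ?d = "\<Oplus>b\<in>{..<n}. c' b \<otimes> \<rho> b j"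
    show "?d = \<zero>"
    proof (rule f_faithful)
      show "?d \<in> carrier R" using c' by simp
    next
      fix i assume i: "i < n"
      have "?d \<otimes> f i = (\<Oplus>b\<in>{..<n}. c' b \<otimes> \<rho> b j \<otimes> f i)"
        by (rule finsum_ldistr) (use c' in auto)
      also have "\<dots> = (\<Oplus>b\<in>{..<n}. c' i \<otimes> (f b \<otimes> \<rho> b j))"
      proof (rule finsum_cong')
        fix b assume b: "b \<in> {..<n}"
        have "c' b \<otimes> \<rho> b j \<otimes> f i = (f i \<otimes> c' b) \<otimes> \<rho> b j" using c' by (simp add: m_ac)
        also have "f i \<otimes> c' b = f b \<otimes> c' i" using exch[of i b] i b by (simp add: c'_def)
        finally show "c' b \<otimes> \<rho> b j \<otimes> f i = c' i \<otimes> (f b \<otimes> \<rho> b j)" using c' by (simp add: m_ac)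
      qed (use c' in auto)
      also have "\<dots> = c' i \<otimes> (\<Oplus>b\<in>{..<n}. f b \<otimes> \<rho> b j)"
        by (rule finsum_rdistr[symmetric]) (use c' in auto)
      finally show "?d \<otimes> f i = \<zero>" using f_rho j c' by simp
    qed
  qed
  then obtain u where u: "u \<in> carrier R" "\<And>b. b < n \<Longrightarrow> c' b = u \<otimes> f b" by blast
  have "cofactor m k = u \<otimes> f m \<otimes> \<psi> k" if "m < n" "k < n" for m k
    using c(2)[OF that] u(2)[OF that(1)] that by (simp add: c'_def)
  then show ?thesis using u(1) by blast
qed

text \<open>Over the localization at the prime \<open>(J : s)\<close> the complex modulo \<open>J\<close> splits, so the
  matrix has rank \<open>n - 1\<close> there. The argument is McCoy's, phrased with determinants whose
  rows are rows of the matrix or unit vectors: among those that do not vanish at the prime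
  and contain the unit vector \<open>e\<^sub>i\<close>, one with the most rows of the matrix is a cofactor.\<close>
lemma cofactor_notin_prime:
  assumes J: "ideal J R" and s: "s \<in> carrier R" "s \<notin> J"
    and prime: "\<And>a b. a \<in> carrier R \<Longrightarrow> b \<in> carrier R \<Longrightarrow> a \<otimes> b \<otimes> s \<in> J \<Longrightarrow> a \<otimes> s \<in> J \<or> b \<otimes> s \<in> J"
    and exact: "\<And>w. (\<And>j. w j \<in> carrier R) \<Longrightarrow> (\<And>b. b < n \<Longrightarrow> (\<Oplus>j\<in>{..<n}. \<rho> b j \<otimes> w j) \<in> J)
      \<Longrightarrow> \<exists>t\<in>carrier R. \<forall>j<n. w j \<ominus> t \<otimes> \<psi> j \<in> J"
    and i: "i < n" "\<psi> i \<otimes> s \<notin> J"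
  shows "\<exists>m<n. cofactor m i \<otimes> s \<notin> J"
proof -
  interpret J: ideal J R by fact
  have Jd: "x \<in> J" if "x \<ominus> y \<in> J" "y \<in> J" "x \<in> carrier R" for x y
  proof -
    have "(x \<ominus> y) \<oplus> y \<in> J" using that by simp
    moreover have "(x \<ominus> y) \<oplus> y = x" using that J.a_subset by (simp add: minus_eq a_assoc l_neg subsetD)
    ultimately show ?thesis by simp
  qed
  define row where "row = (\<lambda>B (g :: nat \<Rightarrow> nat) l. if l \<in> B then \<rho> (g l) else unit_vec (g l))"
  define good where "good = (\<lambda>B g. B \<subseteq> {..<n} \<and> (\<forall>l<n. g l < n) \<and> (\<exists>l<n. l \<notin> B \<and> g l = i)
    \<and> Det n (row B g) \<otimes> s \<notin> J)"
  have row_closed [simp]: "row B g l k \<in> carrier R" for B g l k by (simp add: row_def)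
  have g0: "good {} id"
    using i s Det_unit_vecs[of n] by (auto simp: good_def row_def)
  let ?C = "{card B | B. \<exists>g. good B g}"
  have "?C \<subseteq> {..n}" using card_mono[of "{..<n}"] by (force simp: good_def)
  then have fin: "finite ?C" by (rule finite_subset) simp
  have ne: "?C \<noteq> {}" using g0 by blast
  from Max_in[OF fin ne] have "\<exists>B. Max ?C = card B \<and> (\<exists>g. good B g)" by simp
  then obtain B g where Bg: "Max ?C = card B" "good B g" by blast
  have max: "card B' \<le> card B" if "good B' g'" for B' g'
    unfolding Bg(1)[symmetric] by (rule Max_ge[OF fin]) (use that in blast)
  have B: "B \<subseteq> {..<n}" "\<And>l. l < n \<Longrightarrow> g l < n" "Det n (row B g) \<otimes> s \<notin> J"
    using Bg(2) by (auto simp: good_def)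
  obtain l0 where l0: "l0 < n" "l0 \<notin> B" "g l0 = i" using Bg(2) by (auto simp: good_def)
  have alt: "Det n L \<otimes> s \<in> J" if "\<And>i j. L i j \<in> carrier R" "a < n" "b < n" "a \<noteq> b" "L a = L b" for L a b
    using Det_alternating[of L a n b] that s by simp
  have Bfull: "B = {..<n} - {l0}"
  proof (rule ccontr)
    assume "B \<noteq> {..<n} - {l0}"
    then obtain l1 where l1: "l1 < n" "l1 \<notin> B" "l1 \<noteq> l0" using B l0 by blast
    \<comment> \<open>The vector of determinants with all unit vectors in row \<open>l1\<close>. Its image under \<open>\<rho>\<close> consists
      of determinants with one more row of \<open>\<rho>\<close>, which vanish at the prime by maximality; so it is
      a multiple of \<open>\<psi>\<close> there, and that multiple is zero because the entry at \<open>i\<close> is.\<close>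
    define v where "v = (\<lambda>k. Det n ((row B g)(l1 := unit_vec k)))"
    have v: "v k \<in> carrier R" for k unfolding v_def by (rule Det_closed) simp
    have "\<exists>t\<in>carrier R. \<forall>j<n. s \<otimes> v j \<ominus> t \<otimes> \<psi> j \<in> J"
    proof (rule exact)
      fix b assume b: "b < n"
      have "(\<Oplus>j\<in>{..<n}. \<rho> b j \<otimes> v j) = Det n ((row B g)(l1 := \<rho> b))"
        unfolding v_def by (rule Det_expand_row) (use l1 in auto)
      also have "(row B g)(l1 := \<rho> b) = row (insert l1 B) (g(l1 := b))"
        using l1 by (auto simp: row_def)
      finally have e: "(\<Oplus>j\<in>{..<n}. \<rho> b j \<otimes> v j) = Det n (row (insert l1 B) (g(l1 := b)))" .
      have fB: "finite B" using B(1) finite_subset by blast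
      have "\<not> good (insert l1 B) (g(l1 := b))"
        using max[of "insert l1 B"] l1 fB by auto
      then have "Det n (row (insert l1 B) (g(l1 := b))) \<otimes> s \<in> J"
        using B l0 l1 b unfolding good_def by (metis (no_types, lifting) fun_upd_apply insert_iff insert_subset lessThan_iff)
      moreover have "(\<Oplus>j\<in>{..<n}. \<rho> b j \<otimes> (s \<otimes> v j)) = (\<Oplus>j\<in>{..<n}. s \<otimes> (\<rho> b j \<otimes> v j))"
        by (rule finsum_cong') (use v s in \<open>auto simp: m_ac\<close>)
      moreover have "\<dots> = s \<otimes> (\<Oplus>j\<in>{..<n}. \<rho> b j \<otimes> v j)"
        by (rule finsum_rdistr[symmetric]) (use v s in auto)
      moreover have "s \<otimes> Det n (row (insert l1 B) (g(l1 := b))) = Det n (row (insert l1 B) (g(l1 := b))) \<otimes> s"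
        by (rule m_comm) (use s in auto)
      ultimately show "(\<Oplus>j\<in>{..<n}. \<rho> b j \<otimes> (s \<otimes> v j)) \<in> J" using e by simp
    qed (use v s in simp)
    then obtain t where t: "t \<in> carrier R" "\<And>j. j < n \<Longrightarrow> s \<otimes> v j \<ominus> t \<otimes> \<psi> j \<in> J" by blast
    have "v i = \<zero>"
      unfolding v_def by (rule Det_alternating[of _ l1 n l0]) (use l0 l1 in \<open>auto simp: row_def\<close>)
    then have "\<ominus> (t \<otimes> \<psi> i) \<in> J" using t(2)[OF i(1)] t(1) s by (simp add: minus_eq)
    then have ti: "t \<otimes> \<psi> i \<in> J" using t(1) J.a_inv_closed[of "\<ominus> (t \<otimes> \<psi> i)"] by simp
    define j where "j = g l1"
    have j: "j < n" using B l1 by (simp add: j_def)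
    have vj: "v j = Det n (row B g)"
    proof -
      have "(row B g)(l1 := unit_vec j) = row B g" using l1 by (auto simp: row_def j_def)
      then show ?thesis by (simp add: v_def)
    qed
    have "\<psi> i \<otimes> (s \<otimes> v j \<ominus> t \<otimes> \<psi> j) \<in> J" using t(2)[OF j] J.I_l_closed by simp
    moreover have "\<psi> i \<otimes> (s \<otimes> v j \<ominus> t \<otimes> \<psi> j) = \<psi> i \<otimes> v j \<otimes> s \<ominus> \<psi> j \<otimes> (t \<otimes> \<psi> i)"
      using s v[of j] t(1) by (simp add: minus_eq r_distr r_minus m_ac)
    moreover have "\<psi> j \<otimes> (t \<otimes> \<psi> i) \<in> J" using ti J.I_l_closed by simp
    ultimately have "\<psi> i \<otimes> v j \<otimes> s \<in> J"
      using Jd[of "\<psi> i \<otimes> v j \<otimes> s" "\<psi> j \<otimes> (t \<otimes> \<psi> i)"] v s by simp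
    then show False using prime[of "\<psi> i" "v j"] i(2) v B(3) vj by auto
  qed
  have injg: "inj_on g B"
  proof (rule ccontr)
    assume "\<not> inj_on g B"
    then obtain a b where "a \<in> B" "b \<in> B" "a \<noteq> b" "g a = g b" by (auto simp: inj_on_def)
    then have "Det n (row B g) \<otimes> s \<in> J" using B(1) by (intro alt[of _ a b]) (auto simp: row_def)
    with B(3) show False by simp
  qed
  have "card (g ` B) < n" using card_image[OF injg] l0(1) by (simp add: Bfull)
  moreover have "g ` B \<subseteq> {..<n}" using B by auto
  ultimately obtain m where m: "m < n" "m \<notin> g ` B"
    by (metis card_lessThan lessThan_iff less_irrefl subsetI subset_antisym)
  \<comment> \<open>Row \<open>l0\<close> is \<open>e\<^sub>i\<close> and the others are the rows of \<open>\<rho>\<close> except the one with index \<open>m\<close>.\<close>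
  define q where "q = (\<lambda>l. if l < n then (if l = l0 then m else g l) else l)"
  have "inj_on q {..<n}"
    using injg m by (auto simp: inj_on_def q_def Bfull image_iff)
  then have bij: "bij_betw q {..<n} {..<n}"
    using endo_inj_surj[of "{..<n}" q] m B by (auto simp: bij_betw_def q_def)
  have q: "q permutes {..<n}"
    by (rule bij_imp_permutes[OF bij]) (simp add: q_def)
  have "Det n (row B g) = Det n (\<lambda>l. (\<rho>(m := unit_vec i)) (q l))"
  proof (rule Det_cong)
    fix l k assume "l < n" "k < n"
    then show "row B g l k = (\<rho>(m := unit_vec i)) (q l) k"
      using m l0 by (auto simp: row_def q_def Bfull)
  qed simp
  also have "\<dots> \<in> {Det n (\<rho>(m := unit_vec i)), \<ominus> Det n (\<rho>(m := unit_vec i))}"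
    by (rule Det_permute_rows) (use q in auto)
  finally have "Det n (row B g) = cofactor m i \<or> Det n (row B g) = \<ominus> cofactor m i"
    by (simp add: cofactor_def)
  then have "cofactor m i \<otimes> s \<notin> J" using B(3) s J.a_inv_closed[of "cofactor m i \<otimes> s"] by (auto simp: l_minus)
  then show ?thesis using m by blast
qed

text \<open>The factor \<open>u\<close> is no zero divisor, because the cofactors do not all lie in an associated
  prime of \<open>R\<close>; and it is a unit, because otherwise the same holds for an associated prime
  of \<open>R / (u)\<close>, over which the complex is still exact where it matters.\<close>
lemma cofactor_eq:
  obtains u where "u \<in> Units R" "\<And>m k. m < n \<Longrightarrow> k < n \<Longrightarrow> cofactor m k = u \<otimes> f m \<otimes> \<psi> k"
proof -
  obtain u where u: "u \<in> carrier R" "\<And>m k. m < n \<Longrightarrow> k < n \<Longrightarrow> cofactor m k = u \<otimes> f m \<otimes> \<psi> k"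
    using cofactor_factorization by blast
  \<comment> \<open>Used for \<open>J = 0\<close> and an \<open>s0\<close> that is killed by \<open>u\<close>, and for \<open>J = (u)\<close> and \<open>s0 = 1\<close>.\<close>
  have contra: False if J: "ideal J R" and s0: "s0 \<in> carrier R" "s0 \<notin> J" "u \<otimes> s0 \<in> J"
    and exact: "\<And>w. (\<And>j. w j \<in> carrier R) \<Longrightarrow> (\<And>b. b < n \<Longrightarrow> (\<Oplus>j\<in>{..<n}. \<rho> b j \<otimes> w j) \<in> J)
      \<Longrightarrow> \<exists>t\<in>carrier R. \<forall>j<n. w j \<ominus> t \<otimes> \<psi> j \<in> J"
    and faithful: "\<And>t. t \<in> carrier R \<Longrightarrow> (\<And>j. j < n \<Longrightarrow> \<psi> j \<otimes> t \<in> J) \<Longrightarrow> t \<in> J" for J s0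
  proof -
    interpret J: ideal J R by fact
    obtain r where r: "r \<in> carrier R" "r \<otimes> s0 \<notin> J"
      "\<And>a b. a \<in> carrier R \<Longrightarrow> b \<in> carrier R \<Longrightarrow> a \<otimes> b \<otimes> (r \<otimes> s0) \<in> J \<Longrightarrow>
        a \<otimes> (r \<otimes> s0) \<in> J \<or> b \<otimes> (r \<otimes> s0) \<in> J"
      by (rule associated_prime[OF J s0(1,2)]) (rule that, assumption+)
    obtain i where i: "i < n" "\<psi> i \<otimes> (r \<otimes> s0) \<notin> J"
      using faithful[of "r \<otimes> s0"] r s0 by auto
    obtain m where m: "m < n" "cofactor m i \<otimes> (r \<otimes> s0) \<notin> J"
      using cofactor_notin_prime[OF J _ r(2) r(3) exact i] r s0 by blast
    have "f m \<otimes> \<psi> i \<otimes> r \<otimes> (u \<otimes> s0) \<in> J" using s0(3) r(1) J.I_l_closed by simp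
    moreover have "f m \<otimes> \<psi> i \<otimes> r \<otimes> (u \<otimes> s0) = cofactor m i \<otimes> (r \<otimes> s0)"
      using u m i r(1) s0(1) by (simp add: m_ac)
    ultimately show False using m(2) by simp
  qed
  have nzd: "a = \<zero>" if a: "a \<in> carrier R" "u \<otimes> a = \<zero>" for a
  proof (rule ccontr)
    assume "a \<noteq> \<zero>"
    then show False
    proof (intro contra[of "{\<zero>}" a] zeroideal)
      fix w :: "nat \<Rightarrow> 'a"
      assume w: "\<And>j. w j \<in> carrier R" "\<And>b. b < n \<Longrightarrow> (\<Oplus>j\<in>{..<n}. \<rho> b j \<otimes> w j) \<in> {\<zero>}"
      then obtain t where "t \<in> carrier R" "\<forall>j<n. w j = t \<otimes> \<psi> j" using ker_rho[of w] by auto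
      then show "\<exists>t\<in>carrier R. \<forall>j<n. w j \<ominus> t \<otimes> \<psi> j \<in> {\<zero>}" by (intro bexI[of _ t]) (auto simp: r_neg minus_eq)
    next
      fix t assume "t \<in> carrier R" "\<And>j. j < n \<Longrightarrow> \<psi> j \<otimes> t \<in> {\<zero>}"
      then show "t \<in> {\<zero>}" using psi_faithful[of t] by (auto simp: m_comm)
    qed (use a in auto)
  qed
  have "u \<in> Units R"
  proof (rule ccontr)
    assume nu: "u \<notin> Units R"
    have PI: "PIdl u = {x \<otimes> u | x. x \<in> carrier R}" by (simp add: cgenideal_def)
    then have PIc: "u \<otimes> x \<in> PIdl u" if "x \<in> carrier R" for x
      using that u(1) by (auto simp: m_comm intro!: exI[of _ x])
    have PIe: "\<exists>x\<in>carrier R. y = u \<otimes> x" if "y \<in> PIdl u" for y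
      using that PI u(1) by (auto simp: m_comm intro!: bexI)
    show False
    proof (rule contra[of "PIdl u" \<one>])
      show "ideal (PIdl u) R" by (rule cgenideal_ideal[OF u(1)])
      show "\<one> \<notin> PIdl u"
        using PIe[of \<one>] nu u(1) by (auto simp: Units_def) (metis m_comm)
      show "u \<otimes> \<one> \<in> PIdl u" by (rule PIc) simp
    next
      fix w :: "nat \<Rightarrow> 'a"
      assume w: "\<And>j. w j \<in> carrier R" "\<And>b. b < n \<Longrightarrow> (\<Oplus>j\<in>{..<n}. \<rho> b j \<otimes> w j) \<in> PIdl u"
      then have "\<exists>x\<in>carrier R. b < n \<longrightarrow> (\<Oplus>j\<in>{..<n}. \<rho> b j \<otimes> w j) = u \<otimes> x" for b
        using PIe by (cases "b < n") auto
      then obtain z where z: "\<And>b. z b \<in> carrier R"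
        "\<And>b. b < n \<Longrightarrow> (\<Oplus>j\<in>{..<n}. \<rho> b j \<otimes> w j) = u \<otimes> z b" by metis
      have "u \<otimes> (\<Oplus>b\<in>{..<n}. f b \<otimes> z b) = (\<Oplus>b\<in>{..<n}. u \<otimes> (f b \<otimes> z b))"
        by (rule finsum_rdistr) (use u z in auto)
      also have "\<dots> = (\<Oplus>b\<in>{..<n}. f b \<otimes> (\<Oplus>j\<in>{..<n}. \<rho> b j \<otimes> w j))"
        by (rule finsum_cong') (use u z w in \<open>auto simp: m_lcomm\<close>)
      also have "\<dots> = (\<Oplus>j\<in>{..<n}. (\<Oplus>b\<in>{..<n}. f b \<otimes> \<rho> b j) \<otimes> w j)"
        by (rule bilinear_assoc) (use w in auto)
      also have "\<dots> = \<zero>"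
        by (rule add.finprod_one_eqI) (use f_rho w in auto)
      finally have "(\<Oplus>b\<in>{..<n}. f b \<otimes> z b) = \<zero>" using nzd z by simp
      from ker_f[OF z(1) this] obtain y where y: "\<And>j. y j \<in> carrier R"
        "\<And>b. b < n \<Longrightarrow> z b = (\<Oplus>j\<in>{..<n}. \<rho> b j \<otimes> y j)" by auto
      have "(\<Oplus>j\<in>{..<n}. \<rho> b j \<otimes> (w j \<ominus> u \<otimes> y j)) = \<zero>" if b: "b < n" for b
      proof -
        have "(\<Oplus>j\<in>{..<n}. \<rho> b j \<otimes> (w j \<ominus> u \<otimes> y j)) =
            (\<Oplus>j\<in>{..<n}. \<rho> b j \<otimes> w j \<oplus> (\<ominus> u) \<otimes> (\<rho> b j \<otimes> y j))"
          by (rule finsum_cong') (use u y w in \<open>auto simp: minus_eq r_distr r_minus l_minus m_ac\<close>)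
        also have "\<dots> = (\<Oplus>j\<in>{..<n}. \<rho> b j \<otimes> w j) \<oplus> (\<Oplus>j\<in>{..<n}. (\<ominus> u) \<otimes> (\<rho> b j \<otimes> y j))"
          by (rule finsum_addf) (use u y w in auto)
        also have "(\<Oplus>j\<in>{..<n}. (\<ominus> u) \<otimes> (\<rho> b j \<otimes> y j)) = (\<ominus> u) \<otimes> z b"
          unfolding y(2)[OF b] by (rule finsum_rdistr[symmetric]) (use u y w in auto)
        finally show ?thesis using z b u by (simp add: l_minus r_neg)
      qed
      then obtain t where t: "t \<in> carrier R" "\<forall>j<n. w j \<ominus> u \<otimes> y j = t \<otimes> \<psi> j"
        using ker_rho[of "\<lambda>j. w j \<ominus> u \<otimes> y j"] w y u by auto
      have "w j \<ominus> t \<otimes> \<psi> j \<in> PIdl u" if "j < n" for j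
      proof -
        have "w j \<ominus> (w j \<ominus> u \<otimes> y j) = u \<otimes> y j"
          using w y u by (simp add: minus_eq minus_add a_assoc[symmetric] r_neg)
        then show ?thesis using t that PIc[OF y(1)[of j]] by simp
      qed
      then show "\<exists>t\<in>carrier R. \<forall>j<n. w j \<ominus> t \<otimes> \<psi> j \<in> PIdl u" using t(1) by blast
    next
      fix t assume t: "t \<in> carrier R" "\<And>j. j < n \<Longrightarrow> \<psi> j \<otimes> t \<in> PIdl u"
      then have "\<exists>x\<in>carrier R. j < n \<longrightarrow> \<psi> j \<otimes> t = u \<otimes> x" for j
        using PIe by (cases "j < n") auto
      then obtain z where z: "\<And>j. z j \<in> carrier R" "\<And>j. j < n \<Longrightarrow> \<psi> j \<otimes> t = u \<otimes> z j" by metis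
      have "\<exists>t'\<in>carrier R. \<forall>j<n. z j = t' \<otimes> \<psi> j"
      proof (rule ker_rho[OF z(1)])
        fix b assume b: "b < n"
        have "u \<otimes> (\<Oplus>j\<in>{..<n}. \<rho> b j \<otimes> z j) = (\<Oplus>j\<in>{..<n}. u \<otimes> (\<rho> b j \<otimes> z j))"
          by (rule finsum_rdistr) (use u z in auto)
        also have "\<dots> = (\<Oplus>j\<in>{..<n}. t \<otimes> (\<rho> b j \<otimes> \<psi> j))"
        proof (rule finsum_cong')
          fix j assume j: "j \<in> {..<n}"
          have "u \<otimes> (\<rho> b j \<otimes> z j) = \<rho> b j \<otimes> (u \<otimes> z j)" using u z by (simp add: m_lcomm)
          also have "\<dots> = \<rho> b j \<otimes> (\<psi> j \<otimes> t)" using z(2)[of j] j by simp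
          finally show "u \<otimes> (\<rho> b j \<otimes> z j) = t \<otimes> (\<rho> b j \<otimes> \<psi> j)" using t by (simp add: m_ac)
        qed (use t in auto)
        also have "\<dots> = t \<otimes> (\<Oplus>j\<in>{..<n}. \<rho> b j \<otimes> \<psi> j)"
          by (rule finsum_rdistr[symmetric]) (use t in auto)
        finally show "(\<Oplus>j\<in>{..<n}. \<rho> b j \<otimes> z j) = \<zero>" using nzd z rho_psi b t by simp
      qed
      then obtain t' where t': "t' \<in> carrier R" "\<And>j. j < n \<Longrightarrow> z j = t' \<otimes> \<psi> j" by blast
      have "t \<ominus> u \<otimes> t' = \<zero>"
      proof (rule psi_faithful)
        fix j assume j: "j < n"
        have "t \<otimes> \<psi> j = u \<otimes> t' \<otimes> \<psi> j" using z(2)[OF j] t'(2)[OF j] t t'(1) u by (simp add: m_ac)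
        then show "(t \<ominus> u \<otimes> t') \<otimes> \<psi> j = \<zero>" using t t' u by (simp add: minus_eq l_distr l_minus r_neg)
      qed (use t t' u in simp)
      then have "t = u \<otimes> t'" using t t' u by simp
      then show "t \<in> PIdl u" using PIc t' by simp
    qed simp
  qed
  then show thesis using that u by blast
qed

end


section \<open>Powers of ideals and the determinantal trick\<close>

context cring begin

lemma ideal_pow_ideal: "ideal I R \<Longrightarrow> ideal (ideal_pow R I k) R"
proof (induction k)
  case (Suc k) then show ?case using ideal_prod_is_ideal by simp
qed (simp add: oneideal)

lemma ideal_pow_add:
  assumes "ideal I R"
  shows "ideal_pow R I (a + b) = ideal_prod R (ideal_pow R I a) (ideal_pow R I b)"
proof (induction a)
  case 0
  show ?case
    using ideal_prod_one[OF ideal_pow_ideal[OF assms]]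
      ideal_prod_commute[OF oneideal ideal_pow_ideal[OF assms]] by simp
next
  case (Suc a)
  then show ?case using ideal_prod_assoc[OF assms ideal_pow_ideal[OF assms] ideal_pow_ideal[OF assms]] by simp
qed

lemma ideal_pow_1: "ideal I R \<Longrightarrow> ideal_pow R I (Suc 0) = I"
  by (simp add: ideal_prod_one)

lemma ideal_pow_mult_mem:
  assumes "ideal I R" "x \<in> ideal_pow R I a" "y \<in> ideal_pow R I b"
  shows "x \<otimes> y \<in> ideal_pow R I (a + b)"
  using assms by (simp add: ideal_pow_add ideal_prod.prod)

lemma ideal_prod_mono:
  assumes "I \<subseteq> I'" "J \<subseteq> J'"
  shows "ideal_prod R I J \<subseteq> ideal_prod R I' J'"
proof
  fix x assume "x \<in> ideal_prod R I J"
  then show "x \<in> ideal_prod R I' J'"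
    by induction (use assms in \<open>auto intro: ideal_prod.intros\<close>)
qed

lemma ideal_pow_mono: "I \<subseteq> I' \<Longrightarrow> ideal_pow R I k \<subseteq> ideal_pow R I' k"
  by (induction k) (auto dest: subsetD[OF ideal_prod_mono])

lemma ideal_pow_antimono:
  assumes I: "ideal I R" and "a \<le> b"
  shows "ideal_pow R I b \<subseteq> ideal_pow R I a"
proof -
  have "ideal_pow R I b = ideal_prod R (ideal_pow R I a) (ideal_pow R I (b - a))"
    using ideal_pow_add[OF I, of a "b - a"] assms(2) by simp
  then show ?thesis using ideal_prod_inter[OF ideal_pow_ideal ideal_pow_ideal, OF I I] by blast
qed

lemma ideal_pow_power:
  assumes I: "ideal I R" and z: "z \<in> ideal_pow R I d"
  shows "z [^] (k::nat) \<in> ideal_pow R I (d * k)"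
proof (induction k)
  case (Suc k)
  then have "z [^] k \<otimes> z \<in> ideal_pow R I (d * k + d)" using ideal_pow_mult_mem[OF I] z by blast
  then show ?case by (simp add: add.commute)
qed simp

text \<open>The index set is a parameter because the factors will be attached to the rows of a matrix.\<close>
lemma ideal_pow_subsetI:
  fixes A :: "'i set"
  assumes I: "ideal I R" and Q: "ideal Q R" and A: "finite A" "card A = k"
    and prods: "\<And>x :: 'i \<Rightarrow> 'a. (\<And>i. x i \<in> I) \<Longrightarrow> (\<Otimes>i\<in>A. x i) \<in> Q"
  shows "ideal_pow R I k \<subseteq> Q"
  using A Q prods
proof (induction A arbitrary: Q k rule: finite_induct)
  case empty
  from empty.prems(3)[of "\<lambda>_. \<zero>"] have "\<one> \<in> Q"
    using additive_subgroup.zero_closed[OF ideal.axioms(1)[OF I]] by simp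
  then show ?case using empty.prems ideal.one_imp_carrier by auto
next
  case (insert a A)
  interpret Q: ideal Q R by (rule insert.prems)
  have Ic: "x \<in> carrier R" if "x \<in> I" for x using that I ideal.Icarr by metis
  obtain k' where k': "k = Suc k'" "card A = k'" using insert.prems(1) insert.hyps by auto
  show ?case
  proof
    fix y assume "y \<in> ideal_pow R I k"
    then have "y \<in> ideal_prod R I (ideal_pow R I k')" by (simp add: k')
    then show "y \<in> Q"
    proof (induction y rule: ideal_prod.induct)
      case (prod l y)
      let ?Q = "{b \<in> carrier R. b \<otimes> l \<in> Q}"
      have "ideal_pow R I k' \<subseteq> ?Q"
      proof (rule insert.IH[OF k'(2)])
        show "ideal ?Q R" by (rule colon_ideal) (use prod Ic insert.prems in auto)
        fix x :: "'i \<Rightarrow> 'a" assume x: "\<And>i. x i \<in> I"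
        have c: "(\<Otimes>i\<in>A. x i) \<in> carrier R" by (rule finprod_closed) (use x Ic in auto)
        have "(\<Otimes>i\<in>insert a A. (x(a := l)) i) \<in> Q"
          by (rule insert.prems(3)) (use x prod in simp)
        moreover have "(\<Otimes>i\<in>insert a A. (x(a := l)) i) = (x(a := l)) a \<otimes> (\<Otimes>i\<in>A. (x(a := l)) i)"
          by (rule finprod_insert) (use insert.hyps x prod Ic in auto)
        moreover have "(\<Otimes>i\<in>A. (x(a := l)) i) = (\<Otimes>i\<in>A. x i)"
          by (rule finprod_cong') (use insert.hyps x Ic in auto)
        ultimately show "(\<Otimes>i\<in>A. x i) \<in> ?Q" using c prod(1) Ic by (simp add: m_comm)
      qed
      then show ?case using prod Ic by (auto simp: m_comm)
    qed simp
  qed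
qed

lemma ideal_prod_subsetI:
  assumes "ideal Q R" "\<And>i j. i \<in> I \<Longrightarrow> j \<in> J \<Longrightarrow> i \<otimes> j \<in> Q"
  shows "ideal_prod R I J \<subseteq> Q"
proof
  interpret ideal Q R by fact
  fix x assume "x \<in> ideal_prod R I J"
  then show "x \<in> Q" by induction (use assms(2) in auto)
qed

lemma linear_combinations_ideal:
  fixes h :: "nat \<Rightarrow> 'a"
  assumes h: "\<And>j. h j \<in> carrier R"
  shows "ideal {\<Oplus>j\<in>{..<q}. c j \<otimes> h j | c. \<forall>j. c j \<in> carrier R} R" (is "ideal ?L R")
proof (rule idealI)
  have add: "(\<Oplus>j\<in>{..<q}. c j \<otimes> h j) \<oplus> (\<Oplus>j\<in>{..<q}. d j \<otimes> h j) = (\<Oplus>j\<in>{..<q}. (c j \<oplus> d j) \<otimes> h j)"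
    if "\<forall>j. c j \<in> carrier R" "\<forall>j. d j \<in> carrier R" for c d :: "nat \<Rightarrow> 'a"
    using that h by (simp add: l_distr finsum_addf Pi_def)
  have mult: "x \<otimes> (\<Oplus>j\<in>{..<q}. c j \<otimes> h j) = (\<Oplus>j\<in>{..<q}. (x \<otimes> c j) \<otimes> h j)"
    if "\<forall>j. c j \<in> carrier R" "x \<in> carrier R" for c :: "nat \<Rightarrow> 'a" and x
    using that h by (simp add: finsum_rdistr Pi_def m_assoc)
  have memI: "(\<Oplus>j\<in>{..<q}. c j \<otimes> h j) \<in> ?L" if "\<forall>j. c j \<in> carrier R" for c using that by blast
  have sub: "?L \<subseteq> carrier R" using h by (auto intro!: finsum_closed)
  have l: "x \<otimes> a \<in> ?L" if "a \<in> ?L" "x \<in> carrier R" for a x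
  proof -
    from that(1) obtain c where c: "a = (\<Oplus>j\<in>{..<q}. c j \<otimes> h j)" "\<forall>j. c j \<in> carrier R" by blast
    show ?thesis unfolding c(1) mult[OF c(2) that(2)] by (rule memI) (use c(2) that(2) in simp)
  qed
  show "x \<otimes> a \<in> ?L" "a \<otimes> x \<in> ?L" if "a \<in> ?L" "x \<in> carrier R" for a x
  proof -
    show xa: "x \<otimes> a \<in> ?L" by (rule l[OF that])
    have "a \<in> carrier R" using that(1) sub by (rule rev_subsetD)
    then show "a \<otimes> x \<in> ?L" using xa m_comm[of a x] that(2) by (simp only:)
  qed
  show "subgroup ?L (add_monoid R)"
  proof (rule add.subgroupI)
    show "?L \<noteq> {}" using memI[of "\<lambda>_. \<zero>"] by blast
    show "\<ominus> a \<in> ?L" if "a \<in> ?L" for a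
    proof -
      have "a \<in> carrier R" using that sub by (rule rev_subsetD)
      then have "\<ominus> a = \<ominus> \<one> \<otimes> a" by (simp add: l_minus)
      then show ?thesis using l[OF that, of "\<ominus> \<one>"] by (simp only: a_inv_closed one_closed)
    qed
    show "a \<oplus> b \<in> ?L" if ab: "a \<in> ?L" "b \<in> ?L" for a b
    proof -
      from ab obtain c d where cd: "a = (\<Oplus>j\<in>{..<q}. c j \<otimes> h j)" "\<forall>j. c j \<in> carrier R"
        "b = (\<Oplus>j\<in>{..<q}. d j \<otimes> h j)" "\<forall>j. d j \<in> carrier R" by blast
      have "a \<oplus> b = (\<Oplus>j\<in>{..<q}. (c j \<oplus> d j) \<otimes> h j)"
        unfolding cd(1,3) by (rule add[OF cd(2,4)])
      also have "\<dots> \<in> ?L" by (rule memI) (use cd in simp)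
      finally show ?thesis .
    qed
  qed (rule sub)
qed (rule ring_axioms)

lemma genideal_image_eq:
  fixes h :: "nat \<Rightarrow> 'a"
  assumes h: "\<And>j. h j \<in> carrier R"
  shows "Idl (h ` {..<q}) = {\<Oplus>j\<in>{..<q}. c j \<otimes> h j | c. \<forall>j. c j \<in> carrier R}" (is "_ = ?L")
proof
  show "Idl (h ` {..<q}) \<subseteq> ?L"
  proof (rule genideal_minimal[OF linear_combinations_ideal[of h, OF h]])
    show "h ` {..<q} \<subseteq> ?L"
    proof (rule image_subsetI)
      fix i assume "i \<in> {..<q}"
      then have "(\<Oplus>j\<in>{..<q}. unit_vec i j \<otimes> h j) = h i" by (intro finsum_delta) (use h in auto)
      then show "h i \<in> ?L" by (intro CollectI exI[of _ "unit_vec i"]) simp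
    qed
  qed
  interpret I: ideal "Idl (h ` {..<q})" R by (rule genideal_ideal) (use h in auto)
  have "(\<Oplus>j\<in>{..<q}. c j \<otimes> h j) \<in> Idl (h ` {..<q})" if c: "\<forall>j. c j \<in> carrier R" for c
  proof (rule ideal_finsum_closed[OF I.is_ideal])
    fix j assume "j \<in> {..<q}"
    then have "h j \<in> Idl (h ` {..<q})" using genideal_self[of "h ` {..<q}"] h by auto
    then show "c j \<otimes> h j \<in> Idl (h ` {..<q})" using c I.I_l_closed by simp
  qed
  then show "?L \<subseteq> Idl (h ` {..<q})" by blast
qed

lemma ideal_prod_genideal_image:
  fixes h :: "nat \<Rightarrow> 'a"
  assumes h: "\<And>j. h j \<in> carrier R" and J: "ideal J R"
    and x: "x \<in> ideal_prod R J (Idl (h ` {..<q}))"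
  shows "\<exists>b. (\<forall>j. b j \<in> J) \<and> x = (\<Oplus>j\<in>{..<q}. b j \<otimes> h j)"
  using x
proof (induction x rule: ideal_prod.induct)
  interpret J: ideal J R by fact
  case (prod i y)
  then obtain c where c: "y = (\<Oplus>j\<in>{..<q}. c j \<otimes> h j)" "\<forall>j. c j \<in> carrier R"
    using prod(2) unfolding genideal_image_eq[of h q, OF h] by blast
  have i: "i \<in> carrier R" using prod(1) J.Icarr by simp
  have "i \<otimes> y = (\<Oplus>j\<in>{..<q}. (i \<otimes> c j) \<otimes> h j)"
    using c i h by (simp add: finsum_rdistr Pi_def m_assoc)
  then show ?case using prod(1) c(2) J.I_r_closed by (intro exI[of _ "\<lambda>j. i \<otimes> c j"]) simp
next
  interpret J: ideal J R by fact
  case (sum x y)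
  then obtain b d where "\<forall>j. b j \<in> J" "x = (\<Oplus>j\<in>{..<q}. b j \<otimes> h j)"
    "\<forall>j. d j \<in> J" "y = (\<Oplus>j\<in>{..<q}. d j \<otimes> h j)" by blast
  then show ?case using h J.Icarr
    by (intro exI[of _ "\<lambda>j. b j \<oplus> d j"]) (simp add: l_distr finsum_addf Pi_def)
qed

text \<open>The part of an equation of integral dependence of degree \<open>d\<close> below its leading term. Such parts
  multiply like homogeneous elements, so that the determinant of a characteristic matrix is
  again of this form up to the leading term.\<close>
definition lower_terms :: "'a set \<Rightarrow> 'a \<Rightarrow> nat \<Rightarrow> 'a set"
  where "lower_terms I z d = {\<Oplus>i\<in>{1..d}. a i \<otimes> z [^] (d - i) | a.
    (\<forall>i. a i \<in> carrier R) \<and> (\<forall>i\<in>{1..d}. a i \<in> ideal_pow R I i)}"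

definition monic_terms :: "'a set \<Rightarrow> 'a \<Rightarrow> nat \<Rightarrow> 'a set"
  where "monic_terms I z d = {z [^] d \<oplus> y | y. y \<in> lower_terms I z d}"

context
  fixes I :: "'a set" and z :: 'a
  assumes I: "ideal I R" and z: "z \<in> carrier R"
begin

lemma lower_terms_closed: "lower_terms I z d \<subseteq> carrier R"
  using z by (auto simp: lower_terms_def intro!: finsum_closed)

lemma lower_terms_add:
  assumes "x \<in> lower_terms I z d" "y \<in> lower_terms I z d"
  shows "x \<oplus> y \<in> lower_terms I z d"
proof -
  from assms obtain a b where ab: "x = (\<Oplus>i\<in>{1..d}. a i \<otimes> z [^] (d - i))" "\<forall>i. a i \<in> carrier R"
      "\<forall>i\<in>{1..d}. a i \<in> ideal_pow R I i"
      "y = (\<Oplus>i\<in>{1..d}. b i \<otimes> z [^] (d - i))" "\<forall>i. b i \<in> carrier R"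
      "\<forall>i\<in>{1..d}. b i \<in> ideal_pow R I i"
    unfolding lower_terms_def by blast
  have "x \<oplus> y = (\<Oplus>i\<in>{1..d}. (a i \<oplus> b i) \<otimes> z [^] (d - i))"
    using ab z by (simp add: l_distr finsum_addf Pi_def)
  then show ?thesis
    unfolding lower_terms_def using ab additive_subgroup.a_closed[OF ideal.axioms(1)[OF ideal_pow_ideal[OF I]]]
    by (intro CollectI exI[of _ "\<lambda>i. a i \<oplus> b i"]) auto
qed

lemma lower_terms_single:
  assumes c: "c \<in> ideal_pow R I i" and i: "1 \<le> i" "i \<le> d"
  shows "c \<otimes> z [^] (d - i) \<in> lower_terms I z d"
proof -
  have cc: "c \<in> carrier R" using c ideal_pow_ideal[OF I] ideal.Icarr by metis
  let ?a = "\<lambda>k. if k = i then c else \<zero>"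
  have "(\<Oplus>k\<in>{1..d}. ?a k \<otimes> z [^] (d - k)) = (\<Oplus>k\<in>{1..d}. if i = k then c \<otimes> z [^] (d - k) else \<zero>)"
    by (rule finsum_cong') (use cc z in auto)
  also have "\<dots> = c \<otimes> z [^] (d - i)"
    by (rule finsum_singleton) (use cc z i in auto)
  finally show ?thesis
    unfolding lower_terms_def
    using c cc additive_subgroup.zero_closed[OF ideal.axioms(1)[OF ideal_pow_ideal[OF I]]]
    by (intro CollectI exI[of _ ?a]) auto
qed

lemma lower_terms_zero: "\<zero> \<in> lower_terms I z d"
  unfolding lower_terms_def using z additive_subgroup.zero_closed[OF ideal.axioms(1)[OF ideal_pow_ideal[OF I]]]
  by (intro CollectI exI[of _ "\<lambda>_. \<zero>"]) simp

lemma lower_terms_sum: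
  assumes "finite A" "\<And>i. i \<in> A \<Longrightarrow> x i \<in> lower_terms I z d"
  shows "(\<Oplus>i\<in>A. x i) \<in> lower_terms I z d"
  using assms
proof (induction A rule: finite_induct)
  case (insert a A)
  then have "(\<Oplus>i\<in>insert a A. x i) = x a \<oplus> (\<Oplus>i\<in>A. x i)"
    by (intro finsum_insert) (use lower_terms_closed in auto)
  then show ?case using insert lower_terms_add by simp
qed (simp add: lower_terms_zero)

lemma lower_terms_uminus:
  assumes "x \<in> lower_terms I z d"
  shows "\<ominus> x \<in> lower_terms I z d"
proof -
  from assms obtain a where a: "x = (\<Oplus>i\<in>{1..d}. a i \<otimes> z [^] (d - i))" "\<forall>i. a i \<in> carrier R"
      "\<forall>i\<in>{1..d}. a i \<in> ideal_pow R I i" unfolding lower_terms_def by blast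
  have "\<ominus> x = \<ominus> \<one> \<otimes> x" using a z by (simp add: l_minus)
  also have "\<dots> = (\<Oplus>i\<in>{1..d}. \<ominus> a i \<otimes> z [^] (d - i))"
    unfolding a(1) using a z by (simp add: finsum_rdistr Pi_def l_minus)
  finally show ?thesis
    unfolding lower_terms_def using a additive_subgroup.a_inv_closed[OF ideal.axioms(1)[OF ideal_pow_ideal[OF I]]]
    by (intro CollectI exI[of _ "\<lambda>i. \<ominus> a i"]) auto
qed

lemma lower_terms_mult_power:
  assumes "x \<in> lower_terms I z a"
  shows "x \<otimes> z [^] b \<in> lower_terms I z (a + b)"
proof -
  from assms obtain c where c: "x = (\<Oplus>i\<in>{1..a}. c i \<otimes> z [^] (a - i))" "\<forall>i. c i \<in> carrier R"
      "\<forall>i\<in>{1..a}. c i \<in> ideal_pow R I i" unfolding lower_terms_def by blast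
  have "x \<otimes> z [^] b = (\<Oplus>i\<in>{1..a}. (c i \<otimes> z [^] (a - i)) \<otimes> z [^] b)"
    unfolding c(1) by (rule finsum_ldistr) (use c z in auto)
  moreover have "(c i \<otimes> z [^] (a - i)) \<otimes> z [^] b \<in> lower_terms I z (a + b)" if i: "i \<in> {1..a}" for i
  proof -
    have "(c i \<otimes> z [^] (a - i)) \<otimes> z [^] b = c i \<otimes> z [^] (a + b - i)"
      using c z i by (simp add: m_assoc nat_pow_mult)
    then show ?thesis using lower_terms_single[of "c i" i "a + b"] c i by simp
  qed
  ultimately show ?thesis using lower_terms_sum[of "{1..a}"] by simp
qed

lemma lower_terms_mult:
  assumes "x \<in> lower_terms I z a" "y \<in> lower_terms I z b"
  shows "x \<otimes> y \<in> lower_terms I z (a + b)"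
proof -
  from assms obtain c where c: "x = (\<Oplus>i\<in>{1..a}. c i \<otimes> z [^] (a - i))" "\<forall>i. c i \<in> carrier R"
      "\<forall>i\<in>{1..a}. c i \<in> ideal_pow R I i" unfolding lower_terms_def by blast
  from assms obtain e where e: "y = (\<Oplus>j\<in>{1..b}. e j \<otimes> z [^] (b - j))" "\<forall>j. e j \<in> carrier R"
      "\<forall>j\<in>{1..b}. e j \<in> ideal_pow R I j" unfolding lower_terms_def by blast
  have y: "y \<in> carrier R" using assms(2) lower_terms_closed by auto
  have "x \<otimes> y = (\<Oplus>i\<in>{1..a}. (c i \<otimes> z [^] (a - i)) \<otimes> y)"
    unfolding c(1) by (rule finsum_ldistr) (use c z y in auto)
  moreover have "(c i \<otimes> z [^] (a - i)) \<otimes> y \<in> lower_terms I z (a + b)" if i: "i \<in> {1..a}" for i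
  proof -
    have "(c i \<otimes> z [^] (a - i)) \<otimes> y = (\<Oplus>j\<in>{1..b}. (c i \<otimes> z [^] (a - i)) \<otimes> (e j \<otimes> z [^] (b - j)))"
      unfolding e(1) by (rule finsum_rdistr) (use c e z in auto)
    moreover have "(c i \<otimes> z [^] (a - i)) \<otimes> (e j \<otimes> z [^] (b - j)) \<in> lower_terms I z (a + b)"
      if j: "j \<in> {1..b}" for j
    proof -
      have "(c i \<otimes> z [^] (a - i)) \<otimes> (e j \<otimes> z [^] (b - j)) = (c i \<otimes> e j) \<otimes> (z [^] (a - i) \<otimes> z [^] (b - j))"
        using c e z by (simp add: m_ac)
      also have "z [^] (a - i) \<otimes> z [^] (b - j) = z [^] (a + b - (i + j))"
        using z i j by (simp add: nat_pow_mult)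
      finally show ?thesis
        using lower_terms_single[of "c i \<otimes> e j" "i + j" "a + b"] ideal_pow_mult_mem[OF I, of "c i" i "e j" j] c e i j
        by simp
    qed
    ultimately show ?thesis using lower_terms_sum[of "{1..b}"] by simp
  qed
  ultimately show ?thesis using lower_terms_sum[of "{1..a}"] by simp
qed

text \<open>The determinantal trick: \<open>z\<^sup>N\<close> acts on a faithful ideal through a matrix with entries
  in \<open>I\<^sup>N\<close>, and its characteristic equation is homogeneous.\<close>
lemma integral_if_power_stabilizes:
  fixes h :: "nat \<Rightarrow> 'a" and N q :: nat
  assumes N: "0 < N" and h: "\<And>j. h j \<in> carrier R" and q: "0 < q"
    and faithful: "\<And>r. r \<in> carrier R \<Longrightarrow> (\<And>j. j < q \<Longrightarrow> h j \<otimes> r = \<zero>) \<Longrightarrow> r = \<zero>"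
    and stab: "\<And>j. j < q \<Longrightarrow> z [^] N \<otimes> h j \<in> ideal_prod R (ideal_pow R I N) (Idl (h ` {..<q}))"
  shows "z \<in> integral_closure R I"
proof -
  interpret J: ideal "ideal_pow R I N" R by (rule ideal_pow_ideal[OF I])
  have "\<exists>b. (\<forall>j. b j \<in> ideal_pow R I N) \<and> (i < q \<longrightarrow> z [^] N \<otimes> h i = (\<Oplus>j\<in>{..<q}. b j \<otimes> h j))" for i
    using ideal_prod_genideal_image[of h, OF h J.is_ideal stab[of i]] J.zero_closed
    by (cases "i < q") (blast, auto intro!: exI[of _ "\<lambda>_. \<zero>"])
  then obtain b where b: "\<And>i j. b i j \<in> ideal_pow R I N"
    "\<And>i. i < q \<Longrightarrow> z [^] N \<otimes> h i = (\<Oplus>j\<in>{..<q}. b i j \<otimes> h j)" by metis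
  have bc: "b i j \<in> carrier R" for i j using b(1) J.Icarr by simp
  \<comment> \<open>The transposed matrix, so that the \<open>h\<^sub>j\<close> give a relation between the rows.\<close>
  define L where "L = (\<lambda>j i. z [^] N \<otimes> unit_vec i j \<ominus> b i j)"
  have L: "L j i \<in> carrier R" for j i using z bc by (simp add: L_def)
  have rel: "(\<Oplus>j\<in>{..<q}. h j \<otimes> L j i) = \<zero>" if i: "i < q" for i
  proof -
    have "(\<Oplus>j\<in>{..<q}. h j \<otimes> L j i) = (\<Oplus>j\<in>{..<q}. (z [^] N \<otimes> h j) \<otimes> unit_vec i j \<oplus> \<ominus> \<one> \<otimes> (b i j \<otimes> h j))"
      by (rule finsum_cong') (use h z bc in \<open>auto simp: L_def minus_eq r_distr r_minus l_minus m_ac\<close>)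
    also have "\<dots> = (\<Oplus>j\<in>{..<q}. (z [^] N \<otimes> h j) \<otimes> unit_vec i j) \<oplus> (\<Oplus>j\<in>{..<q}. \<ominus> \<one> \<otimes> (b i j \<otimes> h j))"
      by (rule finsum_addf) (use h z bc in auto)
    also have "(\<Oplus>j\<in>{..<q}. (z [^] N \<otimes> h j) \<otimes> unit_vec i j) = z [^] N \<otimes> h i"
      by (rule finsum_delta) (use i h z in auto)
    also have "(\<Oplus>j\<in>{..<q}. \<ominus> \<one> \<otimes> (b i j \<otimes> h j)) = \<ominus> \<one> \<otimes> (\<Oplus>j\<in>{..<q}. b i j \<otimes> h j)"
      by (rule finsum_rdistr[symmetric]) (use bc h in auto)
    finally have "(\<Oplus>j\<in>{..<q}. h j \<otimes> L j i) = z [^] N \<otimes> h i \<oplus> \<ominus> \<one> \<otimes> (z [^] N \<otimes> h i)"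
      unfolding b(2)[OF i] .
    then show ?thesis using h z by (simp add: l_minus r_neg)
  qed
  have det0: "Det q L = \<zero>"
  proof (rule faithful)
    fix j assume "j < q"
    then show "h j \<otimes> Det q L = \<zero>" by (intro Det_row_relation) (use L h rel in auto)
  qed (use L in simp)
  have Ssub: "z [^] d \<oplus> y \<in> carrier R" if "y \<in> lower_terms I z d" for y d
    using that lower_terms_closed z by auto
  have off: "b i j \<in> lower_terms I z N" for i j
    using lower_terms_single[of "b i j" N N] b(1) bc N by simp
  have "Det q L \<in> monic_terms I z (N * q)"
  proof (rule Det_graded[where S = "lower_terms I z"])
    show "monic_terms I z d \<subseteq> carrier R" for d using Ssub by (auto simp: monic_terms_def)
    show "x \<otimes> y \<in> lower_terms I z (a + b)" if x: "x \<in> lower_terms I z a" and y: "y \<in> lower_terms I z b \<union> monic_terms I z b" for a b x y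
    proof (cases "y \<in> lower_terms I z b")
      case True then show ?thesis using x lower_terms_mult by blast
    next
      case False
      then obtain y' where y': "y = z [^] b \<oplus> y'" "y' \<in> lower_terms I z b" using y by (auto simp: monic_terms_def)
      then have "x \<otimes> y = x \<otimes> z [^] b \<oplus> x \<otimes> y'"
        using z x lower_terms_closed by (auto intro!: r_distr)
      then show ?thesis using lower_terms_add lower_terms_mult_power lower_terms_mult x y'(2) by simp
    qed
    show "x \<otimes> y \<in> monic_terms I z (a + b)" if "x \<in> monic_terms I z a" "y \<in> monic_terms I z b" for a b x y
    proof -
      from that obtain x' y' where xy: "x = z [^] a \<oplus> x'" "x' \<in> lower_terms I z a"
        "y = z [^] b \<oplus> y'" "y' \<in> lower_terms I z b" by (auto simp: monic_terms_def)
      have c: "x' \<in> carrier R" "y' \<in> carrier R" using xy lower_terms_closed by auto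
      have "x \<otimes> y = z [^] (a + b) \<oplus> (y' \<otimes> z [^] a \<oplus> (x' \<otimes> z [^] b \<oplus> x' \<otimes> y'))"
        unfolding xy using z c by (simp add: l_distr r_distr nat_pow_mult[symmetric] m_comm a_ac)
      moreover have "y' \<otimes> z [^] a \<in> lower_terms I z (a + b)"
        using lower_terms_mult_power[OF xy(4), of a] by (simp add: add.commute)
      ultimately show ?thesis
        using lower_terms_add lower_terms_mult_power lower_terms_mult xy by (auto simp: monic_terms_def)
    qed
    show "x \<oplus> y \<in> monic_terms I z d" if "x \<in> monic_terms I z d" "y \<in> lower_terms I z d" for d x y
    proof -
      from that obtain x' where x: "x = z [^] d \<oplus> x'" "x' \<in> lower_terms I z d" by (auto simp: monic_terms_def)
      then have "x \<oplus> y = z [^] d \<oplus> (x' \<oplus> y)" using z that(2) lower_terms_closed by (auto intro!: a_assoc)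
      then show ?thesis using lower_terms_add x that(2) by (auto simp: monic_terms_def)
    qed
    show "\<one> \<in> monic_terms I z 0"
      unfolding monic_terms_def using lower_terms_zero[of 0]
      by (intro CollectI exI[of _ \<zero>]) simp
    show "L i i \<in> monic_terms I z N" if "i < q" for i
      using off z bc lower_terms_uminus by (auto simp: L_def monic_terms_def unit_vec_def minus_eq)
    show "L i j \<in> lower_terms I z N" if "i < q" "j < q" "i \<noteq> j" for i j
      using off[of j i] z bc that lower_terms_uminus by (simp add: L_def unit_vec_def minus_eq)
  qed (use lower_terms_closed lower_terms_zero lower_terms_add lower_terms_uminus L in auto)
  then obtain a where "\<zero> = z [^] (N * q) \<oplus> (\<Oplus>i\<in>{1..N * q}. a i \<otimes> z [^] (N * q - i))"
      "\<forall>i\<in>{1..N * q}. a i \<in> ideal_pow R I i"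
    unfolding det0 by (auto simp: monic_terms_def lower_terms_def)
  then show ?thesis
    unfolding integral_closure_def using z N q by (intro CollectI conjI exI[of _ "N * q"] exI[of _ a]) auto
qed

end

end

lemma (in noetherian_cring) ideal_finite_generators:
  assumes "ideal M R"
  obtains h and q :: nat where "\<And>j. h j \<in> carrier R" "0 < q" "M = Idl (h ` {..<q})"
proof -
  obtain A where A: "A \<subseteq> carrier R" "finite A" "M = Idl A" using finetely_gen[OF assms] by blast
  have zM: "\<zero> \<in> M" using additive_subgroup.zero_closed[OF ideal.axioms(1)[OF assms]] .
  have "Idl (insert \<zero> A) = M"
  proof
    show "Idl (insert \<zero> A) \<subseteq> M"
      by (rule genideal_minimal) (use assms zM A genideal_self in auto)
    show "M \<subseteq> Idl (insert \<zero> A)"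
      unfolding A(3) by (rule subset_Idl_subset) (use A in auto)
  qed
  moreover define k where "k = card (insert \<zero> A)"
  moreover obtain g where g: "bij_betw g {0..<k} (insert \<zero> A)"
    using ex_bij_betw_nat_finite[of "insert \<zero> A"] A(2) unfolding k_def by blast
  moreover define h where "h = (\<lambda>j. if j < k then g j else \<zero>)"
  have img: "h ` {..<k} = insert \<zero> A"
    using bij_betw_imp_surj_on[OF g] by (auto simp: h_def atLeast0LessThan)
  moreover have "h j \<in> carrier R" for j
  proof (cases "j < k")
    case True
    then have "h j \<in> insert \<zero> A" unfolding img[symmetric] by simp
    then show ?thesis using A(1) by auto
  qed (simp add: h_def)
  moreover have "0 < k" using A(2) by (simp add: card_gt_0_iff k_def)
  ultimately show thesis using that[of h k] by simp
qed

text \<open>Since \<open>N \<ge> 4\<close>, twice the inclusion \<open>L\<^sup>N I\<^sup>2 \<subseteq> I\<^sup>N\<close> gives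
  \<open>L\<^bsup>2N\<^esup> I\<^sup>2 \<subseteq> I\<^bsup>2N - 2\<^esup> \<subseteq> I\<^sup>N I\<^sup>2\<close>.\<close>
lemma (in noetherian_cring) square_in_integral_closure:
  assumes I: "ideal I R" and L: "ideal L R" and N: "N \<ge> 4"
    and faithful: "\<And>r. r \<in> carrier R \<Longrightarrow> (\<And>x. x \<in> I \<Longrightarrow> r \<otimes> x = \<zero>) \<Longrightarrow> r = \<zero>"
    and incl: "ideal_prod R (ideal_pow R L N) (ideal_pow R I 2) \<subseteq> ideal_pow R I N"
  shows "ideal_pow R L 2 \<subseteq> integral_closure R I"
proof
  fix z assume zL: "z \<in> ideal_pow R L 2"
  have z: "z \<in> carrier R" using zL ideal_pow_ideal[OF L] ideal.Icarr by metis
  note idI = ideal_pow_ideal[OF I] and idL = ideal_pow_ideal[OF L]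
  have "ideal_prod R (ideal_pow R L (N + N)) (ideal_pow R I 2)
      = ideal_prod R (ideal_pow R L N) (ideal_prod R (ideal_pow R L N) (ideal_pow R I 2))"
    using ideal_prod_assoc idI idL by (simp add: ideal_pow_add[OF L])
  also have "\<dots> \<subseteq> ideal_prod R (ideal_pow R L N) (ideal_pow R I N)"
    by (rule ideal_prod_mono[OF _ incl]) simp
  also have "\<dots> = ideal_prod R (ideal_pow R L N) (ideal_prod R (ideal_pow R I 2) (ideal_pow R I (N - 2)))"
    using ideal_pow_add[OF I, of 2 "N - 2"] N by (simp only: le_add_diff_inverse)
  also have "\<dots> = ideal_prod R (ideal_prod R (ideal_pow R L N) (ideal_pow R I 2)) (ideal_pow R I (N - 2))"
    using ideal_prod_assoc idI idL by simp
  also have "\<dots> \<subseteq> ideal_prod R (ideal_pow R I N) (ideal_pow R I (N - 2))"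
    by (rule ideal_prod_mono[OF incl]) simp
  also have "\<dots> \<subseteq> ideal_prod R (ideal_pow R I N) (ideal_pow R I 2)"
    by (rule ideal_prod_mono[OF order_refl ideal_pow_antimono[OF I]]) (use N in simp)
  finally have incl2: "ideal_prod R (ideal_pow R L (N + N)) (ideal_pow R I 2)
      \<subseteq> ideal_prod R (ideal_pow R I N) (ideal_pow R I 2)" .
  obtain h and q :: nat where h: "\<And>j. h j \<in> carrier R" "0 < q" "ideal_pow R I 2 = Idl (h ` {..<q})"
    using ideal_finite_generators[OF idI[of 2]] by blast
  show "z \<in> integral_closure R I"
  proof (rule integral_if_power_stabilizes[OF I z _ h(1,2)])
    fix j assume "j < q"
    then have "h j \<in> ideal_pow R I 2" using h genideal_self[of "h ` {..<q}"] by auto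
    moreover have "z [^] N \<in> ideal_pow R L (N + N)"
      using ideal_pow_power[OF L zL, of N] by (simp add: mult_2)
    ultimately show "z [^] N \<otimes> h j \<in> ideal_prod R (ideal_pow R I N) (Idl (h ` {..<q}))"
      using subsetD[OF incl2 ideal_prod.prod] h(3) by (simp only:)
  next
    fix r assume r: "r \<in> carrier R" "\<And>j. j < q \<Longrightarrow> h j \<otimes> r = \<zero>"
    let ?A = "{a \<in> carrier R. a \<otimes> r \<in> {\<zero>}}"
    have "Idl (h ` {..<q}) \<subseteq> ?A"
      by (rule genideal_minimal[OF colon_ideal[OF zeroideal r(1)]]) (use h r in auto)
    then have *: "a \<otimes> r = \<zero>" if "a \<in> ideal_pow R I 2" for a using that h by auto
    have Ic: "x \<in> carrier R" if "x \<in> I" for x using that I ideal.Icarr by metis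
    have "r \<otimes> x \<otimes> y = \<zero>" if "x \<in> I" "y \<in> I" for x y
    proof -
      have "x \<otimes> y \<in> ideal_pow R I 2"
        using ideal_pow_mult_mem[OF I, of x 1 y 1] that ideal_pow_1[OF I] by (simp add: numeral_2_eq_2)
      then show ?thesis using *[of "x \<otimes> y"] that Ic r by (simp add: m_ac)
    qed
    then have "r \<otimes> x = \<zero>" if "x \<in> I" for x using faithful[of "r \<otimes> x"] that r Ic by simp
    then show "r = \<zero>" using faithful r by simp
  qed (use N in simp)
qed


section \<open>Grade is at most height\<close>

context noetherian_cring begin

text \<open>An ideal containing \<open>J\<close> that is maximal subject to missing the multiplicative set
  \<open>{s x\<^sup>k | s \<notin> p}\<close> is prime. As \<open>x\<close> is regular modulo \<open>J\<close>, the set misses \<open>J\<close>.\<close>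
lemma smaller_prime_above:
  assumes J: "ideal J R" and p: "primeideal p R" and Jp: "J \<subseteq> p" and x: "x \<in> p"
    and reg: "\<And>y. y \<in> carrier R \<Longrightarrow> x \<otimes> y \<in> J \<Longrightarrow> y \<in> J"
  shows "\<exists>q. primeideal q R \<and> J \<subseteq> q \<and> q \<subset> p"
proof -
  interpret J: ideal J R by fact
  interpret p: primeideal p R by fact
  have xc: "x \<in> carrier R" using x p.Icarr by simp
  define W where "W = {s \<otimes> x [^] (k::nat) | s k. s \<in> carrier R - p}"
  have one: "\<one> \<notin> p" using p.one_imp_carrier p.I_notcarr by auto
  have W1: "\<one> \<in> W" unfolding W_def using one by (intro CollectI exI[of _ \<one>] exI[of _ 0]) simp
  have Wx: "x \<in> W" unfolding W_def using one xc by (intro CollectI exI[of _ \<one>] exI[of _ 1]) simp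
  have Wp: "s \<in> W" if "s \<in> carrier R - p" for s
    unfolding W_def using that by (intro CollectI exI[of _ s] exI[of _ 0]) simp
  have Wmult: "v \<otimes> w \<in> W" if vw: "v \<in> W" "w \<in> W" for v w
  proof -
    from vw obtain s k t l where st: "v = s \<otimes> x [^] (k::nat)" "s \<in> carrier R - p"
      "w = t \<otimes> x [^] (l::nat)" "t \<in> carrier R - p" unfolding W_def by blast
    have "v \<otimes> w = (s \<otimes> t) \<otimes> x [^] (k + l)"
      using st xc by (simp add: nat_pow_mult[symmetric] m_ac)
    moreover have "s \<otimes> t \<in> carrier R - p" using st p.I_prime by auto
    ultimately show ?thesis unfolding W_def by blast
  qed
  have xk: "y \<in> J" if "y \<in> carrier R" "y \<otimes> x [^] (k::nat) \<in> J" for y k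
    using that
  proof (induction k)
    case (Suc k)
    have e: "x \<otimes> (y \<otimes> x [^] k) = y \<otimes> x [^] Suc k" using Suc.prems(1) xc by (simp add: m_ac)
    have "x \<otimes> (y \<otimes> x [^] k) \<in> J" unfolding e by (rule Suc.prems(2))
    then have "y \<otimes> x [^] k \<in> J" using reg[of "y \<otimes> x [^] k"] Suc.prems(1) xc by blast
    then show ?case by (rule Suc.IH[OF Suc.prems(1)])
  qed simp
  have JW: "J \<inter> W = {}"
  proof (rule ccontr)
    assume "J \<inter> W \<noteq> {}"
    then obtain s k where "s \<in> carrier R - p" "s \<otimes> x [^] (k::nat) \<in> J" unfolding W_def by blast
    then show False using xk[of s k] Jp by blast
  qed
  let ?A = "{K. ideal K R \<and> J \<subseteq> K \<and> K \<inter> W = {}}"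
  have "\<exists>M\<in>?A. \<forall>K\<in>?A. M \<subseteq> K \<longrightarrow> K = M"
  proof (rule maximal_in_family)
    show "?A \<noteq> {}" using J JW by blast
  qed simp
  then obtain M where MA: "M \<in> ?A" and Mmax: "\<forall>K\<in>?A. M \<subseteq> K \<longrightarrow> K = M" ..
  from MA have M: "ideal M R" "J \<subseteq> M" "M \<inter> W = {}" by simp_all
  have max: "K = M" if "ideal K R" "M \<subseteq> K" "K \<inter> W = {}" for K
    using Mmax that M(2) by simp
  interpret M: ideal M R by fact
  have meet: "\<exists>m\<in>M. \<exists>r\<in>carrier R. m \<oplus> r \<otimes> a \<in> W" if a: "a \<in> carrier R" "a \<notin> M" for a
  proof (rule ccontr)
    assume no: "\<not> ?thesis"
    let ?K = "set_add R M (PIdl a)"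
    have K: "ideal ?K R" using add_ideals[OF M(1) cgenideal_ideal[OF a(1)]] .
    have mem: "m \<oplus> r \<otimes> a \<in> ?K" if "m \<in> M" "r \<in> carrier R" for m r
      unfolding set_add_def' cgenideal_def using that by blast
    have "M \<subseteq> ?K" using mem[of _ \<zero>] a M.Icarr by fastforce
    moreover have "?K \<inter> W = {}" using no unfolding set_add_def' cgenideal_def by blast
    ultimately have "?K = M" using max K by blast
    moreover have "a \<in> ?K" using mem[of \<zero> \<one>] a by simp
    ultimately show False using a(2) by simp
  qed
  have "primeideal M R"
  proof (rule primeidealI[OF M(1) is_cring])
    show "carrier R \<noteq> M" using W1 M(3) by auto
    fix a b assume ab: "a \<in> carrier R" "b \<in> carrier R" "a \<otimes> b \<in> M"
    show "a \<in> M \<or> b \<in> M"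
    proof (rule ccontr)
      assume "\<not> ?thesis"
      then obtain m r m' r' where m: "m \<in> M" "r \<in> carrier R" "m \<oplus> r \<otimes> a \<in> W"
        "m' \<in> M" "r' \<in> carrier R" "m' \<oplus> r' \<otimes> b \<in> W" using meet ab by meson
      have mc: "m \<in> carrier R" "m' \<in> carrier R" using m M.Icarr by auto
      have "(m \<oplus> r \<otimes> a) \<otimes> (m' \<oplus> r' \<otimes> b) = (m' \<oplus> r' \<otimes> b) \<otimes> m \<oplus> ((r \<otimes> a) \<otimes> m' \<oplus> (r \<otimes> r') \<otimes> (a \<otimes> b))"
        using m mc ab by (simp add: l_distr r_distr m_ac a_ac)
      moreover have "\<dots> \<in> M"
      proof (intro M.a_closed)
        show "(m' \<oplus> r' \<otimes> b) \<otimes> m \<in> M" by (rule M.I_l_closed) (use m mc ab in auto)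
        show "(r \<otimes> a) \<otimes> m' \<in> M" by (rule M.I_l_closed) (use m mc ab in auto)
        show "(r \<otimes> r') \<otimes> (a \<otimes> b) \<in> M" by (rule M.I_l_closed) (use m mc ab in auto)
      qed
      ultimately show False using Wmult[OF m(3,6)] M(3) by auto
    qed
  qed
  moreover have "M \<subseteq> p" using Wp M(3) M.a_subset by blast
  moreover have "x \<notin> M" using Wx M(3) by blast
  ultimately show ?thesis using M(2) x by blast
qed

text \<open>Descend from \<open>p\<close>, dropping the last element of the sequence and shrinking the prime.\<close>
lemma regular_sequence_prime_chain:
  assumes "set xs \<subseteq> carrier R"
    and "\<And>i y. i < length xs \<Longrightarrow> y \<in> carrier R \<Longrightarrow> xs ! i \<otimes> y \<in> Idl (set (take i xs)) \<Longrightarrow> y \<in> Idl (set (take i xs))"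
    and "primeideal p R" "set xs \<subseteq> p"
  shows "\<exists>c :: nat \<Rightarrow> 'a set. (\<forall>i\<le>length xs. primeideal (c i) R) \<and> (\<forall>i<length xs. c i \<subset> c (Suc i)) \<and> c (length xs) = p"
  using assms
proof (induction xs arbitrary: p rule: rev_induct)
  case Nil
  then show ?case by (intro exI[of _ "\<lambda>_. p"]) auto
next
  case (snoc x xs)
  have Jp: "Idl (set xs) \<subseteq> p"
    by (rule genideal_minimal) (use snoc.prems primeideal.axioms in auto)
  have "\<exists>q. primeideal q R \<and> Idl (set xs) \<subseteq> q \<and> q \<subset> p"
  proof (rule smaller_prime_above[OF _ snoc.prems(3) Jp, of x])
    show "ideal (Idl (set xs)) R" by (rule genideal_ideal) (use snoc.prems in auto)
    show "x \<in> p" using snoc.prems by auto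
    show "y \<in> Idl (set xs)" if "y \<in> carrier R" "x \<otimes> y \<in> Idl (set xs)" for y
      using snoc.prems(2)[of "length xs" y] that by simp
  qed
  then obtain q where q: "primeideal q R" "Idl (set xs) \<subseteq> q" "q \<subset> p" by blast
  have "set xs \<subseteq> q" using q(2) genideal_self[of "set xs"] snoc.prems(1) by auto
  moreover have "y \<in> Idl (set (take i xs))"
    if "i < length xs" "y \<in> carrier R" "xs ! i \<otimes> y \<in> Idl (set (take i xs))" for i y
    using snoc.prems(2)[of i y] that by (simp add: nth_append)
  ultimately obtain c where c: "\<forall>i\<le>length xs. primeideal (c i) R" "\<forall>i<length xs. c i \<subset> c (Suc i)"
    "c (length xs) = q" using snoc.IH[OF _ _ q(1)] snoc.prems(1) by auto
  then show ?case
    using q snoc.prems(3)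
    by (intro exI[of _ "\<lambda>i. if i \<le> length xs then c i else p"]) (auto simp: less_Suc_eq le_Suc_eq)
qed

lemma grade_le_height: "grade R I \<le> ideal_height R I"
  unfolding grade_def ideal_height_def
proof (intro Sup_least Inf_greatest)
  fix a b assume "a \<in> {enat (length xs) |xs. set xs \<subseteq> I \<and> regular_sequence R xs}"
    and "b \<in> {prime_height R p |p. primeideal p R \<and> I \<subseteq> p}"
  then obtain xs p where xs: "a = enat (length xs)" "set xs \<subseteq> I" "regular_sequence R xs"
    and p: "b = prime_height R p" "primeideal p R" "I \<subseteq> p" by auto
  have "\<exists>c :: nat \<Rightarrow> 'a set. (\<forall>i\<le>length xs. primeideal (c i) R) \<and> (\<forall>i<length xs. c i \<subset> c (Suc i)) \<and> c (length xs) = p"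
    by (rule regular_sequence_prime_chain) (use xs p in \<open>auto simp: regular_sequence_def\<close>)
  then show "a \<le> b" unfolding xs(1) p(1) prime_height_def by (intro Sup_upper) blast
qed

end

section \<open>Noetherian local rings\<close>

locale noetherian_local = noetherian_cring R for R (structure) +
  fixes \<mm> :: "'a set"
  assumes max_ideal: "maximalideal \<mm> R" and max_unique: "maximalideal M R \<Longrightarrow> M = \<mm>"

lemma (in noetherian_cring) local_ringE:
  assumes "local_ring R"
  obtains \<mm> where "noetherian_local R \<mm>"
proof -
  from assms obtain \<mm> where "maximalideal \<mm> R" "\<And>M. maximalideal M R \<Longrightarrow> M = \<mm>"
    unfolding local_ring_def by blast
  then have "noetherian_local R \<mm>"
    by (intro noetherian_local.intro[OF noetherian_cring_axioms] noetherian_local_axioms.intro)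
  then show thesis by (rule that)
qed

context noetherian_local begin

sublocale mm: maximalideal \<mm> R by (rule max_ideal)

lemma proper_ideal_subset:
  assumes I: "ideal I R" "I \<noteq> carrier R"
  shows "I \<subseteq> \<mm>"
proof -
  let ?A = "{K. ideal K R \<and> I \<subseteq> K \<and> K \<noteq> carrier R}"
  have "\<exists>M\<in>?A. \<forall>K\<in>?A. M \<subseteq> K \<longrightarrow> K = M"
  proof (rule maximal_in_family)
    show "?A \<noteq> {}" using I by blast
  qed simp
  then obtain M where MA: "M \<in> ?A" and Mmax: "\<forall>K\<in>?A. M \<subseteq> K \<longrightarrow> K = M" ..
  from MA have M: "ideal M R" "I \<subseteq> M" "M \<noteq> carrier R" by simp_all
  have max: "K = M" if "ideal K R" "M \<subseteq> K" "K \<noteq> carrier R" for K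
    using Mmax that M(2) by simp
  have "maximalideal M R" by (rule maximalidealI[OF M(1)]) (use M max in blast)+
  then show ?thesis using max_unique M(2) by blast
qed

lemma one_notin_mm: "\<one> \<notin> \<mm>"
  using mm.one_imp_carrier mm.I_notcarr by auto

lemma Units_iff: "a \<in> carrier R \<Longrightarrow> a \<in> Units R \<longleftrightarrow> a \<notin> \<mm>"
proof -
  assume a: "a \<in> carrier R"
  show ?thesis
  proof
    assume "a \<in> Units R"
    then obtain b where b: "b \<in> carrier R" "b \<otimes> a = \<one>" by (auto simp: Units_def)
    then show "a \<notin> \<mm>" using one_notin_mm mm.I_l_closed[of a b] by auto
  next
    assume na: "a \<notin> \<mm>"
    have "PIdl a = carrier R"
      using proper_ideal_subset[OF cgenideal_ideal[OF a]] cgenideal_self[OF a] na by blast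
    then have "\<one> \<in> PIdl a" by simp
    then obtain b where "b \<in> carrier R" "\<one> = b \<otimes> a" unfolding cgenideal_def by blast
    then show "a \<in> Units R" using a m_comm[of a b] by (auto simp: Units_def intro!: bexI[of _ b])
  qed
qed

lemma one_plus_mm_unit: "a \<in> \<mm> \<Longrightarrow> \<one> \<oplus> a \<in> Units R"
proof -
  assume a: "a \<in> \<mm>"
  have "\<one> \<oplus> a \<notin> \<mm>"
  proof
    assume "\<one> \<oplus> a \<in> \<mm>"
    then have "(\<one> \<oplus> a) \<oplus> \<ominus> a \<in> \<mm>" using a by simp
    then show False using one_notin_mm mm.Icarr[OF a] by (simp add: a_assoc r_neg)
  qed
  then show ?thesis using Units_iff mm.Icarr[OF a] by simp
qed

lemma Det_one_mod_mm:
  assumes L: "\<And>i j. L i j \<in> carrier R"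
    and diag: "\<And>i. i < n \<Longrightarrow> L i i \<ominus> \<one> \<in> \<mm>"
    and off: "\<And>i j. i < n \<Longrightarrow> j < n \<Longrightarrow> i \<noteq> j \<Longrightarrow> L i j \<in> \<mm>"
  shows "Det n L \<in> Units R"
proof -
  let ?T = "{\<one> \<oplus> a | a. a \<in> \<mm>}"
  have "Det n L \<in> (\<lambda>d. ?T) (0 * n)"
  proof (rule Det_graded[where S = "\<lambda>_. \<mm>"])
    show "x \<otimes> y \<in> \<mm>" if "x \<in> \<mm>" "y \<in> \<mm> \<union> ?T" for x y
      using that mm.I_r_closed mm.Icarr by auto
    show "x \<otimes> y \<in> ?T" if xy: "x \<in> ?T" "y \<in> ?T" for x y
    proof -
      from xy obtain a b where ab: "x = \<one> \<oplus> a" "a \<in> \<mm>" "y = \<one> \<oplus> b" "b \<in> \<mm>" by blast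
      have "x \<otimes> y = \<one> \<oplus> (a \<oplus> b \<oplus> a \<otimes> b)"
        using ab mm.Icarr by (simp add: l_distr r_distr a_ac)
      moreover have "a \<oplus> b \<oplus> a \<otimes> b \<in> \<mm>" using ab mm.Icarr mm.I_r_closed by simp
      ultimately show ?thesis by blast
    qed
    show "x \<oplus> y \<in> ?T" if xy: "x \<in> ?T" "y \<in> \<mm>" for x y
    proof -
      from xy obtain a where a: "x = \<one> \<oplus> a" "a \<in> \<mm>" by blast
      then have "x \<oplus> y = \<one> \<oplus> (a \<oplus> y)" using xy(2) mm.Icarr by (simp add: a_assoc)
      then show ?thesis using a(2) xy(2) mm.a_closed by blast
    qed
    show "\<one> \<in> ?T" by (intro CollectI exI[of _ \<zero>]) simp
    show "L i i \<in> ?T" if "i < n" for i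
    proof -
      have "L i i = \<one> \<oplus> (L i i \<ominus> \<one>)" using L[of i i] by algebra
      then show ?thesis using diag[OF that] by blast
    qed
  qed (use L off mm.Icarr in \<open>auto\<close>)
  then show ?thesis using one_plus_mm_unit by auto
qed

text \<open>An \<open>n \<times> n\<close> matrix that is the identity modulo \<open>\<mm>\<close> does not factor through \<open>R\<^sup>m\<close>
  with \<open>m < n\<close>, because its determinant would vanish.\<close>
lemma identity_mod_mm_factorization:
  fixes a b :: "nat \<Rightarrow> nat \<Rightarrow> 'a" and n m :: nat
  assumes a: "\<And>j k. a j k \<in> carrier R" and b: "\<And>i j. b i j \<in> carrier R"
    and id: "\<And>i k. i < n \<Longrightarrow> k < n \<Longrightarrow> (\<Oplus>j\<in>{..<m}. b i j \<otimes> a j k) \<ominus> unit_vec i k \<in> \<mm>"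
  shows "n \<le> m"
proof (rule ccontr)
  assume "\<not> n \<le> m"
  then have "Det n (\<lambda>i k. \<Oplus>j\<in>{..<m}. b i j \<otimes> a j k) = \<zero>"
    by (intro Det_low_rank) (use a b in auto)
  moreover have "Det n (\<lambda>i k. \<Oplus>j\<in>{..<m}. b i j \<otimes> a j k) \<in> Units R"
  proof (rule Det_one_mod_mm)
    show c: "(\<Oplus>j\<in>{..<m}. b i j \<otimes> a j k) \<in> carrier R" for i k using a b by simp
    show "(\<Oplus>j\<in>{..<m}. b i j \<otimes> a j i) \<ominus> \<one> \<in> \<mm>" if "i < n" for i
      using id[OF that that] by (simp add: unit_vec_def)
    show "(\<Oplus>j\<in>{..<m}. b i j \<otimes> a j k) \<in> \<mm>" if "i < n" "k < n" "i \<noteq> k" for i k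
      using id[OF that(1,2)] that(3) c[of i k] by (simp add: unit_vec_def minus_eq)
  qed
  ultimately show False using Units_iff[of \<zero>] mm.zero_closed by simp
qed

end


section \<open>Linear maps, free modules and linear relations\<close>

lemma module_homI:
  assumes "\<And>x. x \<in> carrier M \<Longrightarrow> h x \<in> carrier N"
    and "\<And>x y. x \<in> carrier M \<Longrightarrow> y \<in> carrier M \<Longrightarrow> h (x \<oplus>\<^bsub>M\<^esub> y) = h x \<oplus>\<^bsub>N\<^esub> h y"
    and "\<And>r x. r \<in> carrier R \<Longrightarrow> x \<in> carrier M \<Longrightarrow> h (r \<odot>\<^bsub>M\<^esub> x) = r \<odot>\<^bsub>N\<^esub> h x"
  shows "h \<in> module_hom R M N"
  using assms by (auto simp: module_hom_def hom_def)

lemma module_homD: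
  assumes "h \<in> module_hom R M N"
  shows "x \<in> carrier M \<Longrightarrow> h x \<in> carrier N"
    and "x \<in> carrier M \<Longrightarrow> y \<in> carrier M \<Longrightarrow> h (x \<oplus>\<^bsub>M\<^esub> y) = h x \<oplus>\<^bsub>N\<^esub> h y"
    and "r \<in> carrier R \<Longrightarrow> x \<in> carrier M \<Longrightarrow> h (r \<odot>\<^bsub>M\<^esub> x) = r \<odot>\<^bsub>N\<^esub> h x"
  using assms by (auto simp: module_hom_def hom_def)

lemma module_hom_zero:
  assumes "module R M" "module R N" "h \<in> module_hom R M N"
  shows "h \<zero>\<^bsub>M\<^esub> = \<zero>\<^bsub>N\<^esub>"
proof -
  interpret M: module R M by fact
  interpret N: module R N by fact
  have "h (\<zero>\<^bsub>R\<^esub> \<odot>\<^bsub>M\<^esub> \<zero>\<^bsub>M\<^esub>) = \<zero>\<^bsub>R\<^esub> \<odot>\<^bsub>N\<^esub> h \<zero>\<^bsub>M\<^esub>"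
    by (rule module_homD(3)[OF assms(3)]) auto
  then show ?thesis using module_homD(1)[OF assms(3), of "\<zero>\<^bsub>M\<^esub>"] by simp
qed

lemma module_hom_compose:
  assumes "g \<in> module_hom R M N" "h \<in> module_hom R N K"
  shows "(\<lambda>x. h (g x)) \<in> module_hom R M K"
  by (rule module_homI) (simp_all add: module_homD[OF assms(1)] module_homD[OF assms(2)])

text \<open>Diagram chases produce submodules of a product of two modules rather than maps. From a total
  one on a projective module a linear map can be selected.\<close>
definition linear_relation ::
    "('a, 'm) ring_scheme \<Rightarrow> ('a, 'b) module \<Rightarrow> ('a, 'c) module \<Rightarrow> ('b \<times> 'c) set \<Rightarrow> bool"
  where "linear_relation R M N T \<longleftrightarrow> T \<subseteq> carrier M \<times> carrier N \<and>
    (\<forall>x y x' y'. (x, y) \<in> T \<longrightarrow> (x', y') \<in> T \<longrightarrow> (x \<oplus>\<^bsub>M\<^esub> x', y \<oplus>\<^bsub>N\<^esub> y') \<in> T) \<and>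
    (\<forall>r x y. r \<in> carrier R \<longrightarrow> (x, y) \<in> T \<longrightarrow> (r \<odot>\<^bsub>M\<^esub> x, r \<odot>\<^bsub>N\<^esub> y) \<in> T)"

text \<open>The index set is arbitrary, as the lifting property of a projective module is tested with the
  free module on its own carrier. Vectors vanish outside of the index set, so that functions
  represent them uniquely.\<close>
definition free_module :: "('a, 'm) ring_scheme \<Rightarrow> 'b set \<Rightarrow> ('a, 'b \<Rightarrow> 'a) module"
  where "free_module R B =
    \<lparr>carrier = {x. (\<forall>b. x b \<in> carrier R) \<and> finite {b. x b \<noteq> \<zero>\<^bsub>R\<^esub>} \<and> (\<forall>b. b \<notin> B \<longrightarrow> x b = \<zero>\<^bsub>R\<^esub>)},
     monoid.mult = undefined, one = undefined,
     ring.zero = (\<lambda>_. \<zero>\<^bsub>R\<^esub>), ring.add = (\<lambda>x y b. x b \<oplus>\<^bsub>R\<^esub> y b),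
     smult = (\<lambda>r x b. r \<otimes>\<^bsub>R\<^esub> x b)\<rparr>"

abbreviation vec :: "('a, 'm) ring_scheme \<Rightarrow> nat \<Rightarrow> ('a, nat \<Rightarrow> 'a) module"
  where "vec R k \<equiv> free_module R {..<k}"

lemma free_module_simps [simp]:
  "\<zero>\<^bsub>free_module R B\<^esub> = (\<lambda>_. \<zero>\<^bsub>R\<^esub>)"
  "x \<oplus>\<^bsub>free_module R B\<^esub> y = (\<lambda>b. x b \<oplus>\<^bsub>R\<^esub> y b)"
  "r \<odot>\<^bsub>free_module R B\<^esub> x = (\<lambda>b. r \<otimes>\<^bsub>R\<^esub> x b)"
  by (simp_all add: free_module_def)

lemma ring_module_simps [simp]:
  "carrier (ring_module R) = carrier R" "\<zero>\<^bsub>ring_module R\<^esub> = \<zero>\<^bsub>R\<^esub>"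
  "x \<oplus>\<^bsub>ring_module R\<^esub> y = x \<oplus>\<^bsub>R\<^esub> y" "r \<odot>\<^bsub>ring_module R\<^esub> y = r \<otimes>\<^bsub>R\<^esub> y"
  by (simp_all add: ring_module_def)

context cring begin

lemma free_carrier: "x \<in> carrier (free_module R B) \<longleftrightarrow>
    (\<forall>b. x b \<in> carrier R) \<and> finite {b. x b \<noteq> \<zero>} \<and> (\<forall>b. b \<notin> B \<longrightarrow> x b = \<zero>)"
  by (simp add: free_module_def)

lemma vec_carrier: "x \<in> carrier (vec R k) \<longleftrightarrow> (\<forall>b. x b \<in> carrier R) \<and> (\<forall>b\<ge>k. x b = \<zero>)"
proof -
  have "finite {b. x b \<noteq> \<zero>}" if "\<forall>b\<ge>k. x b = \<zero>"
    by (rule finite_subset[of _ "{..<k}"]) (use that in \<open>auto simp: not_le[symmetric]\<close>)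
  then show ?thesis unfolding free_carrier by (auto simp: not_less)
qed

lemma free_module_module: "module R (free_module R B)"
proof (rule moduleI)
  let ?F = "free_module R B"
  have supp: "finite {b. x b \<oplus> y b \<noteq> \<zero>}" if "finite {b. x b \<noteq> \<zero>}" "finite {b. y b \<noteq> \<zero>}"
    for x y :: "'c \<Rightarrow> 'a"
    by (rule finite_subset[of _ "{b. x b \<noteq> \<zero>} \<union> {b. y b \<noteq> \<zero>}"]) (use that in auto)
  have supp': "finite {b. r \<otimes> x b \<noteq> \<zero>}" if "finite {b. x b \<noteq> \<zero>}" "r \<in> carrier R" for r x
    by (rule finite_subset[OF _ that(1)]) (use that in auto)
  show "abelian_group ?F"
  proof (rule abelian_groupI)
    fix x assume x: "x \<in> carrier ?F"
    have "finite {b. \<ominus> x b \<noteq> \<zero>}"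
      by (rule finite_subset[of _ "{b. x b \<noteq> \<zero>}"]) (use x in \<open>auto simp: free_carrier\<close>)
    then show "\<exists>y\<in>carrier ?F. y \<oplus>\<^bsub>?F\<^esub> x = \<zero>\<^bsub>?F\<^esub>"
      using x by (intro bexI[of _ "\<lambda>b. \<ominus> x b"]) (auto simp: free_carrier l_neg)
  qed (auto simp: free_carrier supp a_ac)
  show "r \<odot>\<^bsub>?F\<^esub> x \<in> carrier ?F" if "r \<in> carrier R" "x \<in> carrier ?F" for r x
    using that supp' by (auto simp: free_carrier)
qed (auto simp: free_carrier l_distr r_distr m_assoc is_cring)

lemma ring_module_module: "module R (ring_module R)"
proof (rule moduleI)
  show "abelian_group (ring_module R)"
    by (rule abelian_groupI) (auto simp: a_ac intro!: bexI[of _ "\<ominus> _"] l_neg)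
qed (auto simp: is_cring l_distr r_distr m_assoc)

lemma unit_vec_free [simp]: "b \<in> B \<Longrightarrow> unit_vec b \<in> carrier (free_module R B)"
  by (auto simp: free_carrier unit_vec_def intro: finite_subset[of _ "{b}"])

lemma free_module_induct [consumes 1, case_names zero add]:
  assumes x: "x \<in> carrier (free_module R B)"
    and zero: "P (\<lambda>_. \<zero>)"
    and add: "\<And>x a b. x \<in> carrier (free_module R B) \<Longrightarrow> P x \<Longrightarrow> a \<in> carrier R \<Longrightarrow> b \<in> B \<Longrightarrow>
      P (\<lambda>k. x k \<oplus> a \<otimes> unit_vec b k)"
  shows "P x"
proof -
  have "P x" if "finite S" "S \<subseteq> B" "\<And>b. x b \<in> carrier R" "\<And>b. b \<notin> S \<Longrightarrow> x b = \<zero>" for S x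
    using that
  proof (induction S arbitrary: x rule: finite_induct)
    case empty
    then have "x = (\<lambda>_. \<zero>)" by auto
    then show ?case using zero by simp
  next
    case (insert b S)
    let ?y = "x(b := \<zero>)"
    have supp: "{c. ?y c \<noteq> \<zero>} \<subseteq> S" using insert.prems by auto
    have Py: "P ?y" by (rule insert.IH) (use insert.prems in auto)
    have cy: "?y \<in> carrier (free_module R B)"
      using insert.prems insert.hyps finite_subset[OF supp] by (auto simp: free_carrier)
    have "P (\<lambda>k. ?y k \<oplus> x b \<otimes> unit_vec b k)"
      by (rule add[OF cy Py]) (use insert.prems in auto)
    moreover have "(\<lambda>k. ?y k \<oplus> x b \<otimes> unit_vec b k) = x"
      using insert.prems by (auto simp: unit_vec_def)
    ultimately show ?case by simp
  qed
  moreover have "finite {b. x b \<noteq> \<zero>}" "{b. x b \<noteq> \<zero>} \<subseteq> B" "x b \<in> carrier R" for b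
    using x by (auto simp: free_carrier)
  moreover have "x b = \<zero>" if "b \<notin> {b. x b \<noteq> \<zero>}" for b using that by simp
  ultimately show ?thesis .
qed

lemma free_module_extend:
  assumes N: "module R N" and y: "\<And>b. b \<in> B \<Longrightarrow> y b \<in> carrier N"
  shows "\<exists>h\<in>module_hom R (free_module R B) N. \<forall>b\<in>B. h (unit_vec b) = y b"
proof -
  interpret N: module R N by fact
  define h where "h = (\<lambda>x. \<Oplus>\<^bsub>N\<^esub>b\<in>{b. x b \<noteq> \<zero>}. x b \<odot>\<^bsub>N\<^esub> y b)"
  have h: "h x = (\<Oplus>\<^bsub>N\<^esub>b\<in>S. x b \<odot>\<^bsub>N\<^esub> y b)"
    if "x \<in> carrier (free_module R B)" "finite S" "S \<subseteq> B" "{b. x b \<noteq> \<zero>} \<subseteq> S" for x S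
    unfolding h_def
  proof (rule N.add.finprod_mono_neutral_cong_left)
    show "x i \<odot>\<^bsub>N\<^esub> y i = \<zero>\<^bsub>N\<^esub>" if "i \<in> S - {b. x b \<noteq> \<zero>}" for i
      using that y \<open>S \<subseteq> B\<close> by auto
  qed (use that y in \<open>auto simp: free_carrier\<close>)
  have supp: "finite {b. x b \<noteq> \<zero>} \<and> {b. x b \<noteq> \<zero>} \<subseteq> B \<and> (\<forall>b. x b \<in> carrier R)"
    if "x \<in> carrier (free_module R B)" for x
    using that by (auto simp: free_carrier)
  interpret F: module R "free_module R B" by (rule free_module_module)
  have "h \<in> module_hom R (free_module R B) N"
  proof (rule module_homI)
    fix x assume x: "x \<in> carrier (free_module R B)"
    show "h x \<in> carrier N"
      unfolding h_def using supp[OF x] y by (intro N.finsum_closed) auto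
    show "h (r \<odot>\<^bsub>free_module R B\<^esub> x) = r \<odot>\<^bsub>N\<^esub> h x" if r: "r \<in> carrier R" for r
    proof -
      have "h (r \<odot>\<^bsub>free_module R B\<^esub> x) = (\<Oplus>\<^bsub>N\<^esub>b\<in>{b. x b \<noteq> \<zero>}. (r \<otimes> x b) \<odot>\<^bsub>N\<^esub> y b)"
      proof -
        have "{b. r \<otimes> x b \<noteq> \<zero>} \<subseteq> {b. x b \<noteq> \<zero>}" using r by auto
        then show ?thesis
          using h[OF F.smult_closed[OF r x], of "{b. x b \<noteq> \<zero>}"] supp[OF x] by simp
      qed
      also have "\<dots> = (\<Oplus>\<^bsub>N\<^esub>b\<in>{b. x b \<noteq> \<zero>}. r \<odot>\<^bsub>N\<^esub> (x b \<odot>\<^bsub>N\<^esub> y b))"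
        by (rule N.finsum_cong') (use supp[OF x] y r in \<open>auto simp: N.smult_assoc1\<close>)
      also have "\<dots> = r \<odot>\<^bsub>N\<^esub> h x"
        unfolding h_def by (rule N.finsum_smult_ldistr[symmetric]) (use supp[OF x] y r in auto)
      finally show ?thesis .
    qed
    fix z assume z: "z \<in> carrier (free_module R B)"
    let ?S = "{b. x b \<noteq> \<zero>} \<union> {b. z b \<noteq> \<zero>}"
    have S: "finite ?S" "?S \<subseteq> B" using supp[OF x] supp[OF z] by auto
    have "h (x \<oplus>\<^bsub>free_module R B\<^esub> z) = (\<Oplus>\<^bsub>N\<^esub>b\<in>?S. (x b \<oplus> z b) \<odot>\<^bsub>N\<^esub> y b)"
    proof -
      have "{b. x b \<oplus> z b \<noteq> \<zero>} \<subseteq> ?S" using supp[OF x] supp[OF z] by auto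
      then show ?thesis using h[OF F.add.m_closed[OF x z] S] by simp
    qed
    also have "\<dots> = (\<Oplus>\<^bsub>N\<^esub>b\<in>?S. x b \<odot>\<^bsub>N\<^esub> y b \<oplus>\<^bsub>N\<^esub> z b \<odot>\<^bsub>N\<^esub> y b)"
      by (rule N.finsum_cong') (use supp[OF x] supp[OF z] y S in \<open>auto simp: N.smult_l_distr\<close>)
    also have "\<dots> = h x \<oplus>\<^bsub>N\<^esub> h z"
      unfolding h[OF x S Un_upper1] h[OF z S Un_upper2]
      by (rule N.finsum_addf) (use supp[OF x] supp[OF z] y S in auto)
    finally show "h (x \<oplus>\<^bsub>free_module R B\<^esub> z) = h x \<oplus>\<^bsub>N\<^esub> h z" .
  qed
  moreover have "h (unit_vec b) = y b" if b: "b \<in> B" for b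
  proof -
    have "{c. unit_vec b c \<noteq> \<zero>} \<subseteq> {b}" by (auto simp: unit_vec_def)
    then show ?thesis using h[OF unit_vec_free[OF b], of "{b}"] b y by (simp add: unit_vec_def)
  qed
  ultimately show ?thesis by blast
qed

text \<open>Choose the values on the basis in the relation.\<close>
lemma free_module_selection:
  assumes N: "module R N" and T: "linear_relation R (free_module R B) N T"
    and total: "\<And>x. x \<in> carrier (free_module R B) \<Longrightarrow> \<exists>y. (x, y) \<in> T"
  shows "\<exists>h\<in>module_hom R (free_module R B) N. \<forall>x\<in>carrier (free_module R B). (x, h x) \<in> T"
proof -
  interpret N: module R N by fact
  interpret F: module R "free_module R B" by (rule free_module_module)
  have T1: "(x, y) \<in> T \<Longrightarrow> x \<in> carrier (free_module R B) \<and> y \<in> carrier N"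
    and T2: "(x, y) \<in> T \<Longrightarrow> (x', y') \<in> T \<Longrightarrow> (x \<oplus>\<^bsub>free_module R B\<^esub> x', y \<oplus>\<^bsub>N\<^esub> y') \<in> T"
    and T3: "r \<in> carrier R \<Longrightarrow> (x, y) \<in> T \<Longrightarrow> (r \<odot>\<^bsub>free_module R B\<^esub> x, r \<odot>\<^bsub>N\<^esub> y) \<in> T" for x y x' y' r
    using T unfolding linear_relation_def by blast+
  have "\<exists>y. \<forall>b\<in>B. (unit_vec b, y b) \<in> T"
    by (rule bchoice, rule ballI, rule total, rule unit_vec_free)
  then obtain y where y: "\<And>b. b \<in> B \<Longrightarrow> (unit_vec b, y b) \<in> T" by blast
  then have yN: "y b \<in> carrier N" if "b \<in> B" for b using T1 that by blast
  from free_module_extend[OF N yN] obtain h where h1: "h \<in> module_hom R (free_module R B) N"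
    and h2: "\<forall>b\<in>B. h (unit_vec b) = y b" ..
  note h = h1 bspec[OF h2]
  have "(x, h x) \<in> T" if "x \<in> carrier (free_module R B)" for x
    using that
  proof (induction x rule: free_module_induct)
    case zero
    obtain y0 where "(\<zero>\<^bsub>free_module R B\<^esub>, y0) \<in> T" using total F.zero_closed by blast
    from T3[OF zero_closed this] T1[OF this] show ?case
      using module_hom_zero[OF free_module_module N h(1)] by simp
  next
    case (add x a b)
    have e: "unit_vec b \<in> carrier (free_module R B)" using add by simp
    have "h (x \<oplus>\<^bsub>free_module R B\<^esub> (a \<odot>\<^bsub>free_module R B\<^esub> unit_vec b)) = h x \<oplus>\<^bsub>N\<^esub> a \<odot>\<^bsub>N\<^esub> y b"
      using module_homD[OF h(1)] add h(2) e F.smult_closed[OF _ e] by (simp del: free_module_simps)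
    then show ?case using T2[OF add.IH T3[OF add(2) y[OF add(3)]]] by simp
  qed
  with h(1) show ?thesis by blast
qed

lemma vec_projective: "projective_module R (vec R k)"
  unfolding projective_module_def
proof (intro conjI allI impI)
  show "module R (vec R k)" by (rule free_module_module)
  fix M :: "('a, (nat \<Rightarrow> 'a) \<Rightarrow> 'a) module" and N :: "('a, nat \<Rightarrow> 'a) module" and f g
  assume A: "module R M \<and> module R N \<and> f \<in> module_hom R M N \<and> f ` carrier M = carrier N \<and> g \<in> module_hom R (vec R k) N"
  interpret M: module R M using A by blast
  interpret F: module R "vec R k" by (rule free_module_module)
  let ?T = "{(x, m). x \<in> carrier (vec R k) \<and> m \<in> carrier M \<and> f m = g x}"
  have f: "f \<in> module_hom R M N" and g: "g \<in> module_hom R (vec R k) N" using A by auto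
  have "linear_relation R (vec R k) M ?T"
    unfolding linear_relation_def
    using module_homD(2,3)[OF f] module_homD(2,3)[OF g] F.add.m_closed F.smult_closed
    by (auto simp del: free_module_simps)
  moreover have "\<exists>m. (x, m) \<in> ?T" if "x \<in> carrier (vec R k)" for x
    using A module_homD(1)[OF g that] that by (auto simp: image_iff set_eq_iff) metis
  ultimately obtain h where "h \<in> module_hom R (vec R k) M" "\<forall>x\<in>carrier (vec R k). (x, h x) \<in> ?T"
    using free_module_selection[of M "{..<k}" ?T] A by blast
  then show "\<exists>h\<in>module_hom R (vec R k) M. \<forall>x\<in>carrier (vec R k). f (h x) = g x" by auto
qed

text \<open>Pull the relation back along the surjection from the free module on the carrier of \<open>P\<close>, select
  there, and return by a section of the surjection.\<close>
lemma projective_selection: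
  fixes P :: "('a, 'p) module"
  assumes P: "projective_module R P" and N: "module R N" and T: "linear_relation R P N T"
    and total: "\<And>x. x \<in> carrier P \<Longrightarrow> \<exists>y. (x, y) \<in> T"
  shows "\<exists>h\<in>module_hom R P N. \<forall>x\<in>carrier P. (x, h x) \<in> T"
proof -
  let ?F = "free_module R (carrier P)"
  have Pm: "module R P" using P by (simp add: projective_module_def)
  interpret P: module R P by (rule Pm)
  interpret F: module R ?F by (rule free_module_module)
  obtain ev where ev: "ev \<in> module_hom R ?F P" "\<And>x. x \<in> carrier P \<Longrightarrow> ev (unit_vec x) = x"
    using free_module_extend[OF Pm, of "carrier P" "\<lambda>x. x"] by blast
  have "ev ` carrier ?F = carrier P"
  proof
    show "ev ` carrier ?F \<subseteq> carrier P" using module_homD(1)[OF ev(1)] by (rule image_subsetI)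
    show "carrier P \<subseteq> ev ` carrier ?F"
    proof
      fix x assume x: "x \<in> carrier P"
      show "x \<in> ev ` carrier ?F" using ev(2)[OF x, symmetric] unit_vec_free[OF x] by (rule image_eqI)
    qed
  qed
  moreover have "(\<lambda>x. x) \<in> module_hom R P P" by (rule module_homI) auto
  ultimately obtain \<eta> where \<eta>: "\<eta> \<in> module_hom R P ?F" "\<And>x. x \<in> carrier P \<Longrightarrow> ev (\<eta> x) = x"
    using P F.module_axioms Pm ev(1) unfolding projective_module_def by blast
  let ?T = "{(w, y). w \<in> carrier ?F \<and> (ev w, y) \<in> T}"
  have "linear_relation R ?F N ?T"
    using T module_homD(2,3)[OF ev(1)] F.add.m_closed F.smult_closed
    unfolding linear_relation_def by (auto simp del: free_module_simps)
  moreover have "\<exists>y. (w, y) \<in> ?T" if "w \<in> carrier ?F" for w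
    using total[OF module_homD(1)[OF ev(1) that]] that by auto
  ultimately obtain h where h: "h \<in> module_hom R ?F N" "\<And>w. w \<in> carrier ?F \<Longrightarrow> (w, h w) \<in> ?T"
    using free_module_selection[OF N, of "carrier P" ?T] by blast
  have "(x, h (\<eta> x)) \<in> T" if "x \<in> carrier P" for x
    using h(2)[OF module_homD(1)[OF \<eta>(1) that]] \<eta>(2)[OF that] by simp
  then show ?thesis using module_hom_compose[OF \<eta>(1) h(1)] by (intro bexI[of _ "\<lambda>x. h (\<eta> x)"]) auto
qed

lemma linear_functional_vec:
  assumes w: "w \<in> module_hom R (vec R k) (ring_module R)" and x: "x \<in> carrier (vec R k)"
  shows "w x = (\<Oplus>j\<in>{..<k}. x j \<otimes> w (unit_vec j))"
  using x
proof (induction x rule: free_module_induct)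
  case zero
  have "w (\<lambda>_. \<zero>) = \<zero>" using module_hom_zero[OF free_module_module ring_module_module w] by simp
  moreover have "w (unit_vec j) \<in> carrier R" if "j < k" for j using module_homD(1)[OF w, of "unit_vec j"] that by simp
  ultimately show ?case by (auto intro!: add.finprod_one_eqI[symmetric])
next
  case (add x a b)
  have x: "x j \<in> carrier R" for j using add(1) by (simp add: vec_carrier)
  have we: "w (unit_vec j) \<in> carrier R" if "j \<in> {..<k}" for j using module_homD(1)[OF w, of "unit_vec j"] that by simp
  interpret F: module R "vec R k" by (rule free_module_module)
  have e: "unit_vec b \<in> carrier (vec R k)" using add by simp
  have "w (x \<oplus>\<^bsub>vec R k\<^esub> (a \<odot>\<^bsub>vec R k\<^esub> unit_vec b)) = w x \<oplus> a \<otimes> w (unit_vec b)"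
    using module_homD[OF w] add e F.smult_closed[OF _ e] by (simp del: free_module_simps)
  moreover have "(\<Oplus>j\<in>{..<k}. (x j \<oplus> a \<otimes> unit_vec b j) \<otimes> w (unit_vec j))
    = (\<Oplus>j\<in>{..<k}. x j \<otimes> w (unit_vec j) \<oplus> a \<otimes> (unit_vec b j \<otimes> w (unit_vec j)))"
    by (rule finsum_cong') (use we x add in \<open>auto simp: l_distr m_assoc\<close>)
  moreover have "\<dots> = (\<Oplus>j\<in>{..<k}. x j \<otimes> w (unit_vec j)) \<oplus> (\<Oplus>j\<in>{..<k}. a \<otimes> (unit_vec b j \<otimes> w (unit_vec j)))"
    by (rule finsum_addf) (use we x add in auto)
  moreover have "(\<Oplus>j\<in>{..<k}. a \<otimes> (unit_vec b j \<otimes> w (unit_vec j))) = a \<otimes> w (unit_vec b)"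
  proof -
    have "(\<Oplus>j\<in>{..<k}. a \<otimes> (unit_vec b j \<otimes> w (unit_vec j)))
        = (\<Oplus>j\<in>{..<k}. if b = j then a \<otimes> w (unit_vec j) else \<zero>)"
      by (rule finsum_cong') (use we add in \<open>auto simp: unit_vec_def\<close>)
    also have "\<dots> = a \<otimes> w (unit_vec b)" by (rule finsum_singleton) (use we add in auto)
    finally show ?thesis .
  qed
  ultimately show ?case using add.IH by simp
qed

lemma functional_mem_ideal:
  assumes w: "w \<in> module_hom R (vec R k) (ring_module R)" and x: "x \<in> carrier (vec R k)"
    and J: "ideal J R" "\<And>j. x j \<in> J"
  shows "w x \<in> J"
  unfolding linear_functional_vec[OF w x]
proof (rule ideal_finsum_closed[OF J(1)])
  fix j assume "j \<in> {..<k}"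
  then have "w (unit_vec j) \<in> carrier R" using module_homD(1)[OF w, of "unit_vec j"] by simp
  then show "x j \<otimes> w (unit_vec j) \<in> J" by (rule ideal.I_r_closed[OF J])
qed

lemma coordinate_functional:
  assumes "h \<in> module_hom R M (free_module R B)"
  shows "(\<lambda>x. h x b) \<in> module_hom R M (ring_module R)"
  by (rule module_homI) (use module_homD[OF assms] in \<open>auto simp: free_carrier\<close>)

lemma module_hom_id: "(\<lambda>x. x) \<in> module_hom R M M"
  by (rule module_homI) auto

lemma dot_functional:
  assumes c: "\<And>j. c j \<in> carrier R"
  shows "(\<lambda>x. \<Oplus>j\<in>{..<k}. c j \<otimes> x j) \<in> module_hom R (vec R k) (ring_module R)"
proof (rule module_homI)
  fix x assume x: "x \<in> carrier (vec R k)"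
  then have xc: "x j \<in> carrier R" for j by (simp add: vec_carrier)
  show "(\<Oplus>j\<in>{..<k}. c j \<otimes> x j) \<in> carrier (ring_module R)" using c xc by simp
  show "(\<Oplus>j\<in>{..<k}. c j \<otimes> (r \<odot>\<^bsub>vec R k\<^esub> x) j) = r \<odot>\<^bsub>ring_module R\<^esub> (\<Oplus>j\<in>{..<k}. c j \<otimes> x j)"
    if "r \<in> carrier R" for r
    using c xc that by (simp add: finsum_rdistr m_lcomm Pi_def)
  fix y assume "y \<in> carrier (vec R k)"
  then have yc: "y j \<in> carrier R" for j by (simp add: vec_carrier)
  show "(\<Oplus>j\<in>{..<k}. c j \<otimes> (x \<oplus>\<^bsub>vec R k\<^esub> y) j) = (\<Oplus>j\<in>{..<k}. c j \<otimes> x j) \<oplus>\<^bsub>ring_module R\<^esub> (\<Oplus>j\<in>{..<k}. c j \<otimes> y j)"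
    using c xc yc by (simp add: r_distr finsum_addf Pi_def)
qed

end


section \<open>Comparison of projective resolutions\<close>

context cring begin

text \<open>The kernel of the map out of \<open>P i\<close>, where the augmentation plays the part of the map out of
  \<open>P 0\<close>. With this convention exactness has the same form in all degrees.\<close>
definition res_cycles ::
    "('a, 'q) module \<Rightarrow> (nat \<Rightarrow> ('a, nat \<Rightarrow> 'a) module) \<Rightarrow> (nat \<Rightarrow> (nat \<Rightarrow> 'a) \<Rightarrow> nat \<Rightarrow> 'a) \<Rightarrow>
      ((nat \<Rightarrow> 'a) \<Rightarrow> 'q) \<Rightarrow> nat \<Rightarrow> (nat \<Rightarrow> 'a) set"
  where "res_cycles M P d e i = (case i of 0 \<Rightarrow> {x \<in> carrier (P 0). e x = \<zero>\<^bsub>M\<^esub>}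
    | Suc j \<Rightarrow> {x \<in> carrier (P (Suc j)). d j x = \<zero>\<^bsub>P j\<^esub>})"

lemma resolutionD:
  assumes "projective_resolution R M P d e"
  shows "projective_module R (P i)" "module R (P i)" "d i \<in> module_hom R (P (Suc i)) (P i)"
    "e \<in> module_hom R (P 0) M" "e ` carrier (P 0) = carrier M"
    "d i ` carrier (P (Suc i)) = res_cycles M P d e i"
  using assms unfolding projective_resolution_def projective_module_def
  by (auto simp: res_cycles_def split: nat.split)

text \<open>Lift the identity of \<open>M\<close> degree by degree, carrying along that cycles are mapped to cycles;
  this is what makes the next lifting problem solvable.\<close>
lemma comparison_map:
  assumes P: "projective_resolution R M P d e" and Q: "projective_resolution R M Q d' e'"
  obtains \<alpha> where "\<And>i. \<alpha> i \<in> module_hom R (P i) (Q i)"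
    "\<And>x. x \<in> carrier (P 0) \<Longrightarrow> e' (\<alpha> 0 x) = e x"
    "\<And>i x. x \<in> carrier (P (Suc i)) \<Longrightarrow> d' i (\<alpha> (Suc i) x) = \<alpha> i (d i x)"
proof -
  note P = resolutionD[OF P] and Q = resolutionD[OF Q]
  define OK where "OK = (\<lambda>n a. a \<in> module_hom R (P n) (Q n)
    \<and> (\<forall>x\<in>res_cycles M P d e n. a x \<in> res_cycles M Q d' e' n)
    \<and> (n = 0 \<longrightarrow> (\<forall>x\<in>carrier (P 0). e' (a x) = e x)))"
  have "\<exists>\<alpha>. \<forall>n. OK n (\<alpha> n) \<and> (\<forall>x\<in>carrier (P (Suc n)). d' n (\<alpha> (Suc n) x) = \<alpha> n (d n x))"
  proof (rule dependent_nat_choice)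
    let ?T = "{(x, y). x \<in> carrier (P 0) \<and> y \<in> carrier (Q 0) \<and> e' y = e x}"
    interpret P0: module R "P 0" by (rule P(2))
    interpret Q0: module R "Q 0" by (rule Q(2))
    have "linear_relation R (P 0) (Q 0) ?T"
      unfolding linear_relation_def using module_homD(2,3)[OF P(4)] module_homD(2,3)[OF Q(4)] by auto
    moreover have "\<exists>y. (x, y) \<in> ?T" if "x \<in> carrier (P 0)" for x
    proof -
      have "e x \<in> e' ` carrier (Q 0)" using module_homD(1)[OF P(4) that] Q(5) by simp
      then obtain y where "e x = e' y" "y \<in> carrier (Q 0)" by (rule imageE)
      then show ?thesis using that by auto
    qed
    ultimately obtain a where "a \<in> module_hom R (P 0) (Q 0)" "\<forall>x\<in>carrier (P 0). (x, a x) \<in> ?T"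
      using projective_selection[OF P(1) Q(2), of 0 0 ?T] by blast
    then show "\<exists>a. OK 0 a" by (intro exI[of _ a]) (auto simp: OK_def res_cycles_def)
  next
    fix a n assume "OK n a"
    then have a: "a \<in> module_hom R (P n) (Q n)" "\<And>x. x \<in> res_cycles M P d e n \<Longrightarrow> a x \<in> res_cycles M Q d' e' n"
      unfolding OK_def by blast+
    interpret P1: module R "P (Suc n)" by (rule P(2))
    interpret Q1: module R "Q (Suc n)" by (rule Q(2))
    let ?T = "{(x, y). x \<in> carrier (P (Suc n)) \<and> y \<in> carrier (Q (Suc n)) \<and> d' n y = a (d n x)}"
    have "linear_relation R (P (Suc n)) (Q (Suc n)) ?T"
      unfolding linear_relation_def
      using module_homD[OF P(3)[of n]] module_homD(2,3)[OF Q(3)[of n]] module_homD(2,3)[OF a(1)] by auto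
    moreover have "\<exists>y. (x, y) \<in> ?T" if x: "x \<in> carrier (P (Suc n))" for x
    proof -
      have "d n x \<in> res_cycles M P d e n" unfolding P(6)[symmetric] using x by (rule imageI)
      from a(2)[OF this] have "a (d n x) \<in> d' n ` carrier (Q (Suc n))" unfolding Q(6) .
      then obtain y where "a (d n x) = d' n y" "y \<in> carrier (Q (Suc n))" by (rule imageE)
      then show ?thesis using x by auto
    qed
    ultimately obtain b where b: "b \<in> module_hom R (P (Suc n)) (Q (Suc n))"
      "\<forall>x\<in>carrier (P (Suc n)). (x, b x) \<in> ?T"
      using projective_selection[OF P(1) Q(2), of "Suc n" "Suc n" ?T] by blast
    have "b x \<in> res_cycles M Q d' e' (Suc n)" if "x \<in> res_cycles M P d e (Suc n)" for x
    proof -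
      have x: "x \<in> carrier (P (Suc n))" "d n x = \<zero>\<^bsub>P n\<^esub>" using that by (auto simp: res_cycles_def)
      then have "d' n (b x) = a \<zero>\<^bsub>P n\<^esub>" "b x \<in> carrier (Q (Suc n))" using b(2) by auto
      then show ?thesis using module_hom_zero[OF P(2) Q(2) a(1)] by (simp add: res_cycles_def)
    qed
    then show "\<exists>b. OK (Suc n) b \<and> (\<forall>x\<in>carrier (P (Suc n)). d' n (b x) = a (d n x))"
      using b by (intro exI[of _ b]) (auto simp: OK_def)
  qed
  then obtain \<alpha> where "\<And>n. OK n (\<alpha> n)" "\<And>n x. x \<in> carrier (P (Suc n)) \<Longrightarrow> d' n (\<alpha> (Suc n) x) = \<alpha> n (d n x)"
    by blast
  then show thesis by (intro that[of \<alpha>]) (auto simp: OK_def)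
qed

text \<open>Built degree by degree; the next step is solvable because \<open>\<tau> z = z + d (s z)\<close> holds on the
  cycles of the previous degree.\<close>
lemma homotopy_to_identity:
  assumes P: "projective_resolution R M P d e"
    and \<tau>: "\<And>i. \<tau> i \<in> module_hom R (P i) (P i)"
    and \<tau>e: "\<And>x. x \<in> carrier (P 0) \<Longrightarrow> e (\<tau> 0 x) = e x"
    and \<tau>d: "\<And>i x. x \<in> carrier (P (Suc i)) \<Longrightarrow> d i (\<tau> (Suc i) x) = \<tau> i (d i x)"
  obtains s where "\<And>i. s i \<in> module_hom R (P i) (P (Suc i))"
    "\<And>i x. x \<in> carrier (P (Suc i)) \<Longrightarrow>
      \<tau> (Suc i) x = x \<oplus>\<^bsub>P (Suc i)\<^esub> d (Suc i) (s (Suc i) x) \<oplus>\<^bsub>P (Suc i)\<^esub> s i (d i x)"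
proof -
  note P = resolutionD[OF P]
  define OK where "OK = (\<lambda>n s. s \<in> module_hom R (P n) (P (Suc n))
    \<and> (\<forall>z\<in>res_cycles M P d e n. \<tau> n z = z \<oplus>\<^bsub>P n\<^esub> d n (s z)))"
  have "\<exists>s. \<forall>n. OK n (s n) \<and> (\<forall>x\<in>carrier (P (Suc n)).
      \<tau> (Suc n) x = x \<oplus>\<^bsub>P (Suc n)\<^esub> d (Suc n) (s (Suc n) x) \<oplus>\<^bsub>P (Suc n)\<^esub> s n (d n x))"
  proof (rule dependent_nat_choice)
    interpret P0: module R "P 0" by (rule P(2))
    interpret P1: module R "P (Suc 0)" by (rule P(2))
    let ?T = "{(x, y). x \<in> carrier (P 0) \<and> y \<in> carrier (P (Suc 0)) \<and> \<tau> 0 x = x \<oplus>\<^bsub>P 0\<^esub> d 0 y}"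
    have e0: "e \<zero>\<^bsub>P 0\<^esub> = \<zero>\<^bsub>M\<^esub>"
    proof -
      have "d 0 \<zero>\<^bsub>P (Suc 0)\<^esub> \<in> res_cycles M P d e 0" unfolding P(6)[symmetric] by simp
      then show ?thesis using module_hom_zero[OF P(2) P(2) P(3)] by (simp add: res_cycles_def)
    qed
    have "linear_relation R (P 0) (P (Suc 0)) ?T"
      unfolding linear_relation_def
      using module_homD[OF P(3)[of 0]] module_homD(2,3)[OF \<tau>[of 0]]
      by (auto simp: P0.smult_r_distr P0.a_ac)
    moreover have "\<exists>y. (x, y) \<in> ?T" if x: "x \<in> carrier (P 0)" for x
    proof -
      have tx: "\<tau> 0 x \<in> carrier (P 0)" using module_homD(1)[OF \<tau> x] .
      let ?m = "\<ominus> \<one> \<odot>\<^bsub>P 0\<^esub> x"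
      have m: "?m \<in> carrier (P 0)" using x by simp
      have xm: "x \<oplus>\<^bsub>P 0\<^esub> ?m = \<zero>\<^bsub>P 0\<^esub>" using x P0.smult_l_minus[of \<one> x] by (simp add: P0.M.r_neg)
      have "e (\<tau> 0 x \<oplus>\<^bsub>P 0\<^esub> ?m) = e (x \<oplus>\<^bsub>P 0\<^esub> ?m)"
        using module_homD(2)[OF P(4) tx m] module_homD(2)[OF P(4) x m] \<tau>e[OF x] by simp
      then have "\<tau> 0 x \<oplus>\<^bsub>P 0\<^esub> ?m \<in> res_cycles M P d e 0" using xm e0 tx m by (simp add: res_cycles_def)
      then obtain y where y: "\<tau> 0 x \<oplus>\<^bsub>P 0\<^esub> ?m = d 0 y" "y \<in> carrier (P (Suc 0))"
        unfolding P(6)[symmetric] by (rule imageE)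
      have "x \<oplus>\<^bsub>P 0\<^esub> d 0 y = \<tau> 0 x \<oplus>\<^bsub>P 0\<^esub> (x \<oplus>\<^bsub>P 0\<^esub> ?m)"
        unfolding y(1)[symmetric] using tx x m by (simp add: P0.a_lcomm)
      then show ?thesis using y(2) x xm tx by auto
    qed
    ultimately obtain s where "s \<in> module_hom R (P 0) (P (Suc 0))" "\<forall>x\<in>carrier (P 0). (x, s x) \<in> ?T"
      using projective_selection[OF P(1) P(2), of 0 "Suc 0" ?T] by blast
    then show "\<exists>s. OK 0 s" by (intro exI[of _ s]) (auto simp: OK_def res_cycles_def)
  next
    fix s n assume "OK n s"
    then have s: "s \<in> module_hom R (P n) (P (Suc n))"
      "\<And>z. z \<in> res_cycles M P d e n \<Longrightarrow> \<tau> n z = z \<oplus>\<^bsub>P n\<^esub> d n (s z)"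
      unfolding OK_def by blast+
    interpret P0: module R "P n" by (rule P(2))
    interpret P1: module R "P (Suc n)" by (rule P(2))
    interpret P2: module R "P (Suc (Suc n))" by (rule P(2))
    let ?T = "{(x, y). x \<in> carrier (P (Suc n)) \<and> y \<in> carrier (P (Suc (Suc n))) \<and>
      \<tau> (Suc n) x = x \<oplus>\<^bsub>P (Suc n)\<^esub> d (Suc n) y \<oplus>\<^bsub>P (Suc n)\<^esub> s (d n x)}"
    have "linear_relation R (P (Suc n)) (P (Suc (Suc n))) ?T"
      unfolding linear_relation_def
      using module_homD[OF P(3)[of n]] module_homD[OF P(3)[of "Suc n"]] module_homD(2,3)[OF \<tau>[of "Suc n"]]
        module_homD[OF s(1)]
      by (auto simp: P1.smult_r_distr P1.a_ac)
    moreover have "\<exists>y. (x, y) \<in> ?T" if x: "x \<in> carrier (P (Suc n))" for x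
    proof -
      have tx: "\<tau> (Suc n) x \<in> carrier (P (Suc n))" using module_homD(1)[OF \<tau> x] .
      have dx: "d n x \<in> carrier (P n)" using module_homD(1)[OF P(3) x] .
      have sdx: "s (d n x) \<in> carrier (P (Suc n))" using module_homD(1)[OF s(1) dx] .
      let ?w = "x \<oplus>\<^bsub>P (Suc n)\<^esub> s (d n x)"
      let ?m = "\<ominus> \<one> \<odot>\<^bsub>P (Suc n)\<^esub> ?w"
      have w: "?w \<in> carrier (P (Suc n))" using x sdx by simp
      have m: "?m \<in> carrier (P (Suc n))" using w by simp
      have wm: "?w \<oplus>\<^bsub>P (Suc n)\<^esub> ?m = \<zero>\<^bsub>P (Suc n)\<^esub>"
        using w P1.smult_l_minus[of \<one> ?w] by (simp add: P1.M.r_neg)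
      have "d n x \<in> res_cycles M P d e n" unfolding P(6)[symmetric] using x by (rule imageI)
      then have "d n (\<tau> (Suc n) x) = d n ?w"
        using s(2) \<tau>d[OF x] module_homD(2)[OF P(3) x sdx] by simp
      then have "d n (\<tau> (Suc n) x \<oplus>\<^bsub>P (Suc n)\<^esub> ?m) = d n (?w \<oplus>\<^bsub>P (Suc n)\<^esub> ?m)"
        using module_homD(2)[OF P(3) tx m] module_homD(2)[OF P(3) w m] by simp
      then have "\<tau> (Suc n) x \<oplus>\<^bsub>P (Suc n)\<^esub> ?m \<in> res_cycles M P d e (Suc n)"
        using wm tx m module_hom_zero[OF P(2) P(2) P(3)] by (simp add: res_cycles_def)
      then obtain y where y: "\<tau> (Suc n) x \<oplus>\<^bsub>P (Suc n)\<^esub> ?m = d (Suc n) y" "y \<in> carrier (P (Suc (Suc n)))"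
        unfolding P(6)[symmetric] by (rule imageE)
      have dy: "d (Suc n) y \<in> carrier (P (Suc n))" using module_homD(1)[OF P(3) y(2)] .
      have "x \<oplus>\<^bsub>P (Suc n)\<^esub> d (Suc n) y \<oplus>\<^bsub>P (Suc n)\<^esub> s (d n x) = d (Suc n) y \<oplus>\<^bsub>P (Suc n)\<^esub> ?w"
        using x sdx dy by (simp add: P1.a_ac)
      also have "\<dots> = \<tau> (Suc n) x \<oplus>\<^bsub>P (Suc n)\<^esub> (?w \<oplus>\<^bsub>P (Suc n)\<^esub> ?m)"
        unfolding y(1)[symmetric] using tx w m by (simp only: P1.M.a_ac P1.M.a_closed)
      also have "\<dots> = \<tau> (Suc n) x" unfolding wm using tx by simp
      finally show ?thesis using y(2) x by auto
    qed
    ultimately obtain s' where s': "s' \<in> module_hom R (P (Suc n)) (P (Suc (Suc n)))"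
      "\<forall>x\<in>carrier (P (Suc n)). (x, s' x) \<in> ?T"
      using projective_selection[OF P(1) P(2), of "Suc n" "Suc (Suc n)" ?T] by blast
    have "\<tau> (Suc n) z = z \<oplus>\<^bsub>P (Suc n)\<^esub> d (Suc n) (s' z)" if "z \<in> res_cycles M P d e (Suc n)" for z
    proof -
      have z: "z \<in> carrier (P (Suc n))" "d n z = \<zero>\<^bsub>P n\<^esub>" using that by (auto simp: res_cycles_def)
      have "s' z \<in> carrier (P (Suc (Suc n)))" using module_homD(1)[OF s'(1) z(1)] .
      then have "d (Suc n) (s' z) \<in> carrier (P (Suc n))" using module_homD(1)[OF P(3)] by blast
      moreover have "\<tau> (Suc n) z = z \<oplus>\<^bsub>P (Suc n)\<^esub> d (Suc n) (s' z) \<oplus>\<^bsub>P (Suc n)\<^esub> s (d n z)"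
        using s'(2) z(1) by auto
      ultimately show ?thesis using z module_hom_zero[OF P(2) P(2) s(1)] by simp
    qed
    then show "\<exists>s'. OK (Suc n) s' \<and> (\<forall>x\<in>carrier (P (Suc n)).
        \<tau> (Suc n) x = x \<oplus>\<^bsub>P (Suc n)\<^esub> d (Suc n) (s' x) \<oplus>\<^bsub>P (Suc n)\<^esub> s (d n x))"
      using s' by (intro exI[of _ s']) (auto simp: OK_def)
  qed
  then obtain s where "\<And>n. OK n (s n)" "\<And>n x. x \<in> carrier (P (Suc n)) \<Longrightarrow>
      \<tau> (Suc n) x = x \<oplus>\<^bsub>P (Suc n)\<^esub> d (Suc n) (s (Suc n) x) \<oplus>\<^bsub>P (Suc n)\<^esub> s n (d n x)"
    by blast
  then show thesis by (intro that[of s]) (auto simp: OK_def)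
qed

lemma comparison_homotopy:
  assumes P: "projective_resolution R M P d e" and Q: "projective_resolution R M Q d' e'"
  obtains \<alpha> \<beta> s where
    "\<And>i. \<alpha> i \<in> module_hom R (P i) (Q i)"
    "\<And>i x. x \<in> carrier (P (Suc i)) \<Longrightarrow> d' i (\<alpha> (Suc i) x) = \<alpha> i (d i x)"
    "\<And>i. \<beta> i \<in> module_hom R (Q i) (P i)"
    "\<And>i x. x \<in> carrier (Q (Suc i)) \<Longrightarrow> d i (\<beta> (Suc i) x) = \<beta> i (d' i x)"
    "\<And>i. s i \<in> module_hom R (P i) (P (Suc i))"
    "\<And>i x. x \<in> carrier (P (Suc i)) \<Longrightarrow> \<beta> (Suc i) (\<alpha> (Suc i) x) =
      x \<oplus>\<^bsub>P (Suc i)\<^esub> d (Suc i) (s (Suc i) x) \<oplus>\<^bsub>P (Suc i)\<^esub> s i (d i x)"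
proof -
  obtain \<alpha> where \<alpha>: "\<And>i. \<alpha> i \<in> module_hom R (P i) (Q i)"
    "\<And>x. x \<in> carrier (P 0) \<Longrightarrow> e' (\<alpha> 0 x) = e x"
    "\<And>i x. x \<in> carrier (P (Suc i)) \<Longrightarrow> d' i (\<alpha> (Suc i) x) = \<alpha> i (d i x)"
    using comparison_map[OF P Q] by blast
  obtain \<beta> where \<beta>: "\<And>i. \<beta> i \<in> module_hom R (Q i) (P i)"
    "\<And>x. x \<in> carrier (Q 0) \<Longrightarrow> e (\<beta> 0 x) = e' x"
    "\<And>i x. x \<in> carrier (Q (Suc i)) \<Longrightarrow> d i (\<beta> (Suc i) x) = \<beta> i (d' i x)"
    using comparison_map[OF Q P] by blast
  let ?\<tau> = "\<lambda>i x. \<beta> i (\<alpha> i x)"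
  have \<tau>1: "?\<tau> i \<in> module_hom R (P i) (P i)" for i
    by (rule module_hom_compose[OF \<alpha>(1) \<beta>(1)])
  have \<tau>2: "e (?\<tau> 0 x) = e x" if "x \<in> carrier (P 0)" for x
    using \<beta>(2)[OF module_homD(1)[OF \<alpha>(1) that]] \<alpha>(2)[OF that] by simp
  have \<tau>3: "d i (?\<tau> (Suc i) x) = ?\<tau> i (d i x)" if "x \<in> carrier (P (Suc i))" for i x
    using \<beta>(3)[OF module_homD(1)[OF \<alpha>(1) that]] \<alpha>(3)[OF that] by simp
  obtain s where s: "\<And>i. s i \<in> module_hom R (P i) (P (Suc i))"
    "\<And>i x. x \<in> carrier (P (Suc i)) \<Longrightarrow>
      ?\<tau> (Suc i) x = x \<oplus>\<^bsub>P (Suc i)\<^esub> d (Suc i) (s (Suc i) x) \<oplus>\<^bsub>P (Suc i)\<^esub> s i (d i x)"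
    using homotopy_to_identity[OF P, of ?\<tau>, OF \<tau>1 \<tau>2 \<tau>3] by blast
  show thesis by (rule that[OF \<alpha>(1,3) \<beta>(1,3) s])
qed

end


section \<open>Minimal free resolutions over a Noetherian local ring\<close>

context cring begin

lemma free_submoduleI:
  assumes "N \<subseteq> carrier (free_module R B)" "(\<lambda>_. \<zero>) \<in> N"
    and "\<And>x y. x \<in> N \<Longrightarrow> y \<in> N \<Longrightarrow> (\<lambda>b. x b \<oplus> y b) \<in> N"
    and sm: "\<And>r x. r \<in> carrier R \<Longrightarrow> x \<in> N \<Longrightarrow> (\<lambda>b. r \<otimes> x b) \<in> N"
  shows "submodule N R (free_module R B)"
proof -
  interpret F: module R "free_module R B" by (rule free_module_module)
  show ?thesis
  proof (rule F.submoduleI)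
    fix x assume x: "x \<in> N"
    then have "x \<in> carrier (free_module R B)" using assms(1) by blast
    then have "\<ominus>\<^bsub>free_module R B\<^esub> x = \<ominus> \<one> \<odot>\<^bsub>free_module R B\<^esub> x"
      using F.smult_l_minus[of \<one> x] F.smult_one by (simp del: free_module_simps)
    then show "\<ominus>\<^bsub>free_module R B\<^esub> x \<in> N" using sm[of "\<ominus> \<one>" x] x by simp
  qed (use assms in auto)
qed

lemma free_submoduleD:
  assumes N: "submodule N R (free_module R B)"
  shows "N \<subseteq> carrier (free_module R B)" "(\<lambda>_. \<zero>) \<in> N"
    "x \<in> N \<Longrightarrow> y \<in> N \<Longrightarrow> (\<lambda>b. x b \<oplus> y b) \<in> N"
    "r \<in> carrier R \<Longrightarrow> x \<in> N \<Longrightarrow> (\<lambda>b. r \<otimes> x b) \<in> N"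
    "x \<in> N \<Longrightarrow> y \<in> N \<Longrightarrow> (\<lambda>b. x b \<ominus> y b) \<in> N"
    "x \<in> N \<Longrightarrow> x b \<in> carrier R"
proof -
  interpret F: module R "free_module R B" by (rule free_module_module)
  note E = F.submoduleE[OF N]
  show sub: "N \<subseteq> carrier (free_module R B)" by (rule E)
  show car: "x \<in> N \<Longrightarrow> x b \<in> carrier R" for x b using sub by (auto simp: free_carrier)
  show add: "x \<in> N \<Longrightarrow> y \<in> N \<Longrightarrow> (\<lambda>b. x b \<oplus> y b) \<in> N" for x y using E(5)[of x y] by simp
  show sm: "r \<in> carrier R \<Longrightarrow> x \<in> N \<Longrightarrow> (\<lambda>b. r \<otimes> x b) \<in> N" for r x using E(4)[of r x] by simp
  obtain z where z: "z \<in> N" using E(2) by blast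
  show "(\<lambda>_. \<zero>) \<in> N" using sm[OF zero_closed z] car[OF z] by simp
  show "(\<lambda>b. x b \<ominus> y b) \<in> N" if "x \<in> N" "y \<in> N"
  proof -
    have "(\<lambda>b. x b \<ominus> y b) = (\<lambda>b. x b \<oplus> \<ominus> \<one> \<otimes> y b)" using car[OF that(2)] by (simp add: l_minus minus_eq)
    then show ?thesis using add[OF that(1) sm[of "\<ominus> \<one>" y]] that(2) by simp
  qed
qed

lemma coordinate_ideal:
  assumes N: "submodule N R (free_module R B)"
  shows "ideal ((\<lambda>v. v k) ` N) R"
proof -
  note D = free_submoduleD[OF N]
  show ?thesis
  proof (rule idealI)
    show "subgroup ((\<lambda>v. v k) ` N) (add_monoid R)"
    proof (rule add.subgroupI)
      show "(\<lambda>v. v k) ` N \<subseteq> carrier R" using D(6) by blast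
      show "(\<lambda>v. v k) ` N \<noteq> {}" using D(2) by blast
      fix a assume "a \<in> (\<lambda>v. v k) ` N"
      then obtain x where x: "x \<in> N" "a = x k" by blast
      show "\<ominus> a \<in> (\<lambda>v. v k) ` N"
        by (rule image_eqI[OF _ D(4)[of "\<ominus> \<one>" x]]) (use x D(6)[OF x(1)] in \<open>auto simp: l_minus\<close>)
      fix b assume "b \<in> (\<lambda>v. v k) ` N"
      then obtain y where y: "y \<in> N" "b = y k" by blast
      show "a \<oplus> b \<in> (\<lambda>v. v k) ` N"
        by (rule image_eqI[OF _ D(3)[OF x(1) y(1)]]) (use x y in simp)
    qed
    fix a r assume "a \<in> (\<lambda>v. v k) ` N" and r: "r \<in> carrier R"
    then obtain x where x: "x \<in> N" "a = x k" by blast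
    show ra: "r \<otimes> a \<in> (\<lambda>v. v k) ` N" by (rule image_eqI[OF _ D(4)[OF r x(1)]]) (use x in simp)
    then show "a \<otimes> r \<in> (\<lambda>v. v k) ` N" using m_comm[of r a] r x D(6)[OF x(1)] by simp
  qed (rule ring_axioms)
qed

lemma submodule_Int:
  assumes "submodule N R (free_module R B)" "submodule H R (free_module R B)"
  shows "submodule (H \<inter> N) R (free_module R B)"
proof -
  note D = free_submoduleD[OF assms(1)] and E = free_submoduleD[OF assms(2)]
  show ?thesis
  proof (rule free_submoduleI)
    show "H \<inter> N \<subseteq> carrier (free_module R B)" using D(1) by blast
  qed (use D(2-4) E(2-4) in simp_all)
qed

lemma kernel_submodule:
  assumes h: "h \<in> module_hom R (free_module R B) (free_module R C)"
  shows "submodule {x \<in> carrier (free_module R B). h x = (\<lambda>_. \<zero>)} R (free_module R B)"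
proof -
  interpret F: module R "free_module R B" by (rule free_module_module)
  show ?thesis
  proof (rule free_submoduleI)
    show "(\<lambda>_. \<zero>) \<in> {x \<in> carrier (free_module R B). h x = (\<lambda>_. \<zero>)}"
      using module_hom_zero[OF free_module_module free_module_module h] F.zero_closed by simp
    show "(\<lambda>b. x b \<oplus> y b) \<in> {x \<in> carrier (free_module R B). h x = (\<lambda>_. \<zero>)}"
      if "x \<in> {x \<in> carrier (free_module R B). h x = (\<lambda>_. \<zero>)}" "y \<in> {x \<in> carrier (free_module R B). h x = (\<lambda>_. \<zero>)}" for x y
      using that module_homD(2)[OF h, of x y] F.add.m_closed[of x y] by simp
    show "(\<lambda>b. r \<otimes> x b) \<in> {x \<in> carrier (free_module R B). h x = (\<lambda>_. \<zero>)}"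
      if "r \<in> carrier R" "x \<in> {x \<in> carrier (free_module R B). h x = (\<lambda>_. \<zero>)}" for r x
      using that module_homD(3)[OF h, of r x] F.smult_closed[of r x] by simp
  qed auto
qed

lemma image_submodule:
  assumes h: "h \<in> module_hom R (free_module R B) (free_module R C)"
  shows "submodule (h ` carrier (free_module R B)) R (free_module R C)"
proof -
  interpret F: module R "free_module R B" by (rule free_module_module)
  show ?thesis
  proof (rule free_submoduleI)
    show "h ` carrier (free_module R B) \<subseteq> carrier (free_module R C)"
      using module_homD(1)[OF h] by (rule image_subsetI)
    show "(\<lambda>_. \<zero>) \<in> h ` carrier (free_module R B)"
      using module_hom_zero[OF free_module_module free_module_module h] F.zero_closed
      by (intro image_eqI[of _ _ "\<zero>\<^bsub>free_module R B\<^esub>"]) auto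
    fix x assume "x \<in> h ` carrier (free_module R B)"
    then obtain v where v: "x = h v" "v \<in> carrier (free_module R B)" by (rule imageE)
    show "(\<lambda>b. r \<otimes> x b) \<in> h ` carrier (free_module R B)" if r: "r \<in> carrier R" for r
      by (rule image_eqI[OF _ F.smult_closed[OF r v(2)]]) (use module_homD(3)[OF h r v(2)] v(1) in simp)
    fix y assume "y \<in> h ` carrier (free_module R B)"
    then obtain w where w: "y = h w" "w \<in> carrier (free_module R B)" by (rule imageE)
    show "(\<lambda>b. x b \<oplus> y b) \<in> h ` carrier (free_module R B)"
      by (rule image_eqI[OF _ F.add.m_closed[OF v(2) w(2)]]) (use module_homD(2)[OF h v(2) w(2)] v(1) w(1) in simp)
  qed
qed

end

context noetherian_cring begin

text \<open>Induction on the number of coordinates: the values of the last coordinate form a finitely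
  generated ideal, and vectors on which it vanishes have fewer coordinates. Spanning is expressed
  by the submodules that contain the generators.\<close>
lemma submodule_finite_span:
  assumes "submodule N R (vec R K)" "\<And>v i. v \<in> N \<Longrightarrow> k \<le> i \<Longrightarrow> v i = \<zero>"
  shows "\<exists>S. finite S \<and> S \<subseteq> N \<and> (\<forall>H. submodule H R (vec R K) \<longrightarrow> S \<subseteq> H \<longrightarrow> N \<subseteq> H)"
  using assms
proof (induction k arbitrary: N)
  case 0
  have "v = (\<lambda>_. \<zero>)" if "v \<in> N" for v using 0(2)[OF that] by auto
  then have "N \<subseteq> H" if "submodule H R (vec R K)" for H using free_submoduleD(2)[OF that] by blast
  then show ?case by (intro exI[of _ "{}"]) auto
next
  case (Suc k)
  note D = free_submoduleD[OF Suc.prems(1)]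
  obtain A where A: "A \<subseteq> carrier R" "finite A" "(\<lambda>v. v k) ` N = Idl A"
    using finetely_gen[OF coordinate_ideal[OF Suc.prems(1), of k]] by blast
  have "A \<subseteq> (\<lambda>v. v k) ` N" using genideal_self[OF A(1)] A(3) by simp
  then obtain S1 where S1: "S1 \<subseteq> N" "finite S1" "A = (\<lambda>v. v k) ` S1"
    using finite_subset_image[OF A(2)] by blast
  let ?N0 = "{v \<in> N. v k = \<zero>}"
  have "submodule ?N0 R (vec R K)" by (rule free_submoduleI) (use D in auto)
  moreover have "v i = \<zero>" if "v \<in> ?N0" "k \<le> i" for v i
    using that Suc.prems(2)[of v i] by (cases "i = k") auto
  ultimately obtain S0 where S0: "finite S0" "S0 \<subseteq> ?N0"
    "\<And>H. submodule H R (vec R K) \<Longrightarrow> S0 \<subseteq> H \<Longrightarrow> ?N0 \<subseteq> H"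
    using Suc.IH[of ?N0] by meson
  have "N \<subseteq> H" if H: "submodule H R (vec R K)" "S0 \<union> S1 \<subseteq> H" for H
  proof
    fix v assume v: "v \<in> N"
    have "ideal ((\<lambda>v. v k) ` (H \<inter> N)) R" by (rule coordinate_ideal[OF submodule_Int[OF Suc.prems(1) H(1)]])
    moreover have "A \<subseteq> (\<lambda>v. v k) ` (H \<inter> N)" using S1 H(2) by blast
    ultimately have "Idl A \<subseteq> (\<lambda>v. v k) ` (H \<inter> N)" by (rule genideal_minimal)
    moreover have "v k \<in> Idl A" using v A(3) by blast
    ultimately obtain x where x: "x \<in> H" "x \<in> N" "v k = x k" by blast
    have "(\<lambda>b. v b \<ominus> x b) \<in> ?N0" using D(5)[OF v x(2)] x(3) D(6)[OF x(2)] by (simp add: minus_eq r_neg)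
    then have "(\<lambda>b. v b \<ominus> x b) \<in> H" using S0(3)[OF H(1)] H(2) by blast
    from free_submoduleD(3)[OF H(1) this x(1)] have "(\<lambda>b. v b \<ominus> x b \<oplus> x b) \<in> H" .
    moreover have "(\<lambda>b. v b \<ominus> x b \<oplus> x b) = v"
      using D(6)[OF v] D(6)[OF x(2)] by (simp add: minus_eq a_assoc l_neg)
    ultimately show "v \<in> H" by simp
  qed
  then show ?case using S0(1,2) S1(1,2) by (intro exI[of _ "S0 \<union> S1"]) auto
qed

lemma submodule_is_image:
  assumes N: "submodule N R (vec R K)"
  shows "\<exists>q h. h \<in> module_hom R (vec R q) (vec R K) \<and> h ` carrier (vec R q) = N"
proof -
  note D = free_submoduleD[OF N]
  have "v i = \<zero>" if "v \<in> N" "K \<le> i" for v i using D(1) that by (auto simp: vec_carrier)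
  then have "\<exists>S. finite S \<and> S \<subseteq> N \<and> (\<forall>H. submodule H R (vec R K) \<longrightarrow> S \<subseteq> H \<longrightarrow> N \<subseteq> H)"
    by (rule submodule_finite_span[OF N])
  then obtain S where S: "finite S" "S \<subseteq> N"
    "\<forall>H. submodule H R (vec R K) \<longrightarrow> S \<subseteq> H \<longrightarrow> N \<subseteq> H" by blast
  define q where "q = card S"
  obtain y where y: "bij_betw y {0..<q} S" using ex_bij_betw_nat_finite[OF S(1)] unfolding q_def by blast
  then have yS: "y ` {..<q} = S" by (simp add: bij_betw_def atLeast0LessThan)
  have yN: "y j \<in> N" if "j \<in> {..<q}" for j using that yS S(2) by blast
  have yc: "y j \<in> carrier (vec R K)" if "j \<in> {..<q}" for j using yN[OF that] D(1) by blast
  from free_module_extend[OF free_module_module yc] obtain h where h: "h \<in> module_hom R (vec R q) (vec R K)"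
    and hy: "\<forall>b\<in>{..<q}. h (unit_vec b) = y b" ..
  interpret F: module R "vec R q" by (rule free_module_module)
  have "h x \<in> N" if "x \<in> carrier (vec R q)" for x
    using that
  proof (induction x rule: free_module_induct)
    case zero
    then show ?case using module_hom_zero[OF free_module_module free_module_module h] D(2) by simp
  next
    case (add x a b)
    have e: "unit_vec b \<in> carrier (vec R q)" using add by simp
    have "h (x \<oplus>\<^bsub>vec R q\<^esub> (a \<odot>\<^bsub>vec R q\<^esub> unit_vec b)) = h x \<oplus>\<^bsub>vec R K\<^esub> (a \<odot>\<^bsub>vec R K\<^esub> y b)"
      using module_homD[OF h] add hy e F.smult_closed[OF _ e] by (simp del: free_module_simps)
    then show ?case using D(3)[OF add.IH D(4)[OF add(2) yN[OF add(3)]]] by simp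
  qed
  then have "h ` carrier (vec R q) \<subseteq> N" by (rule image_subsetI)
  moreover have "N \<subseteq> h ` carrier (vec R q)"
  proof -
    have "S \<subseteq> h ` carrier (vec R q)"
    proof
      fix s assume "s \<in> S"
      then obtain j where j: "j \<in> {..<q}" "s = y j" using yS by blast
      show "s \<in> h ` carrier (vec R q)"
        by (rule image_eqI[OF _ unit_vec_free[OF j(1)]]) (use hy j in simp)
    qed
    then show ?thesis using S(3) image_submodule[OF h] by blast
  qed
  ultimately show ?thesis using h by blast
qed

end

context noetherian_local begin

text \<open>With the least number of generators, a relation with a unit coefficient would allow
  one generator to be dropped.\<close>
lemma minimal_cover:
  assumes N: "submodule N R (vec R K)"
  shows "\<exists>q h. h \<in> module_hom R (vec R q) (vec R K) \<and> h ` carrier (vec R q) = N \<and>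
    (\<forall>x\<in>carrier (vec R q). h x = (\<lambda>_. \<zero>) \<longrightarrow> (\<forall>l. x l \<in> \<mm>))"
proof -
  define C where "C = (\<lambda>q. \<exists>h. h \<in> module_hom R (vec R q) (vec R K) \<and> h ` carrier (vec R q) = N)"
  define q where "q = (LEAST q. C q)"
  have "\<exists>q. C q" using submodule_is_image[OF N] unfolding C_def .
  then have "C q" unfolding q_def by (rule LeastI_ex)
  then obtain h where h: "h \<in> module_hom R (vec R q) (vec R K)" "h ` carrier (vec R q) = N"
    unfolding C_def by blast
  interpret F: module R "vec R q" by (rule free_module_module)
  have "x l \<in> \<mm>" if x: "x \<in> carrier (vec R q)" "h x = (\<lambda>_. \<zero>)" for x l
  proof (rule ccontr)
    assume xl: "x l \<notin> \<mm>"
    have xc: "x b \<in> carrier R" for b using x(1) by (simp add: vec_carrier)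
    have "x l \<noteq> \<zero>" using xl mm.zero_closed by auto
    then have lq: "l < q" using x(1) by (auto simp: vec_carrier not_le[symmetric])
    then obtain q' where q': "q = Suc q'" by (cases q) auto
    have "x l \<in> Units R" using Units_iff[OF xc] xl by simp
    then obtain u where u: "u \<in> carrier R" "u \<otimes> x l = \<one>" by (auto simp: Units_def)
    define skip where "skip = (\<lambda>(w :: nat \<Rightarrow> 'a) i. if i < l then w i else if i = l then \<zero> else w (i - 1))"
    have skip: "skip \<in> module_hom R (vec R q') (vec R q)"
      by (rule module_homI) (use lq q' in \<open>auto simp: vec_carrier skip_def fun_eq_iff\<close>)
    have "(\<lambda>w. h (skip w)) ` carrier (vec R q') = N"
    proof
      show "(\<lambda>w. h (skip w)) ` carrier (vec R q') \<subseteq> N"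
        using module_homD(1)[OF skip] h(2) by blast
      show "N \<subseteq> (\<lambda>w. h (skip w)) ` carrier (vec R q')"
      proof
        fix y assume "y \<in> N"
        then obtain v where v: "y = h v" "v \<in> carrier (vec R q)" using h(2) by blast
        have vc: "v b \<in> carrier R" for b using v(2) by (simp add: vec_carrier)
        let ?c = "\<ominus> (v l \<otimes> u)"
        let ?v = "v \<oplus>\<^bsub>vec R q\<^esub> (?c \<odot>\<^bsub>vec R q\<^esub> x)"
        have c: "?c \<in> carrier R" using vc u by simp
        have cx: "?c \<odot>\<^bsub>vec R q\<^esub> x \<in> carrier (vec R q)" by (rule F.smult_closed[OF c x(1)])
        have v': "?v \<in> carrier (vec R q)" by (rule F.add.m_closed[OF v(2) cx])
        have hv: "h ?v = h v"
        proof -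
          have "h ?v = h v \<oplus>\<^bsub>vec R K\<^esub> (?c \<odot>\<^bsub>vec R K\<^esub> h x)"
            by (simp only: module_homD(2)[OF h(1) v(2) cx] module_homD(3)[OF h(1) c x(1)])
          also have "\<dots> = h v"
            using module_homD(1)[OF h(1) v(2)] c unfolding x(2) by (simp add: vec_carrier)
          finally show ?thesis .
        qed
        have "?c \<otimes> x l = \<ominus> v l" using vc u xc by (simp add: l_minus m_assoc)
        then have vl: "?v l = \<zero>" using vc by (simp add: r_neg)
        define w where "w = (\<lambda>i. if i < l then ?v i else ?v (Suc i))"
        have "w \<in> carrier (vec R q')" using v' q' lq by (auto simp: w_def vec_carrier)
        moreover have "skip w = ?v"
        proof
          fix i show "skip w i = ?v i"
            using vl by (cases "i < l"; cases "i = l") (auto simp: skip_def w_def)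
        qed
        ultimately show "y \<in> (\<lambda>w. h (skip w)) ` carrier (vec R q')"
          using hv v(1) by (intro image_eqI[of _ _ w]) simp_all
      qed
    qed
    then have "C q'" unfolding C_def using module_hom_compose[OF skip h(1)] by blast
    then have "q \<le> q'" unfolding q_def by (rule Least_le)
    then show False using q' by simp
  qed
  then show ?thesis using h by blast
qed

end

context cring begin

lemma quotient_ring_module:
  assumes I: "ideal I R"
  defines "Q \<equiv> quotient_module (ring_module R) I"
  shows "carrier Q = {I +> a | a. a \<in> carrier R}" "\<zero>\<^bsub>Q\<^esub> = I"
    "a \<in> carrier R \<Longrightarrow> b \<in> carrier R \<Longrightarrow> (I +> a) \<oplus>\<^bsub>Q\<^esub> (I +> b) = I +> (a \<oplus> b)"
    "r \<in> carrier R \<Longrightarrow> a \<in> carrier R \<Longrightarrow> r \<odot>\<^bsub>Q\<^esub> (I +> a) = I +> (r \<otimes> a)"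
    "a \<in> carrier R \<Longrightarrow> I +> a = I \<longleftrightarrow> a \<in> I"
proof -
  interpret I: ideal I R by fact
  have cos: "a_r_coset (ring_module R) I x = I +> x" for x
    by (simp add: a_r_coset_def r_coset_def ring_module_def)
  show "carrier Q = {I +> a | a. a \<in> carrier R}"
    by (auto simp: Q_def quotient_module_def A_RCOSETS_def RCOSETS_def ring_module_def a_r_coset_def r_coset_def)
  show "\<zero>\<^bsub>Q\<^esub> = I" by (simp add: Q_def quotient_module_def)
  have "set_add (ring_module R) = set_add R"
    by (auto simp: set_add_def set_mult_def ring_module_def fun_eq_iff)
  then show "(I +> a) \<oplus>\<^bsub>Q\<^esub> (I +> b) = I +> (a \<oplus> b)" if "a \<in> carrier R" "b \<in> carrier R"
    using I.a_rcos_sum[OF that] by (simp add: Q_def quotient_module_def)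
  show mem: "I +> a = I \<longleftrightarrow> a \<in> I" if "a \<in> carrier R" for a
    using I.rcos_const_imp_mem[OF that] I.a_rcos_const by blast
  show "r \<odot>\<^bsub>Q\<^esub> (I +> a) = I +> (r \<otimes> a)" if r: "r \<in> carrier R" and a: "a \<in> carrier R"
  proof -
    have e: "r \<odot>\<^bsub>Q\<^esub> (I +> a) = (\<Union>x\<in>I +> a. I +> (r \<otimes> x))"
      by (simp add: Q_def quotient_module_def cos)
    have "I +> (r \<otimes> x) = I +> (r \<otimes> a)" if "x \<in> I +> a" for x
    proof -
      from that obtain i where i: "i \<in> I" "x = i \<oplus> a" by (auto simp: a_r_coset_def r_coset_def)
      have "r \<otimes> x \<ominus> r \<otimes> a = r \<otimes> i"
        using i I.Icarr r a by (simp add: r_distr minus_eq a_assoc r_neg)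
      then show ?thesis
        using quotient_eq_iff_same_a_r_cos[OF I, of "r \<otimes> x" "r \<otimes> a"] i I.Icarr r a I.I_l_closed by simp
    qed
    moreover have "I +> a \<noteq> {}" using I.a_rcos_self[OF a] by blast
    ultimately show ?thesis unfolding e by simp
  qed
qed

end

text \<open>Minimality is imposed on the kernels, in degree 0 on the relations between the generators \<open>f\<close>;
  the entries of the maps from \<open>\<delta> 1\<close> on lie in \<open>\<mm>\<close> by exactness.\<close>
definition min_free_resolution ::
    "('a, 'm) ring_scheme \<Rightarrow> 'a set \<Rightarrow> 'a set \<Rightarrow> nat \<Rightarrow> (nat \<Rightarrow> 'a) \<Rightarrow> (nat \<Rightarrow> nat) \<Rightarrow>
      (nat \<Rightarrow> (nat \<Rightarrow> 'a) \<Rightarrow> nat \<Rightarrow> 'a) \<Rightarrow> bool"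
  where "min_free_resolution R \<mm> I n f r \<delta> \<longleftrightarrow> r 0 = 1 \<and> r 1 = n \<and>
    (\<forall>x\<in>carrier (vec R n). \<delta> 0 x 0 = (\<Oplus>\<^bsub>R\<^esub>j\<in>{..<n}. f j \<otimes>\<^bsub>R\<^esub> x j)) \<and>
    projective_resolution R (quotient_module (ring_module R) I) (\<lambda>i. vec R (r i)) \<delta>
      (\<lambda>v. I +>\<^bsub>R\<^esub> v 0) \<and>
    (\<forall>i. \<forall>x\<in>carrier (vec R (r (Suc i))). \<delta> i x = (\<lambda>_. \<zero>\<^bsub>R\<^esub>) \<longrightarrow> (\<forall>l. x l \<in> \<mm>))"

lemma (in noetherian_local) min_free_resolution_exists:
  fixes f :: "nat \<Rightarrow> 'a"
  assumes f: "\<And>j. f j \<in> carrier R" and I: "I = Idl (f ` {..<n})"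
    and min: "\<And>c. (\<And>j. c j \<in> carrier R) \<Longrightarrow> (\<Oplus>j\<in>{..<n}. f j \<otimes> c j) = \<zero> \<Longrightarrow> (\<forall>l<n. c l \<in> \<mm>)"
  shows "\<exists>r \<delta>. min_free_resolution R \<mm> I n f r \<delta>"
proof -
  have idI: "ideal I R" unfolding I by (rule genideal_ideal) (use f in auto)
  interpret I: ideal I R by (rule idI)
  note Q = quotient_ring_module[OF idI]
  define \<delta>0 where "\<delta>0 = (\<lambda>(x :: nat \<Rightarrow> 'a) (i :: nat). if i = 0 then (\<Oplus>j\<in>{..<n}. f j \<otimes> x j) else \<zero>)"
  have dot: "(\<lambda>x. \<Oplus>j\<in>{..<n}. f j \<otimes> x j) \<in> module_hom R (vec R n) (ring_module R)"
    by (rule dot_functional[OF f])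
  have \<delta>0: "\<delta>0 \<in> module_hom R (vec R n) (vec R 1)"
  proof (rule module_homI)
    fix x assume x: "x \<in> carrier (vec R n)"
    show "\<delta>0 x \<in> carrier (vec R 1)" using module_homD(1)[OF dot x] by (auto simp: vec_carrier \<delta>0_def)
    show "\<delta>0 (r \<odot>\<^bsub>vec R n\<^esub> x) = r \<odot>\<^bsub>vec R 1\<^esub> \<delta>0 x" if "r \<in> carrier R" for r
      using module_homD(3)[OF dot that x] that by (auto simp: \<delta>0_def fun_eq_iff)
    fix y assume y: "y \<in> carrier (vec R n)"
    show "\<delta>0 (x \<oplus>\<^bsub>vec R n\<^esub> y) = \<delta>0 x \<oplus>\<^bsub>vec R 1\<^esub> \<delta>0 y"
      using module_homD(2)[OF dot x y] by (auto simp: \<delta>0_def fun_eq_iff)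
  qed
  have min0: "\<forall>x\<in>carrier (vec R n). \<delta>0 x = (\<lambda>_. \<zero>) \<longrightarrow> (\<forall>l. x l \<in> \<mm>)"
  proof (intro ballI impI allI)
    fix x l assume x: "x \<in> carrier (vec R n)" and 0: "\<delta>0 x = (\<lambda>_. \<zero>)"
    from fun_cong[OF 0, of 0] have "(\<Oplus>j\<in>{..<n}. f j \<otimes> x j) = \<zero>" by (simp add: \<delta>0_def)
    then have "\<forall>l<n. x l \<in> \<mm>" using x by (intro min) (auto simp: vec_carrier)
    then show "x l \<in> \<mm>" using x mm.zero_closed by (cases "l < n") (auto simp: vec_carrier)
  qed
  have im0: "\<delta>0 ` carrier (vec R n) = {x \<in> carrier (vec R 1). I +> x 0 = I}"
  proof
    have "(\<Oplus>j\<in>{..<n}. f j \<otimes> c j) \<in> I" if c: "\<And>j. c j \<in> carrier R" for c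
    proof -
      have "(\<Oplus>j\<in>{..<n}. f j \<otimes> c j) = (\<Oplus>j\<in>{..<n}. c j \<otimes> f j)"
        by (rule finsum_cong') (use c f in \<open>auto simp: m_comm\<close>)
      then show ?thesis unfolding I genideal_image_eq[of f n, OF f] using c by blast
    qed
    then have "I +> \<delta>0 x 0 = I" if "x \<in> carrier (vec R n)" for x
      using that Q(5)[of "\<delta>0 x 0"] I.Icarr by (simp add: \<delta>0_def vec_carrier)
    then show "\<delta>0 ` carrier (vec R n) \<subseteq> {x \<in> carrier (vec R 1). I +> x 0 = I}"
      using module_homD(1)[OF \<delta>0] by blast
    show "{x \<in> carrier (vec R 1). I +> x 0 = I} \<subseteq> \<delta>0 ` carrier (vec R n)"
    proof
      fix x assume "x \<in> {x \<in> carrier (vec R 1). I +> x 0 = I}"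
      then have x: "x \<in> carrier (vec R 1)" "x 0 \<in> I" using Q(5) by (auto simp: vec_carrier)
      then obtain c where c: "x 0 = (\<Oplus>j\<in>{..<n}. c j \<otimes> f j)" "\<forall>j. c j \<in> carrier R"
        unfolding I genideal_image_eq[of f n, OF f] by blast
      let ?c = "\<lambda>j. if j < n then c j else \<zero>"
      have "(\<Oplus>j\<in>{..<n}. f j \<otimes> ?c j) = x 0"
        unfolding c(1) by (rule finsum_cong') (use c f in \<open>auto simp: m_comm\<close>)
      then have "\<delta>0 ?c = x" using x(1) by (auto simp: \<delta>0_def fun_eq_iff vec_carrier)
      moreover have "?c \<in> carrier (vec R n)" using c by (auto simp: vec_carrier)
      ultimately show "x \<in> \<delta>0 ` carrier (vec R n)" by blast
    qed
  qed
  \<comment> \<open>A state of the recursion consists of the two ranks and the map between them.\<close>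
  define OK where "OK = (\<lambda>i (a, b, h). h \<in> module_hom R (vec R b) (vec R a) \<and>
    (\<forall>x\<in>carrier (vec R b). h x = (\<lambda>_. \<zero>) \<longrightarrow> (\<forall>l. x l \<in> \<mm>)) \<and> (i = (0::nat) \<longrightarrow> a = 1 \<and> b = n \<and> h = \<delta>0))"
  define ST where "ST = (\<lambda>(a :: nat, b, h :: (nat \<Rightarrow> 'a) \<Rightarrow> nat \<Rightarrow> 'a) (a', b', h' :: (nat \<Rightarrow> 'a) \<Rightarrow> nat \<Rightarrow> 'a). a' = b \<and>
    h' ` carrier (vec R b') = {x \<in> carrier (vec R b). h x = (\<lambda>_. \<zero>)})"
  have "\<exists>s. \<forall>i. OK i (s i) \<and> ST (s i) (s (Suc i))"
  proof (rule dependent_nat_choice)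
    show "\<exists>x. OK 0 x" using \<delta>0 min0 by (intro exI[of _ "(1, n, \<delta>0)"]) (simp add: OK_def)
    fix x i assume x: "OK i x"
    obtain a b h where abh: "x = (a, b, h)" by (cases x)
    then have h: "h \<in> module_hom R (vec R b) (vec R a)" using x by (simp add: OK_def)
    obtain q h' where "h' \<in> module_hom R (vec R q) (vec R b)"
      "h' ` carrier (vec R q) = {x \<in> carrier (vec R b). h x = (\<lambda>_. \<zero>)}"
      "\<forall>x\<in>carrier (vec R q). h' x = (\<lambda>_. \<zero>) \<longrightarrow> (\<forall>l. x l \<in> \<mm>)"
      using minimal_cover[OF kernel_submodule[OF h]] by blast
    then show "\<exists>y. OK (Suc i) y \<and> ST x y"
      by (intro exI[of _ "(b, q, h')"]) (simp add: OK_def ST_def abh)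
  qed
  then obtain s where s: "\<And>i. OK i (s i)" "\<And>i. ST (s i) (s (Suc i))" by blast
  define r where "r = (\<lambda>i. fst (s i))"
  define \<delta> where "\<delta> = (\<lambda>i. snd (snd (s i)))"
  have r1: "fst (snd (s i)) = r (Suc i)" for i
    using s(2)[of i] by (simp add: ST_def r_def case_prod_beta)
  have hom: "\<delta> i \<in> module_hom R (vec R (r (Suc i))) (vec R (r i))"
    and mini: "\<forall>x\<in>carrier (vec R (r (Suc i))). \<delta> i x = (\<lambda>_. \<zero>) \<longrightarrow> (\<forall>l. x l \<in> \<mm>)" for i
    using s(1)[of i] r1[of i] by (simp_all add: OK_def case_prod_beta r_def \<delta>_def)
  have ex: "\<delta> (Suc i) ` carrier (vec R (r (Suc (Suc i)))) = {x \<in> carrier (vec R (r (Suc i))). \<delta> i x = (\<lambda>_. \<zero>)}" for i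
    using s(2)[of i] r1[of i] r1[of "Suc i"] by (simp add: ST_def case_prod_beta r_def \<delta>_def)
  have z: "r 0 = 1" "r (Suc 0) = n" "\<delta> 0 = \<delta>0"
    using s(1)[of 0] r1[of 0] by (simp_all add: OK_def case_prod_beta r_def \<delta>_def)
  have "(\<lambda>v. I +> v 0) \<in> module_hom R (vec R 1) (quotient_module (ring_module R) I)"
    by (rule module_homI) (use Q in \<open>auto simp: vec_carrier\<close>)
  moreover have "(\<lambda>v. I +> v 0) ` carrier (vec R 1) = carrier (quotient_module (ring_module R) I)"
  proof -
    have "\<exists>v\<in>carrier (vec R 1). v 0 = a" if "a \<in> carrier R" for a
      by (rule bexI[of _ "\<lambda>i. if i = 0 then a else \<zero>"]) (use that in \<open>auto simp: vec_carrier\<close>)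
    moreover have "v 0 \<in> carrier R" if "v \<in> carrier (vec R 1)" for v using that by (simp add: vec_carrier)
    ultimately show ?thesis unfolding Q(1) by (auto simp: image_iff)
  qed
  moreover have "\<delta> 0 ` carrier (vec R (r (Suc 0))) = {x \<in> carrier (vec R (r 0)). I +> x 0 = \<zero>\<^bsub>quotient_module (ring_module R) I\<^esub>}"
    using im0 by (simp only: z Q(2))
  ultimately have "projective_resolution R (quotient_module (ring_module R) I) (\<lambda>i. vec R (r i)) \<delta> (\<lambda>v. I +> v 0)"
    unfolding projective_resolution_def using vec_projective hom ex by (simp add: z)
  then have "min_free_resolution R \<mm> I n f r \<delta>"
    unfolding min_free_resolution_def using mini z by (simp add: \<delta>0_def)
  then show ?thesis by blast
qed


section \<open>Consequences of projective dimension and Ext\<close>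

context cring begin

lemma module_hom_lincomb:
  assumes "f \<in> module_hom R M (ring_module R)" "g \<in> module_hom R M (ring_module R)" "a \<in> carrier R"
  shows "(\<lambda>x. f x \<oplus> a \<otimes> g x) \<in> module_hom R M (ring_module R)"
  by (rule module_homI)
    (use module_homD[OF assms(1)] module_homD[OF assms(2)] assms(3) in \<open>auto simp: r_distr m_lcomm a_ac\<close>)

lemma module_hom_const_zero: "(\<lambda>x. \<zero>) \<in> module_hom R M (ring_module R)"
  by (rule module_homI) auto

lemma module_hom_cong:
  assumes "module R M" "f \<in> module_hom R M N" "\<And>x. x \<in> carrier M \<Longrightarrow> g x = f x"
  shows "g \<in> module_hom R M N"
proof -
  interpret M: module R M by fact
  show ?thesis by (rule module_homI) (use module_homD[OF assms(2)] assms(3) in auto)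
qed

text \<open>A cocycle whose class corresponds to the class of 1 in \<open>R/I\<close> generates the cohomology, and
  \<open>I\<close> annihilates it. The elements of the cohomology are cosets of restricted functions; the two
  conclusions are free of them.\<close>
lemma cohomology_iso_quotient:
  fixes P :: "nat \<Rightarrow> ('a, 'p) module" and d :: "nat \<Rightarrow> 'p \<Rightarrow> 'p"
  assumes I: "ideal I R" and P: "\<And>i. module R (P i)" and d: "\<And>i. d i \<in> module_hom R (P (Suc i)) (P i)"
    and iso: "module_iso R (cohomology_module (\<lambda>j. Hom_module R (P j) (ring_module R))
      (\<lambda>j f. compose (carrier (P (Suc j))) f (d j)) (Suc k)) (quotient_module (ring_module R) I)"
  defines "Z \<equiv> {c \<in> module_hom R (P (Suc k)) (ring_module R). \<forall>x\<in>carrier (P (Suc (Suc k))). c (d (Suc k) x) = \<zero>}"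
  shows "\<exists>\<gamma>\<in>Z. \<forall>c\<in>Z. \<exists>\<rho>\<in>carrier R. \<exists>w\<in>module_hom R (P k) (ring_module R).
      \<forall>x\<in>carrier (P (Suc k)). c x = \<rho> \<otimes> \<gamma> x \<oplus> w (d k x)"
    and "\<forall>c\<in>Z. \<forall>a\<in>I. \<exists>w\<in>module_hom R (P k) (ring_module R).
      \<forall>x\<in>carrier (P (Suc k)). a \<otimes> c x = w (d k x)"
proof -
  interpret I: ideal I R by (rule I)
  interpret Pg: module R "P (Suc k)" by (rule P)
  let ?c = "carrier (P (Suc k))"
  let ?Hom = "\<lambda>j. module_hom R (P j) (ring_module R)"
  define Zx where "Zx = {x \<in> carrier (Hom_module R (P (Suc k)) (ring_module R)).
    compose (carrier (P (Suc (Suc k)))) x (d (Suc k)) = \<zero>\<^bsub>Hom_module R (P (Suc (Suc k))) (ring_module R)\<^esub>}"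
  define B where "B = (\<lambda>f. compose ?c f (d k)) ` carrier (Hom_module R (P k) (ring_module R))"
  define C where "C = (Hom_module R (P (Suc k)) (ring_module R))\<lparr>carrier := Zx\<rparr>"
  define E where "E = quotient_module C B"
  define Q where "Q = quotient_module (ring_module R) I"
  note Qf = quotient_ring_module[OF I, folded Q_def]
  define K where "K = (\<lambda>x. {(\<lambda>p\<in>?c. b p \<oplus> x p) | b. b \<in> B})"
  define sm where "sm = (\<lambda>r x. \<lambda>p\<in>?c. r \<otimes> x p)"
  have E_eq: "cohomology_module (\<lambda>j. Hom_module R (P j) (ring_module R))
      (\<lambda>j f. compose (carrier (P (Suc j))) f (d j)) (Suc k) = E"
    by (simp add: cohomology_module_def E_def C_def B_def Zx_def coboundaries_def)
  have Zx: "x \<in> Zx \<longleftrightarrow> x \<in> Z \<and> x \<in> extensional ?c" for x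
  proof -
    have "compose (carrier (P (Suc (Suc k)))) x (d (Suc k)) = (\<lambda>x\<in>carrier (P (Suc (Suc k))). \<zero>)
      \<longleftrightarrow> (\<forall>p\<in>carrier (P (Suc (Suc k))). x (d (Suc k) p) = \<zero>)"
      by (auto simp: compose_def fun_eq_iff restrict_def)
    then show ?thesis unfolding Zx_def Z_def by (auto simp: Hom_module_def)
  qed
  have cos: "a_r_coset C B x = K x" for x
    unfolding K_def a_r_coset_def r_coset_def C_def Hom_module_def by auto
  have Ec: "carrier E = K ` Zx"
    unfolding E_def quotient_module_def A_RCOSETS_def RCOSETS_def
    using cos by (auto simp: a_r_coset_def C_def)
  have Es: "r \<odot>\<^bsub>E\<^esub> A = (\<Union>x\<in>A. K (sm r x))" for r A
    unfolding E_def quotient_module_def by (simp add: cos) (simp add: C_def Hom_module_def sm_def)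
  have dc: "d k p \<in> carrier (P k)" if "p \<in> ?c" for p using module_homD(1)[OF d that] .
  have BI: "restrict (\<lambda>p. w (d k p)) ?c \<in> B" if w: "w \<in> ?Hom k" for w
  proof -
    interpret Pk: module R "P k" by (rule P)
    have "restrict w (carrier (P k)) \<in> ?Hom k" by (rule module_hom_cong[OF P w]) simp
    then have "restrict w (carrier (P k)) \<in> carrier (Hom_module R (P k) (ring_module R))"
      by (simp add: Hom_module_def)
    moreover have "restrict (\<lambda>p. w (d k p)) ?c = compose ?c (restrict w (carrier (P k))) (d k)"
      using dc by (auto simp: compose_def fun_eq_iff restrict_def)
    ultimately show ?thesis unfolding B_def by blast
  qed
  have BE: "\<exists>w\<in>?Hom k. b = restrict (\<lambda>p. w (d k p)) ?c" if "b \<in> B" for b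
    using that unfolding B_def by (auto simp: Hom_module_def compose_def)
  have Zc: "x p \<in> carrier R" if "x \<in> Zx" "p \<in> ?c" for x p
    using that Zx[of x] module_homD(1)[of x R "P (Suc k)" "ring_module R" p] by (simp add: Z_def)
  have KE: "\<exists>w\<in>?Hom k. \<forall>p\<in>?c. y p = w (d k p) \<oplus> x p" if y: "y \<in> K x" for x y
  proof -
    from y obtain b where b: "b \<in> B" "y = (\<lambda>p\<in>?c. b p \<oplus> x p)" unfolding K_def by blast
    from BE[OF b(1)] obtain w where "w \<in> ?Hom k" "b = restrict (\<lambda>p. w (d k p)) ?c" by blast
    then show ?thesis using b(2) by auto
  qed
  have KI: "y \<in> K x" if "w \<in> ?Hom k" "\<And>p. p \<in> ?c \<Longrightarrow> y p = w (d k p) \<oplus> x p" "y \<in> extensional ?c" for x y w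
  proof -
    have "y = (\<lambda>p\<in>?c. restrict (\<lambda>p. w (d k p)) ?c p \<oplus> x p)"
      using that(2,3) by (auto simp: fun_eq_iff restrict_def extensional_def)
    then show ?thesis unfolding K_def using BI[OF that(1)] by blast
  qed
  have Kself: "x \<in> K x" if "x \<in> Zx" for x
    by (rule KI[OF module_hom_const_zero]) (use that Zc Zx in auto)
  have smZ: "sm r x \<in> Zx" if r: "r \<in> carrier R" and x: "x \<in> Zx" for r x
  proof -
    have h: "x \<in> ?Hom (Suc k)" "\<And>p. p \<in> carrier (P (Suc (Suc k))) \<Longrightarrow> x (d (Suc k) p) = \<zero>"
      using x Zx[of x] by (auto simp: Z_def)
    have "(\<lambda>p. \<zero> \<oplus> r \<otimes> x p) \<in> ?Hom (Suc k)" by (rule module_hom_lincomb[OF module_hom_const_zero h(1) r])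
    then have "sm r x \<in> ?Hom (Suc k)"
      by (rule module_hom_cong[OF P]) (use r Zc[OF x] in \<open>simp add: sm_def\<close>)
    moreover have "sm r x (d (Suc k) p) = \<zero>" if "p \<in> carrier (P (Suc (Suc k)))" for p
      using h(2)[OF that] r module_homD(1)[OF d that] by (simp add: sm_def)
    ultimately show ?thesis unfolding Zx Z_def by (simp add: sm_def)
  qed
  have Ksm: "r \<odot>\<^bsub>E\<^esub> K x = K (sm r x)" if r: "r \<in> carrier R" and x: "x \<in> Zx" for r x
  proof -
    have "K (sm r y) = K (sm r x)" if y: "y \<in> K x" for y
    proof -
      obtain w where w: "w \<in> ?Hom k" "\<And>p. p \<in> ?c \<Longrightarrow> y p = w (d k p) \<oplus> x p" using KE[OF y] by blast
      have wc: "w (d k p) \<in> carrier R" if "p \<in> ?c" for p using module_homD(1)[OF w(1) dc[OF that]] by simp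
      have ext: "z \<in> extensional ?c" if "z \<in> K u" for z u using that unfolding K_def by auto
      have sub: "K u \<subseteq> K v" if uv: "\<And>p. p \<in> ?c \<Longrightarrow> u p = a \<otimes> w (d k p) \<oplus> v p" and a: "a \<in> carrier R"
        and v: "\<And>p. p \<in> ?c \<Longrightarrow> v p \<in> carrier R" for u v a
      proof
        fix z assume z: "z \<in> K u"
        obtain w' where w': "w' \<in> ?Hom k" "\<And>p. p \<in> ?c \<Longrightarrow> z p = w' (d k p) \<oplus> u p" using KE[OF z] by blast
        have w'c: "w' (d k p) \<in> carrier R" if "p \<in> ?c" for p using module_homD(1)[OF w'(1) dc[OF that]] by simp
        show "z \<in> K v"
          by (rule KI[OF module_hom_lincomb[OF w'(1) w(1) a]])
            (use w'(2) uv ext[OF z] a wc w'c v in \<open>auto simp: a_assoc\<close>)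
      qed
      have e1: "sm r y p = r \<otimes> w (d k p) \<oplus> sm r x p" if "p \<in> ?c" for p
        using that w(2)[OF that] wc[OF that] Zc[OF x that] r by (simp add: sm_def r_distr)
      have e2: "sm r x p = \<ominus> r \<otimes> w (d k p) \<oplus> sm r y p" if "p \<in> ?c" for p
        using that e1[OF that] wc[OF that] Zc[OF x that] r
        by (simp add: sm_def l_minus a_assoc[symmetric] l_neg)
      have c1: "sm r x p \<in> carrier R" "sm r y p \<in> carrier R" if "p \<in> ?c" for p
        using that e1[OF that] wc[OF that] Zc[OF x that] r by (simp_all add: sm_def)
      show ?thesis
        using sub[OF e1 r c1(1)] sub[OF e2 _ c1(2)] r by blast
    qed
    then show ?thesis unfolding Es using Kself[OF x] by blast
  qed
  obtain \<theta> where \<theta>: "\<theta> \<in> module_hom R E Q" "bij_betw \<theta> (carrier E) (carrier Q)"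
    using iso unfolding module_iso_def E_eq Q_def by blast
  have inj: "x = y" if "x \<in> carrier E" "y \<in> carrier E" "\<theta> x = \<theta> y" for x y
    using \<theta>(2) that by (auto simp: bij_betw_def inj_on_def)
  have \<theta>K: "\<exists>\<rho>\<in>carrier R. \<theta> (K x) = I +> \<rho>" if "x \<in> Zx" for x
  proof -
    have "\<theta> (K x) \<in> carrier Q" by (rule module_homD(1)[OF \<theta>(1)]) (use that Ec in blast)
    then show ?thesis using Qf(1) by auto
  qed
  have \<theta>sm: "\<theta> (K (sm r x)) = I +> (r \<otimes> \<rho>)" if "x \<in> Zx" "r \<in> carrier R" "\<rho> \<in> carrier R" "\<theta> (K x) = I +> \<rho>" for x r \<rho>
    using module_homD(3)[OF \<theta>(1) that(2), of "K x"] that Ec Ksm Qf(4) by auto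
  have KEin: "K x \<in> carrier E" if "x \<in> Zx" for x using Ec that by blast
  have Zrestrict: "restrict c ?c \<in> Zx" if "c \<in> Z" for c
  proof -
    have "restrict c ?c \<in> ?Hom (Suc k)" by (rule module_hom_cong[OF P]) (use that in \<open>auto simp: Z_def\<close>)
    then show ?thesis using that module_homD(1)[OF d] by (auto simp: Zx Z_def)
  qed
  have "I +> \<one> \<in> \<theta> ` carrier E" using \<theta>(2) Qf(1) by (auto simp: bij_betw_def)
  then obtain \<gamma> where \<gamma>: "\<gamma> \<in> Zx" "\<theta> (K \<gamma>) = I +> \<one>" unfolding Ec by auto
  show "\<exists>\<gamma>\<in>Z. \<forall>c\<in>Z. \<exists>\<rho>\<in>carrier R. \<exists>w\<in>?Hom k. \<forall>x\<in>?c. c x = \<rho> \<otimes> \<gamma> x \<oplus> w (d k x)"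
  proof (rule bexI[of _ \<gamma>], rule ballI)
    fix c assume c: "c \<in> Z"
    let ?r = "restrict c ?c"
    have r: "?r \<in> Zx" by (rule Zrestrict[OF c])
    obtain \<rho> where \<rho>: "\<rho> \<in> carrier R" "\<theta> (K ?r) = I +> \<rho>" using \<theta>K[OF r] by blast
    have "\<theta> (K ?r) = \<theta> (K (sm \<rho> \<gamma>))" using \<theta>sm[OF \<gamma>(1) \<rho>(1) one_closed \<gamma>(2)] \<rho> by simp
    then have "K ?r = K (sm \<rho> \<gamma>)" by (rule inj[OF KEin[OF r] KEin[OF smZ[OF \<rho>(1) \<gamma>(1)]]])
    then have "?r \<in> K (sm \<rho> \<gamma>)" using Kself[OF r] by simp
    then obtain w where w: "w \<in> ?Hom k" "\<And>p. p \<in> ?c \<Longrightarrow> ?r p = w (d k p) \<oplus> sm \<rho> \<gamma> p" using KE by blast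
    have "c p = \<rho> \<otimes> \<gamma> p \<oplus> w (d k p)" if p: "p \<in> ?c" for p
      using w(2)[OF p] p Zc[OF \<gamma>(1) p] \<rho>(1) module_homD(1)[OF w(1) dc[OF p]] by (simp add: sm_def a_comm)
    then show "\<exists>\<rho>\<in>carrier R. \<exists>w\<in>?Hom k. \<forall>x\<in>?c. c x = \<rho> \<otimes> \<gamma> x \<oplus> w (d k x)"
      using \<rho>(1) w(1) by blast
  qed (use \<gamma>(1) Zx in blast)
  show "\<forall>c\<in>Z. \<forall>a\<in>I. \<exists>w\<in>?Hom k. \<forall>x\<in>?c. a \<otimes> c x = w (d k x)"
  proof (intro ballI)
    fix c a assume c: "c \<in> Z" and a: "a \<in> I"
    have ac: "a \<in> carrier R" using I.Icarr[OF a] .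
    let ?r = "restrict c ?c"
    have r: "?r \<in> Zx" by (rule Zrestrict[OF c])
    obtain \<rho> where \<rho>: "\<rho> \<in> carrier R" "\<theta> (K ?r) = I +> \<rho>" using \<theta>K[OF r] by blast
    have "a \<otimes> \<rho> \<in> I" using a \<rho>(1) I.I_r_closed by simp
    then have "\<theta> (K (sm a ?r)) = \<theta> (K (sm \<zero> ?r))"
      using \<theta>sm[OF r ac \<rho>] \<theta>sm[OF r zero_closed \<rho>] Qf(5)[of "a \<otimes> \<rho>"] Qf(5)[of \<zero>] \<rho>(1) ac by simp
    then have "K (sm a ?r) = K (sm \<zero> ?r)" by (rule inj[OF KEin[OF smZ[OF ac r]] KEin[OF smZ[OF zero_closed r]]])
    then have "sm a ?r \<in> K (sm \<zero> ?r)" using Kself[OF smZ[OF ac r]] by simp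
    then obtain w where w: "w \<in> ?Hom k" "\<And>p. p \<in> ?c \<Longrightarrow> sm a ?r p = w (d k p) \<oplus> sm \<zero> ?r p" using KE by blast
    have "a \<otimes> c p = w (d k p)" if p: "p \<in> ?c" for p
      using w(2)[OF p] p Zc[OF r p] module_homD(1)[OF w(1) dc[OF p]] by (simp add: sm_def)
    then show "\<exists>w\<in>?Hom k. \<forall>x\<in>?c. a \<otimes> c x = w (d k x)" using w(1) by blast
  qed
qed

end

context noetherian_local begin

text \<open>On \<open>v\<close> the composite of the comparison maps to and from the short resolution vanishes, and so
  does \<open>s (\<delta> v)\<close> in the homotopy formula. This leaves \<open>v + p v = 0\<close> with
  \<open>p = \<delta> s\<close>, whose values have coordinates in \<open>\<mm>\<close>, so \<open>1 + p\<close> is invertible.\<close>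
lemma minimal_resolution_injective:
  assumes F: "projective_resolution R M (\<lambda>i. vec R (r i)) \<delta> \<epsilon>"
    and min: "\<And>i x l. x \<in> carrier (vec R (r (Suc i))) \<Longrightarrow> \<delta> i x = (\<lambda>_. \<zero>) \<Longrightarrow> x l \<in> \<mm>"
    and P: "projective_resolution R M P d e" and short: "\<And>i. i > Suc k \<Longrightarrow> carrier (P i) = {\<zero>\<^bsub>P i\<^esub>}"
    and v: "v \<in> carrier (vec R (r (Suc k)))" "\<delta> k v = (\<lambda>_. \<zero>)"
  shows "v = (\<lambda>_. \<zero>)"
proof -
  note FD = resolutionD[OF F] and PD = resolutionD[OF P]
  let ?F = "\<lambda>i. carrier (vec R (r i))"
  obtain \<alpha> \<beta> s where \<alpha>: "\<And>i. \<alpha> i \<in> module_hom R (vec R (r i)) (P i)"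
      "\<And>i x. x \<in> ?F (Suc i) \<Longrightarrow> d i (\<alpha> (Suc i) x) = \<alpha> i (\<delta> i x)"
    and \<beta>: "\<And>i. \<beta> i \<in> module_hom R (P i) (vec R (r i))"
      "\<And>i x. x \<in> carrier (P (Suc i)) \<Longrightarrow> \<delta> i (\<beta> (Suc i) x) = \<beta> i (d i x)"
    and s: "\<And>i. s i \<in> module_hom R (vec R (r i)) (vec R (r (Suc i)))"
      "\<And>i x. x \<in> ?F (Suc i) \<Longrightarrow> \<beta> (Suc i) (\<alpha> (Suc i) x) =
        x \<oplus>\<^bsub>vec R (r (Suc i))\<^esub> \<delta> (Suc i) (s (Suc i) x) \<oplus>\<^bsub>vec R (r (Suc i))\<^esub> s i (\<delta> i x)"
    by (rule comparison_homotopy[OF F P]) (rule that, assumption+)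
  let ?n = "r (Suc k)"
  define p where "p = (\<lambda>x. \<delta> (Suc k) (s (Suc k) x))"
  have p: "p \<in> module_hom R (vec R ?n) (vec R ?n)"
    unfolding p_def by (rule module_hom_compose[OF s(1) FD(3)])
  have pm: "p x l \<in> \<mm>" if "x \<in> ?F (Suc k)" for x l
  proof -
    have "p x \<in> \<delta> (Suc k) ` ?F (Suc (Suc k))"
      unfolding p_def by (rule imageI) (rule module_homD(1)[OF s(1) that])
    then have "p x \<in> res_cycles M (\<lambda>i. vec R (r i)) \<delta> \<epsilon> (Suc k)" unfolding FD(6) .
    then show ?thesis using min[of "p x" k] by (simp add: res_cycles_def)
  qed
  have "\<alpha> (Suc k) v = \<zero>\<^bsub>P (Suc k)\<^esub>"
  proof -
    have "d k (\<alpha> (Suc k) v) = \<alpha> k \<zero>\<^bsub>vec R (r k)\<^esub>" using \<alpha>(2)[OF v(1)] v(2) by simp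
    also have "\<dots> = \<zero>\<^bsub>P k\<^esub>" by (rule module_hom_zero[OF FD(2) PD(2) \<alpha>(1)])
    finally have "\<alpha> (Suc k) v \<in> res_cycles M P d e (Suc k)"
      using module_homD(1)[OF \<alpha>(1) v(1)] by (simp add: res_cycles_def)
    then have "\<alpha> (Suc k) v \<in> d (Suc k) ` {\<zero>\<^bsub>P (Suc (Suc k))\<^esub>}"
      unfolding PD(6)[symmetric] using short[of "Suc (Suc k)"] by simp
    then show ?thesis using module_hom_zero[OF PD(2) PD(2) PD(3)] by simp
  qed
  then have "\<beta> (Suc k) (\<alpha> (Suc k) v) = (\<lambda>_. \<zero>)" using module_hom_zero[OF PD(2) FD(2) \<beta>(1)] by simp
  moreover have "s k (\<lambda>_. \<zero>) = (\<lambda>_. \<zero>)" using module_hom_zero[OF FD(2) FD(2) s(1)] by simp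
  moreover have vc: "v l \<in> carrier R" for l using v(1) by (simp add: vec_carrier)
  moreover have "p v l \<in> carrier R" for l using pm[OF v(1)] mm.Icarr by simp
  ultimately have vp: "v l \<oplus> p v l = \<zero>" for l
    using s(2)[OF v(1)] v(2) by (simp add: p_def fun_eq_iff)
  define L where "L = (\<lambda>j l. if j < ?n then unit_vec j l \<oplus> p (unit_vec j) l else \<zero>)"
  have pe: "p (unit_vec j) l \<in> \<mm>" if "j < ?n" for j l using pm[of "unit_vec j" l] that by simp
  have L: "L j l \<in> carrier R" for j l using pe mm.Icarr by (simp add: L_def)
  have unit: "Det ?n L \<in> Units R"
  proof (rule Det_one_mod_mm[OF L])
    show "L i i \<ominus> \<one> \<in> \<mm>" if "i < ?n" for i
    proof -
      have "L i i \<ominus> \<one> = p (unit_vec i) i"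
      proof -
        have "(\<one> \<oplus> x) \<ominus> \<one> = x" if "x \<in> carrier R" for x using that by algebra
        then show ?thesis using that mm.Icarr[OF pe[OF that, of i]] by (simp add: L_def unit_vec_def)
      qed
      then show ?thesis using pe[OF that] by simp
    qed
    show "L i j \<in> \<mm>" if "i < ?n" "j < ?n" "i \<noteq> j" for i j
      using that pe[OF that(1), of j] mm.Icarr[OF pe[OF that(1), of j]] by (simp add: L_def unit_vec_def)
  qed
  have "v i = \<zero>" for i
  proof (cases "i < ?n")
    case True
    have "v i \<otimes> Det ?n L = \<zero>"
    proof (rule Det_row_relation[where h = v])
      fix l assume l: "l < ?n"
      have "(\<Oplus>j\<in>{..<?n}. v j \<otimes> L j l) = (\<Oplus>j\<in>{..<?n}. v j \<otimes> unit_vec j l \<oplus> v j \<otimes> p (unit_vec j) l)"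
        by (rule finsum_cong') (use vc pe mm.Icarr in \<open>auto simp: L_def r_distr\<close>)
      also have "\<dots> = (\<Oplus>j\<in>{..<?n}. v j \<otimes> unit_vec j l) \<oplus> (\<Oplus>j\<in>{..<?n}. v j \<otimes> p (unit_vec j) l)"
        by (rule finsum_addf) (use vc pe mm.Icarr in auto)
      also have "(\<Oplus>j\<in>{..<?n}. v j \<otimes> unit_vec j l) = v l"
        by (rule finsum_delta) (use l vc in auto)
      also have "(\<Oplus>j\<in>{..<?n}. v j \<otimes> p (unit_vec j) l) = p v l"
        by (rule linear_functional_vec[OF coordinate_functional[OF p] v(1), symmetric])
      finally show "(\<Oplus>j\<in>{..<?n}. v j \<otimes> L j l) = \<zero>" using vp by simp
    qed (use L vc True in auto)
    moreover obtain u where u: "u \<in> carrier R" "Det ?n L \<otimes> u = \<one>" using unit by (auto simp: Units_def)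
    moreover have "v i \<otimes> Det ?n L \<otimes> u = v i \<otimes> (Det ?n L \<otimes> u)"
      by (rule m_assoc) (use vc L u in auto)
    ultimately show ?thesis using vc by simp
  next
    case False
    then show ?thesis using v(1) by (simp add: vec_carrier)
  qed
  then show ?thesis by auto
qed

text \<open>The coordinates of \<open>\<beta>\<close> are cocycles of the other resolution, because \<open>\<delta> k\<close> is injective. Pulled
  back along \<open>\<alpha>\<close> they become the coordinates themselves, up to the homotopy, which on the
  last free module is a function of \<open>\<delta> k x\<close>.\<close>
lemma minimal_resolution_ext:
  assumes F: "projective_resolution R (quotient_module (ring_module R) I) (\<lambda>i. vec R (r i)) \<delta> \<epsilon>"
    and I: "ideal I R"
    and P: "projective_resolution R (quotient_module (ring_module R) I) P d e"
    and inj: "\<And>v. v \<in> carrier (vec R (r (Suc k))) \<Longrightarrow> \<delta> k v = (\<lambda>_. \<zero>) \<Longrightarrow> v = (\<lambda>_. \<zero>)"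
    and iso: "module_iso R (cohomology_module (\<lambda>j. Hom_module R (P j) (ring_module R))
      (\<lambda>j f. compose (carrier (P (Suc j))) f (d j)) (Suc k)) (quotient_module (ring_module R) I)"
  shows "\<exists>c\<in>module_hom R (vec R (r (Suc k))) (ring_module R). \<forall>l. \<exists>\<rho>\<in>carrier R.
      \<exists>w\<in>module_hom R (vec R (r k)) (ring_module R).
      \<forall>x\<in>carrier (vec R (r (Suc k))). x l = \<rho> \<otimes> c x \<oplus> w (\<delta> k x)"
    and "\<forall>a\<in>I. \<forall>l. \<exists>w\<in>module_hom R (vec R (r k)) (ring_module R).
      \<forall>x\<in>carrier (vec R (r (Suc k))). a \<otimes> x l = w (\<delta> k x)"
proof -
  let ?M = "quotient_module (ring_module R) I"
  note FD = resolutionD[OF F] and PD = resolutionD[OF P]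
  let ?F = "\<lambda>i. carrier (vec R (r i))"
  obtain \<alpha> \<beta> s where \<alpha>: "\<And>i. \<alpha> i \<in> module_hom R (vec R (r i)) (P i)"
      "\<And>i x. x \<in> ?F (Suc i) \<Longrightarrow> d i (\<alpha> (Suc i) x) = \<alpha> i (\<delta> i x)"
    and \<beta>: "\<And>i. \<beta> i \<in> module_hom R (P i) (vec R (r i))"
      "\<And>i x. x \<in> carrier (P (Suc i)) \<Longrightarrow> \<delta> i (\<beta> (Suc i) x) = \<beta> i (d i x)"
    and s: "\<And>i. s i \<in> module_hom R (vec R (r i)) (vec R (r (Suc i)))"
      "\<And>i x. x \<in> ?F (Suc i) \<Longrightarrow> \<beta> (Suc i) (\<alpha> (Suc i) x) =
        x \<oplus>\<^bsub>vec R (r (Suc i))\<^esub> \<delta> (Suc i) (s (Suc i) x) \<oplus>\<^bsub>vec R (r (Suc i))\<^esub> s i (\<delta> i x)"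
    by (rule comparison_homotopy[OF F P]) (rule that, assumption+)
  have \<tau>eq: "\<beta> (Suc k) (\<alpha> (Suc k) x) l = x l \<oplus> s k (\<delta> k x) l" if x: "x \<in> ?F (Suc k)" for x l
  proof -
    have "\<delta> (Suc k) (s (Suc k) x) \<in> \<delta> (Suc k) ` ?F (Suc (Suc k))"
      by (rule imageI) (rule module_homD(1)[OF s(1) x])
    then have "\<delta> (Suc k) (s (Suc k) x) \<in> res_cycles ?M (\<lambda>i. vec R (r i)) \<delta> \<epsilon> (Suc k)" unfolding FD(6) .
    then have "\<delta> (Suc k) (s (Suc k) x) = (\<lambda>_. \<zero>)" using inj by (simp add: res_cycles_def)
    then show ?thesis using s(2)[OF x] x by (simp add: vec_carrier)
  qed
  define Z where "Z = {c \<in> module_hom R (P (Suc k)) (ring_module R). \<forall>x\<in>carrier (P (Suc (Suc k))). c (d (Suc k) x) = \<zero>}"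
  have cocycle: "(\<lambda>p. \<beta> (Suc k) p l) \<in> Z" for l
  proof -
    have "\<beta> (Suc k) (d (Suc k) x) l = \<zero>" if x: "x \<in> carrier (P (Suc (Suc k)))" for x
    proof -
      have dx: "d (Suc k) x \<in> carrier (P (Suc k))" by (rule module_homD(1)[OF PD(3) x])
      have "d (Suc k) x \<in> d (Suc k) ` carrier (P (Suc (Suc k)))" using x by (rule imageI)
      then have "d (Suc k) x \<in> res_cycles ?M P d e (Suc k)" unfolding PD(6) .
      then have "d k (d (Suc k) x) = \<zero>\<^bsub>P k\<^esub>" by (simp add: res_cycles_def)
      then have "\<delta> k (\<beta> (Suc k) (d (Suc k) x)) = (\<lambda>_. \<zero>)"
        using \<beta>(2)[OF dx] module_hom_zero[OF PD(2) FD(2) \<beta>(1)] by simp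
      then show ?thesis using inj[OF module_homD(1)[OF \<beta>(1) dx]] by simp
    qed
    then show ?thesis using coordinate_functional[OF \<beta>(1)] by (simp add: Z_def)
  qed
  note ext = cohomology_iso_quotient[OF I PD(2) PD(3) iso, folded Z_def]
  have y: "\<delta> k x \<in> ?F k" if "x \<in> ?F (Suc k)" for x using module_homD(1)[OF FD(3) that] .
  have sc: "s k y l \<in> carrier R" if "y \<in> ?F k" for y l
    using module_homD(1)[OF coordinate_functional[OF s(1)] that] by simp
  have hom: "(\<lambda>y. w (\<alpha> k y) \<oplus> \<ominus> a \<otimes> s k y l) \<in> module_hom R (vec R (r k)) (ring_module R)"
    if "w \<in> module_hom R (P k) (ring_module R)" "a \<in> carrier R" for w a l
    by (rule module_hom_lincomb[OF module_hom_compose[OF \<alpha>(1) that(1)] coordinate_functional[OF s(1)]]) (use that in simp)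
  have wc: "w (\<alpha> k y) \<in> carrier R" if "w \<in> module_hom R (P k) (ring_module R)" "y \<in> ?F k" for w y
    using module_homD(1)[OF module_hom_compose[OF \<alpha>(1) that(1)] that(2)] by simp
  from ext(1) obtain \<gamma> where \<gamma>: "\<gamma> \<in> Z" "\<forall>c\<in>Z. \<exists>\<rho>\<in>carrier R. \<exists>w\<in>module_hom R (P k) (ring_module R).
      \<forall>x\<in>carrier (P (Suc k)). c x = \<rho> \<otimes> \<gamma> x \<oplus> w (d k x)" by blast
  have \<gamma>h: "\<gamma> \<in> module_hom R (P (Suc k)) (ring_module R)" using \<gamma>(1) by (simp add: Z_def)
  show "\<exists>c\<in>module_hom R (vec R (r (Suc k))) (ring_module R). \<forall>l. \<exists>\<rho>\<in>carrier R.
      \<exists>w\<in>module_hom R (vec R (r k)) (ring_module R). \<forall>x\<in>?F (Suc k). x l = \<rho> \<otimes> c x \<oplus> w (\<delta> k x)"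
  proof (rule bexI[of _ "\<lambda>x. \<gamma> (\<alpha> (Suc k) x)"], rule allI)
    fix l
    obtain \<rho> w where w: "\<rho> \<in> carrier R" "w \<in> module_hom R (P k) (ring_module R)"
      "\<And>x. x \<in> carrier (P (Suc k)) \<Longrightarrow> \<beta> (Suc k) x l = \<rho> \<otimes> \<gamma> x \<oplus> w (d k x)"
      using bspec[OF \<gamma>(2) cocycle[of l]] by blast
    have "x l = \<rho> \<otimes> \<gamma> (\<alpha> (Suc k) x) \<oplus> (w (\<alpha> k (\<delta> k x)) \<oplus> \<ominus> \<one> \<otimes> s k (\<delta> k x) l)" if x: "x \<in> ?F (Suc k)" for x
    proof -
      have ax: "\<alpha> (Suc k) x \<in> carrier (P (Suc k))" by (rule module_homD(1)[OF \<alpha>(1) x])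
      have g: "\<gamma> (\<alpha> (Suc k) x) \<in> carrier R" using module_homD(1)[OF \<gamma>h ax] by simp
      have "x l \<oplus> s k (\<delta> k x) l = \<rho> \<otimes> \<gamma> (\<alpha> (Suc k) x) \<oplus> w (\<alpha> k (\<delta> k x))"
        using \<tau>eq[OF x, of l] w(3)[OF ax] \<alpha>(2)[OF x] by simp
      moreover have "x l = (x l \<oplus> s k (\<delta> k x) l) \<oplus> \<ominus> s k (\<delta> k x) l"
        using x sc[OF y[OF x]] by (simp add: vec_carrier a_assoc r_neg)
      ultimately show ?thesis
        using g w(1) wc[OF w(2) y[OF x]] sc[OF y[OF x]] by (simp add: l_minus a_assoc)
    qed
    then show "\<exists>\<rho>\<in>carrier R. \<exists>w\<in>module_hom R (vec R (r k)) (ring_module R).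
        \<forall>x\<in>?F (Suc k). x l = \<rho> \<otimes> \<gamma> (\<alpha> (Suc k) x) \<oplus> w (\<delta> k x)"
      by (intro bexI[OF _ w(1)] bexI[OF _ hom[OF w(2) one_closed]]) blast
  qed (rule module_hom_compose[OF \<alpha>(1) \<gamma>h])
  show "\<forall>a\<in>I. \<forall>l. \<exists>w\<in>module_hom R (vec R (r k)) (ring_module R). \<forall>x\<in>?F (Suc k). a \<otimes> x l = w (\<delta> k x)"
  proof (intro ballI allI)
    fix a l assume "a \<in> I"
    then have a: "a \<in> carrier R" using I ideal.Icarr by metis
    obtain w where w: "w \<in> module_hom R (P k) (ring_module R)"
      "\<And>x. x \<in> carrier (P (Suc k)) \<Longrightarrow> a \<otimes> \<beta> (Suc k) x l = w (d k x)"
      using bspec[OF bspec[OF ext(2) cocycle[of l]] \<open>a \<in> I\<close>] by blast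
    have "a \<otimes> x l = w (\<alpha> k (\<delta> k x)) \<oplus> \<ominus> a \<otimes> s k (\<delta> k x) l" if x: "x \<in> ?F (Suc k)" for x
    proof -
      have ax: "\<alpha> (Suc k) x \<in> carrier (P (Suc k))" by (rule module_homD(1)[OF \<alpha>(1) x])
      have "a \<otimes> (x l \<oplus> s k (\<delta> k x) l) = w (\<alpha> k (\<delta> k x))"
        using \<tau>eq[OF x, of l] w(2)[OF ax] \<alpha>(2)[OF x] by simp
      moreover have "a \<otimes> x l = a \<otimes> (x l \<oplus> s k (\<delta> k x) l) \<oplus> \<ominus> a \<otimes> s k (\<delta> k x) l"
        using a sc[OF y[OF x], of l] x by (simp add: vec_carrier r_distr l_minus a_assoc r_neg)
      ultimately show ?thesis by simp
    qed
    then show "\<exists>w\<in>module_hom R (vec R (r k)) (ring_module R). \<forall>x\<in>?F (Suc k). a \<otimes> x l = w (\<delta> k x)"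
      by (intro bexI[OF _ hom[OF w(1) a]]) blast
  qed
qed

end


section \<open>Self-duality of the resolution\<close>

text \<open>Expressing the \<open>x\<^sub>k\<close> by the \<open>y\<^sub>j\<close> and back gives a relation between the \<open>x\<^sub>k\<close>. For minimal
  generators its coefficients lie in the maximal ideal, so the product of the two matrices is the
  identity modulo \<open>\<mm>\<close>.\<close>
lemma (in cring) factorization_relation:
  fixes u v :: "nat \<Rightarrow> nat \<Rightarrow> 'a" and p q i :: nat
  assumes x: "\<And>k. x k \<in> carrier R" and y: "\<And>k. y k \<in> carrier R"
    and u: "\<And>i j. u i j \<in> carrier R" "\<And>j k. v j k \<in> carrier R"
    and xy: "\<And>i. i < p \<Longrightarrow> x i = (\<Oplus>j\<in>{..<q}. u i j \<otimes> y j)" "\<And>j. j < q \<Longrightarrow> y j = (\<Oplus>k\<in>{..<p}. v j k \<otimes> x k)"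
    and i: "i < p"
  shows "(\<Oplus>k\<in>{..<p}. ((\<Oplus>j\<in>{..<q}. u i j \<otimes> v j k) \<ominus> unit_vec i k) \<otimes> x k) = \<zero>"
proof -
  let ?s = "\<lambda>k. \<Oplus>j\<in>{..<q}. u i j \<otimes> v j k"
  have s: "?s k \<in> carrier R" for k using u by simp
  have "(\<Oplus>k\<in>{..<p}. (?s k \<ominus> unit_vec i k) \<otimes> x k) = (\<Oplus>k\<in>{..<p}. ?s k \<otimes> x k \<oplus> (\<ominus> x k) \<otimes> unit_vec i k)"
    by (rule finsum_cong') (use s x in \<open>auto simp: minus_eq l_distr r_distr l_minus r_minus m_comm\<close>)
  also have "\<dots> = (\<Oplus>k\<in>{..<p}. ?s k \<otimes> x k) \<oplus> (\<Oplus>k\<in>{..<p}. (\<ominus> x k) \<otimes> unit_vec i k)"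
    by (rule finsum_addf) (use s x in auto)
  also have "(\<Oplus>k\<in>{..<p}. (\<ominus> x k) \<otimes> unit_vec i k) = \<ominus> x i"
    by (rule finsum_delta) (use i x in auto)
  also have "(\<Oplus>k\<in>{..<p}. ?s k \<otimes> x k) = (\<Oplus>j\<in>{..<q}. u i j \<otimes> (\<Oplus>k\<in>{..<p}. v j k \<otimes> x k))"
    by (rule bilinear_assoc[symmetric]) (use u x in auto)
  also have "\<dots> = (\<Oplus>j\<in>{..<q}. u i j \<otimes> y j)"
    by (rule finsum_cong') (use u xy(2)[symmetric] y in auto)
  also have "\<dots> = x i" by (rule xy(1)[OF i, symmetric])
  finally show ?thesis using x by (simp add: r_neg)
qed

text \<open>A minimal resolution of length three whose last module has rank one and whose dual is exact
  except at its end. The last condition says that the \<open>f\<^sub>b\<close> annihilate the cokernel of the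
  transpose of \<open>\<psi>\<close>.\<close>
locale dual_exact_complex = noetherian_local R \<mm> for R (structure) and \<mm> +
  fixes n m :: nat and \<rho> :: "nat \<Rightarrow> nat \<Rightarrow> 'a" and f \<psi> :: "nat \<Rightarrow> 'a"
  assumes rho_closed [simp]: "\<rho> b j \<in> carrier R"
    and f_closed [simp]: "f b \<in> carrier R"
    and psi_closed [simp]: "\<psi> j \<in> carrier R"
    and rho_mm: "b < n \<Longrightarrow> j < m \<Longrightarrow> \<rho> b j \<in> \<mm>"
    and f_rho: "j < m \<Longrightarrow> (\<Oplus>b\<in>{..<n}. f b \<otimes> \<rho> b j) = \<zero>"
    and rho_psi: "b < n \<Longrightarrow> (\<Oplus>j\<in>{..<m}. \<rho> b j \<otimes> \<psi> j) = \<zero>"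
    and ker_rho: "\<lbrakk>\<And>j. w j \<in> carrier R; \<And>b. b < n \<Longrightarrow> (\<Oplus>j\<in>{..<m}. \<rho> b j \<otimes> w j) = \<zero>\<rbrakk>
      \<Longrightarrow> \<exists>t\<in>carrier R. \<forall>j<m. w j = t \<otimes> \<psi> j"
    and ker_f: "\<lbrakk>\<And>b. z b \<in> carrier R; (\<Oplus>b\<in>{..<n}. f b \<otimes> z b) = \<zero>\<rbrakk>
      \<Longrightarrow> \<exists>y. (\<forall>j. y j \<in> carrier R) \<and> (\<forall>b<n. z b = (\<Oplus>j\<in>{..<m}. \<rho> b j \<otimes> y j))"
    and ker_rho_dual: "\<lbrakk>\<And>b. c b \<in> carrier R; \<And>j. j < m \<Longrightarrow> (\<Oplus>b\<in>{..<n}. c b \<otimes> \<rho> b j) = \<zero>\<rbrakk>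
      \<Longrightarrow> \<exists>u\<in>carrier R. \<forall>b<n. c b = u \<otimes> f b"
    and ker_psi_dual: "\<lbrakk>\<And>j. g j \<in> carrier R; (\<Oplus>j\<in>{..<m}. g j \<otimes> \<psi> j) = \<zero>\<rbrakk>
      \<Longrightarrow> \<exists>w. (\<forall>b. w b \<in> carrier R) \<and> (\<forall>j<m. g j = (\<Oplus>b\<in>{..<n}. w b \<otimes> \<rho> b j))"
    and psi_faithful: "\<lbrakk>t \<in> carrier R; \<And>j. j < m \<Longrightarrow> t \<otimes> \<psi> j = \<zero>\<rbrakk> \<Longrightarrow> t = \<zero>"
    and f_faithful: "\<lbrakk>r \<in> carrier R; \<And>b. b < n \<Longrightarrow> r \<otimes> f b = \<zero>\<rbrakk> \<Longrightarrow> r = \<zero>"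
    and f_in_psi: "b < n \<Longrightarrow> \<exists>c. (\<forall>j. c j \<in> carrier R) \<and> f b = (\<Oplus>j\<in>{..<m}. c j \<otimes> \<psi> j)"
begin

text \<open>Multiplication by \<open>\<psi>\<^sub>k\<close> is null-homotopic on the dual complex, and the last step of the
  homotopy writes \<open>\<psi>\<^sub>k\<close> as a combination of the \<open>f\<^sub>b\<close>.\<close>
lemma psi_in_f:
  assumes k: "k < m"
  shows "\<exists>q. (\<forall>b. q b \<in> carrier R) \<and> \<psi> k = (\<Oplus>b\<in>{..<n}. q b \<otimes> f b)"
proof -
  \<comment> \<open>The first step of the homotopy: \<open>\<psi>\<^sub>k e\<^sub>j - \<psi>\<^sub>j e\<^sub>k\<close> is orthogonal to \<open>\<psi>\<close>.\<close>
  have "\<exists>w. (\<forall>b. w b \<in> carrier R) \<and> (\<forall>l<m. \<psi> k \<otimes> unit_vec j l \<ominus> \<psi> j \<otimes> unit_vec k l = (\<Oplus>b\<in>{..<n}. w b \<otimes> \<rho> b l))"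
    if j: "j < m" for j
  proof (rule ker_psi_dual)
    have "(\<Oplus>l\<in>{..<m}. (\<psi> k \<otimes> unit_vec j l \<ominus> \<psi> j \<otimes> unit_vec k l) \<otimes> \<psi> l)
        = (\<Oplus>l\<in>{..<m}. (\<psi> k \<otimes> \<psi> l) \<otimes> unit_vec j l \<oplus> (\<ominus> \<psi> j \<otimes> \<psi> l) \<otimes> unit_vec k l)"
      by (rule finsum_cong') (auto simp: minus_eq l_distr r_distr l_minus r_minus m_ac)
    also have "\<dots> = (\<Oplus>l\<in>{..<m}. (\<psi> k \<otimes> \<psi> l) \<otimes> unit_vec j l) \<oplus> (\<Oplus>l\<in>{..<m}. (\<ominus> \<psi> j \<otimes> \<psi> l) \<otimes> unit_vec k l)"
      by (rule finsum_addf) auto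
    also have "(\<Oplus>l\<in>{..<m}. (\<psi> k \<otimes> \<psi> l) \<otimes> unit_vec j l) = \<psi> k \<otimes> \<psi> j"
      by (rule finsum_delta) (use j in auto)
    also have "(\<Oplus>l\<in>{..<m}. (\<ominus> \<psi> j \<otimes> \<psi> l) \<otimes> unit_vec k l) = \<ominus> \<psi> j \<otimes> \<psi> k"
      by (rule finsum_delta) (use k in auto)
    finally show "(\<Oplus>l\<in>{..<m}. (\<psi> k \<otimes> unit_vec j l \<ominus> \<psi> j \<otimes> unit_vec k l) \<otimes> \<psi> l) = \<zero>"
      by (simp add: l_minus r_minus m_comm r_neg)
  qed simp
  then have "\<exists>t'. \<forall>j\<in>{..<m}. (\<forall>b. t' j b \<in> carrier R) \<and>
      (\<forall>l<m. \<psi> k \<otimes> unit_vec j l \<ominus> \<psi> j \<otimes> unit_vec k l = (\<Oplus>b\<in>{..<n}. t' j b \<otimes> \<rho> b l))"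
    by (intro bchoice ballI) (simp only: lessThan_iff)
  then obtain t' where t': "\<And>j. j < m \<Longrightarrow> (\<forall>b. t' j b \<in> carrier R) \<and>
      (\<forall>l<m. \<psi> k \<otimes> unit_vec j l \<ominus> \<psi> j \<otimes> unit_vec k l = (\<Oplus>b\<in>{..<n}. t' j b \<otimes> \<rho> b l))"
    unfolding Ball_def lessThan_iff by blast
  define t where "t = (\<lambda>j b. if j < m then t' j b else \<zero>)"
  have t: "t j b \<in> carrier R" for j b using t' by (simp add: t_def)
  have teq: "(\<Oplus>b\<in>{..<n}. t j b \<otimes> \<rho> b l) = \<psi> k \<otimes> unit_vec j l \<ominus> \<psi> j \<otimes> unit_vec k l" if "j < m" "l < m" for j l
    using t' that by (simp add: t_def)
  \<comment> \<open>The second step: \<open>\<rho> t \<rho> = \<psi>\<^sub>k \<rho>\<close>, so each row of \<open>\<rho> t - \<psi>\<^sub>k\<close> is in the left kernel of \<open>\<rho>\<close> and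
    hence a multiple of \<open>f\<close>.\<close>
  define S where "S = (\<lambda>b b'. \<Oplus>j\<in>{..<m}. \<rho> b j \<otimes> t j b')"
  have S: "S b b' \<in> carrier R" for b b' using t by (simp add: S_def)
  have "\<exists>q\<in>carrier R. \<forall>b'<n. S b b' \<ominus> \<psi> k \<otimes> unit_vec b b' = q \<otimes> f b'" if b: "b < n" for b
  proof (rule ker_rho_dual)
    fix l assume l: "l < m"
    have "(\<Oplus>b'\<in>{..<n}. S b b' \<otimes> \<rho> b' l) = (\<Oplus>j\<in>{..<m}. \<rho> b j \<otimes> (\<Oplus>b'\<in>{..<n}. t j b' \<otimes> \<rho> b' l))"
      unfolding S_def by (rule bilinear_assoc[symmetric]) (use t in auto)
    also have "\<dots> = (\<Oplus>j\<in>{..<m}. (\<psi> k \<otimes> \<rho> b j) \<otimes> unit_vec j l \<oplus> (\<ominus> unit_vec k l) \<otimes> (\<rho> b j \<otimes> \<psi> j))"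
      by (rule finsum_cong') (use teq l in \<open>auto simp: minus_eq r_distr r_minus l_minus m_ac\<close>)
    also have "\<dots> = (\<Oplus>j\<in>{..<m}. (\<psi> k \<otimes> \<rho> b j) \<otimes> unit_vec j l) \<oplus> (\<Oplus>j\<in>{..<m}. (\<ominus> unit_vec k l) \<otimes> (\<rho> b j \<otimes> \<psi> j))"
      by (rule finsum_addf) auto
    also have "(\<Oplus>j\<in>{..<m}. (\<psi> k \<otimes> \<rho> b j) \<otimes> unit_vec j l) = \<psi> k \<otimes> \<rho> b l"
      by (rule finsum_delta) (use l in auto)
    also have "(\<Oplus>j\<in>{..<m}. (\<ominus> unit_vec k l) \<otimes> (\<rho> b j \<otimes> \<psi> j)) = (\<ominus> unit_vec k l) \<otimes> (\<Oplus>j\<in>{..<m}. \<rho> b j \<otimes> \<psi> j)"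
      by (rule finsum_rdistr[symmetric]) auto
    finally have 1: "(\<Oplus>b'\<in>{..<n}. S b b' \<otimes> \<rho> b' l) = \<psi> k \<otimes> \<rho> b l" using rho_psi[OF b] by simp
    have "(\<Oplus>b'\<in>{..<n}. (S b b' \<ominus> \<psi> k \<otimes> unit_vec b b') \<otimes> \<rho> b' l)
        = (\<Oplus>b'\<in>{..<n}. S b b' \<otimes> \<rho> b' l \<oplus> (\<ominus> \<psi> k \<otimes> \<rho> b' l) \<otimes> unit_vec b b')"
      by (rule finsum_cong') (use S in \<open>auto simp: minus_eq l_distr r_distr l_minus r_minus m_ac\<close>)
    also have "\<dots> = (\<Oplus>b'\<in>{..<n}. S b b' \<otimes> \<rho> b' l) \<oplus> (\<Oplus>b'\<in>{..<n}. (\<ominus> \<psi> k \<otimes> \<rho> b' l) \<otimes> unit_vec b b')"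
      by (rule finsum_addf) (use S in auto)
    also have "(\<Oplus>b'\<in>{..<n}. (\<ominus> \<psi> k \<otimes> \<rho> b' l) \<otimes> unit_vec b b') = \<ominus> \<psi> k \<otimes> \<rho> b l"
      by (rule finsum_delta) (use b in auto)
    finally show "(\<Oplus>b'\<in>{..<n}. (S b b' \<ominus> \<psi> k \<otimes> unit_vec b b') \<otimes> \<rho> b' l) = \<zero>"
      unfolding 1 by (simp add: l_minus r_neg)
  qed (use S in simp)
  then obtain q' where q': "\<And>b. b < n \<Longrightarrow> q' b \<in> carrier R \<and> (\<forall>b'<n. S b b' \<ominus> \<psi> k \<otimes> unit_vec b b' = q' b \<otimes> f b')"
    by metis
  define q where "q = (\<lambda>b. if b < n then q' b else \<zero>)"
  have q: "q b \<in> carrier R" for b using q' by (simp add: q_def)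
  have qeq: "q b \<otimes> f b' = S b b' \<ominus> \<psi> k \<otimes> unit_vec b b'" if "b < n" "b' < n" for b b'
    using q' that by (simp add: q_def)
  let ?s = "\<Oplus>b\<in>{..<n}. f b \<otimes> q b"
  have sc: "?s \<in> carrier R" using q by simp
  have "?s \<oplus> \<psi> k = \<zero>"
  proof (rule f_faithful)
    fix b' assume b': "b' < n"
    have "?s \<otimes> f b' = (\<Oplus>b\<in>{..<n}. f b \<otimes> q b \<otimes> f b')"
      by (rule finsum_ldistr) (use q in auto)
    also have "\<dots> = (\<Oplus>b\<in>{..<n}. f b \<otimes> S b b' \<oplus> (\<ominus> \<psi> k \<otimes> f b) \<otimes> unit_vec b b')"
      by (rule finsum_cong') (use qeq b' q S in \<open>auto simp: m_assoc minus_eq r_distr r_minus l_minus m_lcomm\<close>)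
    also have "\<dots> = (\<Oplus>b\<in>{..<n}. f b \<otimes> S b b') \<oplus> (\<Oplus>b\<in>{..<n}. (\<ominus> \<psi> k \<otimes> f b) \<otimes> unit_vec b b')"
      by (rule finsum_addf) (use S in auto)
    also have "(\<Oplus>b\<in>{..<n}. f b \<otimes> S b b') = (\<Oplus>j\<in>{..<m}. (\<Oplus>b\<in>{..<n}. f b \<otimes> \<rho> b j) \<otimes> t j b')"
      unfolding S_def by (rule bilinear_assoc) (use t in auto)
    also have "\<dots> = \<zero>" by (rule add.finprod_one_eqI) (use f_rho t in auto)
    also have "(\<Oplus>b\<in>{..<n}. (\<ominus> \<psi> k \<otimes> f b) \<otimes> unit_vec b b') = \<ominus> \<psi> k \<otimes> f b'"
      by (rule finsum_delta) (use b' in auto)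
    finally show "(?s \<oplus> \<psi> k) \<otimes> f b' = \<zero>" using sc by (simp add: l_distr l_minus l_neg)
  qed (use sc in simp)
  then have "\<psi> k = \<ominus> ?s" using sc by (simp add: a_comm minus_equality)
  also have "\<dots> = \<ominus> \<one> \<otimes> ?s" using sc by (simp add: l_minus)
  also have "\<dots> = (\<Oplus>b\<in>{..<n}. \<ominus> q b \<otimes> f b)"
    using q by (simp add: finsum_rdistr Pi_def l_minus r_minus m_comm)
  finally show ?thesis using q by (intro exI[of _ "\<lambda>b. \<ominus> q b"]) simp
qed

lemma f_relation_mm:
  assumes "\<And>b. z b \<in> carrier R" "(\<Oplus>b\<in>{..<n}. f b \<otimes> z b) = \<zero>" "b < n"
  shows "z b \<in> \<mm>"
proof -
  obtain y where y: "\<And>j. y j \<in> carrier R" "\<And>b. b < n \<Longrightarrow> z b = (\<Oplus>j\<in>{..<m}. \<rho> b j \<otimes> y j)"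
    using ker_f[OF assms(1,2)] by blast
  have "(\<Oplus>j\<in>{..<m}. \<rho> b j \<otimes> y j) \<in> \<mm>"
    by (rule ideal_finsum_closed[OF mm.is_ideal], rule mm.I_r_closed[OF rho_mm[OF assms(3)] y(1)]) simp
  then show ?thesis using y(2)[OF assms(3)] by simp
qed

lemma psi_relation_mm:
  assumes "\<And>j. g j \<in> carrier R" "(\<Oplus>j\<in>{..<m}. g j \<otimes> \<psi> j) = \<zero>" "j < m"
  shows "g j \<in> \<mm>"
proof -
  obtain w where w: "\<And>b. w b \<in> carrier R" "\<And>j. j < m \<Longrightarrow> g j = (\<Oplus>b\<in>{..<n}. w b \<otimes> \<rho> b j)"
    using ker_psi_dual[OF assms(1,2)] by blast
  have "(\<Oplus>b\<in>{..<n}. w b \<otimes> \<rho> b j) \<in> \<mm>"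
    by (rule ideal_finsum_closed[OF mm.is_ideal], rule mm.I_l_closed[OF rho_mm[OF _ assms(3)] w(1)]) simp
  then show ?thesis using w(2)[OF assms(3)] by simp
qed

text \<open>The \<open>f\<^sub>b\<close> and the \<open>\<psi>\<^sub>j\<close> are minimal generators of the same ideal, so that expressing either
  family by the other gives matrices that are inverse to each other modulo \<open>\<mm>\<close>.\<close>
lemma ranks_equal: "m = n"
proof -
  have "\<exists>c. \<forall>b. (\<forall>j. c b j \<in> carrier R) \<and> (b < n \<longrightarrow> f b = (\<Oplus>j\<in>{..<m}. c b j \<otimes> \<psi> j))"
  proof (rule choice, rule allI)
    fix b show "\<exists>c. (\<forall>j. c j \<in> carrier R) \<and> (b < n \<longrightarrow> f b = (\<Oplus>j\<in>{..<m}. c j \<otimes> \<psi> j))"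
      using f_in_psi[of b] by (cases "b < n") (auto intro: exI[of _ "\<lambda>_. \<zero>"])
  qed
  then obtain c where c: "\<And>b j. c b j \<in> carrier R" "\<And>b. b < n \<Longrightarrow> f b = (\<Oplus>j\<in>{..<m}. c b j \<otimes> \<psi> j)" by blast
  have "\<exists>a. \<forall>j. (\<forall>b. a j b \<in> carrier R) \<and> (j < m \<longrightarrow> \<psi> j = (\<Oplus>b\<in>{..<n}. a j b \<otimes> f b))"
  proof (rule choice, rule allI)
    fix j show "\<exists>a. (\<forall>b. a b \<in> carrier R) \<and> (j < m \<longrightarrow> \<psi> j = (\<Oplus>b\<in>{..<n}. a b \<otimes> f b))"
      using psi_in_f[of j] by (cases "j < m") (auto intro: exI[of _ "\<lambda>_. \<zero>"])
  qed
  then obtain a where a: "\<And>j b. a j b \<in> carrier R" "\<And>j. j < m \<Longrightarrow> \<psi> j = (\<Oplus>b\<in>{..<n}. a j b \<otimes> f b)" by blast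
  have "n \<le> m"
  proof (rule identity_mod_mm_factorization[OF a(1) c(1)])
    fix i k assume i: "i < n" and k: "k < n"
    show "(\<Oplus>j\<in>{..<m}. c i j \<otimes> a j k) \<ominus> unit_vec i k \<in> \<mm>"
    proof (rule f_relation_mm[OF _ _ k])
      show cl: "(\<Oplus>j\<in>{..<m}. c i j \<otimes> a j k) \<ominus> unit_vec i k \<in> carrier R" for k using a c by simp
      have "(\<Oplus>k\<in>{..<n}. f k \<otimes> ((\<Oplus>j\<in>{..<m}. c i j \<otimes> a j k) \<ominus> unit_vec i k)) =
          (\<Oplus>k\<in>{..<n}. ((\<Oplus>j\<in>{..<m}. c i j \<otimes> a j k) \<ominus> unit_vec i k) \<otimes> f k)"
        by (rule finsum_cong') (use cl in \<open>auto intro: m_comm\<close>)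
      also have "\<dots> = \<zero>" by (rule factorization_relation[where y = \<psi>]) (use a c i in auto)
      finally show "(\<Oplus>k\<in>{..<n}. f k \<otimes> ((\<Oplus>j\<in>{..<m}. c i j \<otimes> a j k) \<ominus> unit_vec i k)) = \<zero>" .
    qed
  qed
  moreover have "m \<le> n"
  proof (rule identity_mod_mm_factorization[OF c(1) a(1)])
    fix i k assume i: "i < m" and k: "k < m"
    show "(\<Oplus>j\<in>{..<n}. a i j \<otimes> c j k) \<ominus> unit_vec i k \<in> \<mm>"
    proof (rule psi_relation_mm[OF _ _ k])
      show cl: "(\<Oplus>j\<in>{..<n}. a i j \<otimes> c j k) \<ominus> unit_vec i k \<in> carrier R" for k using a c by simp
      show "(\<Oplus>k\<in>{..<m}. ((\<Oplus>j\<in>{..<n}. a i j \<otimes> c j k) \<ominus> unit_vec i k) \<otimes> \<psi> k) = \<zero>"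
        by (rule factorization_relation[where y = f]) (use a c i in auto)
    qed
  qed
  ultimately show ?thesis by simp
qed

lemma self_dual: "self_dual_complex R n \<rho> f \<psi>"
proof -
  note facts = rho_closed f_closed psi_closed f_rho rho_psi ker_rho ker_f ker_rho_dual psi_faithful f_faithful
  show ?thesis
    by (rule self_dual_complex.intro[OF noetherian_cring_axioms self_dual_complex_axioms.intro])
      (fact facts[unfolded ranks_equal])+
qed

end


section \<open>Exactness of the dual complex\<close>

context cring begin

lemma genideal_empty: "Idl {} = {\<zero>}"
  using genideal_minimal[OF zeroideal, of "{}"] ideal.axioms(1)[OF genideal_ideal[of "{}"]]
    additive_subgroup.zero_closed by fastforce

lemma genideal_insert:
  assumes S: "S \<subseteq> carrier R" and a: "a \<in> carrier R"
  shows "Idl (insert a S) = {j \<oplus> a \<otimes> r | j r. j \<in> Idl S \<and> r \<in> carrier R}" (is "_ = ?K")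
proof
  interpret S: ideal "Idl S" R by (rule genideal_ideal[OF S])
  interpret T: ideal "Idl (insert a S)" R by (rule genideal_ideal) (use S a in auto)
  have Keq: "?K = set_add R (Idl S) (PIdl a)"
  proof -
    have c: "j \<oplus> a \<otimes> r = j \<oplus> r \<otimes> a" if "r \<in> carrier R" for j r using a that by (simp add: m_comm)
    show ?thesis
    proof (intro equalityI subsetI)
      fix x assume "x \<in> ?K"
      then obtain j r where jr: "x = j \<oplus> r \<otimes> a" "j \<in> Idl S" "r \<in> carrier R" using c by auto
      then have "r \<otimes> a \<in> PIdl a" unfolding cgenideal_def by blast
      then show "x \<in> set_add R (Idl S) (PIdl a)" unfolding set_add_def' using jr by blast
    next
      fix x assume "x \<in> set_add R (Idl S) (PIdl a)"
      then obtain j k where jk: "x = j \<oplus> k" "j \<in> Idl S" "k \<in> PIdl a" unfolding set_add_def' by blast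
      then obtain r where "k = r \<otimes> a" "r \<in> carrier R" unfolding cgenideal_def by blast
      then have "x = j \<oplus> a \<otimes> r" using jk(1) c by simp
      then show "x \<in> ?K" using jk(2) \<open>r \<in> carrier R\<close> by blast
    qed
  qed
  have K: "ideal ?K R" unfolding Keq by (rule add_ideals[OF S.is_ideal cgenideal_ideal[OF a]])
  have memI: "j \<oplus> a \<otimes> r \<in> ?K" if "j \<in> Idl S" "r \<in> carrier R" for j r using that by blast
  have "a \<in> ?K" using memI[of \<zero> \<one>] a by simp
  moreover have "S \<subseteq> ?K"
  proof
    fix x assume x: "x \<in> S"
    then have "x \<in> Idl S" using genideal_self[OF S] by blast
    then show "x \<in> ?K" using memI[of x \<zero>] a S.Icarr by simp
  qed
  ultimately show "Idl (insert a S) \<subseteq> ?K" by (intro genideal_minimal[OF K]) simp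
  show "?K \<subseteq> Idl (insert a S)"
  proof
    fix x assume "x \<in> ?K"
    then obtain j r where x: "x = j \<oplus> a \<otimes> r" "j \<in> Idl S" "r \<in> carrier R" by blast
    have "Idl S \<subseteq> Idl (insert a S)" by (rule subset_Idl_subset) (use S a in auto)
    moreover have "a \<in> Idl (insert a S)" using genideal_self[of "insert a S"] S a by auto
    ultimately show "x \<in> Idl (insert a S)" using x T.I_r_closed by auto
  qed
qed

text \<open>If \<open>W\<close> vanishes modulo \<open>J\<close> wherever \<open>F\<close> does, then \<open>W\<close> descends to a function \<open>h\<close> on the
  image of \<open>F\<close>, and \<open>a h(b) = b h(a)\<close> for two values \<open>a\<close>, \<open>b\<close> that form a regular sequence
  modulo \<open>J\<close> forces \<open>h\<close> to be a multiplication.\<close>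
lemma functional_multiple:
  assumes V: "module R V" and F: "F \<in> module_hom R V (ring_module R)" and W: "W \<in> module_hom R V (ring_module R)"
    and J: "ideal J R" and y: "y1 \<in> carrier V" "y2 \<in> carrier V"
    and desc: "\<And>v. v \<in> carrier V \<Longrightarrow> F v \<in> J \<Longrightarrow> W v \<in> J"
    and reg1: "\<And>y. y \<in> carrier R \<Longrightarrow> F y1 \<otimes> y \<in> J \<Longrightarrow> y \<in> J"
    and reg2: "\<And>y j r. y \<in> carrier R \<Longrightarrow> j \<in> J \<Longrightarrow> r \<in> carrier R \<Longrightarrow> F y2 \<otimes> y = j \<oplus> F y1 \<otimes> r \<Longrightarrow>
      \<exists>j'\<in>J. \<exists>r'\<in>carrier R. y = j' \<oplus> F y1 \<otimes> r'"
  shows "\<exists>u\<in>carrier R. \<forall>v\<in>carrier V. W v \<ominus> u \<otimes> F v \<in> J"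
proof -
  interpret V: module R V by (rule V)
  interpret J: ideal J R by (rule J)
  have Fc: "F v \<in> carrier R" and Wc: "W v \<in> carrier R" if "v \<in> carrier V" for v
    using module_homD(1)[OF F that] module_homD(1)[OF W that] by simp_all
  have cross: "F b \<otimes> W v \<ominus> F v \<otimes> W b \<in> J" if b: "b \<in> carrier V" and v: "v \<in> carrier V" for b v
  proof -
    let ?x = "(F b \<odot>\<^bsub>V\<^esub> v) \<oplus>\<^bsub>V\<^esub> (\<ominus> F v \<odot>\<^bsub>V\<^esub> b)"
    have c: "F b \<odot>\<^bsub>V\<^esub> v \<in> carrier V" "\<ominus> F v \<odot>\<^bsub>V\<^esub> b \<in> carrier V" using b v Fc by auto
    have h: "h ?x = F b \<otimes> h v \<oplus> \<ominus> F v \<otimes> h b" if "h \<in> module_hom R V (ring_module R)" for h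
      using module_homD(2)[OF that c] module_homD(3)[OF that, of "F b" v] module_homD(3)[OF that, of "\<ominus> F v" b]
        b v Fc by simp
    have "F ?x \<in> J" using h[OF F] Fc[OF b] Fc[OF v] by (simp add: l_minus r_minus m_comm r_neg)
    then have "W ?x \<in> J" using c by (intro desc) auto
    then show ?thesis using h[OF W] Fc Wc b v by (simp add: minus_eq l_minus)
  qed
  have eq: "a = (a \<ominus> b) \<oplus> b" if "a \<in> carrier R" "b \<in> carrier R" for a b
    using that by (simp add: minus_eq a_assoc l_neg)
  have "\<exists>j'\<in>J. \<exists>r'\<in>carrier R. W y1 = j' \<oplus> F y1 \<otimes> r'"
    by (rule reg2[OF Wc[OF y(1)] cross[OF y(2,1)] Wc[OF y(2)]]) (rule eq, use y Fc Wc in auto)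
  then obtain j u where u: "j \<in> J" "u \<in> carrier R" "W y1 = j \<oplus> F y1 \<otimes> u" by blast
  have "W v \<ominus> u \<otimes> F v \<in> J" if v: "v \<in> carrier V" for v
  proof (rule reg1)
    have jc: "j \<in> carrier R" using u(1) J.Icarr by simp
    note cc = Fc[OF v] Wc[OF v] Fc[OF y(1)] u(2) jc
    have "F y1 \<otimes> (W v \<ominus> u \<otimes> F v) = (F y1 \<otimes> W v \<ominus> F v \<otimes> W y1) \<oplus> F v \<otimes> j"
      unfolding u(3) using cc by algebra
    moreover have "F v \<otimes> j \<in> J" using u(1) cc J.I_l_closed by simp
    ultimately show "F y1 \<otimes> (W v \<ominus> u \<otimes> F v) \<in> J" using cross[OF y(1) v] by simp
  qed (use Fc Wc v u in auto)
  then show ?thesis using u(2) by blast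
qed

text \<open>A functional on the image of \<open>D\<close>, the kernel of \<open>F\<close>, extends to the whole free module.
  Multiplied by a regular value \<open>x\<close> of \<open>F\<close> it extends, to \<open>W\<close> say; modulo \<open>x\<close> the extension
  \<open>W\<close> is a multiple of \<open>F\<close>, so a multiple of \<open>F\<close> corrects it to one that is divisible by \<open>x\<close>.\<close>
lemma functional_extension:
  assumes U: "module R U" and D: "D \<in> module_hom R U (vec R n)"
    and F: "F \<in> module_hom R (vec R n) (ring_module R)"
    and exact: "D ` carrier U = {v \<in> carrier (vec R n). F v = \<zero>}"
    and G: "G \<in> module_hom R U (ring_module R)" and GD: "\<And>z. z \<in> carrier U \<Longrightarrow> D z = (\<lambda>_. \<zero>) \<Longrightarrow> G z = \<zero>"
    and y: "y1 \<in> carrier (vec R n)" "y2 \<in> carrier (vec R n)" "y3 \<in> carrier (vec R n)"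
    and reg1: "\<And>y. y \<in> carrier R \<Longrightarrow> F y1 \<otimes> y = \<zero> \<Longrightarrow> y = \<zero>"
    and reg2: "\<And>y. y \<in> carrier R \<Longrightarrow> F y2 \<otimes> y \<in> Idl {F y1} \<Longrightarrow> y \<in> Idl {F y1}"
    and reg3: "\<And>y. y \<in> carrier R \<Longrightarrow> F y3 \<otimes> y \<in> Idl {F y1, F y2} \<Longrightarrow> y \<in> Idl {F y1, F y2}"
  shows "\<exists>w\<in>module_hom R (vec R n) (ring_module R). \<forall>z\<in>carrier U. G z = w (D z)"
proof -
  interpret U: module R U by (rule U)
  interpret V: module R "vec R n" by (rule free_module_module)
  have Fc: "F v \<in> carrier R" if "v \<in> carrier (vec R n)" for v using module_homD(1)[OF F that] by simp
  have Gc: "G z \<in> carrier R" if "z \<in> carrier U" for z using module_homD(1)[OF G that] by simp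
  let ?x = "F y1"
  have x: "?x \<in> carrier R" by (rule Fc[OF y(1)])
  \<comment> \<open>A map to the kernel of \<open>F\<close> that is multiplication by \<open>x\<close> on this kernel.\<close>
  define N where "N = (\<lambda>v. (?x \<odot>\<^bsub>vec R n\<^esub> v) \<oplus>\<^bsub>vec R n\<^esub> (\<ominus> F v \<odot>\<^bsub>vec R n\<^esub> y1))"
  have Nc: "N v \<in> carrier (vec R n)" if "v \<in> carrier (vec R n)" for v
    unfolding N_def by (intro V.add.m_closed V.smult_closed) (use that x Fc y in auto)
  have FN: "F (N v) = \<zero>" if v: "v \<in> carrier (vec R n)" for v
  proof -
    have "F (N v) = ?x \<otimes> F v \<oplus> \<ominus> F v \<otimes> ?x"
      unfolding N_def
      using module_homD(2)[OF F V.smult_closed[OF x v] V.smult_closed[OF a_inv_closed[OF Fc[OF v]] y(1)]]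
        module_homD(3)[OF F x v] module_homD(3)[OF F a_inv_closed[OF Fc[OF v]] y(1)] by (simp del: free_module_simps)
    then show ?thesis using x Fc[OF v] by (simp add: l_minus r_minus m_comm r_neg)
  qed
  have Neq: "D z = N v \<longleftrightarrow> (\<forall>b. D z b = ?x \<otimes> v b \<oplus> \<ominus> F v \<otimes> y1 b)" for z v
    by (auto simp: N_def fun_eq_iff)
  have GD': "G z = G z'" if z: "z \<in> carrier U" "z' \<in> carrier U" "D z = D z'" for z z'
  proof -
    have m: "\<ominus> \<one> \<odot>\<^bsub>U\<^esub> z' \<in> carrier U" using z by simp
    have Dz: "D z' b \<in> carrier R" for b using module_homD(1)[OF D z(2)] by (simp add: vec_carrier)
    have "D (z \<oplus>\<^bsub>U\<^esub> (\<ominus> \<one> \<odot>\<^bsub>U\<^esub> z')) = (\<lambda>_. \<zero>)"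
      using module_homD(2)[OF D z(1) m] module_homD(3)[OF D _ z(2), of "\<ominus> \<one>"] z(3) Dz by (simp add: l_minus r_neg)
    then have "G (z \<oplus>\<^bsub>U\<^esub> (\<ominus> \<one> \<odot>\<^bsub>U\<^esub> z')) = \<zero>" using z m by (intro GD) auto
    then have "G z \<oplus> \<ominus> G z' = \<zero>"
      using module_homD(2)[OF G z(1) m] module_homD(3)[OF G _ z(2), of "\<ominus> \<one>"] Gc z by (simp add: l_minus)
    then show ?thesis using Gc z r_right_minus_eq[of "G z" "G z'"] by (simp add: minus_eq)
  qed
  let ?T = "{(v, t). v \<in> carrier (vec R n) \<and> (\<exists>z\<in>carrier U. D z = N v \<and> t = G z)}"
  have Tlin: "linear_relation R (vec R n) (ring_module R) ?T"
    unfolding linear_relation_def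
  proof (intro conjI allI impI)
    show "?T \<subseteq> carrier (vec R n) \<times> carrier (ring_module R)" using Gc by auto
  next
    fix v t v' t' assume "(v, t) \<in> ?T" "(v', t') \<in> ?T"
    then obtain z z' where z: "v \<in> carrier (vec R n)" "z \<in> carrier U" "D z = N v" "t = G z"
      "v' \<in> carrier (vec R n)" "z' \<in> carrier U" "D z' = N v'" "t' = G z'" by blast
    have vc: "v b \<in> carrier R" "v' b \<in> carrier R" "y1 b \<in> carrier R" for b using z y by (simp_all add: vec_carrier)
    have Fv: "F (v \<oplus>\<^bsub>vec R n\<^esub> v') = F v \<oplus> F v'" using module_homD(2)[OF F z(1,5)] by (simp del: free_module_simps)
    have "D (z \<oplus>\<^bsub>U\<^esub> z') b = ?x \<otimes> (v \<oplus>\<^bsub>vec R n\<^esub> v') b \<oplus> \<ominus> F (v \<oplus>\<^bsub>vec R n\<^esub> v') \<otimes> y1 b" for b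
    proof -
      have "D (z \<oplus>\<^bsub>U\<^esub> z') b = D z b \<oplus> D z' b" using module_homD(2)[OF D z(2,6)] by simp
      also have "\<dots> = (?x \<otimes> v b \<oplus> \<ominus> F v \<otimes> y1 b) \<oplus> (?x \<otimes> v' b \<oplus> \<ominus> F v' \<otimes> y1 b)"
        using z(3,7) Neq by simp
      finally show ?thesis unfolding Fv using vc x Fc[OF z(1)] Fc[OF z(5)]
        by (simp add: l_distr r_distr minus_add a_ac)
    qed
    then have "D (z \<oplus>\<^bsub>U\<^esub> z') = N (v \<oplus>\<^bsub>vec R n\<^esub> v')" unfolding Neq by blast
    moreover have "t \<oplus> t' = G (z \<oplus>\<^bsub>U\<^esub> z')" using module_homD(2)[OF G z(2,6)] z by simp
    moreover have "v \<oplus>\<^bsub>vec R n\<^esub> v' \<in> carrier (vec R n)" "z \<oplus>\<^bsub>U\<^esub> z' \<in> carrier U"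
      using z V.add.m_closed by auto
    ultimately show "(v \<oplus>\<^bsub>vec R n\<^esub> v', t \<oplus>\<^bsub>ring_module R\<^esub> t') \<in> ?T" by auto
  next
    fix a v t assume a: "a \<in> carrier R" and "(v, t) \<in> ?T"
    then obtain z where z: "v \<in> carrier (vec R n)" "z \<in> carrier U" "D z = N v" "t = G z" by blast
    have vc: "v b \<in> carrier R" "y1 b \<in> carrier R" for b using z y by (simp_all add: vec_carrier)
    have Fv: "F (a \<odot>\<^bsub>vec R n\<^esub> v) = a \<otimes> F v" using module_homD(3)[OF F a z(1)] by (simp del: free_module_simps)
    have "D (a \<odot>\<^bsub>U\<^esub> z) b = ?x \<otimes> (a \<odot>\<^bsub>vec R n\<^esub> v) b \<oplus> \<ominus> F (a \<odot>\<^bsub>vec R n\<^esub> v) \<otimes> y1 b" for b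
    proof -
      have "D (a \<odot>\<^bsub>U\<^esub> z) b = a \<otimes> D z b" using module_homD(3)[OF D a z(2)] by simp
      also have "\<dots> = a \<otimes> (?x \<otimes> v b \<oplus> \<ominus> F v \<otimes> y1 b)" using z(3) Neq by simp
      finally show ?thesis unfolding Fv using vc x a Fc[OF z(1)]
        by (simp add: r_distr l_minus r_minus m_ac)
    qed
    then have "D (a \<odot>\<^bsub>U\<^esub> z) = N (a \<odot>\<^bsub>vec R n\<^esub> v)" unfolding Neq by blast
    moreover have "a \<otimes> t = G (a \<odot>\<^bsub>U\<^esub> z)" using module_homD(3)[OF G a z(2)] z by simp
    moreover have "a \<odot>\<^bsub>vec R n\<^esub> v \<in> carrier (vec R n)" "a \<odot>\<^bsub>U\<^esub> z \<in> carrier U"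
      using z a V.smult_closed by auto
    ultimately show "(a \<odot>\<^bsub>vec R n\<^esub> v, a \<odot>\<^bsub>ring_module R\<^esub> t) \<in> ?T" by auto
  qed
  have Ttot: "\<exists>t. (v, t) \<in> ?T" if v: "v \<in> carrier (vec R n)" for v
  proof -
    have "N v \<in> D ` carrier U" unfolding exact using Nc[OF v] FN[OF v] by simp
    then obtain z where "N v = D z" "z \<in> carrier U" by (rule imageE)
    then show ?thesis using v by auto
  qed
  from free_module_selection[OF ring_module_module Tlin Ttot]
  obtain W where W: "W \<in> module_hom R (vec R n) (ring_module R)"
    and WT: "\<forall>v\<in>carrier (vec R n). (v, W v) \<in> ?T" ..
  have WG: "W v = G z" if v: "v \<in> carrier (vec R n)" "z \<in> carrier U" "D z = N v" for v z
  proof -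
    have "(v, W v) \<in> ?T" using WT v(1) by (rule bspec)
    then obtain z' where "z' \<in> carrier U" "D z' = N v" "W v = G z'" by blast
    then show ?thesis using GD'[of z' z] v by simp
  qed
  have WD: "W (D z) = ?x \<otimes> G z" if z: "z \<in> carrier U" for z
  proof -
    have Dz: "D z \<in> carrier (vec R n)" "F (D z) = \<zero>" using z exact by auto
    have yc: "y1 b \<in> carrier R" "D z b \<in> carrier R" for b using y Dz by (simp_all add: vec_carrier)
    have "D (?x \<odot>\<^bsub>U\<^esub> z) b = ?x \<otimes> D z b" for b using module_homD(3)[OF D x z] by simp
    then have "D (?x \<odot>\<^bsub>U\<^esub> z) = N (D z)" unfolding Neq using Dz(2) yc x by simp
    then show ?thesis using WG[OF Dz(1) U.smult_closed[OF x z]] module_homD(3)[OF G x z] by simp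
  qed
  have xJ: "Idl {?x} = {?x \<otimes> r | r. r \<in> carrier R}"
  proof -
    have "Idl {?x} = {\<zero> \<oplus> ?x \<otimes> r | r. r \<in> carrier R}"
      using genideal_insert[of "{}" ?x] x by (simp add: genideal_empty)
    also have "\<dots> = {?x \<otimes> r | r. r \<in> carrier R}"
      by (rule Collect_cong, rule ex_cong1) (use x in auto)
    finally show ?thesis .
  qed
  have Jid: "ideal (Idl {?x}) R" by (rule genideal_ideal) (use x in simp)
  have "\<exists>u\<in>carrier R. \<forall>v\<in>carrier (vec R n). W v \<ominus> u \<otimes> F v \<in> Idl {?x}"
  proof (rule functional_multiple[OF free_module_module F W Jid y(2,3)])
    fix v assume v: "v \<in> carrier (vec R n)" "F v \<in> Idl {?x}"
    then obtain r where r: "r \<in> carrier R" "F v = ?x \<otimes> r" using xJ by blast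
    let ?m = "\<ominus> r \<odot>\<^bsub>vec R n\<^esub> y1"
    let ?v = "v \<oplus>\<^bsub>vec R n\<^esub> ?m"
    have m: "?m \<in> carrier (vec R n)" by (rule V.smult_closed) (use r y in auto)
    have v': "?v \<in> carrier (vec R n)" by (rule V.add.m_closed[OF v(1) m])
    have "F ?v = F v \<oplus> \<ominus> r \<otimes> ?x"
      using module_homD(2)[OF F v(1) m] module_homD(3)[OF F _ y(1), of "\<ominus> r"] r by (simp del: free_module_simps)
    then have "F ?v = \<zero>" using r x by (simp add: l_minus r_minus m_comm r_neg)
    then have "?v \<in> D ` carrier U" unfolding exact using v' by simp
    then obtain z where z: "?v = D z" "z \<in> carrier U" by (rule imageE)
    have yc: "y1 b \<in> carrier R" "v b \<in> carrier R" for b using y v by (simp_all add: vec_carrier)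
    have "D (?x \<odot>\<^bsub>U\<^esub> z) b = ?x \<otimes> v b \<oplus> \<ominus> F v \<otimes> y1 b" for b
    proof -
      have "D (?x \<odot>\<^bsub>U\<^esub> z) b = ?x \<otimes> ?v b" using module_homD(3)[OF D x z(2)] z(1)[symmetric] by simp
      also have "\<dots> = ?x \<otimes> v b \<oplus> \<ominus> F v \<otimes> y1 b"
        using r x yc by (simp add: r_distr l_minus r_minus m_ac)
      finally show ?thesis .
    qed
    then have "D (?x \<odot>\<^bsub>U\<^esub> z) = N v" unfolding Neq by blast
    then have "W v = ?x \<otimes> G z" using WG[OF v(1) U.smult_closed[OF x z(2)]] module_homD(3)[OF G x z(2)] by simp
    then show "W v \<in> Idl {?x}" using xJ Gc[OF z(2)] by blast
  next
    show "y \<in> Idl {?x}" if "y \<in> carrier R" "F y2 \<otimes> y \<in> Idl {?x}" for y using reg2 that .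
  next
    fix y j r assume h: "y \<in> carrier R" "j \<in> Idl {?x}" "r \<in> carrier R" "F y3 \<otimes> y = j \<oplus> F y2 \<otimes> r"
    have I2: "Idl {?x, F y2} = {j \<oplus> F y2 \<otimes> r | j r. j \<in> Idl {?x} \<and> r \<in> carrier R}"
      using genideal_insert[of "{?x}" "F y2"] x Fc[OF y(2)] by (simp add: insert_commute)
    have "F y3 \<otimes> y \<in> Idl {?x, F y2}" unfolding I2 using h by blast
    then have "y \<in> Idl {?x, F y2}" by (rule reg3[OF h(1)])
    then show "\<exists>j'\<in>Idl {?x}. \<exists>r'\<in>carrier R. y = j' \<oplus> F y2 \<otimes> r'" unfolding I2 by blast
  qed
  then obtain u where u: "u \<in> carrier R" "\<And>v. v \<in> carrier (vec R n) \<Longrightarrow> W v \<ominus> u \<otimes> F v \<in> Idl {?x}" by blast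
  let ?W = "\<lambda>v. W v \<oplus> \<ominus> u \<otimes> F v"
  have W': "?W \<in> module_hom R (vec R n) (ring_module R)" by (rule module_hom_lincomb[OF W F]) (use u in simp)
  have W'eq: "?W v = W v \<ominus> u \<otimes> F v" if "v \<in> carrier (vec R n)" for v
    using u(1) Fc[OF that] by (simp add: minus_eq l_minus)
  let ?S = "{(v, t). v \<in> carrier (vec R n) \<and> t \<in> carrier R \<and> ?W v = ?x \<otimes> t}"
  have "linear_relation R (vec R n) (ring_module R) ?S"
    unfolding linear_relation_def
    using module_homD(2,3)[OF W'] V.add.m_closed V.smult_closed x
    by (auto simp: r_distr m_lcomm simp del: free_module_simps)
  moreover have "\<exists>t. (v, t) \<in> ?S" if v: "v \<in> carrier (vec R n)" for v
    using u(2)[OF v] v W'eq[OF v] unfolding xJ by auto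
  ultimately have "\<exists>w\<in>module_hom R (vec R n) (ring_module R). \<forall>v\<in>carrier (vec R n). (v, w v) \<in> ?S"
    by (rule free_module_selection[OF ring_module_module])
  then obtain w where w: "w \<in> module_hom R (vec R n) (ring_module R)"
    and wS: "\<forall>v\<in>carrier (vec R n). (v, w v) \<in> ?S" ..
  have "G z = w (D z)" if z: "z \<in> carrier U" for z
  proof -
    have Dz: "D z \<in> carrier (vec R n)" "F (D z) = \<zero>" using z exact by auto
    have s: "w (D z) \<in> carrier R" "?W (D z) = ?x \<otimes> w (D z)" using bspec[OF wS Dz(1)] by simp_all
    then have "?x \<otimes> G z = ?x \<otimes> w (D z)" using WD[OF z] Dz(2) u(1) x Gc[OF z] by simp
    then have 0: "?x \<otimes> (G z \<ominus> w (D z)) = \<zero>" using x s(1) Gc[OF z] by (simp add: minus_eq r_distr r_minus r_neg)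
    have "G z \<ominus> w (D z) = \<zero>" by (rule reg1[OF _ 0]) (use s(1) Gc[OF z] in simp)
    then show ?thesis using s(1) Gc[OF z] by simp
  qed
  then show ?thesis using w by blast
qed

end


section \<open>Minimal resolutions of length at most three\<close>

context noetherian_local begin

context
  fixes I :: "'a set" and n :: nat and f :: "nat \<Rightarrow> 'a" and r :: "nat \<Rightarrow> nat"
    and \<delta> :: "nat \<Rightarrow> (nat \<Rightarrow> 'a) \<Rightarrow> nat \<Rightarrow> 'a"
  assumes H: "min_free_resolution R \<mm> I n f r \<delta>" and I: "ideal I R"
    and f: "\<And>j. f j \<in> carrier R"
begin

lemma res_ranks: "r 0 = 1" "r (Suc 0) = n"
  using H by (simp_all add: min_free_resolution_def)

lemma res_resolution: "projective_resolution R (quotient_module (ring_module R) I) (\<lambda>i. vec R (r i)) \<delta> (\<lambda>v. I +> v 0)"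
  using H by (simp add: min_free_resolution_def)

lemma res_hom: "\<delta> i \<in> module_hom R (vec R (r (Suc i))) (vec R (r i))"
  using resolutionD(3)[OF res_resolution] .

lemma res_hom0: "\<delta> 0 \<in> module_hom R (vec R n) (vec R 1)"
  using res_hom[of 0] by (simp add: res_ranks)

lemma res_exact: "\<delta> (Suc i) ` carrier (vec R (r (Suc (Suc i)))) = {x \<in> carrier (vec R (r (Suc i))). \<delta> i x = (\<lambda>_. \<zero>)}"
  using resolutionD(6)[OF res_resolution, of "Suc i"] by (simp add: res_cycles_def)

lemma res_min: "x \<in> carrier (vec R (r (Suc i))) \<Longrightarrow> \<delta> i x = (\<lambda>_. \<zero>) \<Longrightarrow> x l \<in> \<mm>"
  using H unfolding min_free_resolution_def by blast

lemma res_entries_mm: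
  assumes "x \<in> carrier (vec R (r (Suc (Suc i))))"
  shows "\<delta> (Suc i) x l \<in> \<mm>"
proof -
  have "\<delta> (Suc i) x \<in> {x \<in> carrier (vec R (r (Suc i))). \<delta> i x = (\<lambda>_. \<zero>)}"
    unfolding res_exact[symmetric] using assms by (rule imageI)
  then show ?thesis using res_min[of "\<delta> (Suc i) x" i l] by simp
qed

lemma first_functional: "(\<lambda>v. \<delta> 0 v 0) \<in> module_hom R (vec R n) (ring_module R)"
  by (rule coordinate_functional[OF res_hom0])

lemma first_functional_eq: "v \<in> carrier (vec R n) \<Longrightarrow> \<delta> 0 v 0 = (\<Oplus>j\<in>{..<n}. f j \<otimes> v j)"
  using H by (simp add: min_free_resolution_def)

lemma first_functional_unit: "b < n \<Longrightarrow> \<delta> 0 (unit_vec b) 0 = f b"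
  using first_functional_eq[of "unit_vec b"] finsum_delta(1)[of "{..<n}" b f] f by simp

lemma first_kernel: "v \<in> carrier (vec R n) \<Longrightarrow> \<delta> 0 v = (\<lambda>_. \<zero>) \<longleftrightarrow> \<delta> 0 v 0 = \<zero>"
proof -
  assume v: "v \<in> carrier (vec R n)"
  have "\<delta> 0 v b = \<zero>" if "\<delta> 0 v 0 = \<zero>" for b
    using module_homD(1)[OF res_hom0 v] that by (cases b) (auto simp: vec_carrier)
  then show ?thesis by (auto simp: fun_eq_iff)
qed

lemma first_image: "a \<in> I \<longleftrightarrow> (\<exists>v\<in>carrier (vec R n). a = \<delta> 0 v 0)"
proof -
  interpret I: ideal I R by (rule I)
  have im: "\<delta> 0 ` carrier (vec R n) = {x \<in> carrier (vec R 1). I +> x 0 = I}"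
    using resolutionD(6)[OF res_resolution, of 0] quotient_ring_module(2)[OF I]
    by (simp add: res_cycles_def res_ranks)
  show ?thesis
  proof
    assume a: "a \<in> I"
    let ?x = "\<lambda>i :: nat. if i = 0 then a else \<zero>"
    have "I +> a = I" using quotient_ring_module(5)[OF I I.Icarr[OF a]] a by simp
    then have "?x \<in> \<delta> 0 ` carrier (vec R n)" unfolding im using I.Icarr[OF a] by (auto simp: vec_carrier)
    then obtain v where "?x = \<delta> 0 v" "v \<in> carrier (vec R n)" by (rule imageE)
    then show "\<exists>v\<in>carrier (vec R n). a = \<delta> 0 v 0" using fun_cong[of ?x "\<delta> 0 v" 0] by auto
  next
    assume "\<exists>v\<in>carrier (vec R n). a = \<delta> 0 v 0"
    then obtain v where v: "v \<in> carrier (vec R n)" "a = \<delta> 0 v 0" ..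
    then have "\<delta> 0 v \<in> {x \<in> carrier (vec R 1). I +> x 0 = I}" unfolding im[symmetric] by blast
    then show "a \<in> I" using quotient_ring_module(5)[OF I, of a] v(2) by (simp add: vec_carrier)
  qed
qed

lemma hom_entries:
  assumes "h \<in> module_hom R (vec R k) (vec R l)" "v \<in> carrier (vec R k)"
  shows "h v b = (\<Oplus>j\<in>{..<k}. v j \<otimes> h (unit_vec j) b)"
  using linear_functional_vec[OF coordinate_functional[OF assms(1)] assms(2)] .

lemma f_in_I: "b < n \<Longrightarrow> f b \<in> I"
  using first_image[of "f b"] first_functional_unit[of b] unit_vec_free[of b "{..<n}"] by (metis lessThan_iff)

lemma koszul_relation:
  assumes "i < n" "j < n"
  defines "\<kappa> \<equiv> (\<lambda>b. f j \<otimes> unit_vec i b \<oplus> \<ominus> f i \<otimes> unit_vec j b)"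
  shows "\<kappa> \<in> carrier (vec R n)" "\<delta> 0 \<kappa> = (\<lambda>_. \<zero>)"
proof -
  interpret V: module R "vec R n" by (rule free_module_module)
  have e: "unit_vec i \<in> carrier (vec R n)" "unit_vec j \<in> carrier (vec R n)" using assms by auto
  have c: "f j \<odot>\<^bsub>vec R n\<^esub> unit_vec i \<in> carrier (vec R n)" "\<ominus> f i \<odot>\<^bsub>vec R n\<^esub> unit_vec j \<in> carrier (vec R n)"
    by (rule V.smult_closed; use e f in simp)+
  have \<kappa>: "\<kappa> = (f j \<odot>\<^bsub>vec R n\<^esub> unit_vec i) \<oplus>\<^bsub>vec R n\<^esub> (\<ominus> f i \<odot>\<^bsub>vec R n\<^esub> unit_vec j)"
    by (simp add: \<kappa>_def)
  show k: "\<kappa> \<in> carrier (vec R n)" unfolding \<kappa> by (rule V.add.m_closed[OF c])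
  have "\<delta> 0 \<kappa> 0 = f j \<otimes> f i \<oplus> \<ominus> f i \<otimes> f j"
    unfolding \<kappa> using module_homD(2)[OF first_functional c] module_homD(3)[OF first_functional f e(1)]
      module_homD(3)[OF first_functional a_inv_closed[OF f] e(2)] first_functional_unit assms(1,2)
    by (simp del: free_module_simps)
  then show "\<delta> 0 \<kappa> = (\<lambda>_. \<zero>)" using first_kernel[OF k] f by (simp add: l_minus r_minus m_comm r_neg)
qed

lemma first_map_not_injective:
  assumes inj: "\<And>v. v \<in> carrier (vec R n) \<Longrightarrow> \<delta> 0 v = (\<lambda>_. \<zero>) \<Longrightarrow> v = (\<lambda>_. \<zero>)" and n: "2 \<le> n"
  shows False
proof -
  have "(\<lambda>b :: nat. f 1 \<otimes> unit_vec 0 b \<oplus> \<ominus> f 0 \<otimes> unit_vec 1 b) = (\<lambda>_. \<zero>)"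
    by (rule inj; use koszul_relation[of 0 1] n in simp)
  from fun_cong[OF this, of 0] have "f 1 = \<zero>" using f by (simp add: unit_vec_apply)
  then have "\<delta> 0 (unit_vec 1) 0 = \<zero>" using first_functional_unit[of 1] n by simp
  moreover have e: "(unit_vec 1 :: nat \<Rightarrow> 'a) \<in> carrier (vec R n)" using n by simp
  ultimately have "(unit_vec 1 :: nat \<Rightarrow> 'a) = (\<lambda>_. \<zero>)" using first_kernel[OF e] inj[OF e] by simp
  from fun_cong[OF this, of 1] have "\<one> = \<zero>" by (simp add: unit_vec_def)
  then show False using one_notin_mm mm.zero_closed by simp
qed

text \<open>Cyclicity of Ext bounds the rank: by minimality, the coordinate functionals would all be
  multiples of one functional modulo \<open>\<mm>\<close>.\<close>
lemma last_rank_le_1: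
  assumes c: "c \<in> module_hom R (vec R (r (Suc (Suc k)))) (ring_module R)"
    and ext: "\<forall>l. \<exists>\<rho>\<in>carrier R. \<exists>w\<in>module_hom R (vec R (r (Suc k))) (ring_module R).
      \<forall>x\<in>carrier (vec R (r (Suc (Suc k)))). x l = \<rho> \<otimes> c x \<oplus> w (\<delta> (Suc k) x)"
  shows "r (Suc (Suc k)) \<le> 1"
proof (rule ccontr)
  assume "\<not> ?thesis"
  then have e: "(unit_vec 0 :: nat \<Rightarrow> 'a) \<in> carrier (vec R (r (Suc (Suc k))))"
    "(unit_vec 1 :: nat \<Rightarrow> 'a) \<in> carrier (vec R (r (Suc (Suc k))))" by auto
  have wm: "w (\<delta> (Suc k) x) \<in> \<mm>"
    if w: "w \<in> module_hom R (vec R (r (Suc k))) (ring_module R)" and x: "x \<in> carrier (vec R (r (Suc (Suc k))))" for w x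
    by (rule functional_mem_ideal[OF w module_homD(1)[OF res_hom x] mm.is_ideal res_entries_mm[OF x]])
  obtain \<rho>0 w0 where 0: "\<rho>0 \<in> carrier R" "w0 \<in> module_hom R (vec R (r (Suc k))) (ring_module R)"
    "\<And>x. x \<in> carrier (vec R (r (Suc (Suc k)))) \<Longrightarrow> x 0 = \<rho>0 \<otimes> c x \<oplus> w0 (\<delta> (Suc k) x)"
    using ext by blast
  obtain \<rho>1 w1 where 1: "\<rho>1 \<in> carrier R" "w1 \<in> module_hom R (vec R (r (Suc k))) (ring_module R)"
    "\<And>x. x \<in> carrier (vec R (r (Suc (Suc k)))) \<Longrightarrow> x 1 = \<rho>1 \<otimes> c x \<oplus> w1 (\<delta> (Suc k) x)"
    using ext by blast
  have cc: "c (unit_vec 0) \<in> carrier R" "c (unit_vec 1) \<in> carrier R"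
    using module_homD(1)[OF c e(1)] module_homD(1)[OF c e(2)] by simp_all
  have a: "\<one> = \<rho>0 \<otimes> c (unit_vec 0) \<oplus> w0 (\<delta> (Suc k) (unit_vec 0))"
    using 0(3)[OF e(1)] by (simp add: unit_vec_apply)
  have b: "\<zero> = \<rho>1 \<otimes> c (unit_vec 0) \<oplus> w1 (\<delta> (Suc k) (unit_vec 0))"
    using 1(3)[OF e(1)] by (simp add: unit_vec_apply)
  have d: "\<one> = \<rho>1 \<otimes> c (unit_vec 1) \<oplus> w1 (\<delta> (Suc k) (unit_vec 1))"
    using 1(3)[OF e(2)] by (simp add: unit_vec_apply)
  have "\<rho>1 \<notin> \<mm>"
  proof
    assume "\<rho>1 \<in> \<mm>"
    then have "\<rho>1 \<otimes> c (unit_vec 1) \<in> \<mm>" using cc by (intro mm.I_r_closed)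
    then have "\<one> \<in> \<mm>" using mm.a_closed[OF _ wm[OF 1(2) e(2)]] by (subst d) blast
    then show False using one_notin_mm by simp
  qed
  moreover have "c (unit_vec 0) \<notin> \<mm>"
  proof
    assume "c (unit_vec 0) \<in> \<mm>"
    then have "\<rho>0 \<otimes> c (unit_vec 0) \<in> \<mm>" using 0(1) by (intro mm.I_l_closed)
    then have "\<one> \<in> \<mm>" using mm.a_closed[OF _ wm[OF 0(2) e(1)]] by (subst a) blast
    then show False using one_notin_mm by simp
  qed
  moreover have "\<rho>1 \<otimes> c (unit_vec 0) \<in> \<mm>"
  proof -
    have m: "w1 (\<delta> (Suc k) (unit_vec 0)) \<in> \<mm>" by (rule wm[OF 1(2) e(1)])
    have "\<rho>1 \<otimes> c (unit_vec 0) = \<ominus> w1 (\<delta> (Suc k) (unit_vec 0))"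
      using b mm.Icarr[OF m] 1(1) cc(1) by (simp add: minus_equality[symmetric] add.inv_equality)
    then show ?thesis using m by simp
  qed
  ultimately show False
    using primeideal.I_prime[OF maximalideal_prime[OF max_ideal] 1(1) cc(1)] by blast
qed

text \<open>All Koszul relations would be multiples of one vector; for three indices this forces
  some \<open>f\<^sub>i\<close> with nonzero square to satisfy \<open>f\<^sub>i\<^sup>2 = 0\<close>.\<close>
lemma second_map_not_cyclic:
  assumes n: "3 \<le> n" and x1: "x1 \<in> I" "\<And>y. y \<in> carrier R \<Longrightarrow> x1 \<otimes> y = \<zero> \<Longrightarrow> y = \<zero>"
    and r2: "r (Suc (Suc 0)) \<le> 1"
  shows False
proof -
  define \<phi> where "\<phi> = (if r (Suc (Suc 0)) = 1 then \<delta> (Suc 0) (unit_vec 0) else (\<lambda>_. \<zero>))"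
  have \<phi>c: "\<phi> b \<in> carrier R" for b
  proof (cases "r (Suc (Suc 0)) = 1")
    case True
    then have "\<delta> (Suc 0) (unit_vec 0) \<in> carrier (vec R (r (Suc 0)))"
      by (intro module_homD(1)[OF res_hom[of "Suc 0"]]) simp
    then show ?thesis using True by (simp add: \<phi>_def vec_carrier)
  qed (simp add: \<phi>_def)
  have cyc: "\<exists>c\<in>carrier R. \<forall>b. z b = c \<otimes> \<phi> b" if z: "z \<in> carrier (vec R n)" "\<delta> 0 z = (\<lambda>_. \<zero>)" for z
  proof -
    have "z \<in> \<delta> (Suc 0) ` carrier (vec R (r (Suc (Suc 0))))" unfolding res_exact using z by (simp add: res_ranks)
    then obtain v where v: "z = \<delta> (Suc 0) v" "v \<in> carrier (vec R (r (Suc (Suc 0))))" by (rule imageE)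
    have zb: "z b = (\<Oplus>j\<in>{..<r (Suc (Suc 0))}. v j \<otimes> \<delta> (Suc 0) (unit_vec j) b)" for b
      unfolding v(1) by (rule hom_entries[OF res_hom v(2)])
    have vc: "v 0 \<in> carrier R" using v(2) by (simp add: vec_carrier)
    show ?thesis
    proof (cases "r (Suc (Suc 0)) = 1")
      case True
      then have "z b = v 0 \<otimes> \<phi> b" for b using zb[of b] vc \<phi>c[of b] by (simp add: \<phi>_def lessThan_Suc)
      then show ?thesis using vc by blast
    next
      case False
      then have "r (Suc (Suc 0)) = 0" using r2 by simp
      then have "z b = \<zero> \<otimes> \<phi> b" for b using zb[of b] \<phi>c by simp
      then show ?thesis by blast
    qed
  qed
  \<comment> \<open>Otherwise every \<open>f\<^sub>i\<close> would lie in an associated prime of \<open>R\<close>, and with them the regular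
    element \<open>x1\<close>.\<close>
  have "\<exists>i<n. f i \<otimes> f i \<noteq> \<zero>"
  proof (rule ccontr)
    assume no: "\<not> ?thesis"
    have "\<one> \<notin> {\<zero>}" using one_notin_mm mm.zero_closed by auto
    obtain s where s: "s \<in> carrier R" "s \<otimes> \<one> \<notin> {\<zero>}"
      "\<And>a b. a \<in> carrier R \<Longrightarrow> b \<in> carrier R \<Longrightarrow> a \<otimes> b \<otimes> (s \<otimes> \<one>) \<in> {\<zero>} \<Longrightarrow> a \<otimes> (s \<otimes> \<one>) \<in> {\<zero>} \<or> b \<otimes> (s \<otimes> \<one>) \<in> {\<zero>}"
      by (rule associated_prime[OF zeroideal one_closed \<open>\<one> \<notin> {\<zero>}\<close>]) (rule that, assumption+)
    have fs: "f i \<otimes> s = \<zero>" if "i < n" for i using s(3)[of "f i" "f i"] no that s(1) f by auto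
    obtain v where v: "v \<in> carrier (vec R n)" "x1 = \<delta> 0 v 0" using first_image x1(1) by blast
    have vc: "v j \<in> carrier R" for j using v(1) by (simp add: vec_carrier)
    have "x1 \<otimes> s = (\<Oplus>j\<in>{..<n}. f j \<otimes> v j \<otimes> s)"
      unfolding v(2) first_functional_eq[OF v(1)] by (rule finsum_ldistr) (use f vc s in auto)
    also have "\<dots> = \<zero>"
    proof (rule add.finprod_one_eqI)
      fix j assume j: "j \<in> {..<n}"
      have "f j \<otimes> v j \<otimes> s = v j \<otimes> (f j \<otimes> s)" using f vc s(1) by (simp add: m_ac)
      then show "f j \<otimes> v j \<otimes> s = \<zero>" using fs[of j] j vc by simp
    qed
    finally show False using x1(2)[OF s(1)] s(1,2) by simp
  qed
  then obtain i where i: "i < n" "f i \<otimes> f i \<noteq> \<zero>" by blast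
  obtain j k where jk: "j < n" "k < n" "i \<noteq> j" "i \<noteq> k" "j \<noteq> k"
  proof -
    have "card ({..<n} - {i}) \<ge> 2" using n i by simp
    then obtain j where j: "j \<in> {..<n} - {i}" by (metis card.empty equals0I not_numeral_le_zero)
    have "card ({..<n} - {i} - {j}) \<ge> 1" using n i j by simp
    then obtain k where "k \<in> {..<n} - {i} - {j}" by (metis card.empty equals0I not_one_le_zero)
    then show thesis using j that by auto
  qed
  obtain c where c: "c \<in> carrier R" "\<And>b. f j \<otimes> unit_vec i b \<oplus> \<ominus> f i \<otimes> unit_vec j b = c \<otimes> \<phi> b"
    using cyc[OF koszul_relation[OF i(1) jk(1)]] by blast
  obtain d where d: "d \<in> carrier R" "\<And>b. f k \<otimes> unit_vec i b \<oplus> \<ominus> f i \<otimes> unit_vec k b = d \<otimes> \<phi> b"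
    using cyc[OF koszul_relation[OF i(1) jk(2)]] by blast
  have 1: "\<ominus> f i = c \<otimes> \<phi> j" using c(2)[of j] jk f by (simp add: unit_vec_def)
  have 2: "\<zero> = d \<otimes> \<phi> j" using d(2)[of j] jk f by (simp add: unit_vec_def)
  have 3: "\<ominus> f i = d \<otimes> \<phi> k" using d(2)[of k] jk f by (simp add: unit_vec_def)
  have "f i \<otimes> f i = (\<ominus> f i) \<otimes> (\<ominus> f i)" using f by (simp add: l_minus r_minus)
  also have "\<dots> = (c \<otimes> \<phi> j) \<otimes> (d \<otimes> \<phi> k)" by (subst 1, subst 3) simp
  also have "\<dots> = c \<otimes> \<phi> k \<otimes> (d \<otimes> \<phi> j)" using c(1) d(1) \<phi>c by (simp add: m_ac)
  also have "\<dots> = \<zero>" using 2[symmetric] c(1) \<phi>c by simp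
  finally show False using i(2) by simp
qed

context
  fixes x1 x2 x3 :: 'a
  assumes x: "x1 \<in> I" "x2 \<in> I" "x3 \<in> I"
    and reg1: "\<And>y. y \<in> carrier R \<Longrightarrow> x1 \<otimes> y = \<zero> \<Longrightarrow> y = \<zero>"
    and reg2: "\<And>y. y \<in> carrier R \<Longrightarrow> x2 \<otimes> y \<in> Idl {x1} \<Longrightarrow> y \<in> Idl {x1}"
    and reg3: "\<And>y. y \<in> carrier R \<Longrightarrow> x3 \<otimes> y \<in> Idl {x1, x2} \<Longrightarrow> y \<in> Idl {x1, x2}"
begin

lemma I_faithful: "t \<in> carrier R \<Longrightarrow> (\<And>a. a \<in> I \<Longrightarrow> t \<otimes> a = \<zero>) \<Longrightarrow> t = \<zero>"
  using reg1[of t] x(1) m_comm[of x1 t] ideal.Icarr[OF I x(1)] by simp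

lemma f_annihilator:
  assumes t: "t \<in> carrier R" "\<And>b. b < n \<Longrightarrow> t \<otimes> f b = \<zero>"
  shows "t = \<zero>"
proof (rule I_faithful[OF t(1)])
  fix a assume "a \<in> I"
  then obtain v where v: "v \<in> carrier (vec R n)" "a = \<delta> 0 v 0" using first_image by blast
  have vc: "v j \<in> carrier R" for j using v(1) by (simp add: vec_carrier)
  have "t \<otimes> a = (\<Oplus>j\<in>{..<n}. t \<otimes> (f j \<otimes> v j))"
    unfolding v(2) first_functional_eq[OF v(1)] by (rule finsum_rdistr) (use f vc t in auto)
  also have "\<dots> = \<zero>"
  proof (rule add.finprod_one_eqI)
    fix j assume "j \<in> {..<n}"
    then show "t \<otimes> (f j \<otimes> v j) = \<zero>" using t(2)[of j] t(1) f vc by (simp add: m_assoc[symmetric])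
  qed
  finally show "t \<otimes> a = \<zero>" .
qed

lemma first_dual_exact:
  assumes W: "W \<in> module_hom R (vec R n) (ring_module R)"
    and van: "\<And>v. v \<in> carrier (vec R n) \<Longrightarrow> \<delta> 0 v = (\<lambda>_. \<zero>) \<Longrightarrow> W v = \<zero>"
  shows "\<exists>u\<in>carrier R. \<forall>v\<in>carrier (vec R n). W v = u \<otimes> \<delta> 0 v 0"
proof -
  obtain y1 where y1: "y1 \<in> carrier (vec R n)" "x1 = \<delta> 0 y1 0" using first_image x(1) by blast
  obtain y2 where y2: "y2 \<in> carrier (vec R n)" "x2 = \<delta> 0 y2 0" using first_image x(2) by blast
  have xc: "x1 \<in> carrier R" using ideal.Icarr[OF I x(1)] .
  have I1: "Idl {x1} = {j \<oplus> x1 \<otimes> r | j r. j \<in> {\<zero>} \<and> r \<in> carrier R}"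
    using genideal_insert[of "{}" x1] xc by (simp add: genideal_empty)
  have "\<exists>u\<in>carrier R. \<forall>v\<in>carrier (vec R n). W v \<ominus> u \<otimes> \<delta> 0 v 0 \<in> {\<zero>}"
  proof (rule functional_multiple[OF free_module_module first_functional W zeroideal y1(1) y2(1)])
    show "W v \<in> {\<zero>}" if "v \<in> carrier (vec R n)" "\<delta> 0 v 0 \<in> {\<zero>}" for v
      using van[OF that(1)] first_kernel[OF that(1)] that(2) by simp
    show "y \<in> {\<zero>}" if "y \<in> carrier R" "\<delta> 0 y1 0 \<otimes> y \<in> {\<zero>}" for y
      using reg1[OF that(1)] that(2) y1(2) by simp
    fix y j r assume h: "y \<in> carrier R" "j \<in> {\<zero>}" "r \<in> carrier R" "\<delta> 0 y2 0 \<otimes> y = j \<oplus> \<delta> 0 y1 0 \<otimes> r"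
    have "x2 \<otimes> y = j \<oplus> x1 \<otimes> r" using h(4) y1(2) y2(2) by simp
    then have "x2 \<otimes> y \<in> Idl {x1}" unfolding I1 using h(2,3) by blast
    then have "y \<in> Idl {x1}" by (rule reg2[OF h(1)])
    then obtain j' r' where "y = j' \<oplus> x1 \<otimes> r'" "j' \<in> {\<zero>}" "r' \<in> carrier R" unfolding I1 by blast
    then show "\<exists>j'\<in>{\<zero>}. \<exists>r'\<in>carrier R. y = j' \<oplus> \<delta> 0 y1 0 \<otimes> r'" using y1(2) by auto
  qed
  then obtain u where u: "u \<in> carrier R" "\<And>v. v \<in> carrier (vec R n) \<Longrightarrow> W v \<ominus> u \<otimes> \<delta> 0 v 0 = \<zero>" by blast
  have "W v = u \<otimes> \<delta> 0 v 0" if v: "v \<in> carrier (vec R n)" for v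
  proof -
    have "W v \<in> carrier R" "\<delta> 0 v 0 \<in> carrier R"
      using module_homD(1)[OF W v] module_homD(1)[OF first_functional v] by simp_all
    then show ?thesis using u(2)[OF v] u(1) by simp
  qed
  then show ?thesis using u(1) by blast
qed

lemma second_dual_exact:
  assumes G: "G \<in> module_hom R (vec R (r (Suc (Suc 0)))) (ring_module R)"
    and van: "\<And>z. z \<in> carrier (vec R (r (Suc (Suc 0)))) \<Longrightarrow> \<delta> (Suc 0) z = (\<lambda>_. \<zero>) \<Longrightarrow> G z = \<zero>"
  shows "\<exists>w\<in>module_hom R (vec R n) (ring_module R). \<forall>z\<in>carrier (vec R (r (Suc (Suc 0)))). G z = w (\<delta> (Suc 0) z)"
proof -
  obtain y1 where y1: "y1 \<in> carrier (vec R n)" "x1 = \<delta> 0 y1 0" using first_image x(1) by blast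
  obtain y2 where y2: "y2 \<in> carrier (vec R n)" "x2 = \<delta> 0 y2 0" using first_image x(2) by blast
  obtain y3 where y3: "y3 \<in> carrier (vec R n)" "x3 = \<delta> 0 y3 0" using first_image x(3) by blast
  have D: "\<delta> (Suc 0) \<in> module_hom R (vec R (r (Suc (Suc 0)))) (vec R n)"
    using res_hom[of "Suc 0"] by (simp add: res_ranks)
  have ex: "\<delta> (Suc 0) ` carrier (vec R (r (Suc (Suc 0)))) = {v \<in> carrier (vec R n). \<delta> 0 v 0 = \<zero>}"
    unfolding res_exact using first_kernel by (auto simp: res_ranks)
  show ?thesis
    by (rule functional_extension[OF free_module_module D first_functional ex G van y1(1) y2(1) y3(1)])
      (use reg1 reg2 reg3 y1(2) y2(2) y3(2) in auto)
qed

text \<open>If the last module were zero, \<open>\<delta> 1\<close> would be injective, and a coordinate functional would factor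
  through it by the exactness of the dual complex; but the entries of \<open>\<delta> 1\<close> lie in \<open>\<mm>\<close>.\<close>
lemma last_rank_pos:
  assumes n: "2 \<le> n"
  shows "r (Suc (Suc (Suc 0))) \<noteq> 0"
proof
  assume r3: "r (Suc (Suc (Suc 0))) = 0"
  have zero: "z = (\<lambda>_. \<zero>)" if "z \<in> carrier (vec R 0)" for z using that by (auto simp: free_carrier)
  have ker: "z = (\<lambda>_. \<zero>)" if z: "z \<in> carrier (vec R (r (Suc (Suc 0))))" "\<delta> (Suc 0) z = (\<lambda>_. \<zero>)" for z
  proof -
    have "z \<in> \<delta> (Suc (Suc 0)) ` carrier (vec R (r (Suc (Suc (Suc 0)))))" unfolding res_exact using z by simp
    then obtain v where v: "z = \<delta> (Suc (Suc 0)) v" "v \<in> carrier (vec R 0)" unfolding r3 by (rule imageE)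
    then have "z = \<delta> (Suc (Suc 0)) (\<lambda>_. \<zero>)" using zero by simp
    then show ?thesis using module_hom_zero[OF free_module_module free_module_module res_hom[of "Suc (Suc 0)"]] by simp
  qed
  show False
  proof (cases "r (Suc (Suc 0)) = 0")
    case True
    have "v = (\<lambda>_. \<zero>)" if v: "v \<in> carrier (vec R n)" "\<delta> 0 v = (\<lambda>_. \<zero>)" for v
    proof -
      have "v \<in> \<delta> (Suc 0) ` carrier (vec R (r (Suc (Suc 0))))" unfolding res_exact using v by (simp add: res_ranks)
      then obtain w where w: "v = \<delta> (Suc 0) w" "w \<in> carrier (vec R 0)" unfolding True by (rule imageE)
      then have "v = \<delta> (Suc 0) (\<lambda>_. \<zero>)" using zero by simp
      then show ?thesis using module_hom_zero[OF free_module_module free_module_module res_hom[of "Suc 0"]] by simp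
    qed
    then show False by (rule first_map_not_injective[OF _ n])
  next
    case False
    let ?e = "unit_vec 0 :: nat \<Rightarrow> 'a"
    have e: "?e \<in> carrier (vec R (r (Suc (Suc 0))))" using False by simp
    have "(\<lambda>z. z 0) \<in> module_hom R (vec R (r (Suc (Suc 0)))) (ring_module R)"
      by (rule coordinate_functional[OF module_hom_id])
    then obtain w where w: "w \<in> module_hom R (vec R n) (ring_module R)"
      "\<And>z. z \<in> carrier (vec R (r (Suc (Suc 0)))) \<Longrightarrow> z 0 = w (\<delta> (Suc 0) z)"
      using second_dual_exact[of "\<lambda>z. z 0"] ker by auto
    have dx: "\<delta> (Suc 0) ?e \<in> carrier (vec R n)" using module_homD(1)[OF res_hom e] by (simp add: res_ranks)
    have "w (\<delta> (Suc 0) ?e) \<in> \<mm>"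
      by (rule functional_mem_ideal[OF w(1) dx mm.is_ideal res_entries_mm[OF e]])
    then have "?e 0 \<in> \<mm>" using w(2)[OF e] by simp
    then show False using one_notin_mm by (simp add: unit_vec_def)
  qed
qed

text \<open>Exactness of the dual complex was obtained for functionals; here it is expressed by matrices.
  Entries of \<open>\<rho>\<close> beyond the rank are set to zero because \<open>\<delta> 1\<close> is only controlled on its domain.\<close>
lemma dual_exact:
  assumes inj: "\<And>v. v \<in> carrier (vec R (r (Suc (Suc (Suc 0))))) \<Longrightarrow> \<delta> (Suc (Suc 0)) v = (\<lambda>_. \<zero>) \<Longrightarrow> v = (\<lambda>_. \<zero>)"
    and r3: "r (Suc (Suc (Suc 0))) = 1"
    and ext: "\<forall>a\<in>I. \<forall>l. \<exists>w\<in>module_hom R (vec R (r (Suc (Suc 0)))) (ring_module R).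
      \<forall>x\<in>carrier (vec R (r (Suc (Suc (Suc 0))))). a \<otimes> x l = w (\<delta> (Suc (Suc 0)) x)"
  shows "dual_exact_complex R \<mm> n (r (Suc (Suc 0)))
    (\<lambda>b j. if j < r (Suc (Suc 0)) then \<delta> (Suc 0) (unit_vec j) b else \<zero>) f (\<delta> (Suc (Suc 0)) (unit_vec 0))"
proof -
  let ?m = "r (Suc (Suc 0))"
  let ?\<rho> = "\<lambda>b j. if j < ?m then \<delta> (Suc 0) (unit_vec j) b else \<zero>"
  let ?e = "unit_vec 0 :: nat \<Rightarrow> 'a"
  let ?\<psi> = "\<delta> (Suc (Suc 0)) ?e"
  have D1: "\<delta> (Suc 0) \<in> module_hom R (vec R ?m) (vec R n)" using res_hom[of "Suc 0"] by (simp add: res_ranks)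
  have D2: "\<delta> (Suc (Suc 0)) \<in> module_hom R (vec R 1) (vec R ?m)" using res_hom[of "Suc (Suc 0)"] by (simp add: r3)
  have ex1: "\<delta> (Suc 0) ` carrier (vec R ?m) = {v \<in> carrier (vec R n). \<delta> 0 v = (\<lambda>_. \<zero>)}"
    using res_exact[of 0] by (simp add: res_ranks)
  have ex2: "\<delta> (Suc (Suc 0)) ` carrier (vec R 1) = {v \<in> carrier (vec R ?m). \<delta> (Suc 0) v = (\<lambda>_. \<zero>)}"
    using res_exact[of "Suc 0"] by (simp add: r3)
  have e: "?e \<in> carrier (vec R 1)" by simp
  have \<psi>v: "?\<psi> \<in> carrier (vec R ?m)" "\<delta> (Suc 0) ?\<psi> = (\<lambda>_. \<zero>)" using ex2 e by blast+
  have \<delta>c: "\<delta> (Suc 0) (unit_vec j) b \<in> carrier R" if "j < ?m" for b j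
  proof -
    have "\<delta> (Suc 0) (unit_vec j) \<in> carrier (vec R n)" using that by (intro module_homD(1)[OF D1]) simp
    then show ?thesis by (simp add: vec_carrier)
  qed
  then have \<rho>c: "?\<rho> b j \<in> carrier R" for b j by simp
  have \<psi>c: "?\<psi> j \<in> carrier R" for j using \<psi>v(1) by (simp add: vec_carrier)
  have tr: "(\<lambda>j. if j < k then w j else \<zero>) \<in> carrier (vec R k)" if "\<And>j. w j \<in> carrier R" for w :: "nat \<Rightarrow> 'a" and k
    using that by (auto simp: vec_carrier)
  have D1e: "\<delta> (Suc 0) v b = (\<Oplus>j\<in>{..<?m}. ?\<rho> b j \<otimes> v j)" if v: "v \<in> carrier (vec R ?m)" for v b
  proof -
    have vc: "v j \<in> carrier R" for j using v by (simp add: vec_carrier)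
    have "\<delta> (Suc 0) v b = (\<Oplus>j\<in>{..<?m}. v j \<otimes> \<delta> (Suc 0) (unit_vec j) b)" by (rule hom_entries[OF D1 v])
    also have "\<dots> = (\<Oplus>j\<in>{..<?m}. ?\<rho> b j \<otimes> v j)"
      by (rule finsum_cong') (use vc \<delta>c in \<open>auto simp: m_comm split: if_splits\<close>)
    finally show ?thesis .
  qed
  have col: "\<delta> (Suc 0) (unit_vec j) \<in> carrier (vec R n)" "\<delta> 0 (\<delta> (Suc 0) (unit_vec j)) = (\<lambda>_. \<zero>)" if "j < ?m" for j
  proof -
    have "\<delta> (Suc 0) (unit_vec j) \<in> \<delta> (Suc 0) ` carrier (vec R ?m)" by (rule imageI) (use that in simp)
    then show "\<delta> (Suc 0) (unit_vec j) \<in> carrier (vec R n)" "\<delta> 0 (\<delta> (Suc 0) (unit_vec j)) = (\<lambda>_. \<zero>)"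
      unfolding ex1 by simp_all
  qed
  have mult: "\<exists>t\<in>carrier R. \<forall>j. z j = t \<otimes> ?\<psi> j" if z: "z \<in> carrier (vec R ?m)" "\<delta> (Suc 0) z = (\<lambda>_. \<zero>)" for z
  proof -
    have "z \<in> \<delta> (Suc (Suc 0)) ` carrier (vec R 1)" unfolding ex2 using z by simp
    then obtain v where v: "z = \<delta> (Suc (Suc 0)) v" "v \<in> carrier (vec R 1)" by (rule imageE)
    have vc: "v 0 \<in> carrier R" using v(2) by (simp add: vec_carrier)
    have "z j = v 0 \<otimes> ?\<psi> j" for j
      unfolding v(1) using hom_entries[OF D2 v(2), of j] vc \<psi>c[of j] by (simp add: lessThan_Suc)
    then show ?thesis using vc by blast
  qed
  show ?thesis
  proof (intro dual_exact_complex.intro dual_exact_complex_axioms.intro noetherian_local_axioms)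
    show "?\<rho> b j \<in> carrier R" for b j by (rule \<rho>c)
    show "f b \<in> carrier R" for b by (rule f)
    show "?\<psi> j \<in> carrier R" for j by (rule \<psi>c)
    show "?\<rho> b j \<in> \<mm>" if "b < n" "j < ?m" for b j
      using that res_entries_mm[of "unit_vec j" 0 b] by simp
    show "(\<Oplus>b\<in>{..<n}. f b \<otimes> ?\<rho> b j) = \<zero>" if "j < ?m" for j
      using first_functional_eq[OF col(1)[OF that]] fun_cong[OF col(2)[OF that], of 0] that by simp
    show "(\<Oplus>j\<in>{..<?m}. ?\<rho> b j \<otimes> ?\<psi> j) = \<zero>" if "b < n" for b
      using D1e[OF \<psi>v(1), of b] \<psi>v(2) by simp
  next
    fix w :: "nat \<Rightarrow> 'a" assume w: "\<And>j. w j \<in> carrier R" "\<And>b. b < n \<Longrightarrow> (\<Oplus>j\<in>{..<?m}. ?\<rho> b j \<otimes> w j) = \<zero>"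
    let ?w = "\<lambda>j. if j < ?m then w j else \<zero>"
    have v: "?w \<in> carrier (vec R ?m)" by (rule tr[OF w(1)])
    have "\<delta> (Suc 0) ?w b = \<zero>" for b
    proof (cases "b < n")
      case True
      have "\<delta> (Suc 0) ?w b = (\<Oplus>j\<in>{..<?m}. ?\<rho> b j \<otimes> ?w j)" by (rule D1e[OF v])
      also have "\<dots> = (\<Oplus>j\<in>{..<?m}. ?\<rho> b j \<otimes> w j)"
        by (rule finsum_cong') (use w \<delta>c in \<open>auto split: if_splits\<close>)
      finally show ?thesis using w(2)[OF True] by simp
    next
      case False
      then show ?thesis using module_homD(1)[OF D1 v] by (simp add: vec_carrier)
    qed
    then obtain t where t: "t \<in> carrier R" "\<And>j. ?w j = t \<otimes> ?\<psi> j" using mult[OF v] by auto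
    have "w j = t \<otimes> ?\<psi> j" if "j < ?m" for j using t(2)[of j] that by simp
    then show "\<exists>t\<in>carrier R. \<forall>j<?m. w j = t \<otimes> ?\<psi> j" using t(1) by blast
  next
    fix z :: "nat \<Rightarrow> 'a" assume z: "\<And>b. z b \<in> carrier R" "(\<Oplus>b\<in>{..<n}. f b \<otimes> z b) = \<zero>"
    let ?z = "\<lambda>j. if j < n then z j else \<zero>"
    have v: "?z \<in> carrier (vec R n)" by (rule tr[OF z(1)])
    have "(\<Oplus>b\<in>{..<n}. f b \<otimes> ?z b) = (\<Oplus>b\<in>{..<n}. f b \<otimes> z b)"
      by (rule finsum_cong') (use z f in auto)
    then have "\<delta> 0 ?z = (\<lambda>_. \<zero>)" using first_kernel[OF v] first_functional_eq[OF v] z(2) by simp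
    then have "?z \<in> \<delta> (Suc 0) ` carrier (vec R ?m)" unfolding ex1 using v by simp
    then obtain y where y: "?z = \<delta> (Suc 0) y" "y \<in> carrier (vec R ?m)" by (rule imageE)
    have "z b = (\<Oplus>j\<in>{..<?m}. ?\<rho> b j \<otimes> y j)" if "b < n" for b
      using fun_cong[OF y(1), of b] D1e[OF y(2), of b] that by simp
    moreover have "\<forall>j. y j \<in> carrier R" using y(2) by (simp add: vec_carrier)
    ultimately show "\<exists>y. (\<forall>j. y j \<in> carrier R) \<and> (\<forall>b<n. z b = (\<Oplus>j\<in>{..<?m}. ?\<rho> b j \<otimes> y j))" by blast
  next
    fix c :: "nat \<Rightarrow> 'a" assume c: "\<And>b. c b \<in> carrier R" "\<And>j. j < ?m \<Longrightarrow> (\<Oplus>b\<in>{..<n}. c b \<otimes> ?\<rho> b j) = \<zero>"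
    let ?W = "\<lambda>v. \<Oplus>b\<in>{..<n}. c b \<otimes> v b"
    have W: "?W \<in> module_hom R (vec R n) (ring_module R)" by (rule dot_functional[OF c(1)])
    have "?W v = \<zero>" if v: "v \<in> carrier (vec R n)" "\<delta> 0 v = (\<lambda>_. \<zero>)" for v
    proof -
      have "v \<in> \<delta> (Suc 0) ` carrier (vec R ?m)" unfolding ex1 using v by simp
      then obtain y where y: "v = \<delta> (Suc 0) y" "y \<in> carrier (vec R ?m)" by (rule imageE)
      have yc: "y j \<in> carrier R" for j using y(2) by (simp add: vec_carrier)
      have "?W v = (\<Oplus>b\<in>{..<n}. c b \<otimes> (\<Oplus>j\<in>{..<?m}. ?\<rho> b j \<otimes> y j))" unfolding y(1) by (simp only: D1e[OF y(2)])
      also have "\<dots> = (\<Oplus>j\<in>{..<?m}. (\<Oplus>b\<in>{..<n}. c b \<otimes> ?\<rho> b j) \<otimes> y j)"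
        by (rule bilinear_assoc) (use c(1) \<rho>c yc in blast)+
      also have "\<dots> = \<zero>" by (rule add.finprod_one_eqI) (use c(2) yc in simp)
      finally show ?thesis .
    qed
    then obtain u where u: "u \<in> carrier R" "\<forall>v\<in>carrier (vec R n). ?W v = u \<otimes> \<delta> 0 v 0"
      using first_dual_exact[OF W] by blast
    have "c b = u \<otimes> f b" if b: "b < n" for b
    proof -
      have "?W (unit_vec b) = c b" by (rule finsum_delta) (use b c in auto)
      moreover have "?W (unit_vec b) = u \<otimes> \<delta> 0 (unit_vec b) 0" using u(2) unit_vec_free[of b "{..<n}"] b by blast
      ultimately show ?thesis using first_functional_unit[OF b] by simp
    qed
    then show "\<exists>u\<in>carrier R. \<forall>b<n. c b = u \<otimes> f b" using u(1) by blast
  next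
    fix g :: "nat \<Rightarrow> 'a" assume g: "\<And>j. g j \<in> carrier R" "(\<Oplus>j\<in>{..<?m}. g j \<otimes> ?\<psi> j) = \<zero>"
    let ?G = "\<lambda>v. \<Oplus>j\<in>{..<?m}. g j \<otimes> v j"
    have G: "?G \<in> module_hom R (vec R ?m) (ring_module R)" by (rule dot_functional[OF g(1)])
    have "?G z = \<zero>" if z: "z \<in> carrier (vec R ?m)" "\<delta> (Suc 0) z = (\<lambda>_. \<zero>)" for z
    proof -
      obtain t where t: "t \<in> carrier R" "\<And>j. z j = t \<otimes> ?\<psi> j" using mult[OF z] by blast
      have "?G z = (\<Oplus>j\<in>{..<?m}. t \<otimes> (g j \<otimes> ?\<psi> j))"
        by (rule finsum_cong') (use t g(1) \<psi>c in \<open>auto simp: m_lcomm\<close>)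
      also have "\<dots> = t \<otimes> (\<Oplus>j\<in>{..<?m}. g j \<otimes> ?\<psi> j)"
        by (rule finsum_rdistr[symmetric]) (use t g(1) \<psi>c in auto)
      finally show ?thesis using g(2) t(1) by simp
    qed
    then obtain w where w: "w \<in> module_hom R (vec R n) (ring_module R)"
      "\<forall>z\<in>carrier (vec R ?m). ?G z = w (\<delta> (Suc 0) z)"
      using second_dual_exact[OF G] by blast
    have we: "w (unit_vec b) \<in> carrier R" if "b < n" for b using module_homD(1)[OF w(1), of "unit_vec b"] that by simp
    let ?w = "\<lambda>b. if b < n then w (unit_vec b) else \<zero>"
    have "g j = (\<Oplus>b\<in>{..<n}. ?w b \<otimes> ?\<rho> b j)" if j: "j < ?m" for j
    proof -
      have "g j = ?G (unit_vec j)" by (rule finsum_delta(1)[symmetric]) (use j g in auto)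
      also have "\<dots> = w (\<delta> (Suc 0) (unit_vec j))" using w(2) unit_vec_free[of j "{..<?m}"] j by blast
      also have "\<dots> = (\<Oplus>b\<in>{..<n}. \<delta> (Suc 0) (unit_vec j) b \<otimes> w (unit_vec b))"
        by (rule linear_functional_vec[OF w(1) col(1)[OF j]])
      also have "\<dots> = (\<Oplus>b\<in>{..<n}. ?w b \<otimes> ?\<rho> b j)"
        by (rule finsum_cong') (use we \<delta>c j in \<open>auto simp: m_comm\<close>)
      finally show ?thesis .
    qed
    moreover have "\<forall>b. ?w b \<in> carrier R" using we by simp
    ultimately show "\<exists>w. (\<forall>b. w b \<in> carrier R) \<and> (\<forall>j<?m. g j = (\<Oplus>b\<in>{..<n}. w b \<otimes> ?\<rho> b j))"
      by (intro exI[of _ ?w] conjI allI impI) simp_all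
  next
    fix t assume t: "t \<in> carrier R" "\<And>j. j < ?m \<Longrightarrow> t \<otimes> ?\<psi> j = \<zero>"
    interpret V: module R "vec R 1" by (rule free_module_module)
    have te: "t \<odot>\<^bsub>vec R 1\<^esub> ?e \<in> carrier (vec R 1)" by (rule V.smult_closed[OF t(1) e])
    have "\<delta> (Suc (Suc 0)) (t \<odot>\<^bsub>vec R 1\<^esub> ?e) j = \<zero>" for j
    proof -
      have "\<delta> (Suc (Suc 0)) (t \<odot>\<^bsub>vec R 1\<^esub> ?e) j = t \<otimes> ?\<psi> j" using module_homD(3)[OF D2 t(1) e] by simp
      then show ?thesis using t \<psi>v(1) by (cases "j < ?m") (auto simp: vec_carrier)
    qed
    then have "t \<odot>\<^bsub>vec R 1\<^esub> ?e = (\<lambda>_. \<zero>)" using inj te unfolding r3 by blast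
    from fun_cong[OF this, of 0] show "t = \<zero>" using t(1) by (simp add: unit_vec_def)
  next
    fix t assume "t \<in> carrier R" "\<And>b. b < n \<Longrightarrow> t \<otimes> f b = \<zero>"
    then show "t = \<zero>" by (rule f_annihilator)
  next
    fix b assume b: "b < n"
    obtain w where w: "w \<in> module_hom R (vec R ?m) (ring_module R)"
      "\<forall>x\<in>carrier (vec R 1). f b \<otimes> x 0 = w (\<delta> (Suc (Suc 0)) x)"
      using ext f_in_I[OF b] unfolding r3 by blast
    have we: "w (unit_vec j) \<in> carrier R" if "j < ?m" for j using module_homD(1)[OF w(1), of "unit_vec j"] that by simp
    let ?w = "\<lambda>j. if j < ?m then w (unit_vec j) else \<zero>"
    have "f b = w ?\<psi>" using bspec[OF w(2) e] f by (simp add: unit_vec_apply)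
    also have "\<dots> = (\<Oplus>j\<in>{..<?m}. ?\<psi> j \<otimes> w (unit_vec j))" by (rule linear_functional_vec[OF w(1) \<psi>v(1)])
    also have "\<dots> = (\<Oplus>j\<in>{..<?m}. ?w j \<otimes> ?\<psi> j)"
      by (rule finsum_cong') (use we \<psi>c in \<open>auto simp: m_comm\<close>)
    finally have "f b = (\<Oplus>j\<in>{..<?m}. ?w j \<otimes> ?\<psi> j)" .
    moreover have "\<forall>j. ?w j \<in> carrier R" using we by simp
    ultimately show "\<exists>c. (\<forall>j. c j \<in> carrier R) \<and> f b = (\<Oplus>j\<in>{..<?m}. c j \<otimes> ?\<psi> j)"
      by (intro exI[of _ ?w] conjI)
  qed
qed

end

end

end


section \<open>The annihilator of the first Koszul homology\<close>

context cring begin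

text \<open>The syzygy \<open>z\<close> is a cycle of degree one. If \<open>x\<close> kills its class, then \<open>x z\<close> is a boundary,
  whose coordinates are combinations of the \<open>f\<^sub>k\<close>.\<close>
lemma koszul_annihilator_syzygy:
  assumes fs: "set fs \<subseteq> carrier R" and x: "x \<in> annihilator R (koszul_homology R fs 1)"
    and z: "\<And>j. z j \<in> carrier R" "(\<Oplus>j\<in>{..<length fs}. fs ! j \<otimes> z j) = \<zero>" and j: "j < length fs"
  shows "x \<otimes> z j \<in> Idl (set fs)"
proof -
  let ?n = "length fs"
  let ?C = "koszul_module R ?n"
  let ?d = "koszul_diff R fs"
  have xc: "x \<in> carrier R" using x by (simp add: annihilator_def)
  have fc: "fs ! k \<in> carrier R" if "k < ?n" for k using fs that by auto
  have b0: "koszul_basis ?n 0 = {{}}"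
    by (auto simp: koszul_basis_def dest: finite_subset)
  have b1: "S \<in> koszul_basis ?n 1 \<longleftrightarrow> (\<exists>k<?n. S = {k})" for S
    by (auto simp: koszul_basis_def card_1_singleton_iff)
  define zz where "zz = (\<lambda>S\<in>koszul_basis ?n 1. z (the_elem S))"
  have zzk: "zz {k} = z k" if "k < ?n" for k using that b1 by (auto simp: zz_def)
  have zzc: "zz \<in> carrier (?C 1)" using z by (auto simp: koszul_module_def zz_def)
  have "?d 0 zz = \<zero>\<^bsub>?C 0\<^esub>"
  proof -
    have "(\<Oplus>k\<in>{..<?n} - {}. (\<ominus> \<one>) [^] card {j \<in> {}. j < k} \<otimes> (fs ! k \<otimes> zz (insert k {}))) = (\<Oplus>k\<in>{..<?n}. fs ! k \<otimes> z k)"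
      by (rule finsum_cong') (use zzk fc z in auto)
    then show ?thesis using z(2) by (auto simp: koszul_diff_def koszul_module_def b0 fun_eq_iff restrict_def)
  qed
  then have cyc: "zz \<in> cycles ?C ?d 1" using zzc by (simp add: cycles_def)
  let ?C' = "(?C 1)\<lparr>carrier := cycles ?C ?d 1\<rparr>"
  let ?B = "?d 1 ` carrier (?C (Suc 1))"
  have H: "koszul_homology R fs 1 = quotient_module ?C' ?B"
    by (simp add: koszul_homology_def homology_module_def)
  have cos: "a_r_coset ?C' B y = {(\<lambda>S\<in>koszul_basis ?n 1. b S \<oplus> y S) | b. b \<in> B}" for B y
    by (auto simp: a_r_coset_def r_coset_def koszul_module_def)
  have zeroB: "(\<lambda>S\<in>koszul_basis ?n 1. \<zero>) \<in> ?B"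
  proof (rule image_eqI)
    show "(\<lambda>S\<in>koszul_basis ?n (Suc 1). \<zero>) \<in> carrier (?C (Suc 1))" by (auto simp: koszul_module_def)
    show "(\<lambda>S\<in>koszul_basis ?n 1. \<zero>) = ?d 1 (\<lambda>S\<in>koszul_basis ?n (Suc 1). \<zero>)"
    proof (rule ext)
      fix T
      show "(\<lambda>S\<in>koszul_basis ?n 1. \<zero>) T = ?d 1 (\<lambda>S\<in>koszul_basis ?n (Suc 1). \<zero>) T"
      proof (cases "T \<in> koszul_basis ?n 1")
        case True
        have "(\<Oplus>k\<in>{..<?n} - T. (\<ominus> \<one>) [^] card {j \<in> T. j < k} \<otimes> (fs ! k \<otimes> (\<lambda>S\<in>koszul_basis ?n (Suc 1). \<zero>) (insert k T))) = \<zero>"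
        proof (rule add.finprod_one_eqI)
          fix k assume k: "k \<in> {..<?n} - T"
          then have "insert k T \<in> koszul_basis ?n (Suc 1)"
            using True finite_subset[of T "{..<?n}"] by (auto simp: koszul_basis_def)
          then show "(\<ominus> \<one>) [^] card {j \<in> T. j < k} \<otimes> (fs ! k \<otimes> (\<lambda>S\<in>koszul_basis ?n (Suc 1). \<zero>) (insert k T)) = \<zero>"
            using fc k by simp
        qed
        then show ?thesis using True by (simp add: koszul_diff_def)
      qed (simp add: koszul_diff_def)
    qed
  qed
  have self: "y \<in> a_r_coset ?C' ?B y" if y: "y \<in> carrier (?C 1)" for y
  proof -
    have "y = (\<lambda>S\<in>koszul_basis ?n 1. (\<lambda>S\<in>koszul_basis ?n 1. \<zero>) S \<oplus> y S)"
      using y by (auto simp: koszul_module_def fun_eq_iff PiE_def Pi_def extensional_def)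
    then show ?thesis unfolding cos using zeroB by blast
  qed
  let ?x = "\<lambda>y. \<lambda>S\<in>koszul_basis ?n 1. x \<otimes> y S"
  have xz: "?x zz \<in> carrier (?C 1)" using xc z by (auto simp: koszul_module_def zz_def)
  have "a_r_coset ?C' ?B zz \<in> carrier (koszul_homology R fs 1)"
    unfolding H quotient_module_def A_RCOSETS_def RCOSETS_def using cyc by (auto simp: a_r_coset_def)
  then have "x \<odot>\<^bsub>koszul_homology R fs 1\<^esub> a_r_coset ?C' ?B zz = \<zero>\<^bsub>koszul_homology R fs 1\<^esub>"
    using x by (simp add: annihilator_def)
  then have "(\<Union>y\<in>a_r_coset ?C' ?B zz. a_r_coset ?C' ?B (?x y)) = ?B"
    unfolding H quotient_module_def by (simp add: koszul_module_def)
  then have "?x zz \<in> ?B" using self[OF zzc] self[OF xz] by blast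
  then obtain w where w: "?x zz = ?d 1 w" "w \<in> carrier (?C (Suc 1))" by (rule imageE)
  interpret I: ideal "Idl (set fs)" R by (rule genideal_ideal[OF fs])
  have wc: "w (insert k {j}) \<in> carrier R" if "k \<in> {..<?n} - {j}" for k
  proof -
    have "insert k {j} \<in> koszul_basis ?n (Suc 1)" using that j by (auto simp: koszul_basis_def)
    then show ?thesis using w(2) by (auto simp: koszul_module_def)
  qed
  have jb: "{j} \<in> koszul_basis ?n 1" using b1 j by blast
  have sum: "(\<Oplus>k\<in>{..<?n} - {j}. (\<ominus> \<one>) [^] card {i \<in> {j}. i < k} \<otimes> (fs ! k \<otimes> w (insert k {j}))) \<in> Idl (set fs)"
  proof (rule ideal_finsum_closed[OF I.is_ideal])
    fix k assume k: "k \<in> {..<?n} - {j}"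
    have "fs ! k \<in> Idl (set fs)" using genideal_self[OF fs] k by auto
    then have "fs ! k \<otimes> w (insert k {j}) \<in> Idl (set fs)" using wc[OF k] by (rule I.I_r_closed)
    then show "(\<ominus> \<one>) [^] card {i \<in> {j}. i < k} \<otimes> (fs ! k \<otimes> w (insert k {j})) \<in> Idl (set fs)"
      by (rule I.I_l_closed) simp
  qed
  have "x \<otimes> z j = ?x zz {j}" using jb zzk[OF j] by simp
  also have "\<dots> = ?d 1 w {j}" by (rule fun_cong[OF w(1)])
  also have "\<dots> = (\<Oplus>k\<in>{..<?n} - {j}. (\<ominus> \<one>) [^] card {i \<in> {j}. i < k} \<otimes> (fs ! k \<otimes> w (insert k {j})))"
    using jb by (simp add: koszul_diff_def)
  finally show ?thesis using sum by (simp only:)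
qed

lemma Det_scale_rows:
  assumes L: "\<And>i j. L i j \<in> carrier R" and x: "\<And>i. x i \<in> carrier R" and A: "finite A" "A \<subseteq> {..<n}"
  shows "Det n (\<lambda>i. if i \<in> A then (\<lambda>k. x i \<otimes> L i k) else L i) = (\<Otimes>i\<in>A. x i) \<otimes> Det n L"
  using A
proof (induction A rule: finite_induct)
  case empty
  then show ?case using L by simp
next
  case (insert a A)
  let ?L = "\<lambda>i. if i \<in> A then (\<lambda>k. x i \<otimes> L i k) else L i"
  have c: "?L i k \<in> carrier R" for i k using L x by simp
  have "(\<lambda>i. if i \<in> insert a A then (\<lambda>k. x i \<otimes> L i k) else L i) = ?L(a := \<lambda>k. x a \<otimes> L a k)"
    by (auto simp: fun_eq_iff)
  moreover have "Det n (?L(a := \<lambda>k. x a \<otimes> L a k)) = x a \<otimes> Det n (?L(a := L a))"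
    by (rule Det_scale_row) (use c L x insert in auto)
  moreover have "?L(a := L a) = ?L" using insert.hyps by (auto simp: fun_eq_iff)
  moreover have "(\<Otimes>i\<in>insert a A. x i) = x a \<otimes> (\<Otimes>i\<in>A. x i)"
    by (rule finprod_insert) (use insert x in auto)
  ultimately show ?case using insert L x by (simp add: m_assoc)
qed

lemma Det_mem_ideal_pow:
  assumes L: "\<And>i j. L i j \<in> carrier R" and I: "ideal I R" and A: "A \<subseteq> {..<n}"
    and ent: "\<And>i j. i \<in> A \<Longrightarrow> j < n \<Longrightarrow> L i j \<in> I"
  shows "Det n L \<in> ideal_pow R I (card A)"
proof -
  interpret J: ideal "ideal_pow R I (card A)" R by (rule ideal_pow_ideal[OF I])
  have Ic: "a \<in> carrier R" if "a \<in> I" for a using that I ideal.Icarr by metis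
  have fA: "finite A" using A finite_subset by blast
  have prod: "(\<Otimes>i\<in>B. y i) \<in> ideal_pow R I (card B)" if "finite B" "\<And>i. i \<in> B \<Longrightarrow> y i \<in> I" for B :: "nat set" and y
    using that
  proof (induction B rule: finite_induct)
    case (insert a B)
    have "(\<Otimes>i\<in>insert a B. y i) = y a \<otimes> (\<Otimes>i\<in>B. y i)"
      by (rule finprod_insert) (use insert Ic in auto)
    moreover have "y a \<otimes> (\<Otimes>i\<in>B. y i) \<in> ideal_pow R I (Suc (card B))"
      using insert by (auto intro!: ideal_prod.prod)
    ultimately show ?case using insert.hyps by simp
  qed simp
  have trm: "leibniz_term n L p \<in> ideal_pow R I (card A)" if p: "p permutes {..<n}" for p
  proof -
    have lt: "p k < n" if "k < n" for k using p that permutes_in_image by fastforce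
    have "(\<Otimes>i\<in>A \<union> ({..<n} - A). L i (p i)) = (\<Otimes>i\<in>A. L i (p i)) \<otimes> (\<Otimes>i\<in>{..<n} - A. L i (p i))"
      by (rule finprod_Un_disjoint) (use fA L in auto)
    moreover have "A \<union> ({..<n} - A) = {..<n}" using A by auto
    moreover have "(\<Otimes>i\<in>A. L i (p i)) \<in> ideal_pow R I (card A)"
      by (rule prod[OF fA]) (use ent lt A in auto)
    ultimately have "(\<Otimes>i\<in>{..<n}. L i (p i)) \<in> ideal_pow R I (card A)"
      using J.I_r_closed L by simp
    then show ?thesis by (simp add: leibniz_term_def)
  qed
  show ?thesis unfolding Det_def by (rule ideal_finsum_closed[OF J.is_ideal]) (use trm in simp)
qed

end

context self_dual_complex begin

text \<open>Scale the \<open>n - 1\<close> rows of \<open>\<rho>\<close> in the cofactor \<open>u f\<^sub>m \<psi>\<^sub>k\<close> by elements of \<open>L\<close>. Then let the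
  \<open>\<psi>\<^sub>k\<close> combine to elements of \<open>I\<close>, and finally the \<open>f\<^sub>m\<close>.\<close>
lemma multiplier_power_inclusion:
  assumes I: "I = Idl (f ` {..<n})"
    and f_psi: "\<And>b. b < n \<Longrightarrow> \<exists>c. (\<forall>j. c j \<in> carrier R) \<and> f b = (\<Oplus>j\<in>{..<n}. c j \<otimes> \<psi> j)"
    and L: "ideal L R" and mult: "\<And>x b j. x \<in> L \<Longrightarrow> b < n \<Longrightarrow> j < n \<Longrightarrow> x \<otimes> \<rho> b j \<in> I"
  shows "ideal_prod R (ideal_pow R L (n - 1)) (ideal_pow R I 2) \<subseteq> ideal_pow R I (n - 1)"
proof -
  have idI: "ideal I R" unfolding I by (rule genideal_ideal) auto
  interpret I: ideal I R by (rule idI)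
  let ?J = "ideal_pow R I (n - 1)"
  have idJ: "ideal ?J R" by (rule ideal_pow_ideal[OF idI])
  interpret J: ideal ?J R by (rule idJ)
  have Lc: "x \<in> carrier R" if "x \<in> L" for x using that L ideal.Icarr by metis
  obtain u where u: "u \<in> Units R" "\<And>m k. m < n \<Longrightarrow> k < n \<Longrightarrow> cofactor m k = u \<otimes> f m \<otimes> \<psi> k"
    by (rule cofactor_eq) (rule that, assumption+)
  obtain v where v: "v \<in> carrier R" "v \<otimes> u = \<one>" using u(1) by (auto simp: Units_def)
  have uc: "u \<in> carrier R" using u(1) by (rule Units_closed)
  have gens: "y \<otimes> (f m \<otimes> \<psi> k) \<in> ?J" if y: "y \<in> ideal_pow R L (n - 1)" and mk: "m < n" "k < n" for y m k
  proof -
    let ?Q = "{a \<in> carrier R. a \<otimes> (f m \<otimes> \<psi> k) \<in> ?J}"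
    have "ideal_pow R L (n - 1) \<subseteq> ?Q"
    proof (rule ideal_pow_subsetI[OF L])
      show "ideal ?Q R" by (rule colon_ideal[OF idJ]) simp
      show "card ({..<n} - {m}) = n - 1" using mk by simp
      fix x :: "nat \<Rightarrow> 'a" assume x: "\<And>i. x i \<in> L"
      let ?p = "\<Otimes>i\<in>{..<n} - {m}. x i"
      have pc: "?p \<in> carrier R" using x Lc by (intro finprod_closed) auto
      let ?M = "\<rho>(m := unit_vec k)"
      have "Det n (\<lambda>i. if i \<in> {..<n} - {m} then (\<lambda>k. x i \<otimes> ?M i k) else ?M i) \<in> ideal_pow R I (card ({..<n} - {m}))"
        by (rule Det_mem_ideal_pow[OF _ idI]) (use x Lc mult in auto)
      moreover have "Det n (\<lambda>i. if i \<in> {..<n} - {m} then (\<lambda>k. x i \<otimes> ?M i k) else ?M i) = ?p \<otimes> cofactor m k"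
        unfolding cofactor_def by (rule Det_scale_rows) (use x Lc in auto)
      ultimately have "?p \<otimes> (u \<otimes> f m \<otimes> \<psi> k) \<in> ?J" using u(2)[OF mk] mk by simp
      then have "v \<otimes> (?p \<otimes> (u \<otimes> f m \<otimes> \<psi> k)) \<in> ?J" using v(1) by (rule J.I_l_closed)
      moreover have "v \<otimes> (?p \<otimes> (u \<otimes> f m \<otimes> \<psi> k)) = (v \<otimes> u) \<otimes> (?p \<otimes> (f m \<otimes> \<psi> k))"
        using v(1) uc pc by (simp add: m_ac)
      ultimately show "?p \<in> ?Q" using pc v(2) by simp
    qed simp
    then show ?thesis using y by blast
  qed
  have yI: "y \<otimes> (f m \<otimes> a) \<in> ?J" if y: "y \<in> ideal_pow R L (n - 1)" and m: "m < n" and a: "a \<in> I" for y m a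
  proof -
    have yc: "y \<in> carrier R" using y ideal_pow_ideal[OF L] ideal.Icarr by metis
    define Q where "Q = {a \<in> carrier R. a \<otimes> (y \<otimes> f m) \<in> ?J}"
    have Q: "ideal Q R" unfolding Q_def by (rule colon_ideal[OF idJ]) (use yc in simp)
    have psiQ: "\<psi> k \<in> Q" if "k < n" for k
    proof -
      have "\<psi> k \<otimes> (y \<otimes> f m) = y \<otimes> (f m \<otimes> \<psi> k)" using yc by (simp add: m_ac)
      then show ?thesis using gens[OF y m that] by (simp add: Q_def)
    qed
    have "f b \<in> Q" if b: "b < n" for b
    proof -
      obtain c where c: "\<And>j. c j \<in> carrier R" "f b = (\<Oplus>j\<in>{..<n}. c j \<otimes> \<psi> j)" using f_psi[OF b] by blast
      show ?thesis
        unfolding c(2) by (rule ideal_finsum_closed[OF Q]) (rule ideal.I_l_closed[OF Q psiQ c(1)], simp)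
    qed
    then have "f ` {..<n} \<subseteq> Q" by blast
    then have "Idl (f ` {..<n}) \<subseteq> Q" by (rule genideal_minimal[OF Q])
    then have "a \<in> Q" using a unfolding I by (rule subsetD)
    then have "a \<otimes> (y \<otimes> f m) \<in> ?J" unfolding Q_def mem_Collect_eq by (rule conjunct2)
    moreover have "a \<otimes> (y \<otimes> f m) = y \<otimes> (f m \<otimes> a)" using yc I.Icarr[OF a] by (simp add: m_ac)
    ultimately show ?thesis by simp
  qed
  have yII: "y \<otimes> (b \<otimes> a) \<in> ?J" if y: "y \<in> ideal_pow R L (n - 1)" and b: "b \<in> I" and a: "a \<in> I" for y a b
  proof -
    have yc: "y \<in> carrier R" using y ideal_pow_ideal[OF L] ideal.Icarr by metis
    define Q where "Q = {b \<in> carrier R. b \<otimes> (y \<otimes> a) \<in> ?J}"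
    have Q: "ideal Q R" unfolding Q_def by (rule colon_ideal[OF idJ]) (use yc I.Icarr[OF a] in simp)
    have "f m \<in> Q" if m: "m < n" for m
    proof -
      have "f m \<otimes> (y \<otimes> a) = y \<otimes> (f m \<otimes> a)" using yc I.Icarr[OF a] by (simp add: m_ac)
      then show ?thesis using yI[OF y m a] by (simp add: Q_def)
    qed
    then have "f ` {..<n} \<subseteq> Q" by blast
    then have "Idl (f ` {..<n}) \<subseteq> Q" by (rule genideal_minimal[OF Q])
    then have "b \<in> Q" using b unfolding I by (rule subsetD)
    then have "b \<otimes> (y \<otimes> a) \<in> ?J" unfolding Q_def mem_Collect_eq by (rule conjunct2)
    moreover have "b \<otimes> (y \<otimes> a) = y \<otimes> (b \<otimes> a)" using yc I.Icarr[OF a] I.Icarr[OF b] by (simp add: m_ac)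
    ultimately show ?thesis by simp
  qed
  have I2: "ideal_pow R I 2 = ideal_prod R I I"
    using ideal_prod_one[OF idI] by (simp add: numeral_2_eq_2)
  show ?thesis
  proof (rule ideal_prod_subsetI[OF idJ])
    fix y a assume y: "y \<in> ideal_pow R L (n - 1)" and a: "a \<in> ideal_pow R I 2"
    have yc: "y \<in> carrier R" using y ideal_pow_ideal[OF L] ideal.Icarr by metis
    have Q: "ideal {a \<in> carrier R. a \<otimes> y \<in> ?J} R" by (rule colon_ideal[OF idJ yc])
    have "ideal_prod R I I \<subseteq> {a \<in> carrier R. a \<otimes> y \<in> ?J}"
    proof (rule ideal_prod_subsetI[OF Q])
      fix b c assume bc: "b \<in> I" "c \<in> I"
      then have c: "b \<in> carrier R" "c \<in> carrier R" using I.Icarr by auto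
      have "(b \<otimes> c) \<otimes> y = y \<otimes> (b \<otimes> c)" using c yc by (simp add: m_comm)
      then show "b \<otimes> c \<in> {a \<in> carrier R. a \<otimes> y \<in> ?J}" using yII[OF y bc] c by simp
    qed
    then have "a \<otimes> y \<in> ?J" "a \<in> carrier R" using a I2 by auto
    then show "y \<otimes> a \<in> ?J" using yc by (simp add: m_comm)
  qed
qed

end


section \<open>Perfect Gorenstein ideals of height three\<close>

context noetherian_local begin

text \<open>If \<open>c\<^sub>l\<close> were a unit, the relation would express \<open>f\<^sub>l\<close> by the other generators.\<close>
lemma minimal_generators_relation:
  assumes fs: "minimally_generates R fs I" and c: "\<And>j. c j \<in> carrier R"
    and rel: "(\<Oplus>j\<in>{..<length fs}. fs ! j \<otimes> c j) = \<zero>" and l: "l < length fs"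
  shows "c l \<in> \<mm>"
proof (rule ccontr)
  assume "c l \<notin> \<mm>"
  then have "c l \<in> Units R" using Units_iff c by simp
  then obtain u where u: "u \<in> carrier R" "u \<otimes> c l = \<one>" by (auto simp: Units_def)
  let ?n = "length fs"
  let ?B = "set fs - {fs ! l}"
  have sub: "set fs \<subseteq> carrier R" and dist: "distinct fs" and gen: "Idl (set fs) = I"
    and min: "\<And>B. B \<subset> set fs \<Longrightarrow> Idl B \<noteq> I"
    using fs by (auto simp: minimally_generates_def)
  have fc: "fs ! j \<in> carrier R" if "j < ?n" for j using sub that by auto
  interpret B: ideal "Idl ?B" R by (rule genideal_ideal) (use sub in auto)
  have fB: "fs ! j \<in> Idl ?B" if "j < ?n" "j \<noteq> l" for j
  proof -
    have "fs ! j \<in> ?B" using that l dist by (auto simp: nth_eq_iff_index_eq)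
    then show ?thesis using genideal_self[of ?B] sub by blast
  qed
  let ?s = "\<Oplus>j\<in>{..<?n} - {l}. fs ! j \<otimes> c j"
  have s: "?s \<in> Idl ?B"
    by (rule ideal_finsum_closed[OF B.is_ideal], rule B.I_r_closed[OF fB c]) auto
  have "(\<Oplus>j\<in>insert l ({..<?n} - {l}). fs ! j \<otimes> c j) = fs ! l \<otimes> c l \<oplus> ?s"
    by (rule finsum_insert) (use fc c l in auto)
  moreover have "insert l ({..<?n} - {l}) = {..<?n}" using l by auto
  ultimately have "fs ! l \<otimes> c l \<oplus> ?s = \<zero>" using rel by simp
  then have "fs ! l \<otimes> c l = \<ominus> ?s" using B.Icarr[OF s] fc[OF l] c by (simp add: minus_equality[symmetric] add.inv_equality)
  then have "fs ! l \<otimes> c l \<in> Idl ?B" using s by simp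
  then have "u \<otimes> (fs ! l \<otimes> c l) \<in> Idl ?B" using u(1) by (rule B.I_l_closed)
  moreover have "u \<otimes> (fs ! l \<otimes> c l) = (u \<otimes> c l) \<otimes> fs ! l" using u(1) c fc[OF l] by (simp add: m_ac)
  ultimately have "fs ! l \<in> Idl ?B" using u(2) fc[OF l] by simp
  then have "set fs \<subseteq> Idl ?B" using genideal_self[of ?B] sub by blast
  then have "Idl (set fs) \<subseteq> Idl ?B" by (rule genideal_minimal[OF B.is_ideal])
  moreover have "Idl ?B \<subseteq> Idl (set fs)" by (rule subset_Idl_subset) (use sub in auto)
  ultimately have "Idl ?B = I" using gen by simp
  moreover have "?B \<subset> set fs" using nth_mem[OF l] by auto
  ultimately show False using min by blast
qed

end

lemma projective_dimension_resolution:
  assumes "projective_dimension R M = enat g"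
  obtains P d e where "projective_resolution R M P d e" "\<And>i. i > g \<Longrightarrow> carrier (P i) = {\<zero>\<^bsub>P i\<^esub>}"
proof -
  let ?A = "{enat n | n. \<exists>P d e. projective_resolution R M P d e \<and> (\<forall>i>n. carrier (P i) = {\<zero>\<^bsub>P i\<^esub>})}"
  have "Inf ?A = enat g" using assms by (simp add: projective_dimension_def)
  then have ne: "?A \<noteq> {}" by (auto simp: Inf_enat_def split: if_splits)
  have InfI: "Inf A \<in> A" if "A \<noteq> {}" for A :: "enat set"
    using that unfolding Inf_enat_def by (auto intro: LeastI)
  from InfI[OF ne] have "Inf ?A \<in> ?A" .
  then have "enat g \<in> ?A" unfolding \<open>Inf ?A = enat g\<close> .
  then show thesis using that by auto
qed

lemma grade_regular_sequence:
  assumes "grade R I = enat (Suc k)"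
  obtains xs where "set xs \<subseteq> I" "regular_sequence R xs" "k < length xs"
proof -
  have "enat k < grade R I" using assms by simp
  then obtain xs where "set xs \<subseteq> I" "regular_sequence R xs" "enat k < enat (length xs)"
    unfolding grade_def less_Sup_iff by blast
  then show thesis using that by simp
qed

text \<open>This names the resolution that the definition of Ext chooses.\<close>
lemma Ext_module_resolution:
  assumes "projective_resolution R M P d e"
  obtains P' d' e' where "projective_resolution R M P' d' e'"
    "\<And>i. Ext_module R i M N = cohomology_module (\<lambda>j. Hom_module R (P' j) N) (\<lambda>j f. compose (carrier (P' (Suc j))) f (d' j)) i"
proof -
  define t where "t = (SOME (P, d, e). projective_resolution R M P d e)"
  obtain P' d' e' where t: "t = (P', d', e')" by (cases t)
  have "case t of (P, d, e) \<Rightarrow> projective_resolution R M P d e"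
    unfolding t_def by (rule someI[of _ "(P, d, e)"]) (use assms in simp)
  then have "projective_resolution R M P' d' e'" by (simp add: t)
  moreover have "Ext_module R i M N = cohomology_module (\<lambda>j. Hom_module R (P' j) N) (\<lambda>j f. compose (carrier (P' (Suc j))) f (d' j)) i" for i
    unfolding Ext_module_def t_def[symmetric] t by simp
  ultimately show thesis by (rule that)
qed

theorem theorem2p12:
  fixes R :: "('a, 'm) ring_scheme"
    and I :: "'a set"
    and fs :: "'a list"
    and n :: nat
  assumes "noetherian_ring R"
    and "local_ring R"
    and "ring_char R \<noteq> 2"
    and "perfect_gorenstein_ideal R I"
    and "ideal_height R I = 3"
    and "minimally_generates R fs I"
    and "length fs = n"
    and "n \<ge> 5"
  shows "ideal_pow R (annihilator R (koszul_homology R fs 1)) 2 \<subseteq> integral_closure R I"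
proof -
  have cr: "cring R" using assms(2) by (simp add: local_ring_def)
  interpret noetherian_cring R
    by (rule noetherian_cring.intro[OF assms(1) cr])
  obtain \<mm> where "noetherian_local R \<mm>" using local_ringE[OF assms(2)] .
  then interpret noetherian_local R \<mm> .
  let ?Q = "quotient_module (ring_module R) I"
  \<comment> \<open>The value \<open>\<zero>\<close> beyond the list keeps all values in the ring.\<close>
  define f where "f = (\<lambda>j. if j < n then fs ! j else \<zero>\<^bsub>R\<^esub>)"
  have sub: "set fs \<subseteq> carrier R" and gen: "Idl\<^bsub>R\<^esub> (set fs) = I"
    using assms(6) by (auto simp: minimally_generates_def)
  have f: "f j \<in> carrier R" for j using sub assms(7) by (auto simp: f_def)
  have img: "f ` {..<n} = set fs"
    using assms(7) by (auto simp: f_def set_conv_nth)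
  have I_eq: "I = Idl\<^bsub>R\<^esub> (f ` {..<n})" using gen img by simp
  have idI: "ideal I R" unfolding I_eq by (rule genideal_ideal) (use f in auto)
  interpret I: ideal I R by (rule idI)
  have fc: "fs ! j \<in> carrier R" if "j < n" for j using sub assms(7) that by auto
  have fsum: "(\<Oplus>\<^bsub>R\<^esub>j\<in>{..<n}. f j \<otimes>\<^bsub>R\<^esub> c j) = (\<Oplus>\<^bsub>R\<^esub>j\<in>{..<n}. fs ! j \<otimes>\<^bsub>R\<^esub> c j)"
    if "\<And>j. c j \<in> carrier R" for c
    by (rule finsum_cong') (use that fc in \<open>auto simp: f_def\<close>)
  have "\<exists>r \<delta>. min_free_resolution R \<mm> I n f r \<delta>"
  proof (rule min_free_resolution_exists[OF f I_eq])
    fix c assume c: "\<And>j. c j \<in> carrier R" "(\<Oplus>\<^bsub>R\<^esub>j\<in>{..<n}. f j \<otimes>\<^bsub>R\<^esub> c j) = \<zero>\<^bsub>R\<^esub>"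
    show "\<forall>l<n. c l \<in> \<mm>"
      using minimal_generators_relation[OF assms(6), of c] c fsum[of c] assms(7) by simp
  qed
  then obtain r \<delta> where H: "min_free_resolution R \<mm> I n f r \<delta>" by blast
  note ctx = H idI f
  have n2: "2 \<le> n" using assms(8) by simp
  obtain g where g: "grade R I = enat g" "projective_dimension R ?Q = enat g"
    "module_iso R (Ext_module R g ?Q (ring_module R)) ?Q"
    using assms(4) unfolding perfect_gorenstein_ideal_def perfect_ideal_def by auto
  have "enat g \<le> 3" using grade_le_height[of I] g(1) assms(5) by simp
  then have g3: "g \<le> 3" by (simp add: numeral_eq_enat)
  obtain P d e where P: "projective_resolution R ?Q P d e" and short: "\<And>i. i > g \<Longrightarrow> carrier (P i) = {\<zero>\<^bsub>P i\<^esub>}"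
    using projective_dimension_resolution[OF g(2)] by blast
  obtain P' d' e' where P': "projective_resolution R ?Q P' d' e'"
    and Ext: "\<And>i. Ext_module R i ?Q (ring_module R) = cohomology_module (\<lambda>j. Hom_module R (P' j) (ring_module R)) (\<lambda>j f. compose (carrier (P' (Suc j))) f (d' j)) i"
    by (rule Ext_module_resolution[OF P, of "ring_module R"]) (rule that, assumption+)
  have inj: "v = (\<lambda>_. \<zero>\<^bsub>R\<^esub>)" if "g \<le> Suc k" "v \<in> carrier (vec R (r (Suc k)))" "\<delta> k v = (\<lambda>_. \<zero>\<^bsub>R\<^esub>)" for k v
  proof (rule minimal_resolution_injective[OF res_resolution[OF ctx] _ P _ that(2,3)])
    show "x l \<in> \<mm>" if "x \<in> carrier (vec R (r (Suc i)))" "\<delta> i x = (\<lambda>_. \<zero>\<^bsub>R\<^esub>)" for i x l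
      using that by (rule res_min[OF ctx])
    show "carrier (P i) = {\<zero>\<^bsub>P i\<^esub>}" if "i > Suc k" for i
      by (rule short) (use that \<open>g \<le> Suc k\<close> in simp)
  qed
  have ext: "\<exists>c\<in>module_hom R (vec R (r (Suc k))) (ring_module R). \<forall>l. \<exists>\<rho>\<in>carrier R.
      \<exists>w\<in>module_hom R (vec R (r k)) (ring_module R).
      \<forall>x\<in>carrier (vec R (r (Suc k))). x l = \<rho> \<otimes>\<^bsub>R\<^esub> c x \<oplus>\<^bsub>R\<^esub> w (\<delta> k x)"
    "\<forall>a\<in>I. \<forall>l. \<exists>w\<in>module_hom R (vec R (r k)) (ring_module R).
      \<forall>x\<in>carrier (vec R (r (Suc k))). a \<otimes>\<^bsub>R\<^esub> x l = w (\<delta> k x)" if k: "g = Suc k" for k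
  proof -
    have iso: "module_iso R (cohomology_module (\<lambda>j. Hom_module R (P' j) (ring_module R))
      (\<lambda>j f. compose (carrier (P' (Suc j))) f (d' j)) (Suc k)) ?Q"
      using g(3) unfolding Ext k .
    have inj': "v = (\<lambda>_. \<zero>\<^bsub>R\<^esub>)" if "v \<in> carrier (vec R (r (Suc k)))" "\<delta> k v = (\<lambda>_. \<zero>\<^bsub>R\<^esub>)" for v
      by (rule inj[OF _ that]) (simp add: k)
    note E = minimal_resolution_ext[OF res_resolution[OF ctx] idI P' inj' iso]
    show "\<exists>c\<in>module_hom R (vec R (r (Suc k))) (ring_module R). \<forall>l. \<exists>\<rho>\<in>carrier R.
      \<exists>w\<in>module_hom R (vec R (r k)) (ring_module R).
      \<forall>x\<in>carrier (vec R (r (Suc k))). x l = \<rho> \<otimes>\<^bsub>R\<^esub> c x \<oplus>\<^bsub>R\<^esub> w (\<delta> k x)" by (rule E(1))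
    show "\<forall>a\<in>I. \<forall>l. \<exists>w\<in>module_hom R (vec R (r k)) (ring_module R).
      \<forall>x\<in>carrier (vec R (r (Suc k))). a \<otimes>\<^bsub>R\<^esub> x l = w (\<delta> k x)" by (rule E(2))
  qed
  have regD: "y \<in> Idl\<^bsub>R\<^esub> (set (take i xs))"
    if "regular_sequence R xs" "i < length xs" "y \<in> carrier R" "xs ! i \<otimes>\<^bsub>R\<^esub> y \<in> Idl\<^bsub>R\<^esub> (set (take i xs))" for xs i y
    using that unfolding regular_sequence_def by blast
  have reg0: "y = \<zero>\<^bsub>R\<^esub>" if "regular_sequence R xs" "0 < length xs" "y \<in> carrier R" "xs ! 0 \<otimes>\<^bsub>R\<^esub> y = \<zero>\<^bsub>R\<^esub>" for xs y
    using regD[OF that(1-3)] that(4) by (simp add: genideal_empty)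
  \<comment> \<open>The Koszul relations exclude resolutions of length at most two.\<close>
  have "g = 3"
  proof -
    have "\<not> g \<le> 1"
    proof
      assume "g \<le> 1"
      then have "v = (\<lambda>_. \<zero>\<^bsub>R\<^esub>)" if "v \<in> carrier (vec R n)" "\<delta> 0 v = (\<lambda>_. \<zero>\<^bsub>R\<^esub>)" for v
        using inj[of 0 v] that res_ranks[OF ctx] by simp
      then show False using n2 by (rule first_map_not_injective[OF ctx])
    qed
    moreover have "g \<noteq> 2"
    proof
      assume g2: "g = 2"
      then have gS: "g = Suc (Suc 0)" by simp
      obtain xs where xs: "set xs \<subseteq> I" "regular_sequence R xs" "1 < length xs"
        using grade_regular_sequence[of R I 1] g(1) g2 by (auto simp: numeral_2_eq_2)
      from ext(1)[OF gS] obtain c where "c \<in> module_hom R (vec R (r (Suc (Suc 0)))) (ring_module R)"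
        "\<forall>l. \<exists>\<rho>\<in>carrier R. \<exists>w\<in>module_hom R (vec R (r (Suc 0))) (ring_module R).
          \<forall>x\<in>carrier (vec R (r (Suc (Suc 0)))). x l = \<rho> \<otimes>\<^bsub>R\<^esub> c x \<oplus>\<^bsub>R\<^esub> w (\<delta> (Suc 0) x)" ..
      then have r2: "r (Suc (Suc 0)) \<le> 1" by (rule last_rank_le_1[OF ctx])
      show False
      proof (rule second_map_not_cyclic[OF ctx _ _ _ r2])
        show "3 \<le> n" using assms(8) by simp
        show "xs ! 0 \<in> I" using xs(1,3) by (meson nth_mem order_less_trans subsetD zero_less_one)
        show "y = \<zero>\<^bsub>R\<^esub>" if "y \<in> carrier R" "xs ! 0 \<otimes>\<^bsub>R\<^esub> y = \<zero>\<^bsub>R\<^esub>" for y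
          by (rule reg0[OF xs(2) _ that]) (use xs(3) in linarith)
      qed
    qed
    ultimately show ?thesis using g3 by simp
  qed
  then have gS: "g = Suc (Suc (Suc 0))" by simp
  obtain xs where xs: "set xs \<subseteq> I" "regular_sequence R xs" "2 < length xs"
    using grade_regular_sequence[of R I 2] g(1) gS by (auto simp: numeral_2_eq_2)
  have xI: "xs ! i \<in> I" if "i < 3" for i
    by (rule subsetD[OF xs(1) nth_mem]) (use xs(3) that in linarith)
  have take1: "set (take 1 xs) = {xs ! 0}" and take2: "set (take 2 xs) = {xs ! 0, xs ! 1}"
    using xs(3) by (cases xs; cases "tl xs"; auto simp: numeral_2_eq_2)+
  have reg1: "y \<in> Idl\<^bsub>R\<^esub> {xs ! 0}" if "y \<in> carrier R" "xs ! 1 \<otimes>\<^bsub>R\<^esub> y \<in> Idl\<^bsub>R\<^esub> {xs ! 0}" for y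
    using regD[OF xs(2) _ that(1), of 1] that(2) xs(3) take1 by simp
  have reg2: "y \<in> Idl\<^bsub>R\<^esub> {xs ! 0, xs ! 1}" if "y \<in> carrier R" "xs ! 2 \<otimes>\<^bsub>R\<^esub> y \<in> Idl\<^bsub>R\<^esub> {xs ! 0, xs ! 1}" for y
    using regD[OF xs(2) _ that(1), of 2] that(2) xs(3) take2 by simp
  have reg0': "y = \<zero>\<^bsub>R\<^esub>" if "y \<in> carrier R" "xs ! 0 \<otimes>\<^bsub>R\<^esub> y = \<zero>\<^bsub>R\<^esub>" for y
    by (rule reg0[OF xs(2) _ that]) (use xs(3) in linarith)
  have xs_I: "xs ! 0 \<in> I" "xs ! 1 \<in> I" "xs ! 2 \<in> I" by (rule xI; simp)+
  note ctx3 = ctx xs_I reg0' reg1 reg2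
  have inj3: "v = (\<lambda>_. \<zero>\<^bsub>R\<^esub>)" if "v \<in> carrier (vec R (r (Suc (Suc (Suc 0)))))" "\<delta> (Suc (Suc 0)) v = (\<lambda>_. \<zero>\<^bsub>R\<^esub>)" for v
    by (rule inj[OF _ that]) (simp add: gS)
  from ext(1)[OF gS] obtain c where "c \<in> module_hom R (vec R (r (Suc (Suc (Suc 0))))) (ring_module R)"
    "\<forall>l. \<exists>\<rho>\<in>carrier R. \<exists>w\<in>module_hom R (vec R (r (Suc (Suc 0)))) (ring_module R).
      \<forall>x\<in>carrier (vec R (r (Suc (Suc (Suc 0))))). x l = \<rho> \<otimes>\<^bsub>R\<^esub> c x \<oplus>\<^bsub>R\<^esub> w (\<delta> (Suc (Suc 0)) x)" ..
  then have "r (Suc (Suc (Suc 0))) \<le> 1" by (rule last_rank_le_1[OF ctx])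
  moreover have "r (Suc (Suc (Suc 0))) \<noteq> 0" by (rule last_rank_pos[OF ctx3 n2])
  ultimately have r3: "r (Suc (Suc (Suc 0))) = 1" by simp
  define \<rho> where "\<rho> = (\<lambda>b j. if j < r (Suc (Suc 0)) then \<delta> (Suc 0) (unit_vec j) b else \<zero>\<^bsub>R\<^esub>)"
  define \<psi> where "\<psi> = \<delta> (Suc (Suc 0)) (unit_vec 0)"
  interpret D: dual_exact_complex R \<mm> n "r (Suc (Suc 0))" \<rho> f \<psi>
    unfolding \<rho>_def \<psi>_def by (rule dual_exact[OF ctx3 inj3 r3 ext(2)[OF gS]])
  interpret S: self_dual_complex R n \<rho> f \<psi> by (rule D.self_dual)
  \<comment> \<open>The annihilator acts on the matrix of syzygies only through this ideal.\<close>
  define L where "L = {x \<in> carrier R. \<forall>z. (\<forall>j. z j \<in> carrier R) \<longrightarrow> (\<Oplus>\<^bsub>R\<^esub>j\<in>{..<n}. f j \<otimes>\<^bsub>R\<^esub> z j) = \<zero>\<^bsub>R\<^esub> \<longrightarrow>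
    (\<forall>j<n. x \<otimes>\<^bsub>R\<^esub> z j \<in> I)}"
  have annL: "annihilator R (koszul_homology R fs 1) \<subseteq> L"
  proof
    fix x assume x: "x \<in> annihilator R (koszul_homology R fs 1)"
    have "x \<otimes>\<^bsub>R\<^esub> z j \<in> I" if "\<forall>j. z j \<in> carrier R" "(\<Oplus>\<^bsub>R\<^esub>j\<in>{..<n}. f j \<otimes>\<^bsub>R\<^esub> z j) = \<zero>\<^bsub>R\<^esub>" "j < n" for z j
      using koszul_annihilator_syzygy[OF sub x, of z j] that fsum[of z] gen assms(7) by simp
    then show "x \<in> L" using x by (simp add: L_def annihilator_def)
  qed
  have L: "ideal L R"
  proof (rule idealI)
    show "subgroup L (add_monoid R)"
    proof (rule add.subgroupI)
      show "L \<noteq> {}" using I.zero_closed by (auto simp: L_def intro!: exI[of _ "\<zero>\<^bsub>R\<^esub>"])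
      show "\<ominus>\<^bsub>R\<^esub> a \<in> L" if "a \<in> L" for a using that by (simp add: L_def l_minus)
      show "a \<oplus>\<^bsub>R\<^esub> b \<in> L" if "a \<in> L" "b \<in> L" for a b using that by (simp add: L_def l_distr)
    qed (auto simp: L_def)
    show lx: "x \<otimes>\<^bsub>R\<^esub> a \<in> L" if "a \<in> L" "x \<in> carrier R" for a x
      using that I.I_l_closed by (simp add: L_def m_assoc)
    show "a \<otimes>\<^bsub>R\<^esub> x \<in> L" if "a \<in> L" "x \<in> carrier R" for a x
      using lx[OF that] that m_comm[of a x] by (simp add: L_def)
  qed (rule ring_axioms)
  have "ideal_prod R (ideal_pow R L (n - 1)) (ideal_pow R I 2) \<subseteq> ideal_pow R I (n - 1)"
  proof (rule S.multiplier_power_inclusion[OF I_eq _ L])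
    show "\<exists>c. (\<forall>j. c j \<in> carrier R) \<and> f b = (\<Oplus>\<^bsub>R\<^esub>j\<in>{..<n}. c j \<otimes>\<^bsub>R\<^esub> \<psi> j)" if "b < n" for b
      using D.f_in_psi[OF that] D.ranks_equal by simp
    show "x \<otimes>\<^bsub>R\<^esub> \<rho> b j \<in> I" if "x \<in> L" "b < n" "j < n" for x b j
    proof -
      have "(\<forall>b. z b \<in> carrier R) \<longrightarrow> (\<Oplus>\<^bsub>R\<^esub>b\<in>{..<n}. f b \<otimes>\<^bsub>R\<^esub> z b) = \<zero>\<^bsub>R\<^esub> \<longrightarrow> (\<forall>b<n. x \<otimes>\<^bsub>R\<^esub> z b \<in> I)" for z
        using that(1) by (simp add: L_def)
      from this[of "\<lambda>b. \<rho> b j"] show ?thesis using S.f_rho[OF that(3)] that(2) by simp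
    qed
  qed
  then have "ideal_pow R L 2 \<subseteq> integral_closure R I"
    by (rule square_in_integral_closure[OF idI L, of "n - 1", rotated -1]) (use assms(8) I_faithful[OF ctx3] in auto)
  then show ?thesis using ideal_pow_mono[OF annL, of 2] by blast
qed

end
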